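(* Let $1\le j\le k-1$ be fixed integers and let $p_0=p_0(k,j):=\frac{1}{\binom{k}{j}-1}\cdot\frac{1}{\binom{n}{k-j}}$. Let $\varepsilon=\varepsilon(n)>0$ satisfy $\varepsilon\to 0$, $\varepsilon^3 n^j\to\infty$ and $\varepsilon^2 n^{1-2\delta}\to\infty$ as $n\to\infty$, for some constant $\delta>0$. (a) If $p=(1-\varepsilon)p_0$, then with high probability all $j$-components of $\mathcal{H}^k(n,p)$ have size at most $O(\varepsilon^{-2}\log n)$. (b) If $p=(1+\varepsilon)p_0$, then with high probability the largest $j$-component of $\mathcal{H}^k(n,p)$ has size $(1\pm o(1))\frac{2\varepsilon}{\binom{k}{j}-1}\binom{n}{j}$, while all other $j$-components have size $o(\varepsilon n^j)$.
   Context: $\mathcal{H}^k(n,p)$ is the random $k$-uniform hypergraph on vertex set $[n]$ in which each $k$-element subset of $[n]$ is an edge independently with probability $p$. Two $j$-element vertex sets $J_1,J_2$ are $j$-connected if there is a sequence of edges $E_1,\dots,E_\ell$ with $J_1\subseteq E_1$, $J_2\subseteq E_\ell$ and $|E_i\cap E_{i+1}|\ge j$ for all $i$; this is an equivalence relation on $j$-sets, and its equivalence classes are the $j$-components. The size of a $j$-component is its number of $j$-sets. "With high probability" means with probability tending to $1$ as $n\to\infty$; asymptotics are as $n\to\infty$. *)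

theory Defs
  imports "HOL-Probability.Probability"
begin

definition ksets :: "nat \<Rightarrow> nat \<Rightarrow> nat set set" where
  "ksets n k = {e. e \<subseteq> {..<n} \<and> card e = k}"

definition random_hypergraph :: "nat \<Rightarrow> nat \<Rightarrow> real \<Rightarrow> nat set set pmf" where
  "random_hypergraph n k p =
     map_pmf (\<lambda>f. {e \<in> ksets n k. f e}) (Pi_pmf (ksets n k) False (\<lambda>_. bernoulli_pmf p))"

text \<open>j-connectivity of j-sets: a sequence of edges E_1..E_l with J1 in E_1,
  J2 in E_l and consecutive edges sharing at least j vertices.  We add
  reflexivity so that every j-set lies in a component (isolated j-sets form
  singleton components).\<close>
definition jconnected :: "nat set set \<Rightarrow> nat \<Rightarrow> nat set \<Rightarrow> nat set \<Rightarrow> bool" where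
  "jconnected H j J1 J2 \<longleftrightarrow> J1 = J2 \<or>
     (\<exists>es. es \<noteq> [] \<and> set es \<subseteq> H \<and> J1 \<subseteq> hd es \<and> J2 \<subseteq> last es \<and>
        (\<forall>i. Suc i < length es \<longrightarrow> j \<le> card (es ! i \<inter> es ! Suc i)))"

definition jcomponents :: "nat \<Rightarrow> nat \<Rightarrow> nat set set \<Rightarrow> nat set set set" where
  "jcomponents n j H = (\<lambda>J. {J' \<in> ksets n j. jconnected H j J J'}) ` ksets n j"

definition p0 :: "nat \<Rightarrow> nat \<Rightarrow> nat \<Rightarrow> real" where
  "p0 k j n = (1 / (real (k choose j) - 1)) * (1 / real (n choose (k - j)))"

end

(* A j-component is explored by breadth-first search: a state consists of the dead j-sets, whose
   supersets have all been queried, and the frontier. In both regimes the frontier is compared with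
   a branching process of mean offspring lam close to 1. The losses of this comparison come from
   pairs of explored j-sets with a common k-element superset. They are controlled by a symmetric
   kernel on j-sets with constant row sums lam; its powers equidistribute geometrically fast by
   Doeblin's minorisation argument, so the explored set is nearly spread out over all j-sets.

   (a) The potential exp(theta |D|) z^|G| with z = exp(eps/2q), theta = eps^2/4q and q = C(k,j)-1 is
   a supermartingale, so components have exponential tails at scale eps^-2, and a union bound over
   the j-sets applies.

   (b) Put Lam = eps^3 N with N = C(n,j), and let a j-set be large if its component has at least
   Lam^(1/2)/eps^2 elements. A j-set is large with probability about 2 eps/q, and two
   j-sets are asymptotically independent in this respect. After about (3/4) log Lam / log lam levels
   both the frontier and the dead set of a surviving exploration are far above these
   scales. By invariance under vertex permutations and Chebyshev's inequality a fresh exploration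
   then hits the frontier of another one, so nearly all pairs of large j-sets lie in the same
   component. Comparing the number of large j-sets with the sum of squares of the large component
   sizes leaves a single giant component. *)
theory Submission
  imports Defs "HOL-Real_Asymp.Real_Asymp"
begin

section \<open>Expectations over random subsets\<close>

text \<open>With \<open>e = lam - 1\<close>, the levels obey competing bounds. Losses up to level
  \<open>r\<close> stay small while \<open>lam ^ r\<close> is far below Lam, whereas a dead set of
  order \<open>lam ^ r / e ^ 2\<close> meets a frontier of order \<open>lam ^ r / e\<close> once
  \<open>lam ^ (2 * r)\<close> is far above Lam; the exponent 3/4 lies between 1/2 and 1. Pairs of
  large j-sets are bounded from above at a shorter level \<open>r0\<close>: \<open>lam ^ r0\<close>
  must tend to infinity, so that survival to \<open>r0\<close> is about as likely as survival
  forever, and rare collisions ask for \<open>lam ^ (2 * r0)\<close> far below Lam, hence 1/4. The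
  size threshold sits between \<open>lam ^ r0 / e ^ 2\<close> and \<open>lam ^ r / e ^ 2\<close>.
  The obstacle is dependence: j-sets with a recent common ancestor share vertices and compete for
  the same hyperedges. Each such coincidence costs order 1/n, which is negligible in total because
  \<open>e * n\<close> tends to infinity faster than logarithms. Moreover, the hypergraph left over
  by one exploration has lost its symmetry, so the second exploration runs in a full fresh copy, and
  a taint records what may depend on replaced hyperedges.\<close>

definition bexp :: "real \<Rightarrow> 'a set \<Rightarrow> ('a set \<Rightarrow> real) \<Rightarrow> real" where
  "bexp p A f = (\<Sum>H\<in>Pow A. p ^ card H * (1 - p) ^ card (A - H) * f H)"

lemma bexp_empty [simp]: "bexp p {} f = f {}"
  by (simp add: bexp_def)

lemma bexp_insert:
  assumes "finite A" "K \<notin> A"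
  shows "bexp p (insert K A) f = p * bexp p A (\<lambda>H. f (insert K H)) + (1 - p) * bexp p A f"
proof -
  have inj: "inj_on (insert K) (Pow A)"
    using assms by (auto simp: inj_on_def)
  have disj: "Pow A \<inter> insert K ` Pow A = {}"
    using assms by auto
  have c1: "card (insert K A - H) = Suc (card (A - H))" if "H \<subseteq> A" for H
  proof -
    have "insert K A - H = insert K (A - H)" using that assms by auto
    thus ?thesis using assms by simp
  qed
  have c2: "insert K A - insert K H = A - H" if "H \<subseteq> A" for H
    using that assms by auto
  have c3: "card (insert K H) = Suc (card H)" if "H \<subseteq> A" for H
    using that assms by (metis card_insert_disjoint finite_subset subsetD)
  have "bexp p (insert K A) f = (\<Sum>H\<in>Pow A. p ^ card H * (1 - p) ^ card (insert K A - H) * f H)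
      + (\<Sum>H\<in>insert K ` Pow A. p ^ card H * (1 - p) ^ card (insert K A - H) * f H)"
    unfolding bexp_def Pow_insert using assms disj by (subst sum.union_disjoint) auto
  also have "(\<Sum>H\<in>insert K ` Pow A. p ^ card H * (1 - p) ^ card (insert K A - H) * f H) =
     p * bexp p A (\<lambda>H. f (insert K H))"
    unfolding bexp_def sum_distrib_left
    by (subst sum.reindex[OF inj]) (simp add: c3 mult.assoc assms)
  also have "(\<Sum>H\<in>Pow A. p ^ card H * (1 - p) ^ card (insert K A - H) * f H) = (1 - p) * bexp p A f"
    unfolding bexp_def sum_distrib_left by (auto intro!: sum.cong simp: c1)
  finally show ?thesis by simp
qed

lemma bexp_cong:
  assumes "\<And>H. H \<subseteq> A \<Longrightarrow> f H = g H"
  shows "bexp p A f = bexp p A g"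
  unfolding bexp_def using assms by (auto intro!: sum.cong)

lemma bexp_add: "bexp p A (\<lambda>H. f H + g H) = bexp p A f + bexp p A g"
  by (simp add: bexp_def algebra_simps sum.distrib)

lemma bexp_diff: "bexp p A (\<lambda>H. f H - g H) = bexp p A f - bexp p A g"
  by (simp add: bexp_def algebra_simps sum_subtractf)

lemma bexp_cmult: "bexp p A (\<lambda>H. c * f H) = c * bexp p A f"
  by (simp add: bexp_def sum_distrib_left mult.left_commute)

lemma bexp_multc: "bexp p A (\<lambda>H. f H * c) = bexp p A f * c"
  by (simp add: bexp_def sum_distrib_right mult.assoc)

lemma bexp_sum: "bexp p A (\<lambda>H. \<Sum>i\<in>I. f i H) = (\<Sum>i\<in>I. bexp p A (f i))"
  by (simp add: bexp_def sum_distrib_left) (rule sum.swap)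

lemma bexp_const [simp]:
  assumes "finite A"
  shows "bexp p A (\<lambda>_. c) = c"
  using assms by induction (auto simp: bexp_insert algebra_simps)

lemma bexp_mono:
  assumes "0 \<le> p" "p \<le> 1" "\<And>H. H \<subseteq> A \<Longrightarrow> f H \<le> g H"
  shows "bexp p A f \<le> bexp p A g"
  unfolding bexp_def using assms by (auto intro!: sum_mono mult_left_mono)

lemma bexp_nonneg:
  assumes "0 \<le> p" "p \<le> 1" "\<And>H. H \<subseteq> A \<Longrightarrow> 0 \<le> f H"
  shows "0 \<le> bexp p A f"
  unfolding bexp_def using assms by (auto intro!: sum_nonneg)

text \<open>Independence of disjoint blocks in Fubini form; every argument that reveals hyperedges
  in stages rests on it.\<close>

lemma bexp_union:
  assumes "finite A" "finite B" "A \<inter> B = {}"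
  shows "bexp p (A \<union> B) f = bexp p A (\<lambda>H1. bexp p B (\<lambda>H2. f (H1 \<union> H2)))"
  using assms(1,3)
proof (induction A arbitrary: f)
  case empty
  thus ?case by simp
next
  case (insert K A)
  have "bexp p (insert K A \<union> B) f = p * bexp p (A \<union> B) (\<lambda>H. f (insert K H)) + (1 - p) * bexp p (A \<union> B) f"
    using insert assms by (simp add: bexp_insert)
  thus ?case using insert by (simp add: bexp_insert)
qed

text \<open>Lets an expectation over the unqueried hyperedges be rewritten as one over the whole
  hypergraph, as needed when a second exploration runs in a full copy.\<close>

lemma bexp_restrict:
  assumes "finite A"
  shows "bexp p A (\<lambda>H. f (H \<inter> B)) = bexp p (A \<inter> B) f"
proof -
  have "bexp p A (\<lambda>H. f (H \<inter> B)) = bexp p ((A \<inter> B) \<union> (A - B)) (\<lambda>H. f (H \<inter> B))"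
    by (simp add: Int_Diff_Un)
  also have "\<dots> = bexp p (A \<inter> B) (\<lambda>H1. bexp p (A - B) (\<lambda>H2. f ((H1 \<union> H2) \<inter> B)))"
    using assms by (subst bexp_union) auto
  also have "\<dots> = bexp p (A \<inter> B) (\<lambda>H1. bexp p (A - B) (\<lambda>H2. f H1))"
    by (intro bexp_cong arg_cong[where f = f]) auto
  also have "\<dots> = bexp p (A \<inter> B) f"
    using assms by simp
  finally show ?thesis .
qed

lemma bexp_power_card:
  assumes "finite A"
  shows "bexp p A (\<lambda>H. w ^ card H) = (1 - p + p * w) ^ card A"
  using assms
proof induction
  case (insert K A)
  have "bexp p A (\<lambda>H. w ^ card (insert K H)) = bexp p A (\<lambda>H. w * w ^ card H)"
    using insert by (intro bexp_cong) (metis card_insert_disjoint finite_subset power_Suc subsetD)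
  thus ?case using insert by (simp add: bexp_insert bexp_cmult algebra_simps)
qed simp

lemma bexp_remove:
  assumes "finite A" "K \<in> A"
  shows "bexp p A f = p * bexp p (A - {K}) (\<lambda>H. f (insert K H)) + (1 - p) * bexp p (A - {K}) f"
  using bexp_insert[of "A - {K}" K p f] assms by (simp add: insert_absorb)

lemma bexp_mem:
  assumes "finite A" "K \<in> A"
  shows "bexp p A (\<lambda>H. of_bool (K \<in> H)) = p"
proof -
  have "bexp p (A - {K}) (\<lambda>H. of_bool (K \<in> H)) = bexp p (A - {K}) (\<lambda>H. 0)"
    by (rule bexp_cong) auto
  thus ?thesis using assms by (simp add: bexp_remove[OF assms])
qed

lemma bexp_mem2:
  assumes "finite A" "K \<in> A" "K' \<in> A" "K \<noteq> K'"
  shows "bexp p A (\<lambda>H. of_bool (K \<in> H \<and> K' \<in> H)) = p ^ 2"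
proof -
  have "bexp p (A - {K}) (\<lambda>H. of_bool (K \<in> H \<and> K' \<in> H)) = bexp p (A - {K}) (\<lambda>H. 0)"
    by (rule bexp_cong) auto
  moreover have "bexp p (A - {K}) (\<lambda>H. of_bool (K' \<in> insert K H)) = bexp p (A - {K}) (\<lambda>H. of_bool (K' \<in> H))"
    using assms by (intro bexp_cong) auto
  ultimately show ?thesis using assms by (simp add: bexp_remove[of A K] bexp_mem power2_eq_square)
qed

lemma bexp_sum_mem:
  assumes "finite A"
  shows "bexp p A (\<lambda>H. \<Sum>K\<in>H. f K) = p * (\<Sum>K\<in>A. f K)"
proof -
  have "bexp p A (\<lambda>H. \<Sum>K\<in>H. f K) = bexp p A (\<lambda>H. \<Sum>K\<in>A. of_bool (K \<in> H) * f K)"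
  proof (rule bexp_cong)
    fix H assume "H \<subseteq> A"
    thus "(\<Sum>K\<in>H. f K) = (\<Sum>K\<in>A. of_bool (K \<in> H) * f K)"
      using assms by (intro sum.mono_neutral_cong_left) auto
  qed
  also have "\<dots> = (\<Sum>K\<in>A. bexp p A (\<lambda>H. of_bool (K \<in> H)) * f K)"
    unfolding bexp_sum bexp_multc ..
  also have "\<dots> = (\<Sum>K\<in>A. p * f K)"
    using assms by (intro sum.cong) (auto simp: bexp_mem)
  finally show ?thesis by (simp add: sum_distrib_left)
qed

lemma bexp_sum_mem2:
  assumes "finite A"
  shows "bexp p A (\<lambda>H. \<Sum>K\<in>H. \<Sum>K'\<in>H - {K}. f K K') = p ^ 2 * (\<Sum>K\<in>A. \<Sum>K'\<in>A - {K}. f K K')"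
proof -
  have "bexp p A (\<lambda>H. \<Sum>K\<in>H. \<Sum>K'\<in>H - {K}. f K K')
     = bexp p A (\<lambda>H. \<Sum>K\<in>A. \<Sum>K'\<in>A - {K}. of_bool (K \<in> H \<and> K' \<in> H) * f K K')"
  proof (rule bexp_cong)
    fix H assume H: "H \<subseteq> A"
    have "(\<Sum>K'\<in>A - {K}. of_bool (K \<in> H \<and> K' \<in> H) * f K K') = (\<Sum>K'\<in>H - {K}. f K K')" if "K \<in> H" for K
      using assms H that by (intro sum.mono_neutral_cong_right) auto
    moreover have "(\<Sum>K'\<in>A - {K}. of_bool (K \<in> H \<and> K' \<in> H) * f K K') = 0" if "K \<notin> H" for K
      using that by simp
    ultimately show "(\<Sum>K\<in>H. \<Sum>K'\<in>H - {K}. f K K') = (\<Sum>K\<in>A. \<Sum>K'\<in>A - {K}. of_bool (K \<in> H \<and> K' \<in> H) * f K K')"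
      using assms H by (intro sum.mono_neutral_cong_left) auto
  qed
  also have "\<dots> = (\<Sum>K\<in>A. \<Sum>K'\<in>A - {K}. bexp p A (\<lambda>H. of_bool (K \<in> H \<and> K' \<in> H)) * f K K')"
    unfolding bexp_sum bexp_multc ..
  also have "\<dots> = (\<Sum>K\<in>A. \<Sum>K'\<in>A - {K}. p ^ 2 * f K K')"
    using assms by (intro sum.cong) (auto simp: bexp_mem2)
  finally show ?thesis by (simp add: sum_distrib_left)
qed

lemma bexp_permute:
  assumes "finite A" "bij_betw g A A"
  shows "bexp p A (\<lambda>H. f (g ` H)) = bexp p A f"
proof -
  have inj: "inj_on g A" and im: "g ` A = A" using assms by (auto simp: bij_betw_def)
  have b: "bij_betw (image g) (Pow A) (Pow A)"
    using assms(2) by (simp add: bij_betw_Pow)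
  have "bexp p A f = (\<Sum>H\<in>Pow A. p ^ card (g ` H) * (1 - p) ^ card (A - g ` H) * f (g ` H))"
    unfolding bexp_def by (rule sum.reindex_bij_betw[OF b, symmetric])
  also have "\<dots> = bexp p A (\<lambda>H. f (g ` H))"
    unfolding bexp_def
  proof (intro sum.cong refl)
    fix H assume H: "H \<in> Pow A"
    have "card (g ` H) = card H" using inj H by (auto intro: card_image inj_on_subset)
    moreover have "A - g ` H = g ` (A - H)" using inj_on_image_set_diff[OF inj, of A H] im H by auto
    moreover have "card (g ` (A - H)) = card (A - H)"
      by (intro card_image inj_on_subset[OF inj]) auto
    ultimately show "p ^ card (g ` H) * (1 - p) ^ card (A - g ` H) * f (g ` H) = p ^ card H * (1 - p) ^ card (A - H) * f (g ` H)" by simp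
  qed
  finally show ?thesis by simp
qed

lemma finite_ksets [simp]: "finite (ksets n k)"
  by (rule finite_subset[of _ "Pow {..<n}"]) (auto simp: ksets_def)

lemma card_ksets: "card (ksets n k) = n choose k"
  unfolding ksets_def using n_subsets[of "{..<n}" k] by simp

lemma prob_random_hypergraph:
  assumes "0 \<le> p" "p \<le> 1"
  shows "measure_pmf.prob (random_hypergraph n k p) X = bexp p (ksets n k) (\<lambda>H. of_bool (H \<in> X))"
proof -
  let ?E = "ksets n k"
  let ?M = "Pi_pmf ?E False (\<lambda>_. bernoulli_pmf p)"
  let ?g = "\<lambda>f. {e \<in> ?E. f e}"
  have pmf_eq: "pmf (random_hypergraph n k p) H = p ^ card H * (1 - p) ^ card (?E - H)" if "H \<subseteq> ?E" for H
  proof -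
    \<comment> \<open>On the support of the product measure \<open>f\<close> is False outside the
      k-sets, so it is determined by the k-sets where it is True.\<close>
    have "f = (\<lambda>e. e \<in> H) \<longleftrightarrow> {e \<in> ?E. f e} = H" if "f \<in> set_pmf ?M" for f
      using that \<open>H \<subseteq> ?E\<close> set_Pi_pmf_subset[OF finite_ksets, of n k False "\<lambda>_. bernoulli_pmf p"]
      by (fastforce simp: fun_eq_iff)
    hence "measure_pmf.prob ?M (?g -` {H}) = measure_pmf.prob ?M {\<lambda>e. e \<in> H}"
      by (intro measure_pmf.finite_measure_eq_AE) (auto simp: AE_measure_pmf_iff)
    hence "pmf (random_hypergraph n k p) H = pmf ?M (\<lambda>e. e \<in> H)"
      by (simp add: random_hypergraph_def pmf_map measure_pmf_single)
    also have "\<dots> = (\<Prod>e\<in>?E. pmf (bernoulli_pmf p) (e \<in> H))"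
      using that by (subst pmf_Pi) auto
    also have "\<dots> = (\<Prod>e\<in>H \<union> (?E - H). if e \<in> H then p else 1 - p)"
      using that assms by (intro prod.cong) auto
    also have "\<dots> = p ^ card H * (1 - p) ^ card (?E - H)"
      using that finite_subset[OF that] by (subst prod.union_disjoint) auto
    finally show ?thesis .
  qed
  have sub: "set_pmf (random_hypergraph n k p) \<subseteq> Pow ?E"
    by (auto simp: random_hypergraph_def)
  have "measure_pmf.prob (random_hypergraph n k p) X = measure_pmf.prob (random_hypergraph n k p) (X \<inter> Pow ?E)"
    using sub by (intro measure_pmf.finite_measure_eq_AE) (auto simp: AE_measure_pmf_iff)
  also have "\<dots> = (\<Sum>H\<in>X \<inter> Pow ?E. pmf (random_hypergraph n k p) H)"
    by (intro measure_measure_pmf_finite) auto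
  also have "\<dots> = (\<Sum>H\<in>Pow ?E. p ^ card H * (1 - p) ^ card (?E - H) * of_bool (H \<in> X))"
    by (intro sum.mono_neutral_cong_left) (auto simp: pmf_eq)
  finally show ?thesis by (simp add: bexp_def)
qed

section \<open>The exploration process\<close>

definition jsub :: "nat \<Rightarrow> nat set \<Rightarrow> nat set set" where
  "jsub j K = {J. J \<subseteq> K \<and> card J = j}"

text \<open>Removing \<open>G\<close> is enough: hyperedges from \<open>KK D G\<close> contain no
  j-set of \<open>D\<close>, so the result is disjoint from everything explored before
  (\<open>nw_disjoint\<close>).\<close>

definition nw :: "nat \<Rightarrow> nat set set \<Rightarrow> nat set set \<Rightarrow> nat set set" where
  "nw j H G = (\<Union>K\<in>H. jsub j K) - G"

lemma ksets_finite_elem: "J \<in> ksets n k \<Longrightarrow> finite J"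
  by (auto simp: ksets_def intro: finite_subset)

lemma card_jsub: "K \<in> ksets n k \<Longrightarrow> card (jsub j K) = k choose j"
  unfolding jsub_def using n_subsets[of K j] ksets_finite_elem[of K n k] by (auto simp: ksets_def)

lemma finite_jsub [intro]: "K \<in> ksets n k \<Longrightarrow> finite (jsub j K)"
  using ksets_finite_elem[of K n k] by (auto simp: jsub_def)

lemma jsub_subset: "K \<in> ksets n k \<Longrightarrow> jsub j K \<subseteq> ksets n j"
  by (auto simp: jsub_def ksets_def)

lemma mem_jsub_iff: "J \<in> ksets n j \<Longrightarrow> J \<in> jsub j K \<longleftrightarrow> J \<subseteq> K"
  by (auto simp: jsub_def ksets_def)

lemma card_supersets:
  assumes "finite S" "S \<subseteq> {..<n}" "card S \<le> k"
  shows "card {K \<in> ksets n k. S \<subseteq> K} = (n - card S) choose (k - card S)"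
proof -
  have "bij_betw (\<lambda>T. T \<union> S) {T. T \<subseteq> {..<n} - S \<and> card T = k - card S} {K \<in> ksets n k. S \<subseteq> K}"
  proof (rule bij_betw_byWitness[where f' = "\<lambda>K. K - S"])
    show "(\<lambda>T. T \<union> S) ` {T. T \<subseteq> {..<n} - S \<and> card T = k - card S} \<subseteq> {K \<in> ksets n k. S \<subseteq> K}"
    proof safe
      fix T assume T: "T \<subseteq> {..<n} - S" "card T = k - card S"
      have "finite T" using T(1) by (rule finite_subset) auto
      hence "card (T \<union> S) = card T + card S" using T assms by (subst card_Un_disjoint) auto
      thus "T \<union> S \<in> ksets n k" using T assms by (auto simp: ksets_def)
    qed
    show "(\<lambda>K. K - S) ` {K \<in> ksets n k. S \<subseteq> K} \<subseteq> {T. T \<subseteq> {..<n} - S \<and> card T = k - card S}"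
      using assms by (auto simp: ksets_def card_Diff_subset)
  qed auto
  hence "card {K \<in> ksets n k. S \<subseteq> K} = card {T. T \<subseteq> {..<n} - S \<and> card T = k - card S}"
    by (simp add: bij_betw_same_card)
  also have "\<dots> = (n - card S) choose (k - card S)"
    using assms by (subst n_subsets) (auto simp: card_Diff_subset)
  finally show ?thesis .
qed

text \<open>The bound \<open>4 * k \<le> n\<close> leaves room for a j-set disjoint from two given
  ones and keeps \<open>n - j\<close> and \<open>n - 2 * j\<close> comparable with
  \<open>n\<close>.\<close>

locale hyp =
  fixes n k j :: nat and p :: real
  assumes j1: "1 \<le> j" and jk: "j < k" and nk: "4 * k \<le> n" and p0: "0 \<le> p" and p1: "p \<le> 1"
begin

abbreviation "JS \<equiv> ksets n j"
abbreviation "KS \<equiv> ksets n k"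

definition q :: nat where "q = (k choose j) - 1"
definition M :: nat where "M = (n - j) choose (k - j)"
definition N :: nat where "N = n choose j"
text \<open>Mean offspring of a j-set: \<open>M\<close> possible hyperedges above it, each present
  with probability \<open>p\<close> and each bringing \<open>q\<close> further j-sets.\<close>

definition lam :: real where "lam = p * real M * real q"

text \<open>A k-set counts as queried once one of its j-subsets is dead, so the dead set alone
  determines which hyperedges are still random.\<close>

definition free :: "nat set set \<Rightarrow> nat set set" where
  "free D = {K \<in> KS. \<forall>J\<in>D. \<not> J \<subseteq> K}"

definition KK :: "nat set set \<Rightarrow> nat set set \<Rightarrow> nat set set" where
  "KK D G = {K \<in> free D. \<exists>J\<in>G. J \<subseteq> K}"

text \<open>A whole frontier is processed in one step, so that the counter is the level of the
  search and one step corresponds to one generation of the branching process.\<close>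

fun run :: "nat set set \<Rightarrow> nat \<Rightarrow> nat set set \<times> nat set set \<Rightarrow> nat set set \<times> nat set set" where
  "run H 0 s = s"
| "run H (Suc i) (D, G) = run H i (D \<union> G, nw j (H \<inter> KK D G) G)"

text \<open>The integration runs over the unqueried hyperedges; by \<open>run_restrict\<close> no
  others influence the run.\<close>

definition Ex :: "nat \<Rightarrow> nat set set \<times> nat set set \<Rightarrow> (nat set set \<times> nat set set \<Rightarrow> real) \<Rightarrow> real" where
  "Ex i s \<phi> = bexp p (free (fst s)) (\<lambda>H. \<phi> (run H i s))"

lemma card_JS: "card JS = N"
  by (simp add: card_ksets N_def)

lemma N_pos: "N > 0"
  using nk jk by (simp add: N_def)

lemma q_pos: "q \<ge> 1"
proof -
  obtain k' j' where kj: "k = Suc k'" "j = Suc j'" using j1 jk by (metis Suc_le_D One_nat_def less_imp_Suc_add)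
  have "k' choose j' > 0" "k' choose Suc j' > 0" using jk kj by (auto simp: zero_less_binomial_iff)
  hence "k choose j > 1" unfolding kj binomial_Suc_Suc by linarith
  thus ?thesis by (simp add: q_def)
qed

lemma Suc_q: "Suc q = k choose j"
  using jk by (simp add: q_def)

lemma M_pos: "M \<ge> 1"
  using jk nk by (simp add: M_def Suc_leI)

lemma finite_free [simp]: "finite (free D)"
  unfolding free_def by simp

lemma finite_KK [simp]: "finite (KK D G)"
  unfolding KK_def by simp

lemma free_subset: "free D \<subseteq> KS" by (auto simp: free_def)

lemma KK_subset_free: "KK D G \<subseteq> free D" by (auto simp: KK_def)

lemma KK_subset: "KK D G \<subseteq> KS" using free_subset KK_subset_free by blast

lemma free_empty [simp]: "free {} = KS" by (auto simp: free_def)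

lemma free_Un: "free (D \<union> G) = free D \<inter> free G"
  by (auto simp: free_def)

lemma free_split: "free D = KK D G \<union> free (D \<union> G)" "KK D G \<inter> free (D \<union> G) = {}"
  by (auto simp: free_def KK_def)

lemma finite_JS_sub: "G \<subseteq> JS \<Longrightarrow> finite G"
  by (rule finite_subset[OF _ finite_ksets])

lemma card_above:
  assumes "J \<in> JS"
  shows "card {K \<in> KS. J \<subseteq> K} = M"
  using card_supersets[of J n k] assms jk ksets_finite_elem[OF assms] by (auto simp: ksets_def M_def)

lemma nw_subset:
  assumes "H \<subseteq> KS" shows "nw j H G \<subseteq> JS"
  using assms jsub_subset by (fastforce simp: nw_def)

lemma nw_disjoint:
  assumes "H \<subseteq> KK D G" "D \<subseteq> JS" shows "nw j H G \<inter> (D \<union> G) = {}"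
  using assms by (fastforce simp: nw_def KK_def free_def jsub_def)

text \<open>All queries after \<open>s\<close> go to sets \<open>KK D' G'\<close> with
  \<open>D'\<close> containing \<open>fst s\<close>, and these lie in
  \<open>free (fst s)\<close>.\<close>

lemma run_restrict: "run H i s = run (H \<inter> free (fst s)) i s"
proof (induction i arbitrary: s H)
  case (Suc i)
  obtain D G where s: "s = (D, G)" by (cases s)
  have e: "H \<inter> free D \<inter> KK D G = H \<inter> KK D G" by (auto simp: KK_def)
  have "run H (Suc i) s = run H i (D \<union> G, nw j (H \<inter> KK D G) G)" by (simp add: s)
  also have "\<dots> = run (H \<inter> free (D \<union> G)) i (D \<union> G, nw j (H \<inter> KK D G) G)"
    by (subst Suc.IH) simp
  also have "H \<inter> free (D \<union> G) = H \<inter> free D \<inter> free (D \<union> G)"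
    by (auto simp: free_Un)
  also have "run (H \<inter> free D \<inter> free (D \<union> G)) i (D \<union> G, nw j (H \<inter> KK D G) G) 
      = run (H \<inter> free D) i (D \<union> G, nw j (H \<inter> KK D G) G)"
    by (subst (2) Suc.IH) simp
  finally show ?case by (simp add: s e)
qed simp

lemma run_sub:
  assumes "fst s \<subseteq> JS" "snd s \<subseteq> JS"
  shows "fst (run H i s) \<subseteq> JS" "snd (run H i s) \<subseteq> JS"
proof -
  have "fst (run H i s) \<subseteq> JS \<and> snd (run H i s) \<subseteq> JS" using assms
  proof (induction i arbitrary: s)
    case (Suc i)
    obtain D G where s: "s = (D, G)" by (cases s)
    have "nw j (H \<inter> KK D G) G \<subseteq> JS" using KK_subset by (intro nw_subset) auto
    thus ?case using Suc by (simp add: s)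
  qed simp
  thus "fst (run H i s) \<subseteq> JS" "snd (run H i s) \<subseteq> JS" by auto
qed

lemma run_fst_mono: "fst s \<subseteq> fst (run H i s)"
proof (induction i arbitrary: s)
  case (Suc i)
  obtain D G where s: "s = (D, G)" by (cases s)
  show ?case using Suc[of "(D \<union> G, nw j (H \<inter> KK D G) G)"] by (auto simp: s)
qed simp

lemma run_disjoint:
  assumes "fst s \<subseteq> JS" "snd s \<subseteq> JS" "fst s \<inter> snd s = {}"
  shows "fst (run H i s) \<inter> snd (run H i s) = {}"
  using assms
proof (induction i arbitrary: s)
  case (Suc i)
  obtain D G where s: "s = (D, G)" by (cases s)
  have "nw j (H \<inter> KK D G) G \<subseteq> JS" using KK_subset by (intro nw_subset) auto
  moreover have "(D \<union> G) \<inter> nw j (H \<inter> KK D G) G = {}"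
    using nw_disjoint[of "H \<inter> KK D G" D G] Suc.prems by (auto simp: s)
  ultimately show ?case using Suc by (simp add: s)
qed simp

lemma run_add: "run H (i + m) s = run H m (run H i s)"
proof (induction i arbitrary: s)
  case (Suc i)
  obtain D G where s: "s = (D, G)" by (cases s)
  show ?case using Suc by (simp add: s)
qed simp

lemma run_union:
  assumes "H1 \<subseteq> KK D G" "H2 \<subseteq> free (D \<union> G)"
  shows "run (H1 \<union> H2) (Suc i) (D, G) = run H2 i (D \<union> G, nw j H1 G)"
proof -
  have "(H1 \<union> H2) \<inter> KK D G = H1" "(H1 \<union> H2) \<inter> free (D \<union> G) = H2"
    using assms free_split(2)[of D G] by auto
  thus ?thesis
    using run_restrict[of "H1 \<union> H2" i "(D \<union> G, nw j H1 G)"] by simp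
qed

lemma Ex_0 [simp]: "Ex 0 s \<phi> = \<phi> s"
  by (simp add: Ex_def)

text \<open>The first step reveals exactly \<open>KK D G\<close>, and everything afterwards depends
  on the disjoint block \<open>free (D \<union> G)\<close>.\<close>

lemma Ex_Suc: "Ex (Suc i) (D, G) \<phi> = bexp p (KK D G) (\<lambda>H. Ex i (D \<union> G, nw j H G) \<phi>)"
proof -
  have "Ex (Suc i) (D, G) \<phi> = bexp p (KK D G \<union> free (D \<union> G)) (\<lambda>H. \<phi> (run H (Suc i) (D, G)))"
    unfolding Ex_def fst_conv using free_split(1)[of D G] by simp
  also have "\<dots> = bexp p (KK D G) (\<lambda>H1. bexp p (free (D \<union> G)) (\<lambda>H2. \<phi> (run (H1 \<union> H2) (Suc i) (D, G))))"
    by (rule bexp_union) (use free_split(2) in auto)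
  also have "\<dots> = bexp p (KK D G) (\<lambda>H1. bexp p (free (D \<union> G)) (\<lambda>H2. \<phi> (run H2 i (D \<union> G, nw j H1 G))))"
    by (intro bexp_cong) (simp add: run_union del: run.simps)
  finally show ?thesis by (simp add: Ex_def)
qed

lemma Ex_mono:
  assumes "fst s \<subseteq> JS" "snd s \<subseteq> JS"
    "\<And>D G. D \<subseteq> JS \<Longrightarrow> G \<subseteq> JS \<Longrightarrow> \<phi> (D, G) \<le> \<psi> (D, G)"
  shows "Ex i s \<phi> \<le> Ex i s \<psi>"
  unfolding Ex_def using assms run_sub[OF assms(1,2)] p0 p1
  by (intro bexp_mono) (metis prod.collapse)+

lemma Ex_cmult: "Ex i s (\<lambda>x. c * \<phi> x) = c * Ex i s \<phi>"
  by (simp add: Ex_def bexp_cmult)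

lemma Ex_add: "Ex i s (\<lambda>x. \<phi> x + \<psi> x) = Ex i s \<phi> + Ex i s \<psi>"
  by (simp add: Ex_def bexp_add)

lemma Ex_sum: "Ex i s (\<lambda>x. \<Sum>a\<in>I. \<phi> a x) = (\<Sum>a\<in>I. Ex i s (\<phi> a))"
  by (simp add: Ex_def bexp_sum)

lemma Ex_const [simp]: "Ex i s (\<lambda>_. c) = c"
  by (simp add: Ex_def)

text \<open>Spatial Markov property: the hyperedges that the exploration has not queried are fresh.\<close>

lemma run_markov:
  "bexp p (free (fst s)) (\<lambda>H. \<Phi> (run H i s) (H \<inter> free (fst (run H i s)))) =
   Ex i s (\<lambda>s'. bexp p (free (fst s')) (\<Phi> s'))"
proof (induction i arbitrary: s)
  case 0
  have "bexp p (free (fst s)) (\<lambda>H. \<Phi> s (H \<inter> free (fst s))) = bexp p (free (fst s)) (\<Phi> s)"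
    by (rule bexp_cong) (simp add: Int_absorb2)
  thus ?case by simp
next
  case (Suc i)
  obtain D G where s: "s = (D, G)" by (cases s)
  let ?F = "\<lambda>H. \<Phi> (run H (Suc i) (D, G)) (H \<inter> free (fst (run H (Suc i) (D, G))))"
  have "bexp p (free D) ?F = bexp p (KK D G \<union> free (D \<union> G)) ?F"
    using free_split(1)[of D G] by simp
  also have "\<dots> = bexp p (KK D G) (\<lambda>H1. bexp p (free (D \<union> G)) (\<lambda>H2. ?F (H1 \<union> H2)))"
    by (rule bexp_union) (use free_split(2) in auto)
  also have "\<dots> = bexp p (KK D G) (\<lambda>H1. bexp p (free (D \<union> G)) (\<lambda>H2. \<Phi> (run H2 i (D \<union> G, nw j H1 G)) 
        (H2 \<inter> free (fst (run H2 i (D \<union> G, nw j H1 G))))))"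
  proof (intro bexp_cong)
    fix H1 H2 assume H: "H1 \<subseteq> KK D G" "H2 \<subseteq> free (D \<union> G)"
    let ?s = "run H2 i (D \<union> G, nw j H1 G)"
    have "D \<union> G \<subseteq> fst ?s" using run_fst_mono[of "(D \<union> G, nw j H1 G)" H2 i] by simp
    \<comment> \<open>A hyperedge of the first step contains a j-set of \<open>G\<close>, which is
      dead from then on, so it is not free at any later time.\<close>
    hence "H1 \<inter> free (fst ?s) = {}"
      using H(1) by (fastforce simp: KK_def free_def)
    hence "(H1 \<union> H2) \<inter> free (fst ?s) = H2 \<inter> free (fst ?s)" by auto
    thus "?F (H1 \<union> H2) = \<Phi> ?s (H2 \<inter> free (fst ?s))"
      by (simp add: run_union[OF H] del: run.simps)
  qed
  also have "\<dots> = bexp p (KK D G) (\<lambda>H1. Ex i (D \<union> G, nw j H1 G) (\<lambda>s'. bexp p (free (fst s')) (\<Phi> s')))"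
    using Suc[of "(D \<union> G, nw j H1 G)" for H1] by simp
  also have "\<dots> = Ex (Suc i) s (\<lambda>s'. bexp p (free (fst s')) (\<Phi> s'))"
    by (simp add: s Ex_Suc)
  finally show ?case by (simp add: s)
qed

text \<open>After time \<open>i\<close> the run continues in fresh hyperedges. Keeping both states
  in \<open>\<Phi>\<close> gives the correlations between two levels that the pair statistics
  need.\<close>

lemma Ex_two:
  "bexp p (free (fst s)) (\<lambda>H. \<Phi> (run H i s) (run H (i + m) s)) = Ex i s (\<lambda>s'. Ex m s' (\<Phi> s'))"
proof -
  have "run H (i + m) s = run (H \<inter> free (fst (run H i s))) m (run H i s)" for H
    unfolding run_add by (rule run_restrict)
  thus ?thesis
    using run_markov[of s "\<lambda>s' H. \<Phi> s' (run H m s')" i] by (simp add: Ex_def)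
qed

lemma Ex_add_steps: "Ex (i + m) s \<phi> = Ex i s (\<lambda>s'. Ex m s' \<phi>)"
  using Ex_two[of s "\<lambda>_. \<phi>" i m] by (simp add: Ex_def)

end

section \<open>The transition kernel and one exploration step\<close>

lemma sum_UN_le:
  assumes "finite I" "\<And>i. i \<in> I \<Longrightarrow> finite (A i)" "\<And>i x. i \<in> I \<Longrightarrow> x \<in> A i \<Longrightarrow> (0::real) \<le> f x"
  shows "(\<Sum>x\<in>(\<Union>i\<in>I. A i). f x) \<le> (\<Sum>i\<in>I. \<Sum>x\<in>A i. f x)"
  using assms
proof (induction I)
  case (insert i I)
  let ?U = "\<Union>i\<in>I. A i"
  have "(\<Sum>x\<in>A i \<union> ?U. f x) = (\<Sum>x\<in>A i. f x) + (\<Sum>x\<in>?U - A i. f x)"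
    using insert.prems(1) insert.hyps(1) by (subst sum.union_disjoint[symmetric]) (auto intro!: sum.cong)
  also have "(\<Sum>x\<in>?U - A i. f x) \<le> (\<Sum>x\<in>?U. f x)"
    using insert by (intro sum_mono2) auto
  also have "\<dots> \<le> (\<Sum>i\<in>I. \<Sum>x\<in>A i. f x)"
    using insert by auto
  finally show ?case using insert by simp
qed simp

context hyp begin

definition cnt :: "nat set \<Rightarrow> nat set \<Rightarrow> nat" where
  "cnt J J' = card {K \<in> KS. J \<subseteq> K \<and> J' \<subseteq> K}"

text \<open>Expected number of hyperedges through both j-sets. The diagonal is removed because a
  j-set is not its own offspring, which makes the row sums equal to \<open>lam\<close>.\<close>

definition t :: "nat set \<Rightarrow> nat set \<Rightarrow> real" where
  "t J J' = (if J = J' then 0 else p * real (cnt J J'))"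

definition Tr :: "(nat set \<Rightarrow> real) \<Rightarrow> nat set \<Rightarrow> real" where
  "Tr h J = (\<Sum>J'\<in>JS. t J J' * h J')"

lemma cnt_sym: "cnt J J' = cnt J' J"
  by (simp add: cnt_def conj_commute)

lemma t_sym: "t J J' = t J' J"
  by (simp add: t_def cnt_sym)

lemma t_diag [simp]: "t J J = 0"
  by (simp add: t_def)

lemma t_nonneg [simp]: "0 \<le> t J J'"
  using p0 by (simp add: t_def)

lemma Tr_nonneg: "(\<And>J. J \<in> JS \<Longrightarrow> 0 \<le> h J) \<Longrightarrow> 0 \<le> Tr h J"
  unfolding Tr_def by (intro sum_nonneg) auto

lemma Tr_mono: "(\<And>J. J \<in> JS \<Longrightarrow> h J \<le> h' J) \<Longrightarrow> Tr h J \<le> Tr h' J"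
  unfolding Tr_def by (intro sum_mono mult_left_mono) auto

lemma Tr_cong: "(\<And>J. J \<in> JS \<Longrightarrow> h J = h' J) \<Longrightarrow> Tr h J = Tr h' J"
  unfolding Tr_def by (intro sum.cong) auto

lemma Tr_cmult: "Tr (\<lambda>J. c * h J) J = c * Tr h J"
  by (simp add: Tr_def sum_distrib_left mult.left_commute)

lemma Tr_sum: "Tr (\<lambda>J. \<Sum>i\<in>I. h i J) J = (\<Sum>i\<in>I. Tr (h i) J)"
  unfolding Tr_def sum_distrib_left by (rule sum.swap)

text \<open>Double counting of pairs formed by a hyperedge above \<open>J\<close> and a further
  j-set in it.\<close>

lemma Tr_alt:
  assumes "J \<in> JS"
  shows "p * (\<Sum>K | K \<in> KS \<and> J \<subseteq> K. \<Sum>J'\<in>jsub j K - {J}. h J') = Tr h J"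
proof -
  have "(\<Sum>K | K \<in> KS \<and> J \<subseteq> K. \<Sum>J'\<in>jsub j K - {J}. h J')
    = (\<Sum>K | K \<in> KS \<and> J \<subseteq> K. \<Sum>J'\<in>JS. of_bool (J' \<subseteq> K \<and> J' \<noteq> J) * h J')"
  proof (rule sum.cong[OF refl])
    fix K assume "K \<in> {K. K \<in> KS \<and> J \<subseteq> K}"
    hence K: "K \<in> KS" by simp
    have "jsub j K - {J} = {J' \<in> JS. J' \<subseteq> K \<and> J' \<noteq> J}"
      using jsub_subset[OF K, of j] by (auto simp: jsub_def ksets_def)
    thus "(\<Sum>J'\<in>jsub j K - {J}. h J') = (\<Sum>J'\<in>JS. of_bool (J' \<subseteq> K \<and> J' \<noteq> J) * h J')"
      by (simp only: sum.inter_filter[OF finite_ksets]) (rule sum.cong, simp_all)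
  qed
  also have "\<dots> = (\<Sum>J'\<in>JS. \<Sum>K | K \<in> KS \<and> J \<subseteq> K. of_bool (J' \<subseteq> K \<and> J' \<noteq> J) * h J')"
    by (rule sum.swap)
  also have "\<dots> = (\<Sum>J'\<in>JS. (if J = J' then 0 else real (cnt J J')) * h J')"
  proof (intro sum.cong refl)
    fix J' assume "J' \<in> JS"
    have "(\<Sum>K | K \<in> KS \<and> J \<subseteq> K. of_bool (J' \<subseteq> K \<and> J' \<noteq> J) * h J')
      = (\<Sum>K | K \<in> KS \<and> J \<subseteq> K. of_bool (J' \<subseteq> K \<and> J' \<noteq> J)) * h J'"
      by (simp add: sum_distrib_right)
    also have "(\<Sum>K | K \<in> KS \<and> J \<subseteq> K. of_bool (J' \<subseteq> K \<and> J' \<noteq> J)) = (if J = J' then 0 else real (cnt J J'))"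
    proof (cases "J = J'")
      case False
      have "{K. K \<in> KS \<and> J \<subseteq> K} \<inter> {K. J' \<subseteq> K} = {K \<in> KS. J \<subseteq> K \<and> J' \<subseteq> K}" by auto
      moreover have "(\<Sum>K | K \<in> KS \<and> J \<subseteq> K. of_bool (J' \<subseteq> K \<and> J' \<noteq> J) :: real)
         = real (card ({K. K \<in> KS \<and> J \<subseteq> K} \<inter> {K. J' \<subseteq> K}))"
        using False by (subst sum_of_bool_eq) auto
      ultimately show ?thesis using False by (simp add: cnt_def)
    qed simp
    finally show "(\<Sum>K | K \<in> KS \<and> J \<subseteq> K. of_bool (J' \<subseteq> K \<and> J' \<noteq> J) * h J') =
      (if J = J' then 0 else real (cnt J J')) * h J'" .
  qed
  finally show ?thesis
    by (simp add: Tr_def t_def sum_distrib_left if_distrib mult.assoc cong: if_cong)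
      (intro sum.cong, auto)
qed

lemma Tr_const: 
  assumes "J \<in> JS" shows "Tr (\<lambda>_. c) J = lam * c"
proof -
  have "(\<Sum>K | K \<in> KS \<and> J \<subseteq> K. \<Sum>J'\<in>jsub j K - {J}. c) = (\<Sum>K | K \<in> KS \<and> J \<subseteq> K. real q * c)"
  proof (intro sum.cong refl)
    fix K assume K: "K \<in> {K. K \<in> KS \<and> J \<subseteq> K}"
    hence "J \<in> jsub j K" using assms by (simp add: mem_jsub_iff)
    hence "card (jsub j K - {J}) = q"
      using K card_jsub[of K n k j] by (simp add: card_Diff_singleton q_def)
    thus "(\<Sum>J'\<in>jsub j K - {J}. c) = real q * c" by simp
  qed
  also have "\<dots> = real M * real q * c" using card_above[OF assms] by simp
  finally show ?thesis unfolding Tr_alt[OF assms, symmetric] by (simp add: lam_def)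
qed

lemma t_rowsum: "J \<in> JS \<Longrightarrow> (\<Sum>J'\<in>JS. t J J') = lam"
  using Tr_const[of J 1] by (simp add: Tr_def)

lemma sum_Tr: "(\<Sum>J\<in>JS. Tr h J) = lam * (\<Sum>J\<in>JS. h J)"
proof -
  have "(\<Sum>J\<in>JS. Tr h J) = (\<Sum>J'\<in>JS. (\<Sum>J\<in>JS. t J' J) * h J')"
    unfolding Tr_def sum_distrib_right using t_sym by (subst sum.swap) simp
  also have "\<dots> = (\<Sum>J'\<in>JS. lam * h J')" by (intro sum.cong) (auto simp: t_rowsum)
  finally show ?thesis by (simp add: sum_distrib_left)
qed

lemma lam_nonneg: "0 \<le> lam" using p0 by (simp add: lam_def)

lemma sum_nw_le:
  assumes "H \<subseteq> KS" "\<And>J. J \<in> JS \<Longrightarrow> (0::real) \<le> h J"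
  shows "(\<Sum>J\<in>nw j H G. h J) \<le> (\<Sum>K\<in>H. \<Sum>J\<in>jsub j K - G. h J)"
proof -
  have fin: "finite H" using assms(1) by (rule finite_subset) simp
  have "nw j H G = (\<Union>K\<in>H. jsub j K - G)" by (auto simp: nw_def)
  also have "(\<Sum>J\<in>\<dots>. h J) \<le> (\<Sum>K\<in>H. \<Sum>J\<in>jsub j K - G. h J)"
    
  proof (rule sum_UN_le[OF fin])
    fix K assume "K \<in> H"
    hence "K \<in> KS" using assms(1) by auto
    thus "finite (jsub j K - G)" "\<And>x. x \<in> jsub j K - G \<Longrightarrow> 0 \<le> h x"
      using assms(2) jsub_subset[of K n k j] by auto
  qed
  finally show ?thesis .
qed

text \<open>Union bound: a queried k-set contains some frontier set and is charged to all of
  them.\<close>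

lemma sum_KK_le:
  assumes "G \<subseteq> JS" "\<And>J K. K \<in> KS \<Longrightarrow> J \<in> G \<Longrightarrow> J \<subseteq> K \<Longrightarrow> w K \<le> v J K"
    "\<And>J K. K \<in> KS \<Longrightarrow> J \<in> G \<Longrightarrow> J \<subseteq> K \<Longrightarrow> (0::real) \<le> v J K"
  shows "(\<Sum>K\<in>KK D G. w K) \<le> (\<Sum>J\<in>G. \<Sum>K | K \<in> KS \<and> J \<subseteq> K. v J K)"
proof -
  have fin: "finite G" using assms(1) by (rule finite_JS_sub)
  have "(\<Sum>K\<in>KK D G. w K) \<le> (\<Sum>K\<in>KK D G. \<Sum>J | J \<in> G \<and> J \<subseteq> K. v J K)"
  proof (rule sum_mono)
    fix K assume K: "K \<in> KK D G"
    hence KS: "K \<in> KS" using KK_subset by auto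
    from K obtain J where J: "J \<in> G" "J \<subseteq> K" by (auto simp: KK_def)
    have "w K \<le> v J K" using assms(2) KS J by auto
    also have "\<dots> \<le> (\<Sum>J | J \<in> G \<and> J \<subseteq> K. v J K)"
      using fin J KS assms(3) by (intro member_le_sum) auto
    finally show "w K \<le> (\<Sum>J | J \<in> G \<and> J \<subseteq> K. v J K)" .
  qed
  also have "\<dots> \<le> (\<Sum>K\<in>KS. \<Sum>J | J \<in> G \<and> J \<subseteq> K. v J K)"
    using KK_subset assms(3) by (intro sum_mono2 sum_nonneg) auto
  also have "\<dots> = (\<Sum>J\<in>G. \<Sum>K | K \<in> KS \<and> J \<subseteq> K. v J K)"
    by (rule sum.swap_restrict) (use fin in auto)
  finally show ?thesis .
qed

text \<open>The new j-sets in a hyperedge avoid all of \<open>G\<close>, in particular the frontier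
  set to which the hyperedge is charged, so the charges at \<open>J\<close> add up to at most one
  row of the kernel.\<close>

lemma step_linear:
  assumes "G \<subseteq> JS" "\<And>J. J \<in> JS \<Longrightarrow> 0 \<le> h J"
  shows "bexp p (KK D G) (\<lambda>H. \<Sum>J\<in>nw j H G. h J) \<le> (\<Sum>J\<in>G. Tr h J)"
proof -
  have "bexp p (KK D G) (\<lambda>H. \<Sum>J\<in>nw j H G. h J) \<le> bexp p (KK D G) (\<lambda>H. \<Sum>K\<in>H. \<Sum>J\<in>jsub j K - G. h J)"
    using KK_subset[of D G] assms by (intro bexp_mono p0 p1 sum_nw_le) auto
  also have "\<dots> = p * (\<Sum>K\<in>KK D G. \<Sum>J\<in>jsub j K - G. h J)"
    by (simp add: bexp_sum_mem)
  also have "\<dots> \<le> p * (\<Sum>J\<in>G. \<Sum>K | K \<in> KS \<and> J \<subseteq> K. \<Sum>J'\<in>jsub j K - {J}. h J')"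
  proof (intro mult_left_mono sum_KK_le p0 assms)
    fix J K assume *: "K \<in> KS" "J \<in> G" "J \<subseteq> K"
    have pos: "0 \<le> h J'" if "J' \<in> jsub j K" for J' using that jsub_subset[OF *(1)] assms(2) by auto
    show "(\<Sum>J\<in>jsub j K - G. h J) \<le> (\<Sum>J'\<in>jsub j K - {J}. h J')"
      using * pos finite_jsub[OF *(1)] by (intro sum_mono2) auto
    show "0 \<le> (\<Sum>J'\<in>jsub j K - {J}. h J')"
      using pos by (intro sum_nonneg) auto
  qed
  also have "\<dots> = (\<Sum>J\<in>G. Tr h J)"
    using assms by (subst sum_distrib_left) (intro sum.cong refl Tr_alt, auto)
  finally show ?thesis .
qed

text \<open>Expected \<open>a\<close>-weight of the pairs of offspring of \<open>J\<close> that lie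
  in one hyperedge; pairs of equal members are included.\<close>

definition S :: "(nat set \<Rightarrow> nat set \<Rightarrow> real) \<Rightarrow> nat set \<Rightarrow> real" where
  "S a J = p * (\<Sum>K | K \<in> KS \<and> J \<subseteq> K. \<Sum>J'\<in>jsub j K - {J}. \<Sum>J''\<in>jsub j K - {J}. a J' J'')"

lemma S_le:
  assumes "J \<in> JS" "\<And>J' J''. J' \<in> JS \<Longrightarrow> J'' \<in> JS \<Longrightarrow> a J' J'' \<le> c"
  shows "S a J \<le> lam * real q * c"
proof -
  have "S a J \<le> p * (\<Sum>K | K \<in> KS \<and> J \<subseteq> K. \<Sum>J'\<in>jsub j K - {J}. real q * c)"
    unfolding S_def
  proof (intro mult_left_mono sum_mono p0)
    fix K J' assume K: "K \<in> {K. K \<in> KS \<and> J \<subseteq> K}" and J': "J' \<in> jsub j K - {J}"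
    have sub: "jsub j K \<subseteq> JS" using K jsub_subset[of K n k j] by auto
    have "J \<in> jsub j K" using assms(1) K by (simp add: mem_jsub_iff)
    hence c: "card (jsub j K - {J}) = q"
      using K card_jsub[of K n k j] by (simp add: card_Diff_singleton q_def)
    have "(\<Sum>J''\<in>jsub j K - {J}. a J' J'') \<le> (\<Sum>J''\<in>jsub j K - {J}. c)"
      using sub J' by (intro sum_mono assms) auto
    thus "(\<Sum>J''\<in>jsub j K - {J}. a J' J'') \<le> real q * c" using c by simp
  qed
  also have "\<dots> = lam * real q * c"
    unfolding Tr_alt[OF assms(1)] Tr_const[OF assms(1)] by simp
  finally show ?thesis .
qed

text \<open>Offspring in two different hyperedges are independent and move both coordinates by the
  kernel; siblings in one hyperedge are collected in \<open>S\<close>. This is the second-moment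
  recursion of a branching process with positions.\<close>

lemma step_pair:
  assumes "G \<subseteq> JS" "\<And>J J'. J \<in> JS \<Longrightarrow> J' \<in> JS \<Longrightarrow> 0 \<le> a J J'"
  shows "bexp p (KK D G) (\<lambda>H. \<Sum>J\<in>nw j H G. \<Sum>J'\<in>nw j H G. a J J') \<le>
    (\<Sum>J1\<in>G. \<Sum>J2\<in>G. Tr (\<lambda>J. Tr (a J) J2) J1) + (\<Sum>J\<in>G. S a J)"
proof -
  define b where "b K1 K2 = (\<Sum>J\<in>jsub j K1 - G. \<Sum>J'\<in>jsub j K2 - G. a J J')" for K1 K2
  have pos: "0 \<le> a J J'" if "J \<in> jsub j K" "K \<in> KS" "J' \<in> jsub j K'" "K' \<in> KS" for J J' K K'
    using that jsub_subset assms(2) by blast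
  have bpos: "0 \<le> b K1 K2" if "K1 \<in> KS" "K2 \<in> KS" for K1 K2
    unfolding b_def using that pos by (intro sum_nonneg) auto
  have "bexp p (KK D G) (\<lambda>H. \<Sum>J\<in>nw j H G. \<Sum>J'\<in>nw j H G. a J J') \<le>
    bexp p (KK D G) (\<lambda>H. (\<Sum>K1\<in>H. \<Sum>K2\<in>H - {K1}. b K1 K2) + (\<Sum>K\<in>H. b K K))"
  proof (intro bexp_mono p0 p1)
    fix H assume H: "H \<subseteq> KK D G"
    hence HK: "H \<subseteq> KS" using KK_subset[of D G] by auto
    have fin: "finite H" using HK by (rule finite_subset) simp
    have nwJ: "nw j H G \<subseteq> JS" using HK by (rule nw_subset)
    have "(\<Sum>J\<in>nw j H G. \<Sum>J'\<in>nw j H G. a J J') \<le> (\<Sum>J\<in>nw j H G. \<Sum>K2\<in>H. \<Sum>J'\<in>jsub j K2 - G. a J J')"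
      using nwJ HK assms(2) by (intro sum_mono sum_nw_le) auto
    also have "\<dots> \<le> (\<Sum>K1\<in>H. \<Sum>J\<in>jsub j K1 - G. \<Sum>K2\<in>H. \<Sum>J'\<in>jsub j K2 - G. a J J')"
    proof (intro sum_nw_le HK sum_nonneg)
      fix J K J' assume "J \<in> JS" "K \<in> H" "J' \<in> jsub j K - G"
      thus "0 \<le> a J J'" using HK jsub_subset by (intro assms) blast+
    qed
    also have "\<dots> = (\<Sum>K1\<in>H. \<Sum>K2\<in>H. b K1 K2)"
      unfolding b_def by (intro sum.cong refl sum.swap)
    also have "\<dots> = (\<Sum>K1\<in>H. b K1 K1 + (\<Sum>K2\<in>H - {K1}. b K1 K2))"
      using fin by (intro sum.cong refl sum.remove) auto
    finally show "(\<Sum>J\<in>nw j H G. \<Sum>J'\<in>nw j H G. a J J') \<le> (\<Sum>K1\<in>H. \<Sum>K2\<in>H - {K1}. b K1 K2) + (\<Sum>K\<in>H. b K K)"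
      by (simp add: sum.distrib)
  qed
  also have "\<dots> = p ^ 2 * (\<Sum>K1\<in>KK D G. \<Sum>K2\<in>KK D G - {K1}. b K1 K2) + p * (\<Sum>K\<in>KK D G. b K K)"
    by (simp add: bexp_add bexp_sum_mem bexp_sum_mem2)
  also have "(\<Sum>K1\<in>KK D G. \<Sum>K2\<in>KK D G - {K1}. b K1 K2) \<le> (\<Sum>K1\<in>KK D G. \<Sum>K2\<in>KK D G. b K1 K2)"
    using KK_subset[of D G] bpos by (intro sum_mono sum_mono2) auto
  also have "\<dots> \<le> (\<Sum>K1\<in>KK D G. \<Sum>J2\<in>G. \<Sum>K2 | K2 \<in> KS \<and> J2 \<subseteq> K2. \<Sum>J'\<in>jsub j K2 - {J2}. \<Sum>J\<in>jsub j K1 - G. a J J')"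
  proof (intro sum_mono sum_KK_le assms)
    fix K1 J2 K2 assume *: "K1 \<in> KK D G" "K2 \<in> KS" "J2 \<in> G" "J2 \<subseteq> K2"
    have K1: "K1 \<in> KS" using * KK_subset by auto
    show "b K1 K2 \<le> (\<Sum>J'\<in>jsub j K2 - {J2}. \<Sum>J\<in>jsub j K1 - G. a J J')"
      unfolding b_def using * K1 finite_jsub[OF *(2)] pos
      by (subst sum.swap, intro sum_mono2 sum_nonneg) auto
    show "0 \<le> (\<Sum>J'\<in>jsub j K2 - {J2}. \<Sum>J\<in>jsub j K1 - G. a J J')"
      using pos * K1 by (intro sum_nonneg) auto
  qed
  also have "\<dots> \<le> (\<Sum>J1\<in>G. \<Sum>K1 | K1 \<in> KS \<and> J1 \<subseteq> K1. \<Sum>J\<in>jsub j K1 - {J1}. \<Sum>J2\<in>G. \<Sum>K2 | K2 \<in> KS \<and> J2 \<subseteq> K2. \<Sum>J'\<in>jsub j K2 - {J2}. a J J')"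
  proof (intro sum_KK_le assms)
    fix J1 K1 assume *: "K1 \<in> KS" "J1 \<in> G" "J1 \<subseteq> K1"
    have "(\<Sum>J2\<in>G. \<Sum>K2 | K2 \<in> KS \<and> J2 \<subseteq> K2. \<Sum>J'\<in>jsub j K2 - {J2}. \<Sum>J\<in>jsub j K1 - G. a J J')
       = (\<Sum>J\<in>jsub j K1 - G. \<Sum>J2\<in>G. \<Sum>K2 | K2 \<in> KS \<and> J2 \<subseteq> K2. \<Sum>J'\<in>jsub j K2 - {J2}. a J J')"
      by (simp only: sum.swap[where A = "jsub j K1 - G"])
    also have "\<dots> \<le> (\<Sum>J\<in>jsub j K1 - {J1}. \<Sum>J2\<in>G. \<Sum>K2 | K2 \<in> KS \<and> J2 \<subseteq> K2. \<Sum>J'\<in>jsub j K2 - {J2}. a J J')"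
      using * finite_jsub[OF *(1)] pos by (intro sum_mono2 sum_nonneg) auto
    finally show "(\<Sum>J2\<in>G. \<Sum>K2 | K2 \<in> KS \<and> J2 \<subseteq> K2. \<Sum>J'\<in>jsub j K2 - {J2}. \<Sum>J\<in>jsub j K1 - G. a J J') \<le>
      (\<Sum>J\<in>jsub j K1 - {J1}. \<Sum>J2\<in>G. \<Sum>K2 | K2 \<in> KS \<and> J2 \<subseteq> K2. \<Sum>J'\<in>jsub j K2 - {J2}. a J J')" .
    show "0 \<le> (\<Sum>J\<in>jsub j K1 - {J1}. \<Sum>J2\<in>G. \<Sum>K2 | K2 \<in> KS \<and> J2 \<subseteq> K2. \<Sum>J'\<in>jsub j K2 - {J2}. a J J')"
      using * pos by (intro sum_nonneg) auto
  qed
  also have "p ^ 2 * \<dots> = (\<Sum>J1\<in>G. p * (\<Sum>K1 | K1 \<in> KS \<and> J1 \<subseteq> K1. \<Sum>J\<in>jsub j K1 - {J1}. 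
      \<Sum>J2\<in>G. p * (\<Sum>K2 | K2 \<in> KS \<and> J2 \<subseteq> K2. \<Sum>J'\<in>jsub j K2 - {J2}. a J J')))"
    by (simp add: sum_distrib_left power2_eq_square mult.assoc)
  also have "\<dots> = (\<Sum>J1\<in>G. Tr (\<lambda>J. \<Sum>J2\<in>G. Tr (a J) J2) J1)"
  proof (intro sum.cong refl)
    fix J1 assume J1: "J1 \<in> G"
    have "(\<Sum>J2\<in>G. p * (\<Sum>K2 | K2 \<in> KS \<and> J2 \<subseteq> K2. \<Sum>J'\<in>jsub j K2 - {J2}. a J J')) = (\<Sum>J2\<in>G. Tr (a J) J2)" for J
      using assms(1) by (intro sum.cong refl Tr_alt) auto
    thus "p * (\<Sum>K1 | K1 \<in> KS \<and> J1 \<subseteq> K1. \<Sum>J\<in>jsub j K1 - {J1}. 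
      \<Sum>J2\<in>G. p * (\<Sum>K2 | K2 \<in> KS \<and> J2 \<subseteq> K2. \<Sum>J'\<in>jsub j K2 - {J2}. a J J')) = Tr (\<lambda>J. \<Sum>J2\<in>G. Tr (a J) J2) J1"
      using Tr_alt[of J1] assms J1 by auto
  qed
  also have "\<dots> = (\<Sum>J1\<in>G. \<Sum>J2\<in>G. Tr (\<lambda>J. Tr (a J) J2) J1)"
    by (simp add: Tr_sum)
  also have "p * (\<Sum>K\<in>KK D G. b K K) \<le> p * (\<Sum>J\<in>G. \<Sum>K | K \<in> KS \<and> J \<subseteq> K. \<Sum>J'\<in>jsub j K - {J}. \<Sum>J''\<in>jsub j K - {J}. a J' J'')"
  proof (intro mult_left_mono sum_KK_le p0 assms)
    fix J K assume *: "K \<in> KS" "J \<in> G" "J \<subseteq> K"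
    have "b K K \<le> (\<Sum>J'\<in>jsub j K - {J}. \<Sum>J''\<in>jsub j K - G. a J' J'')"
      unfolding b_def using * finite_jsub[OF *(1)] pos by (intro sum_mono2 sum_nonneg) auto
    also have "\<dots> \<le> (\<Sum>J'\<in>jsub j K - {J}. \<Sum>J''\<in>jsub j K - {J}. a J' J'')"
      using * finite_jsub[OF *(1)] pos by (intro sum_mono sum_mono2) auto
    finally show "b K K \<le> (\<Sum>J'\<in>jsub j K - {J}. \<Sum>J''\<in>jsub j K - {J}. a J' J'')" .
    show "0 \<le> (\<Sum>J'\<in>jsub j K - {J}. \<Sum>J''\<in>jsub j K - {J}. a J' J'')"
      using * pos by (intro sum_nonneg) auto
  qed
  also have "\<dots> = (\<Sum>J\<in>G. S a J)" by (simp add: S_def sum_distrib_left)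
  finally show ?thesis using p0 by (simp add: mult_left_mono)
qed

end

text \<open>Bernoulli's inequality bounds the price of a smaller exponent. It is applied twice in
  \<open>step_power_le\<close>, to missing hyperedges and to missing offspring.\<close>

lemma power_le_add_diff:
  fixes x :: real
  assumes "0 \<le> x" "x \<le> 1" "a \<le> b"
  shows "x ^ a \<le> x ^ b + (real b - real a) * (1 - x)"
proof -
  have "x ^ b = x ^ a * x ^ (b - a)" using assms by (simp flip: power_add)
  moreover have "1 + real (b - a) * (x - 1) \<le> x ^ (b - a)"
    using Bernoulli_inequality[of "x - 1" "b - a"] assms by simp
  moreover have "x ^ a \<le> 1" using assms by (simp add: power_le_one)
  ultimately have "x ^ a - x ^ b \<le> real (b - a) * (1 - x)"
  proof -
    have "x ^ a - x ^ b = x ^ a * (1 - x ^ (b - a))" using \<open>x ^ b = _\<close> by (simp add: algebra_simps)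
    also have "\<dots> \<le> 1 * (1 - x ^ (b - a))"
      using assms \<open>x ^ a \<le> 1\<close> by (intro mult_right_mono) (auto simp: power_le_one)
    also have "\<dots> \<le> real (b - a) * (1 - x)"
      using \<open>1 + real (b - a) * (x - 1) \<le> x ^ (b - a)\<close> by (simp add: algebra_simps)
    finally show ?thesis .
  qed
  thus ?thesis using assms by (simp add: of_nat_diff)
qed

lemma one_minus_power_le:
  fixes x :: real
  assumes "0 \<le> x" "x \<le> 1"
  shows "1 - x ^ m \<le> real m * (1 - x)"
  using power_le_add_diff[OF assms, of 0 m] by simp

text \<open>Bonferroni's inequality. The correction runs over ordered pairs, so each intersection is
  subtracted twice, which is harmless here.\<close>

lemma card_UN_ge:
  assumes "finite I" "\<And>i. i \<in> I \<Longrightarrow> finite (A i)"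
  shows "real (card (\<Union>i\<in>I. A i)) \<ge> (\<Sum>i\<in>I. real (card (A i))) - (\<Sum>i\<in>I. \<Sum>i'\<in>I - {i}. real (card (A i \<inter> A i')))"
  using assms
proof (induction I)
  case (insert i I)
  let ?U = "\<Union>i\<in>I. A i"
  have fin: "finite ?U" "finite (A i)" using insert by auto
  have "card (A i) + card ?U = card (A i \<union> ?U) + card (A i \<inter> ?U)"
    by (rule card_Un_Int) (use fin in auto)
  moreover have "card (A i \<inter> ?U) \<le> (\<Sum>i'\<in>I. card (A i \<inter> A i'))"
  proof -
    have "A i \<inter> ?U = (\<Union>i'\<in>I. A i \<inter> A i')" by auto
    thus ?thesis using card_UN_le[OF insert.hyps(1), of "\<lambda>i'. A i \<inter> A i'"] by simp
  qed
  ultimately have 1: "real (card (A i \<union> ?U)) \<ge> real (card (A i)) + real (card ?U) - (\<Sum>i'\<in>I. real (card (A i \<inter> A i')))"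
    by (simp flip: of_nat_sum add: of_nat_add)
  have 2: "(\<Sum>i'\<in>insert i I. \<Sum>i''\<in>insert i I - {i'}. real (card (A i' \<inter> A i''))) \<ge>
     (\<Sum>i'\<in>I. real (card (A i \<inter> A i'))) + (\<Sum>i'\<in>I. \<Sum>i''\<in>I - {i'}. real (card (A i' \<inter> A i'')))"
  proof -
    have "(\<Sum>i'\<in>I. \<Sum>i''\<in>I - {i'}. real (card (A i' \<inter> A i''))) \<le> (\<Sum>i'\<in>I. \<Sum>i''\<in>insert i I - {i'}. real (card (A i' \<inter> A i'')))"
      using insert by (intro sum_mono sum_mono2) auto
    moreover have "insert i I - {i} = I" using insert by auto
    ultimately show ?thesis using insert by simp
  qed
  show ?case using 1 2 insert by simp
qed simp

context hyp begin

text \<open>Intensity of common offspring: the sum over \<open>L\<close> of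
  \<open>t J1 L * t J2 L\<close>.\<close>

definition t2 :: "nat set \<Rightarrow> nat set \<Rightarrow> real" where
  "t2 J1 J2 = Tr (t J2) J1"

text \<open>What the branching comparison may lose in one step. A hyperedge that is already queried
  or shared by frontier sets costs \<open>q\<close> offspring, a surplus frontier set inside a found
  hyperedge costs one, and \<open>t2\<close> accounts for j-sets found through two
  hyperedges.\<close>

definition loss :: "nat set set \<Rightarrow> nat set set \<Rightarrow> real" where
  "loss D G = (real q + 1) * (\<Sum>J\<in>G. \<Sum>J'\<in>D \<union> G. t J J') + (\<Sum>J1\<in>G. \<Sum>J2\<in>G. t2 J1 J2)"

text \<open>Offspring generating function: a binomial number of hyperedges, each worth
  \<open>q\<close> offspring.\<close>

definition gen :: "real \<Rightarrow> real" where
  "gen z = (1 - p + p * z ^ q) ^ M"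

definition pre :: "nat set set \<Rightarrow> nat set set \<Rightarrow> bool" where
  "pre D G \<longleftrightarrow> D \<subseteq> JS \<and> G \<subseteq> JS \<and> D \<inter> G = {}"

lemma t2_nonneg: "0 \<le> t2 J1 J2"
  unfolding t2_def by (rule Tr_nonneg) simp

lemma loss_nonneg: "0 \<le> loss D G"
  unfolding loss_def by (intro add_nonneg_nonneg mult_nonneg_nonneg sum_nonneg t2_nonneg) auto

lemma pre_step:
  assumes "pre D G" "H \<subseteq> KK D G"
  shows "pre (D \<union> G) (nw j H G)"
  using assms nw_disjoint[OF assms(2)] nw_subset[of H G] KK_subset[of D G] unfolding pre_def by blast

lemma card_KK_le:
  assumes "G \<subseteq> JS" shows "card (KK D G) \<le> M * card G"
proof -
  have "real (card (KK D G)) = (\<Sum>K\<in>KK D G. 1)" by simp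
  also have "\<dots> \<le> (\<Sum>J\<in>G. \<Sum>K | K \<in> KS \<and> J \<subseteq> K. 1)"
    by (rule sum_KK_le) (use assms in auto)
  also have "\<dots> = (\<Sum>J\<in>G. real M)"
    by (intro sum.cong refl) (use assms card_above in \<open>auto simp: subset_iff\<close>)
  finally have "real (card (KK D G)) \<le> real (M * card G)" by (simp add: mult.commute)
  thus ?thesis by (simp only: of_nat_le_iff)
qed

lemma card_jsub_Diff:
  assumes "K \<in> KS" "G \<subseteq> JS"
  shows "real (card (jsub j K - G)) = real (Suc q) - real (card {J \<in> G. J \<subseteq> K})"
proof -
  have "jsub j K \<inter> G = {J \<in> G. J \<subseteq> K}" using assms by (auto simp: jsub_def ksets_def)
  moreover have "card (jsub j K - G) = card (jsub j K) - card (jsub j K \<inter> G)"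
    by (rule card_Diff_subset_Int) (use assms finite_jsub in auto)
  moreover have "card (jsub j K \<inter> G) \<le> card (jsub j K)"
    using assms finite_jsub by (intro card_mono) auto
  ultimately show ?thesis using card_jsub[OF assms(1), of j] by (simp add: Suc_q of_nat_diff)
qed

text \<open>Each queried hyperedge contains a frontier set, which takes up one of its
  \<open>q + 1\<close> j-sets.\<close>

lemma card_nw_le:
  assumes "H \<subseteq> KK D G" "G \<subseteq> JS"
  shows "card (nw j H G) \<le> q * card H"
proof -
  have HK: "H \<subseteq> KS" using assms KK_subset[of D G] by auto
  have "real (card (nw j H G)) \<le> (\<Sum>K\<in>H. \<Sum>J\<in>jsub j K - G. 1)"
    using sum_nw_le[OF HK, of "\<lambda>_. 1" G] by simp
  also have "\<dots> \<le> (\<Sum>K\<in>H. real q)"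
  proof (rule sum_mono)
    fix K assume K: "K \<in> H"
    obtain J where J: "J \<in> G" "J \<subseteq> K" using K assms(1) by (auto simp: KK_def)
    hence "card {J \<in> G. J \<subseteq> K} \<ge> 1"
      using finite_JS_sub[OF assms(2)] by (auto simp: Suc_le_eq card_gt_0_iff)
    thus "(\<Sum>J\<in>jsub j K - G. 1) \<le> real q"
      using card_jsub_Diff[of K G] K HK assms(2) by auto
  qed
  finally have "real (card (nw j H G)) \<le> real (q * card H)" by (simp add: mult.commute)
  thus ?thesis by (simp only: of_nat_le_iff)
qed

lemma base_bounds:
  assumes "0 \<le> z" "z \<le> 1"
  shows "0 \<le> 1 - p + p * z ^ q" "1 - p + p * z ^ q \<le> 1"
proof -
  have "z ^ q \<le> 1" "0 \<le> z ^ q" using assms by (auto simp: power_le_one)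
  thus "0 \<le> 1 - p + p * z ^ q" "1 - p + p * z ^ q \<le> 1" 
    using p0 p1 mult_left_mono[of "z ^ q" 1 p] by auto
qed

lemma gen_bounds:
  assumes "0 \<le> z" "z \<le> 1" shows "0 \<le> gen z" "gen z \<le> 1"
  unfolding gen_def using base_bounds[OF assms] by (auto simp: power_le_one)

lemma gen_ge:
  assumes "0 \<le> z" "z \<le> 1" shows "1 - gen z \<le> lam * (1 - z)"
proof -
  have "1 - gen z \<le> real M * (1 - (1 - p + p * z ^ q))"
    unfolding gen_def by (intro one_minus_power_le base_bounds assms)
  also have "\<dots> = real M * (p * (1 - z ^ q))" by (simp add: algebra_simps)
  also have "\<dots> \<le> real M * (p * (real q * (1 - z)))"
    using p0 by (intro mult_left_mono one_minus_power_le assms) auto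
  finally show ?thesis by (simp add: lam_def mult_ac)
qed

text \<open>Domination by the branching process: at most \<open>M * card G\<close> queries and at
  most \<open>q\<close> new j-sets per success, and having fewer can only raise a power of
  \<open>z \<le> 1\<close>. For \<open>z \<ge> 1\<close> the inequality reverses
  (\<open>step_power_large\<close>).\<close>

lemma step_power_ge:
  assumes "G \<subseteq> JS" "0 \<le> z" "z \<le> 1"
  shows "gen z ^ card G \<le> bexp p (KK D G) (\<lambda>H. z ^ card (nw j H G))"
proof -
  have "gen z ^ card G = (1 - p + p * z ^ q) ^ (M * card G)" by (simp add: gen_def power_mult)
  also have "\<dots> \<le> (1 - p + p * z ^ q) ^ card (KK D G)"
    using base_bounds[OF assms(2,3)] by (intro power_decreasing card_KK_le assms) auto
  also have "\<dots> = bexp p (KK D G) (\<lambda>H. (z ^ q) ^ card H)"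
    by (simp add: bexp_power_card)
  also have "\<dots> \<le> bexp p (KK D G) (\<lambda>H. z ^ card (nw j H G))"
    using assms by (intro bexp_mono p0 p1) (auto simp flip: power_mult intro!: power_decreasing card_nw_le)
  finally show ?thesis .
qed

lemma step_power_large:
  assumes "G \<subseteq> JS" "1 \<le> z"
  shows "bexp p (KK D G) (\<lambda>H. z ^ card (nw j H G)) \<le> gen z ^ card G"
proof -
  have w: "1 \<le> 1 - p + p * z ^ q" using p0 assms(2) mult_left_mono[of 1 "z ^ q" p] by simp
  have "bexp p (KK D G) (\<lambda>H. z ^ card (nw j H G)) \<le> bexp p (KK D G) (\<lambda>H. (z ^ q) ^ card H)"
    using assms by (intro bexp_mono p0 p1) (auto simp flip: power_mult intro!: power_increasing card_nw_le)
  also have "\<dots> = (1 - p + p * z ^ q) ^ card (KK D G)"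
    by (simp add: bexp_power_card)
  also have "\<dots> \<le> (1 - p + p * z ^ q) ^ (M * card G)"
    using w by (intro power_increasing card_KK_le assms) auto
  also have "\<dots> = gen z ^ card G" by (simp add: gen_def power_mult)
  finally show ?thesis .
qed

text \<open>Count pairs of a frontier set and a k-set above it. A queried k-set pays for one of its
  pairs; every other pair comes with a further explored j-set inside the k-set and is paid by the
  kernel.\<close>

lemma KK_deficit:
  assumes "pre D G"
  shows "p * (real M * real (card G) - real (card (KK D G))) \<le> (\<Sum>J\<in>G. \<Sum>J'\<in>D \<union> G. t J J')"
proof -
  have GJ: "G \<subseteq> JS" and DJ: "D \<subseteq> JS" and dis: "D \<inter> G = {}" using assms by (auto simp: pre_def)
  have fin: "finite G" "finite D" using GJ DJ finite_JS_sub by auto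
  have "real M * real (card G) = (\<Sum>J\<in>G. \<Sum>K | K \<in> KS \<and> J \<subseteq> K. 1)"
  proof -
    have "(\<Sum>J\<in>G. \<Sum>K | K \<in> KS \<and> J \<subseteq> K. 1) = (\<Sum>J\<in>G. real M)"
      by (intro sum.cong refl) (use GJ card_above in \<open>auto simp: subset_iff\<close>)
    thus ?thesis by simp
  qed
  also have "\<dots> = (\<Sum>K\<in>KS. \<Sum>J | J \<in> G \<and> J \<subseteq> K. 1)"
    by (rule sum.swap_restrict) (use fin in auto)
  also have "\<dots> \<le> (\<Sum>K\<in>KS. of_bool (K \<in> KK D G) + (\<Sum>J | J \<in> G \<and> J \<subseteq> K. \<Sum>J'\<in>D \<union> G - {J}. of_bool (J' \<subseteq> K)))"
  proof (rule sum_mono)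
    fix K assume K: "K \<in> KS"
    let ?g = "{J. J \<in> G \<and> J \<subseteq> K}"
    let ?R = "\<Sum>J\<in>?g. \<Sum>J'\<in>D \<union> G - {J}. of_bool (J' \<subseteq> K) :: real"
    have fg: "finite ?g" using fin by auto
    show "(\<Sum>J\<in>?g. 1) \<le> of_bool (K \<in> KK D G) + ?R"
    proof (cases "?g = {}")
      case False
      then obtain J0 where J0: "J0 \<in> G" "J0 \<subseteq> K" by auto
      show ?thesis
      proof (cases "K \<in> KK D G")
        case True
        have "real (card ?g) - 1 = (\<Sum>J\<in>?g - {J0}. 1)" 
        proof -
          have "card ?g = Suc (card (?g - {J0}))" using J0 fg by (intro card.remove) auto
          thus ?thesis by simp
        qed
        also have "\<dots> \<le> (\<Sum>J\<in>?g - {J0}. \<Sum>J'\<in>D \<union> G - {J}. of_bool (J' \<subseteq> K))"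
        proof (rule sum_mono)
          fix J assume J: "J \<in> ?g - {J0}"
          have "of_bool (J0 \<subseteq> K) \<le> (\<Sum>J'\<in>D \<union> G - {J}. of_bool (J' \<subseteq> K) :: real)"
            using J J0 fin by (intro member_le_sum) auto
          thus "1 \<le> (\<Sum>J'\<in>D \<union> G - {J}. of_bool (J' \<subseteq> K) :: real)" using J0 by simp
        qed
        also have "\<dots> \<le> ?R" using fg by (intro sum_mono2 sum_nonneg) auto
        finally show ?thesis using True by simp
      next
        case False
        hence "K \<notin> free D" using J0 by (auto simp: KK_def)
        then obtain d where d: "d \<in> D" "d \<subseteq> K" using K by (auto simp: free_def)
        have "(\<Sum>J\<in>?g. 1) \<le> ?R"
        proof (rule sum_mono)
          fix J assume J: "J \<in> ?g"
          have "of_bool (d \<subseteq> K) \<le> (\<Sum>J'\<in>D \<union> G - {J}. of_bool (J' \<subseteq> K) :: real)"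
            using J d dis fin by (intro member_le_sum) auto
          thus "1 \<le> (\<Sum>J'\<in>D \<union> G - {J}. of_bool (J' \<subseteq> K) :: real)" using d by simp
        qed
        thus ?thesis by simp
      qed
    next
      case True
      show ?thesis unfolding True by simp
    qed
  qed
  also have "\<dots> = real (card (KK D G)) + (\<Sum>K\<in>KS. \<Sum>J | J \<in> G \<and> J \<subseteq> K. \<Sum>J'\<in>D \<union> G - {J}. of_bool (J' \<subseteq> K))"
    using KK_subset[of D G] by (simp add: sum.distrib sum_of_bool_eq Int_absorb1)
  also have "(\<Sum>K\<in>KS. \<Sum>J | J \<in> G \<and> J \<subseteq> K. \<Sum>J'\<in>D \<union> G - {J}. of_bool (J' \<subseteq> K))
     = (\<Sum>J\<in>G. \<Sum>K | K \<in> KS \<and> J \<subseteq> K. \<Sum>J'\<in>D \<union> G - {J}. of_bool (J' \<subseteq> K) :: real)"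
    by (rule sum.swap_restrict) (use fin in auto)
  also have "\<dots> = (\<Sum>J\<in>G. \<Sum>J'\<in>D \<union> G - {J}. real (cnt J J'))"
  proof (rule sum.cong[OF refl])
    fix J assume J: "J \<in> G"
    have "(\<Sum>K | K \<in> KS \<and> J \<subseteq> K. \<Sum>J'\<in>D \<union> G - {J}. of_bool (J' \<subseteq> K) :: real) = 
       (\<Sum>J'\<in>D \<union> G - {J}. \<Sum>K | K \<in> KS \<and> J \<subseteq> K. of_bool (J' \<subseteq> K))"
      by (rule sum.swap)
    also have "\<dots> = (\<Sum>J'\<in>D \<union> G - {J}. real (cnt J J'))"
    proof (rule sum.cong[OF refl])
      fix J' 
      have "{K. K \<in> KS \<and> J \<subseteq> K} \<inter> {K. J' \<subseteq> K} = {K \<in> KS. J \<subseteq> K \<and> J' \<subseteq> K}" by auto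
      thus "(\<Sum>K | K \<in> KS \<and> J \<subseteq> K. of_bool (J' \<subseteq> K) :: real) = real (cnt J J')"
        by (subst sum_of_bool_eq) (auto simp: cnt_def)
    qed
    finally show "(\<Sum>K | K \<in> KS \<and> J \<subseteq> K. \<Sum>J'\<in>D \<union> G - {J}. of_bool (J' \<subseteq> K) :: real) = (\<Sum>J'\<in>D \<union> G - {J}. real (cnt J J'))" .
  qed
  finally have "real M * real (card G) - real (card (KK D G)) \<le> (\<Sum>J\<in>G. \<Sum>J'\<in>D \<union> G - {J}. real (cnt J J'))"
    by simp
  hence "p * (real M * real (card G) - real (card (KK D G))) \<le> p * (\<Sum>J\<in>G. \<Sum>J'\<in>D \<union> G - {J}. real (cnt J J'))"
    using p0 by (rule mult_left_mono)
  also have "\<dots> = (\<Sum>J\<in>G. \<Sum>J'\<in>D \<union> G - {J}. t J J')"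
    unfolding sum_distrib_left by (intro sum.cong refl) (auto simp: t_def)
  also have "\<dots> \<le> (\<Sum>J\<in>G. \<Sum>J'\<in>D \<union> G. t J J')"
    using fin by (intro sum_mono sum_mono2) auto
  finally show ?thesis .
qed

section \<open>Potentials along the exploration\<close>

text \<open>A found hyperedge yields fewer than \<open>q\<close> new j-sets if it contains several
  frontier sets, and a j-set in two found hyperedges is counted twice; these are the two
  terms.\<close>

lemma nw_deficit:
  assumes "pre D G"
  shows "bexp p (KK D G) (\<lambda>H. real q * real (card H) - real (card (nw j H G))) \<le>
    (\<Sum>J\<in>G. \<Sum>J'\<in>D \<union> G. t J J') + (\<Sum>J1\<in>G. \<Sum>J2\<in>G. t2 J1 J2)"
proof -
  have GJ: "G \<subseteq> JS" and DJ: "D \<subseteq> JS" using assms by (auto simp: pre_def)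
  have fin: "finite G" "finite D" using GJ DJ finite_JS_sub by auto
  let ?g = "\<lambda>K. real (card {J \<in> G. J \<subseteq> K}) - 1"
  let ?c = "\<lambda>K K'. real (card ((jsub j K - G) \<inter> (jsub j K' - G)))"
  have "bexp p (KK D G) (\<lambda>H. real q * real (card H) - real (card (nw j H G))) \<le>
     bexp p (KK D G) (\<lambda>H. (\<Sum>K\<in>H. ?g K) + (\<Sum>K\<in>H. \<Sum>K'\<in>H - {K}. ?c K K'))"
  proof (intro bexp_mono p0 p1)
    fix H assume H: "H \<subseteq> KK D G"
    hence HK: "H \<subseteq> KS" using KK_subset[of D G] by auto
    have fH: "finite H" using HK by (rule finite_subset) simp
    have "nw j H G = (\<Union>K\<in>H. jsub j K - G)" by (auto simp: nw_def)
    hence "real (card (nw j H G)) \<ge> (\<Sum>K\<in>H. real (card (jsub j K - G))) - (\<Sum>K\<in>H. \<Sum>K'\<in>H - {K}. ?c K K')"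
    proof -
      have "finite (jsub j K - G)" if "K \<in> H" for K using that HK finite_jsub[of K n k j] by auto
      thus ?thesis using card_UN_ge[OF fH, of "\<lambda>K. jsub j K - G"] \<open>nw j H G = _\<close> by simp
    qed
    moreover have "(\<Sum>K\<in>H. real (card (jsub j K - G))) = (\<Sum>K\<in>H. real q - ?g K)"
      using HK GJ by (intro sum.cong) (auto simp: card_jsub_Diff)
    ultimately show "real q * real (card H) - real (card (nw j H G)) \<le> (\<Sum>K\<in>H. ?g K) + (\<Sum>K\<in>H. \<Sum>K'\<in>H - {K}. ?c K K')"
      by (simp add: sum_subtractf algebra_simps)
  qed
  also have "\<dots> = p * (\<Sum>K\<in>KK D G. ?g K) + p ^ 2 * (\<Sum>K\<in>KK D G. \<Sum>K'\<in>KK D G - {K}. ?c K K')"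
    by (simp add: bexp_add bexp_sum_mem bexp_sum_mem2)
  also have "p * (\<Sum>K\<in>KK D G. ?g K) \<le> (\<Sum>J\<in>G. \<Sum>J'\<in>D \<union> G. t J J')"
  proof -
    have "(\<Sum>K\<in>KK D G. ?g K) \<le> (\<Sum>J\<in>G. \<Sum>K | K \<in> KS \<and> J \<subseteq> K. \<Sum>J'\<in>G - {J}. of_bool (J' \<subseteq> K))"
    proof (rule sum_KK_le[OF GJ])
      fix J K assume *: "K \<in> KS" "J \<in> G" "J \<subseteq> K"
      have "card {J \<in> G. J \<subseteq> K} = Suc (card ({J \<in> G. J \<subseteq> K} - {J}))" using * fin by (intro card.remove) auto
      moreover have "(\<Sum>J'\<in>G - {J}. of_bool (J' \<subseteq> K)) = real (card ((G - {J}) \<inter> {J'. J' \<subseteq> K}))"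
        using fin by (subst sum_of_bool_eq) auto
      moreover have "(G - {J}) \<inter> {J'. J' \<subseteq> K} = {J \<in> G. J \<subseteq> K} - {J}" by auto
      ultimately show "?g K \<le> (\<Sum>J'\<in>G - {J}. of_bool (J' \<subseteq> K))" by simp
    qed (intro sum_nonneg, simp)
    also have "\<dots> = (\<Sum>J\<in>G. \<Sum>J'\<in>G - {J}. real (cnt J J'))"
    proof (rule sum.cong[OF refl])
      fix J assume J: "J \<in> G"
      have "(\<Sum>K | K \<in> KS \<and> J \<subseteq> K. \<Sum>J'\<in>G - {J}. of_bool (J' \<subseteq> K) :: real) = 
         (\<Sum>J'\<in>G - {J}. \<Sum>K | K \<in> KS \<and> J \<subseteq> K. of_bool (J' \<subseteq> K))"
        by (rule sum.swap)
      also have "\<dots> = (\<Sum>J'\<in>G - {J}. real (cnt J J'))"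
      proof (rule sum.cong[OF refl])
        fix J' 
        have "{K. K \<in> KS \<and> J \<subseteq> K} \<inter> {K. J' \<subseteq> K} = {K \<in> KS. J \<subseteq> K \<and> J' \<subseteq> K}" by auto
        thus "(\<Sum>K | K \<in> KS \<and> J \<subseteq> K. of_bool (J' \<subseteq> K) :: real) = real (cnt J J')"
          by (subst sum_of_bool_eq) (auto simp: cnt_def)
      qed
      finally show "(\<Sum>K | K \<in> KS \<and> J \<subseteq> K. \<Sum>J'\<in>G - {J}. of_bool (J' \<subseteq> K) :: real) = (\<Sum>J'\<in>G - {J}. real (cnt J J'))" .
    qed
    finally have "p * (\<Sum>K\<in>KK D G. ?g K) \<le> p * (\<Sum>J\<in>G. \<Sum>J'\<in>G - {J}. real (cnt J J'))"
      using p0 by (rule mult_left_mono)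
    also have "\<dots> = (\<Sum>J\<in>G. \<Sum>J'\<in>G - {J}. t J J')"
      unfolding sum_distrib_left by (intro sum.cong refl) (auto simp: t_def)
    also have "\<dots> \<le> (\<Sum>J\<in>G. \<Sum>J'\<in>D \<union> G. t J J')"
      using fin by (intro sum_mono sum_mono2) auto
    finally show ?thesis .
  qed
  also have "p ^ 2 * (\<Sum>K\<in>KK D G. \<Sum>K'\<in>KK D G - {K}. ?c K K') \<le> (\<Sum>J1\<in>G. \<Sum>J2\<in>G. t2 J1 J2)"
  proof -
    let ?B = "KK D G"
    have c: "?c K K' = (\<Sum>J\<in>JS - G. of_bool (J \<subseteq> K) * of_bool (J \<subseteq> K'))" if "K \<in> ?B" "K' \<in> ?B" for K K'
    proof -
      have "(jsub j K - G) \<inter> (jsub j K' - G) = (JS - G) \<inter> {J. J \<subseteq> K \<and> J \<subseteq> K'}"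
        using that KK_subset[of D G] by (fastforce simp: jsub_def ksets_def)
      moreover have "(\<Sum>J\<in>JS - G. of_bool (J \<subseteq> K) * of_bool (J \<subseteq> K')) = (\<Sum>J\<in>JS - G. of_bool (J \<subseteq> K \<and> J \<subseteq> K') :: real)"
        by (intro sum.cong) auto
      ultimately show ?thesis by (simp add: sum_of_bool_eq)
    qed
    have "(\<Sum>K\<in>?B. \<Sum>K'\<in>?B - {K}. ?c K K') \<le> (\<Sum>K\<in>?B. \<Sum>K'\<in>?B. ?c K K')"
      by (intro sum_mono sum_mono2) auto
    also have "\<dots> = (\<Sum>K\<in>?B. \<Sum>K'\<in>?B. \<Sum>J\<in>JS - G. of_bool (J \<subseteq> K) * of_bool (J \<subseteq> K'))"
      by (intro sum.cong refl c)
    also have "\<dots> = (\<Sum>J\<in>JS - G. \<Sum>K\<in>?B. \<Sum>K'\<in>?B. of_bool (J \<subseteq> K) * of_bool (J \<subseteq> K'))"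
      by (subst sum.swap[where A = "JS - G"]) (intro sum.cong refl sum.swap)
    \<comment> \<open>For a fixed \<open>J\<close> the pairs of hyperedges above it form a square,
      so a first-moment bound on the factor suffices.\<close>
    also have "\<dots> = (\<Sum>J\<in>JS - G. (\<Sum>K\<in>?B. of_bool (J \<subseteq> K)) ^ 2)"
      unfolding power2_eq_square sum_product ..
    finally have "p ^ 2 * (\<Sum>K\<in>?B. \<Sum>K'\<in>?B - {K}. ?c K K') \<le> p ^ 2 * (\<Sum>J\<in>JS - G. (\<Sum>K\<in>?B. of_bool (J \<subseteq> K)) ^ 2)"
      by (intro mult_left_mono) auto
    also have "\<dots> = (\<Sum>J\<in>JS - G. (p * (\<Sum>K\<in>?B. of_bool (J \<subseteq> K))) ^ 2)"
      by (simp add: sum_distrib_left power_mult_distrib)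
    also have "\<dots> \<le> (\<Sum>J\<in>JS - G. (\<Sum>J'\<in>G. t J' J) ^ 2)"
    proof (intro sum_mono power_mono)
      fix J assume J: "J \<in> JS - G"
      have "(\<Sum>K\<in>?B. of_bool (J \<subseteq> K)) \<le> (\<Sum>J'\<in>G. \<Sum>K | K \<in> KS \<and> J' \<subseteq> K. of_bool (J \<subseteq> K) :: real)"
        by (rule sum_KK_le[OF GJ]) auto
      also have "\<dots> = (\<Sum>J'\<in>G. real (cnt J' J))"
      proof (rule sum.cong[OF refl])
        fix J' 
        have "{K. K \<in> KS \<and> J' \<subseteq> K} \<inter> {K. J \<subseteq> K} = {K \<in> KS. J' \<subseteq> K \<and> J \<subseteq> K}" by auto
        thus "(\<Sum>K | K \<in> KS \<and> J' \<subseteq> K. of_bool (J \<subseteq> K) :: real) = real (cnt J' J)"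
          by (subst sum_of_bool_eq) (auto simp: cnt_def)
      qed
      finally have "p * (\<Sum>K\<in>?B. of_bool (J \<subseteq> K)) \<le> p * (\<Sum>J'\<in>G. real (cnt J' J))"
        using p0 by (rule mult_left_mono)
      also have "\<dots> = (\<Sum>J'\<in>G. t J' J)"
        unfolding sum_distrib_left using J by (intro sum.cong refl) (auto simp: t_def)
      finally show "p * (\<Sum>K\<in>?B. of_bool (J \<subseteq> K)) \<le> (\<Sum>J'\<in>G. t J' J)" .
    qed (use p0 in \<open>auto intro!: mult_nonneg_nonneg sum_nonneg\<close>)
    also have "\<dots> \<le> (\<Sum>J\<in>JS. (\<Sum>J'\<in>G. t J' J) ^ 2)"
      by (intro sum_mono2) auto
    also have "\<dots> = (\<Sum>J\<in>JS. \<Sum>J1\<in>G. \<Sum>J2\<in>G. t J1 J * t J2 J)"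
      by (simp add: power2_eq_square sum_product)
    also have "\<dots> = (\<Sum>J1\<in>G. \<Sum>J2\<in>G. \<Sum>J\<in>JS. t J1 J * t J2 J)"
      by (subst sum.swap) (intro sum.cong refl sum.swap)
    also have "\<dots> = (\<Sum>J1\<in>G. \<Sum>J2\<in>G. t2 J1 J2)"
      by (simp add: t2_def Tr_def)
    finally show ?thesis .
  qed
  finally show ?thesis by simp
qed

text \<open>Converse of \<open>step_power_ge\<close> up to an additive error. The error carries the
  factor \<open>1 - z\<close>, since a lost offspring matters only if it would have been
  noticed.\<close>

lemma step_power_le:
  assumes "pre D G" "0 \<le> z" "z \<le> 1"
  shows "bexp p (KK D G) (\<lambda>H. z ^ card (nw j H G)) \<le> gen z ^ card G + (1 - z) * loss D G"
proof -
  have GJ: "G \<subseteq> JS" using assms by (auto simp: pre_def)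
  let ?w = "1 - p + p * z ^ q"
  have "bexp p (KK D G) (\<lambda>H. z ^ card (nw j H G)) \<le> 
     bexp p (KK D G) (\<lambda>H. (z ^ q) ^ card H + (1 - z) * (real q * real (card H) - real (card (nw j H G))))"
  proof (intro bexp_mono p0 p1)
    fix H assume H: "H \<subseteq> KK D G"
    show "z ^ card (nw j H G) \<le> (z ^ q) ^ card H + (1 - z) * (real q * real (card H) - real (card (nw j H G)))"
      using power_le_add_diff[OF assms(2,3) card_nw_le[OF H GJ]] by (simp add: power_mult mult.commute[of "1 - z"])
  qed
  also have "\<dots> = ?w ^ card (KK D G) + (1 - z) * bexp p (KK D G) (\<lambda>H. real q * real (card H) - real (card (nw j H G)))"
    by (simp add: bexp_add bexp_cmult bexp_power_card)
  also have "(1 - z) * bexp p (KK D G) (\<lambda>H. real q * real (card H) - real (card (nw j H G))) \<le>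
    (1 - z) * ((\<Sum>J\<in>G. \<Sum>J'\<in>D \<union> G. t J J') + (\<Sum>J1\<in>G. \<Sum>J2\<in>G. t2 J1 J2))"
    using assms(3) by (intro mult_left_mono nw_deficit[OF assms(1)]) auto
  also have "?w ^ card (KK D G) \<le> ?w ^ (M * card G) + (real (M * card G) - real (card (KK D G))) * (1 - ?w)"
    by (rule power_le_add_diff[OF base_bounds[OF assms(2,3)] card_KK_le[OF GJ]])
  also have "?w ^ (M * card G) = gen z ^ card G" by (simp add: gen_def power_mult)
  also have "(real (M * card G) - real (card (KK D G))) * (1 - ?w) = 
     (p * (real M * real (card G) - real (card (KK D G)))) * (1 - z ^ q)"
    by (simp add: algebra_simps)
  also have "\<dots> \<le> (\<Sum>J\<in>G. \<Sum>J'\<in>D \<union> G. t J J') * (real q * (1 - z))"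
    using assms by (intro mult_mono KK_deficit one_minus_power_le sum_nonneg) (auto simp: power_le_one)
  finally show ?thesis by (simp add: loss_def algebra_simps)
qed

text \<open>Backward induction: \<open>\<psi> i\<close> is the potential when \<open>i\<close> steps
  remain, so its form may change along the way, as generating functions require.\<close>

lemma Ex_induct_le:
  assumes step: "\<And>i D G. pre D G \<Longrightarrow> bexp p (KK D G) (\<lambda>H. \<psi> i (D \<union> G, nw j H G)) \<le> \<psi> (Suc i) (D, G)"
    and base: "\<And>D G. pre D G \<Longrightarrow> \<phi> (D, G) \<le> \<psi> 0 (D, G)"
    and "pre D G"
  shows "Ex i (D, G) \<phi> \<le> \<psi> i (D, G)"
  using assms(3)
proof (induction i arbitrary: D G)
  case (Suc i)
  have "Ex (Suc i) (D, G) \<phi> \<le> bexp p (KK D G) (\<lambda>H. \<psi> i (D \<union> G, nw j H G))"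
    unfolding Ex_Suc using Suc by (intro bexp_mono p0 p1 Suc.IH pre_step)
  also have "\<dots> \<le> \<psi> (Suc i) (D, G)" by (rule step) fact
  finally show ?case .
qed (simp add: base)

text \<open>Joint generating function of the branching process started with one individual:
  \<open>v\<close> marks the total progeny before generation \<open>i\<close>, and \<open>z\<close>
  marks generation \<open>i\<close>.\<close>

fun zs :: "real \<Rightarrow> real \<Rightarrow> nat \<Rightarrow> real" where
  "zs v z 0 = z"
| "zs v z (Suc i) = v * gen (zs v z i)"

lemma zs_bounds:
  assumes "0 \<le> z" "z \<le> 1" "0 \<le> v" "v \<le> 1"
  shows "0 \<le> zs v z i \<and> zs v z i \<le> 1"
proof (induction i)
  case (Suc i)
  thus ?case using assms gen_bounds[of "zs v z i"] by (auto intro: mult_le_one)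
qed (use assms in auto)

lemma upper_potential:
  assumes "pre D G" "0 \<le> z" "z \<le> 1"
  shows "zs 1 z r ^ card G \<le> Ex r (D, G) (\<lambda>s. z ^ card (snd s))"
proof -
  \<comment> \<open>Negation turns the induction for upper bounds into one for lower bounds.\<close>
  have "Ex r (D, G) (\<lambda>s. - (z ^ card (snd s))) \<le> - (zs 1 z r ^ card (snd (D, G)))"
  proof (rule Ex_induct_le[where \<psi> = "\<lambda>i s. - (zs 1 z i ^ card (snd s))"])
    fix i D G assume "pre D G"
    hence "zs 1 z (Suc i) ^ card G \<le> bexp p (KK D G) (\<lambda>H. zs 1 z i ^ card (nw j H G))"
      using zs_bounds[OF assms(2,3), of 1 i] by (simp add: step_power_ge pre_def)
    thus "bexp p (KK D G) (\<lambda>H. - (zs 1 z i ^ card (snd (D \<union> G, nw j H G)))) \<le> - (zs 1 z (Suc i) ^ card (snd (D, G)))"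
      using bexp_cmult[of p "KK D G" "-1" "\<lambda>H. zs 1 z i ^ card (nw j H G)"] by simp
  qed (use assms in auto)
  thus ?thesis using Ex_cmult[of r "(D, G)" "-1" "\<lambda>s. z ^ card (snd s)"] by simp
qed

text \<open>The weight \<open>1 - zs v z (r - Suc i)\<close> is the influence of a single individual
  over the remaining levels, which is what a loss at level \<open>i\<close> can change in the final
  expectation.\<close>

lemma lower_potential:
  assumes "pre D G" "0 \<le> z" "z \<le> 1" "0 \<le> v" "v \<le> 1"
  shows "Ex r (D, G) (\<lambda>s. v ^ card (fst s) * z ^ card (snd s)) \<le> v ^ card D * zs v z r ^ card G +
     (\<Sum>i<r. (1 - zs v z (r - Suc i)) * Ex i (D, G) (\<lambda>s. loss (fst s) (snd s)))"
  using assms(1)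
proof (induction r arbitrary: D G)
  case (Suc r)
  let ?z = "zs v z r"
  let ?L = "\<lambda>s. loss (fst s) (snd s)"
  have zb: "0 \<le> ?z" "?z \<le> 1" using zs_bounds[OF assms(2-)] by auto
  have DG: "D \<inter> G = {}" "finite D" "finite G" using Suc.prems finite_JS_sub by (auto simp: pre_def)
  have "Ex (Suc r) (D, G) (\<lambda>s. v ^ card (fst s) * z ^ card (snd s)) \<le> 
    bexp p (KK D G) (\<lambda>H. v ^ card (D \<union> G) * ?z ^ card (nw j H G) + (\<Sum>i<r. (1 - zs v z (r - Suc i)) * Ex i (D \<union> G, nw j H G) ?L))"
    unfolding Ex_Suc using Suc by (intro bexp_mono p0 p1 Suc.IH pre_step)
  also have "\<dots> = v ^ card (D \<union> G) * bexp p (KK D G) (\<lambda>H. ?z ^ card (nw j H G)) + (\<Sum>i<r. (1 - zs v z (r - Suc i)) * Ex (Suc i) (D, G) ?L)"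
    by (simp add: bexp_add bexp_cmult bexp_sum Ex_Suc)
  also have "\<dots> \<le> v ^ card (D \<union> G) * (gen ?z ^ card G + (1 - ?z) * loss D G) + (\<Sum>i<r. (1 - zs v z (r - Suc i)) * Ex (Suc i) (D, G) ?L)"
    using assms by (intro add_mono mult_left_mono step_power_le Suc.prems zb) auto
  also have "v ^ card (D \<union> G) * (gen ?z ^ card G + (1 - ?z) * loss D G) \<le> v ^ card D * (v * gen ?z) ^ card G + (1 - ?z) * loss D G"
  proof -
    have "v ^ card (D \<union> G) * ((1 - ?z) * loss D G) \<le> 1 * ((1 - ?z) * loss D G)"
      using assms zb loss_nonneg[of D G] by (intro mult_right_mono mult_nonneg_nonneg) (auto simp: power_le_one)
    thus ?thesis using DG by (simp add: card_Un_disjoint power_add power_mult_distrib algebra_simps)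
  qed
  also have "(1 - ?z) * loss D G = (1 - zs v z (Suc r - Suc 0)) * Ex 0 (D, G) ?L" by simp
  finally show ?case
    by (simp add: sum.lessThan_Suc_shift del: sum.lessThan_Suc)
qed simp

text \<open>Truncated Green function of the kernel (\<open>As_expand\<close>): the expected
  \<open>h\<close>-weight of all that a branching exploration from \<open>J\<close> finds up to
  level \<open>i\<close>.\<close>

fun As :: "(nat set \<Rightarrow> real) \<Rightarrow> nat \<Rightarrow> nat set \<Rightarrow> real" where
  "As h 0 J = h J"
| "As h (Suc i) J = h J + Tr (As h i) J"

lemma As_nonneg: "(\<And>J. J \<in> JS \<Longrightarrow> 0 \<le> h J) \<Longrightarrow> J \<in> JS \<Longrightarrow> 0 \<le> As h i J"
  by (induction i arbitrary: J) (auto intro!: add_nonneg_nonneg Tr_nonneg)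

lemma linear_potential:
  assumes "pre D G" "\<And>J. J \<in> JS \<Longrightarrow> 0 \<le> h J"
  shows "Ex r (D, G) (\<lambda>s. \<Sum>J\<in>snd s. h J) \<le> (\<Sum>J\<in>G. (Tr ^^ r) h J)"
proof -
  have pos: "0 \<le> (Tr ^^ i) h J" if "J \<in> JS" for i J
    using that assms(2) by (induction i arbitrary: J) (auto intro!: Tr_nonneg)
  have "Ex r (D, G) (\<lambda>s. \<Sum>J\<in>snd s. h J) \<le> (\<Sum>J\<in>snd (D, G). (Tr ^^ r) h J)"
    by (rule Ex_induct_le[where \<psi> = "\<lambda>i s. \<Sum>J\<in>snd s. (Tr ^^ i) h J"])
      (use assms pos in \<open>auto intro!: step_linear simp: pre_def\<close>)
  thus ?thesis by simp
qed

lemma linear_potential_all: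
  assumes "pre D G" "\<And>J. J \<in> JS \<Longrightarrow> 0 \<le> h J"
  shows "Ex r (D, G) (\<lambda>s. \<Sum>J\<in>fst s \<union> snd s. h J) \<le> (\<Sum>J\<in>D. h J) + (\<Sum>J\<in>G. As h r J)"
proof -
  let ?\<psi> = "\<lambda>i s. (\<Sum>J\<in>fst s. h J) + (\<Sum>J\<in>snd s. As h i J)"
  have "Ex r (D, G) (\<lambda>s. \<Sum>J\<in>fst s \<union> snd s. h J) \<le> ?\<psi> r (D, G)"
  proof (rule Ex_induct_le[where \<psi> = ?\<psi>])
    fix i D G assume pre: "pre D G"
    have dis: "(\<Sum>J\<in>D \<union> G. h J) = (\<Sum>J\<in>D. h J) + (\<Sum>J\<in>G. h J)"
      using pre finite_JS_sub by (intro sum.union_disjoint) (auto simp: pre_def)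
    have "bexp p (KK D G) (\<lambda>H. \<Sum>J\<in>nw j H G. As h i J) \<le> (\<Sum>J\<in>G. Tr (As h i) J)"
      using pre assms by (intro step_linear As_nonneg) (auto simp: pre_def)
    thus "bexp p (KK D G) (\<lambda>H. ?\<psi> i (D \<union> G, nw j H G)) \<le> ?\<psi> (Suc i) (D, G)"
      by (simp add: bexp_add dis sum.distrib)
  next
    fix D G assume "pre D G"
    thus "(\<Sum>J\<in>fst (D, G) \<union> snd (D, G). h J) \<le> ?\<psi> 0 (D, G)"
      using finite_JS_sub by (auto simp: pre_def sum.union_disjoint)
  qed fact
  thus ?thesis by simp
qed

section \<open>Equidistribution of the kernel\<close>

text \<open>Entries of the powers of the kernel; minorisation is a statement about entries.\<close>

definition Kj :: "nat \<Rightarrow> nat set \<Rightarrow> nat set \<Rightarrow> real" where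
  "Kj m J J' = (Tr ^^ m) (\<lambda>x. of_bool (x = J')) J"

lemma Trn_nonneg: "(\<And>J. J \<in> JS \<Longrightarrow> 0 \<le> h J) \<Longrightarrow> J \<in> JS \<Longrightarrow> 0 \<le> (Tr ^^ m) h J"
  by (induction m arbitrary: J) (auto intro!: Tr_nonneg)

lemma Trn_mono: "(\<And>J. J \<in> JS \<Longrightarrow> h J \<le> h' J) \<Longrightarrow> J \<in> JS \<Longrightarrow> (Tr ^^ m) h J \<le> (Tr ^^ m) h' J"
  by (induction m arbitrary: J) (auto intro!: Tr_mono)

lemma Trn_const: "J \<in> JS \<Longrightarrow> (Tr ^^ m) (\<lambda>_. c) J = lam ^ m * c"
proof (induction m arbitrary: J)
  case (Suc m)
  have "Tr ((Tr ^^ m) (\<lambda>_. c)) J = Tr (\<lambda>_. lam ^ m * c) J"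
    by (rule Tr_cong) (rule Suc.IH)
  thus ?case using Suc.prems by (simp add: Tr_const)
qed simp

lemma sum_Trn: "(\<Sum>J\<in>JS. (Tr ^^ m) h J) = lam ^ m * (\<Sum>J\<in>JS. h J)"
  by (induction m) (simp_all add: sum_Tr)

lemma Trn_sum: "(Tr ^^ m) (\<lambda>x. \<Sum>i\<in>I. c i * h i x) J = (\<Sum>i\<in>I. c i * (Tr ^^ m) (h i) J)"
proof (induction m arbitrary: J)
  case (Suc m)
  have "(Tr ^^ m) (\<lambda>x. \<Sum>i\<in>I. c i * h i x) = (\<lambda>J. \<Sum>i\<in>I. c i * (Tr ^^ m) (h i) J)"
    using Suc.IH by blast
  thus ?case by (simp add: Tr_sum Tr_cmult)
qed simp

lemma Trn_Kj:
  assumes "J \<in> JS"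
  shows "(Tr ^^ m) h J = (\<Sum>J'\<in>JS. Kj m J J' * h J')"
proof -
  let ?g = "\<lambda>x. \<Sum>J'\<in>JS. h J' * of_bool (x = J')"
  have "(Tr ^^ m) h J = (Tr ^^ m) ?g J"
    by (intro antisym Trn_mono assms) (auto simp: if_distrib of_bool_def cong: if_cong)
  also have "\<dots> = (\<Sum>J'\<in>JS. h J' * Kj m J J')"
    by (simp only: Trn_sum Kj_def)
  finally show ?thesis by (simp add: mult.commute)
qed

lemma Kj_nonneg: "J \<in> JS \<Longrightarrow> 0 \<le> Kj m J J'"
  unfolding Kj_def by (rule Trn_nonneg) auto

lemma Kj_rowsum: "J \<in> JS \<Longrightarrow> (\<Sum>J'\<in>JS. Kj m J J') = lam ^ m"
  using Trn_Kj[of J m "\<lambda>_. 1"] by (simp add: Trn_const)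

lemma Kj_add:
  assumes "J \<in> JS"
  shows "Kj (m + m') J J' = (\<Sum>L\<in>JS. Kj m J L * Kj m' L J')"
  using Trn_Kj[OF assms, of m "\<lambda>L. Kj m' L J'"] by (simp add: Kj_def funpow_add)

text \<open>Entry of \<open>t\<close> at two j-sets that differ in one vertex
  (\<open>t_swap\<close>). It is the largest entry and of order \<open>lam / n\<close>.\<close>

definition tau :: real where "tau = p * real ((n - j - 1) choose (k - j - 1))"

lemma tau_eq: "real (n - j) * real q * tau = real (k - j) * lam"
proof -
  have e: "Suc (n - j - 1) = n - j" "Suc (k - j - 1) = k - j" using jk nk by auto
  have "(n - j) * ((n - j - 1) choose (k - j - 1)) = M * (k - j)"
    using Suc_times_binomial_eq[of "n - j - 1" "k - j - 1"] unfolding e M_def .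
  hence "real (n - j) * real ((n - j - 1) choose (k - j - 1)) = real M * real (k - j)"
    by (simp only: flip: of_nat_mult)
  hence "p * real q * (real (n - j) * real ((n - j - 1) choose (k - j - 1))) = p * real q * (real M * real (k - j))"
    by simp
  thus ?thesis unfolding tau_def lam_def by (simp only: mult_ac)
qed

lemma tau_ge: "lam / (real q * real n) \<le> tau"
proof -
  have "lam \<le> real (k - j) * lam" using jk lam_nonneg by (simp add: mult_le_cancel_right1)
  also have "\<dots> = real (n - j) * real q * tau" by (simp add: tau_eq)
  also have "\<dots> \<le> real n * real q * tau"
    using p0 by (intro mult_right_mono) (auto simp: tau_def)
  finally show ?thesis using q_pos nk jk by (simp add: field_simps)
qed

lemma tau_le: "tau \<le> lam * (2 * real k / real n)"
proof -
  have "real n / 2 * tau \<le> real (n - j) * real q * tau"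
  proof (intro mult_right_mono)
    have "real n / 2 \<le> real (n - j) * 1" using nk jk by (simp add: of_nat_diff)
    also have "\<dots> \<le> real (n - j) * real q" using q_pos by (intro mult_left_mono) auto
    finally show "real n / 2 \<le> real (n - j) * real q" .
  qed (use p0 in \<open>auto simp: tau_def\<close>)
  also have "\<dots> = real (k - j) * lam" by (rule tau_eq)
  also have "\<dots> \<le> real k * lam" using lam_nonneg by (intro mult_right_mono) auto
  finally show ?thesis using nk jk by (simp add: field_simps)
qed

text \<open>Two different j-sets together span at least \<open>j + 1\<close> vertices.\<close>

lemma t_le:
  assumes "J \<in> JS" "J' \<in> JS"
  shows "t J J' \<le> lam * (2 * real k / real n)"
proof (cases "J = J'")
  case True
  thus ?thesis using lam_nonneg by simp
next
  case False
  have fin: "finite J" "finite J'" using assms ksets_finite_elem by auto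
  obtain v where v: "v \<in> J'" "v \<notin> J"
    using False assms card_subset_eq[OF fin(1), of J'] by (auto simp: ksets_def)
  have cv: "card (insert v J) = Suc j" using v fin assms by (auto simp: ksets_def)
  have "cnt J J' \<le> card {K \<in> KS. insert v J \<subseteq> K}"
    unfolding cnt_def using v by (intro card_mono) auto
  also have "\<dots> = (n - j - 1) choose (k - j - 1)"
    using card_supersets[of "insert v J" n k] v assms fin jk cv by (auto simp: ksets_def)
  finally have "t J J' \<le> tau"
    using False p0 by (simp add: t_def tau_def mult_left_mono)
  thus ?thesis using tau_le by simp
qed

lemma t_swap:
  assumes "J \<in> JS" "u \<in> J" "v \<notin> J" "v < n"
  shows "insert v (J - {u}) \<in> JS" "t J (insert v (J - {u})) = tau"
proof -
  have fin: "finite J" using assms ksets_finite_elem by auto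
  have cJ: "card J = j" using assms by (auto simp: ksets_def)
  have "card (J - {u}) = j - 1" using assms cJ by simp
  thus 1: "insert v (J - {u}) \<in> JS" using assms fin cJ j1 by (auto simp: ksets_def)
  have ne: "J \<noteq> insert v (J - {u})" using assms by auto
  have "{K \<in> KS. J \<subseteq> K \<and> insert v (J - {u}) \<subseteq> K} = {K \<in> KS. insert v J \<subseteq> K}" using assms by auto
  hence "cnt J (insert v (J - {u})) = (n - j - 1) choose (k - j - 1)"
    using card_supersets[of "insert v J" n k] assms fin jk cJ by (auto simp: ksets_def cnt_def)
  thus "t J (insert v (J - {u})) = tau" using ne by (simp add: t_def tau_def)
qed

text \<open>Exchange the vertices of \<open>J - J'\<close> for those of \<open>J' - J\<close> one at
  a time; each exchange is a step of weight \<open>tau\<close>.\<close>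

lemma Kj_path:
  assumes "J \<in> JS" "J' \<in> JS" "card (J' - J) = d"
  shows "tau ^ d \<le> Kj d J J'"
  using assms
proof (induction d arbitrary: J)
  case 0
  have fin: "finite J" "finite J'" using 0 ksets_finite_elem by auto
  hence "J' \<subseteq> J" using 0 by auto
  hence "J' = J" using 0 fin card_subset_eq[OF fin(1)] by (auto simp: ksets_def)
  thus ?case by (simp add: Kj_def)
next
  case (Suc d)
  have fin: "finite J" "finite J'" using Suc.prems ksets_finite_elem by auto
  have cc: "card J = j" "card J' = j" using Suc.prems by (auto simp: ksets_def)
  obtain v where v: "v \<in> J'" "v \<notin> J" using Suc.prems(3) by (metis DiffE card.empty equals0I nat.distinct(1))
  have "card (J - J') = card (J' - J)"
    using card_Diff_subset_Int[of J J'] card_Diff_subset_Int[of J' J] fin cc by (simp add: Int_commute)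
  then obtain u where u: "u \<in> J" "u \<notin> J'" using Suc.prems(3) by (metis DiffE card.empty equals0I nat.distinct(1))
  let ?J = "insert v (J - {u})"
  have vn: "v < n" using v Suc.prems by (auto simp: ksets_def)
  note sw = t_swap[OF Suc.prems(1) u(1) v(2) vn]
  have "J' - ?J = (J' - J) - {v}" using u v by auto
  hence "card (J' - ?J) = d" using Suc.prems(3) v fin by simp
  hence IH: "tau ^ d \<le> Kj d ?J J'" using Suc.IH sw(1) Suc.prems(2) by auto
  have "tau ^ Suc d \<le> t J ?J * Kj d ?J J'" 
    using IH p0 sw by (simp add: mult_left_mono tau_def)
  also have "\<dots> \<le> (\<Sum>L\<in>JS. t J L * Kj d L J')"
    using sw Kj_nonneg by (intro member_le_sum) (auto intro!: mult_nonneg_nonneg)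
  also have "\<dots> = Kj (Suc d) J J'" by (simp add: Kj_def Tr_def)
  finally show ?case .
qed

text \<open>This is \<open>(n / (2 * j)) ^ j * (n / j) ^ j * (1 / (q * n)) ^ (2 * j)\<close>, in
  which \<open>n\<close> cancels. The factors are lower bounds for the number of intermediate
  j-sets, for \<open>N\<close>, and for the power of \<open>tau / lam\<close>.\<close>

definition dc :: real where "dc = (1 / (2 * real j ^ 2 * real q ^ 2)) ^ j"

lemma dc_bounds: "0 < dc" "dc \<le> 1 / 2"
proof -
  have "1 \<le> real j ^ 2 * real q ^ 2" using j1 q_pos by (simp add: mult_ge1_I)
  hence b: "1 / (2 * real j ^ 2 * real q ^ 2) \<le> 1 / 2" by (intro divide_left_mono) auto
  show "0 < dc" unfolding dc_def using j1 q_pos by simp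
  have "dc \<le> (1 / (2 * real j ^ 2 * real q ^ 2)) ^ 1" unfolding dc_def
    using b j1 by (intro power_decreasing) auto
  thus "dc \<le> 1 / 2" using b by simp
qed

text \<open>Walk from \<open>J\<close> to a j-set disjoint from both ends and on to
  \<open>J'\<close>. A positive proportion of all j-sets can serve, and each route takes exactly
  \<open>2 * j\<close> steps, whatever \<open>J\<close> and \<open>J'\<close> share; this common
  length is the purpose of the detour.\<close>

lemma Kj_doeblin:
  assumes "J \<in> JS" "J' \<in> JS"
  shows "lam ^ (2 * j) * dc / real N \<le> Kj (2 * j) J J'"
proof -
  have fin: "finite J" "finite J'" using assms ksets_finite_elem by auto
  have sub: "J \<subseteq> {..<n}" "J' \<subseteq> {..<n}" and c: "card J = j" "card J' = j"
    using assms by (simp_all add: ksets_def)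
  let ?L = "{L \<in> JS. L \<inter> (J \<union> J') = {}}"
  have tau0: "0 \<le> tau" using p0 by (simp add: tau_def)
  have "card ?L * tau ^ (2 * j) = (\<Sum>L\<in>?L. tau ^ j * tau ^ j)" by (simp flip: power_add add: mult_2)
  also have "\<dots> \<le> (\<Sum>L\<in>?L. Kj j J L * Kj j L J')"
  proof (rule sum_mono)
    fix L assume L: "L \<in> ?L"
    have LJ: "L \<in> JS" using L by simp
    have "L - J = L" "J' - L = J'" using L by auto
    moreover have "card L = j" using LJ by (simp add: ksets_def)
    ultimately have "tau ^ j \<le> Kj j J L" "tau ^ j \<le> Kj j L J'"
      using Kj_path[OF assms(1) LJ] Kj_path[OF LJ assms(2)] c(2) by metis+
    thus "tau ^ j * tau ^ j \<le> Kj j J L * Kj j L J'" using tau0 assms by (intro mult_mono Kj_nonneg) auto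
  qed
  also have "\<dots> \<le> (\<Sum>L\<in>JS. Kj j J L * Kj j L J')"
    using assms Kj_nonneg by (intro sum_mono2) (auto intro!: mult_nonneg_nonneg)
  also have "\<dots> = Kj (2 * j) J J'" using Kj_add[OF assms(1), of j j J'] by (simp add: mult_2)
  finally have 1: "card ?L * tau ^ (2 * j) \<le> Kj (2 * j) J J'" .
  have "?L = {L. L \<subseteq> {..<n} - (J \<union> J') \<and> card L = j}" by (auto simp: ksets_def)
  hence "card ?L = (n - card (J \<union> J')) choose j"
    using sub fin by (simp add: n_subsets card_Diff_subset)
  moreover have cu: "card (J \<union> J') \<le> 2 * j" using card_Un_le[of J J'] c by simp
  ultimately have cL: "(n - 2 * j) choose j \<le> card ?L" by (simp add: binomial_right_mono)
  have "(real n / (2 * real j)) ^ j \<le> (real (n - 2 * j) / real j) ^ j"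
    using nk jk j1 by (intro power_mono) (auto simp: field_simps of_nat_diff)
  also have "\<dots> \<le> real ((n - 2 * j) choose j)"
    using nk jk by (intro binomial_ge_n_over_k_pow_k) auto
  also have "\<dots> \<le> real (card ?L)" using cL by simp
  finally have cL2: "(real n / (2 * real j)) ^ j \<le> real (card ?L)" .
  have NN: "(real n / real j) ^ j \<le> real N" unfolding N_def
    using nk jk by (intro binomial_ge_n_over_k_pow_k) auto
  have "lam ^ (2 * j) * dc = (real n / (2 * real j)) ^ j * (real n / real j) ^ j * (lam / (real q * real n)) ^ (2 * j)"
  proof -
    have "lam ^ 2 * (1 / (2 * real j ^ 2 * real q ^ 2)) = real n / (2 * real j) * (real n / real j) * (lam / (real q * real n)) ^ 2"
      using j1 q_pos nk jk by (simp add: field_simps power2_eq_square)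
    note eq = this
    have "lam ^ (2 * j) * dc = (lam ^ 2 * (1 / (2 * real j ^ 2 * real q ^ 2))) ^ j"
      unfolding dc_def power_mult power_mult_distrib ..
    also have "\<dots> = (real n / (2 * real j) * (real n / real j) * (lam / (real q * real n)) ^ 2) ^ j"
      by (simp only: eq)
    finally show ?thesis by (simp only: power_mult power_mult_distrib)
  qed
  also have "\<dots> \<le> real (card ?L) * real N * tau ^ (2 * j)"
    using cL2 NN tau_ge lam_nonneg by (intro mult_mono power_mono) auto
  finally have "lam ^ (2 * j) * dc / real N \<le> real (card ?L) * tau ^ (2 * j)"
    using N_pos by (simp add: field_simps)
  thus ?thesis using 1 by simp
qed

definition avg :: "(nat set \<Rightarrow> real) \<Rightarrow> real" where "avg h = (\<Sum>J\<in>JS. h J) / real N"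

lemma avg_Trn: "avg ((Tr ^^ m) h) = lam ^ m * avg h"
  by (simp add: avg_def sum_Trn)

text \<open>Minorisation applied to the nonnegative function \<open>c - h\<close>: the guaranteed
  part of the kernel averages, so the gap between the bound and the mean shrinks by
  \<open>1 - dc\<close>.\<close>

lemma doeblin_step:
  assumes "J \<in> JS" "\<And>J. J \<in> JS \<Longrightarrow> h J \<le> c"
  shows "(Tr ^^ (2 * j)) h J \<le> lam ^ (2 * j) * (avg h + (1 - dc) * (c - avg h))"
proof -
  have "(\<Sum>J'\<in>JS. lam ^ (2 * j) * dc / real N * (c - h J')) \<le> (\<Sum>J'\<in>JS. Kj (2 * j) J J' * (c - h J'))"
    using assms by (intro sum_mono mult_right_mono Kj_doeblin) auto
  also have "\<dots> = lam ^ (2 * j) * c - (Tr ^^ (2 * j)) h J"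
    using assms(1) by (simp add: Trn_Kj right_diff_distrib sum_subtractf flip: sum_distrib_right Kj_rowsum)
  finally have "(Tr ^^ (2 * j)) h J \<le> lam ^ (2 * j) * c - lam ^ (2 * j) * dc / real N * (\<Sum>J'\<in>JS. c - h J')"
    by (simp add: sum_distrib_left)
  also have "(\<Sum>J'\<in>JS. c - h J') = real N * (c - avg h)"
    using N_pos by (simp add: sum_subtractf avg_def card_JS right_diff_distrib)
  also have "lam ^ (2 * j) * dc / real N * (real N * (c - avg h)) = lam ^ (2 * j) * dc * (c - avg h)"
    using N_pos by simp
  finally show ?thesis by (simp add: algebra_simps)
qed

lemma doeblin_iter:
  assumes "J \<in> JS" "\<And>J. J \<in> JS \<Longrightarrow> h J \<le> c"
  shows "(Tr ^^ (2 * j * i)) h J \<le> lam ^ (2 * j * i) * (avg h + (1 - dc) ^ i * (c - avg h))"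
  using assms(1)
proof (induction i arbitrary: J)
  case 0
  thus ?case using assms by simp
next
  case (Suc i)
  let ?h = "(Tr ^^ (2 * j * i)) h"
  have "(Tr ^^ (2 * j * Suc i)) h J = (Tr ^^ (2 * j)) ?h J" by (simp add: funpow_add)
  also have "\<dots> \<le> lam ^ (2 * j) * (avg ?h + (1 - dc) * (lam ^ (2 * j * i) * (avg h + (1 - dc) ^ i * (c - avg h)) - avg ?h))"
    by (rule doeblin_step) (use Suc in auto)
  also have "\<dots> = lam ^ (2 * j * Suc i) * (avg h + (1 - dc) ^ Suc i * (c - avg h))"
    unfolding avg_Trn by (simp add: power_add algebra_simps)
  finally show ?case .
qed

text \<open>Contraction rate per single step, since one block has \<open>2 * j\<close> steps; it
  depends on \<open>k\<close> and \<open>j\<close> only.\<close>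

definition alpha :: real where "alpha = root (2 * j) (1 - dc)"

lemma alpha_bounds: "0 < alpha" "alpha < 1"
  using dc_bounds j1 by (auto simp: alpha_def)

lemma Trn_decay:
  assumes J: "J \<in> JS" and h: "\<And>J. J \<in> JS \<Longrightarrow> 0 \<le> h J" "\<And>J. J \<in> JS \<Longrightarrow> h J \<le> c"
  shows "(Tr ^^ m) h J \<le> lam ^ m * (avg h + 2 * alpha ^ m * c)"
proof -
  define i where "i = m div (2 * j)"
  define d where "d = m mod (2 * j)"
  have m: "m = 2 * j * i + d" by (simp add: i_def d_def)
  have d: "d \<le> 2 * j" using j1 unfolding d_def by (intro less_imp_le pos_mod_bound mod_less_divisor) auto
  obtain J0 where "J0 \<in> JS" using J by auto
  hence c0: "0 \<le> c" using h by (meson order_trans)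
  have avg0: "0 \<le> avg h" unfolding avg_def using h by (intro divide_nonneg_nonneg sum_nonneg) auto
  \<comment> \<open>The factor 2 pays for the incomplete last block:
    \<open>alpha ^ d \<ge> alpha ^ (2 * j) = 1 - dc \<ge> 1 / 2\<close>.\<close>
  have al: "(1 - dc) ^ i \<le> 2 * alpha ^ m"
  proof -
    have a2: "alpha ^ (2 * j) = 1 - dc"
      unfolding alpha_def using j1 dc_bounds by (intro real_root_pow_pos2) auto
    have "alpha ^ (2 * j) \<le> alpha ^ d" using d alpha_bounds by (intro power_decreasing) auto
    hence "1 / 2 \<le> alpha ^ d" using a2 dc_bounds by simp
    moreover have "(1 - dc) ^ i = alpha ^ (2 * j * i)" unfolding a2[symmetric] power_mult[symmetric] ..
    ultimately show ?thesis
      using mult_left_mono[of "1 / 2" "alpha ^ d" "2 * alpha ^ (2 * j * i)"] alpha_bounds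
      by (simp add: m power_add)
  qed
  have "(Tr ^^ m) h J = (Tr ^^ d) ((Tr ^^ (2 * j * i)) h) J" by (simp add: m add.commute[of _ d] funpow_add)
  also have "\<dots> \<le> (Tr ^^ d) (\<lambda>_. lam ^ (2 * j * i) * (avg h + (1 - dc) ^ i * (c - avg h))) J"
    by (intro Trn_mono doeblin_iter J) (use h in auto)
  also have "\<dots> = lam ^ m * (avg h + (1 - dc) ^ i * (c - avg h))"
    using J by (simp add: Trn_const m power_add)
  also have "\<dots> \<le> lam ^ m * (avg h + 2 * alpha ^ m * c)"
  proof (intro mult_left_mono add_left_mono)
    have "(1 - dc) ^ i * (c - avg h) \<le> (1 - dc) ^ i * c"
      using dc_bounds avg0 by (intro mult_left_mono) auto
    also have "\<dots> \<le> 2 * alpha ^ m * c" using al c0 by (intro mult_right_mono) auto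
    finally show "(1 - dc) ^ i * (c - avg h) \<le> 2 * alpha ^ m * c" .
  qed (use lam_nonneg in auto)
  finally show ?thesis .
qed

section \<open>Pair statistics\<close>

text \<open>The lines of descent of two members separate either at \<open>G\<close> or inside one
  hyperedge, with \<open>m\<close> generations still to come. One coordinate then contributes
  \<open>lam ^ m\<close> and the other \<open>u m\<close>.\<close>

lemma pair_same:
  assumes "pre D G" "\<And>J J'. J \<in> JS \<Longrightarrow> J' \<in> JS \<Longrightarrow> 0 \<le> a J J'"
    "\<And>m J J'. J \<in> JS \<Longrightarrow> J' \<in> JS \<Longrightarrow> (Tr ^^ m) (a J) J' \<le> u m"
  shows "Ex i (D, G) (\<lambda>s. \<Sum>J\<in>snd s. \<Sum>J'\<in>snd s. a J J') \<le>
    lam ^ i * u i * real (card G) ^ 2 + real q * real (card G) * lam ^ i * (\<Sum>m<i. u m)"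
  using assms(2,3)
proof (induction i arbitrary: a u)
  case 0
  have GJ: "G \<subseteq> JS" using assms(1) by (simp add: pre_def)
  have "(\<Sum>J\<in>G. \<Sum>J'\<in>G. a J J') \<le> (\<Sum>J\<in>G. \<Sum>J'\<in>G. u 0)"
    using GJ "0.prems"(2)[of _ _ 0] by (intro sum_mono) auto
  thus ?case by (simp add: power2_eq_square mult_ac)
next
  case (Suc i)
  \<comment> \<open>The induction peels off the last step, which advances both coordinates; the new
    statistic obeys the bound \<open>lam * u (Suc m)\<close>.\<close>
  let ?a = "\<lambda>J1 J2. Tr (\<lambda>J. Tr (a J) J2) J1"
  have a0: "0 \<le> ?a J J'" if "J \<in> JS" "J' \<in> JS" for J J'
    using that Suc.prems(1) by (intro Tr_nonneg)
  have a1: "(Tr ^^ m) (?a J) J' \<le> lam * u (Suc m)" if J: "J \<in> JS" "J' \<in> JS" for m J J'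
  proof -
    have "(Tr ^^ m) (?a J) J' = (\<Sum>L\<in>JS. t J L * (Tr ^^ m) (Tr (a L)) J')"
      by (subst (2) Tr_def, subst Trn_sum) simp
    also have "\<dots> = (\<Sum>L\<in>JS. t J L * (Tr ^^ Suc m) (a L) J')" by (simp add: funpow_Suc_right del: funpow.simps)
    also have "\<dots> \<le> (\<Sum>L\<in>JS. t J L * u (Suc m))"
      using J by (intro sum_mono mult_left_mono Suc.prems(2)) auto
    also have "\<dots> = lam * u (Suc m)" using J by (simp add: t_rowsum flip: sum_distrib_right)
    finally show ?thesis .
  qed
  have "Ex (Suc i) (D, G) (\<lambda>s. \<Sum>J\<in>snd s. \<Sum>J'\<in>snd s. a J J') =
     Ex i (D, G) (\<lambda>s. Ex (Suc 0) s (\<lambda>s. \<Sum>J\<in>snd s. \<Sum>J'\<in>snd s. a J J'))"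
    using Ex_add_steps[of i "Suc 0"] by simp
  also have "\<dots> \<le> Ex i (D, G) (\<lambda>s. (\<Sum>J\<in>snd s. \<Sum>J'\<in>snd s. ?a J J') + lam * real q * u 0 * (\<Sum>J\<in>snd s. 1))"
  proof (rule Ex_mono)
    fix D G assume DG: "D \<subseteq> JS" "G \<subseteq> JS"
    have "Ex (Suc 0) (D, G) (\<lambda>s. \<Sum>J\<in>snd s. \<Sum>J'\<in>snd s. a J J') \<le> (\<Sum>J\<in>G. \<Sum>J'\<in>G. ?a J J') + (\<Sum>J\<in>G. S a J)"
      unfolding Ex_Suc using step_pair[OF DG(2) Suc.prems(1)] by simp
    also have "(\<Sum>J\<in>G. S a J) \<le> (\<Sum>J\<in>G. lam * real q * u 0)"
      using DG Suc.prems(2)[of _ _ 0] by (intro sum_mono S_le) auto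
    finally show "Ex (Suc 0) (D, G) (\<lambda>s. \<Sum>J\<in>snd s. \<Sum>J'\<in>snd s. a J J') \<le> 
       (\<Sum>J\<in>snd (D, G). \<Sum>J'\<in>snd (D, G). ?a J J') + lam * real q * u 0 * (\<Sum>J\<in>snd (D, G). 1)"
      by (simp add: mult.commute)
  qed (use assms(1) in \<open>auto simp: pre_def\<close>)
  also have "\<dots> = Ex i (D, G) (\<lambda>s. \<Sum>J\<in>snd s. \<Sum>J'\<in>snd s. ?a J J') + lam * real q * u 0 * Ex i (D, G) (\<lambda>s. \<Sum>J\<in>snd s. 1)"
    by (simp add: Ex_add Ex_cmult)
  also have "\<dots> \<le> (lam ^ i * (lam * u (Suc i)) * real (card G) ^ 2 + real q * real (card G) * lam ^ i * (\<Sum>m<i. lam * u (Suc m))) 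
     + lam * real q * u 0 * (lam ^ i * real (card G))"
  proof (intro add_mono mult_left_mono)
    show "Ex i (D, G) (\<lambda>s. \<Sum>J\<in>snd s. \<Sum>J'\<in>snd s. ?a J J') \<le> lam ^ i * (lam * u (Suc i)) * real (card G) ^ 2 + real q * real (card G) * lam ^ i * (\<Sum>m<i. lam * u (Suc m))"
      by (rule Suc.IH[of ?a "\<lambda>m. lam * u (Suc m)"]) (use a0 a1 in auto)
    have "Ex i (D, G) (\<lambda>s. \<Sum>J\<in>snd s. 1) \<le> (\<Sum>J\<in>G. (Tr ^^ i) (\<lambda>_. 1) J)"
      by (rule linear_potential) (use assms in auto)
    also have "\<dots> = (\<Sum>J\<in>G. lam ^ i)"
      using assms(1) by (intro sum.cong refl) (auto simp: Trn_const pre_def subset_iff)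
    finally show "Ex i (D, G) (\<lambda>s. \<Sum>J\<in>snd s. 1) \<le> lam ^ i * real (card G)" by (simp add: mult.commute)
    obtain J0 :: "nat set" where "J0 \<in> JS" using N_pos card_JS by (metis card.empty equals0I less_numeral_extra(3))
    hence "0 \<le> u 0" using Suc.prems(1)[of J0 J0] Suc.prems(2)[of J0 J0 0] by auto
    thus "0 \<le> lam * real q * u 0" using lam_nonneg by simp
  qed
  also have "\<dots> = lam ^ Suc i * u (Suc i) * real (card G) ^ 2 + real q * real (card G) * lam ^ Suc i * (\<Sum>m<Suc i. u m)"
    unfolding sum.lessThan_Suc_shift sum_distrib_left[symmetric] by (simp add: algebra_simps)
  finally show ?case .
qed

definition init :: "nat set \<Rightarrow> nat set set \<times> nat set set" where "init J = ({}, {J})"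

lemma fst_init [simp]: "fst (init J) = {}" by (simp add: init_def)
lemma snd_init [simp]: "snd (init J) = {J}" by (simp add: init_def)

text \<open>The \<open>i - i'\<close> extra steps of the later level act on one coordinate and are
  absorbed into \<open>a\<close>; afterwards both members belong to level \<open>i'\<close>.\<close>

lemma pair_cross:
  assumes "J0 \<in> JS" "\<And>J J'. J \<in> JS \<Longrightarrow> J' \<in> JS \<Longrightarrow> 0 \<le> a J J'"
    "\<And>m J J'. J \<in> JS \<Longrightarrow> J' \<in> JS \<Longrightarrow> (Tr ^^ m) (a J) J' \<le> u m" "i' \<le> i"
  shows "bexp p KS (\<lambda>H. \<Sum>J\<in>snd (run H i' (init J0)). \<Sum>J'\<in>snd (run H i (init J0)). a J J') \<le>
    real q * lam ^ i' * (\<Sum>m\<le>i'. u (m + (i - i')))"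
proof -
  define d where "d = i - i'"
  have i: "i = i' + d" using assms by (simp add: d_def)
  let ?a = "\<lambda>J. (Tr ^^ d) (a J)"
  have a0: "0 \<le> ?a J J'" if "J \<in> JS" "J' \<in> JS" for J J'
    using that assms(2) by (intro Trn_nonneg)
  have a1: "(Tr ^^ m) (?a J) J' \<le> u (m + d)" if "J \<in> JS" "J' \<in> JS" for m J J'
    using assms(3)[OF that, of "m + d"] by (simp add: funpow_add)
  have "bexp p KS (\<lambda>H. \<Sum>J\<in>snd (run H i' (init J0)). \<Sum>J'\<in>snd (run H i (init J0)). a J J') =
    Ex i' (init J0) (\<lambda>s. Ex d s (\<lambda>s'. \<Sum>J\<in>snd s. \<Sum>J'\<in>snd s'. a J J'))"
    using Ex_two[of "init J0" "\<lambda>s s'. \<Sum>J\<in>snd s. \<Sum>J'\<in>snd s'. a J J'" i' d] by (simp add: i)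
  also have "\<dots> \<le> Ex i' (init J0) (\<lambda>s. \<Sum>J\<in>snd s. \<Sum>J'\<in>snd s. ?a J J')"
  proof -
    have "bexp p KS (\<lambda>H. Ex d (run H i' (init J0)) (\<lambda>s'. \<Sum>J\<in>snd (run H i' (init J0)). \<Sum>J'\<in>snd s'. a J J')) \<le>
      bexp p KS (\<lambda>H. \<Sum>J\<in>snd (run H i' (init J0)). \<Sum>J'\<in>snd (run H i' (init J0)). ?a J J')"
    proof (intro bexp_mono p0 p1)
      fix H
      let ?s = "run H i' (init J0)"
      obtain D G where s: "?s = (D, G)" by (cases ?s)
      have pre: "pre D G"
        using run_sub[of "init J0" H i'] run_disjoint[of "init J0" H i'] assms(1) s by (simp add: pre_def)
      show "Ex d ?s (\<lambda>s'. \<Sum>J\<in>snd ?s. \<Sum>J'\<in>snd s'. a J J') \<le> (\<Sum>J\<in>snd ?s. \<Sum>J'\<in>snd ?s. ?a J J')"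
        unfolding s Ex_sum snd_conv
        by (intro sum_mono linear_potential pre) (use pre assms(2) in \<open>auto simp: pre_def\<close>)
    qed
    thus ?thesis by (simp add: Ex_def[of i'])
  qed
  also have "\<dots> \<le> lam ^ i' * u (i' + d) * real (card {J0}) ^ 2 + real q * real (card {J0}) * lam ^ i' * (\<Sum>m<i'. u (m + d))"
    unfolding init_def
    by (rule pair_same[of _ _ ?a "\<lambda>m. u (m + d)"]) (use a0 a1 assms(1) in \<open>auto simp: pre_def\<close>)
  also have "\<dots> \<le> real q * lam ^ i' * u (i' + d) + real q * lam ^ i' * (\<Sum>m<i'. u (m + d))"
  proof -
    have "0 \<le> u (i' + d)" using a0[OF assms(1,1)] a1[OF assms(1,1), of i'] Trn_nonneg[of "?a J0" J0 i'] a0 assms(1) by force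
    hence "1 * (lam ^ i' * u (i' + d)) \<le> real q * (lam ^ i' * u (i' + d))"
      using q_pos lam_nonneg by (intro mult_right_mono) auto
    thus ?thesis by simp
  qed
  also have "\<dots> = real q * lam ^ i' * (\<Sum>m\<le>i'. u (m + (i - i')))"
    by (simp add: d_def[symmetric] lessThan_Suc_atMost[symmetric] algebra_simps)
  finally show ?thesis .
qed

lemma sum_dead:
  assumes "J0 \<in> JS"
  shows "(\<Sum>J\<in>fst (run H r (init J0)). h J) = (\<Sum>i<r. \<Sum>J\<in>snd (run H i (init J0)). (h J :: real))"
proof (induction r)
  case (Suc r)
  let ?s = "run H r (init J0)"
  obtain D G where s: "?s = (D, G)" by (cases ?s)
  have "run H (Suc r) (init J0) = run H (Suc 0) ?s" using run_add[of H r "Suc 0"] by simp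
  hence "fst (run H (Suc r) (init J0)) = D \<union> G" by (simp add: s)
  moreover have "D \<subseteq> JS" "G \<subseteq> JS" "D \<inter> G = {}"
    using run_sub[of "init J0" H r] run_disjoint[of "init J0" H r] assms s by auto
  hence "(\<Sum>J\<in>D \<union> G. h J) = (\<Sum>J\<in>D. h J) + (\<Sum>J\<in>G. h J)"
    using finite_JS_sub by (intro sum.union_disjoint) auto
  ultimately show ?case using Suc by (simp add: s)
qed simp

text \<open>The third condition keeps \<open>lam * alpha\<close> away from 1, so that
  equidistribution beats the growth of the branching process. It holds once \<open>lam\<close> is
  close enough to 1.\<close>

definition regular :: bool where
  "regular \<longleftrightarrow> 1 < lam \<and> lam \<le> 2 \<and> lam * alpha \<le> (1 + alpha) / 2"

definition e :: real where "e = lam - 1"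

lemma geo_lam:
  assumes "1 < lam" shows "(\<Sum>m\<le>i. lam ^ m) \<le> lam ^ Suc i / e"
  using geometric_sum[of lam "Suc i"] assms unfolding e_def lessThan_Suc_atMost[symmetric]
  by (simp add: divide_right_mono)

lemma geo_small:
  fixes x :: real
  assumes "0 \<le> x" "x < 1" shows "(\<Sum>m\<le>i. x ^ m) \<le> 1 / (1 - x)"
proof -
  have "(\<Sum>m<Suc i. x ^ m) = (1 - x ^ Suc i) / (1 - x)" using sum_gp_strict[of x "Suc i"] assms by simp
  also have "\<dots> \<le> 1 / (1 - x)" using assms by (intro divide_right_mono) auto
  finally show ?thesis by (simp add: lessThan_Suc_atMost)
qed

lemma geo_mixed:
  assumes "regular" shows "(\<Sum>m\<le>i. (lam * alpha) ^ m) \<le> 2 / (1 - alpha)"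
proof -
  have "lam * alpha < 1" "0 \<le> lam * alpha" using assms alpha_bounds lam_nonneg unfolding regular_def by auto
  hence "(\<Sum>m\<le>i. (lam * alpha) ^ m) \<le> 1 / (1 - lam * alpha)" by (intro geo_small)
  also have "\<dots> \<le> 1 / ((1 - alpha) / 2)"
    using assms alpha_bounds unfolding regular_def by (intro frac_le) (simp_all add: diff_divide_distrib add_divide_distrib)
  finally show ?thesis by simp
qed

text \<open>\<open>B\<close> is the equidistributed part of a pair statistic and \<open>E\<close>
  its local part. Summation over the separation times turns the former into a factor
  \<open>1 / e\<close>; the latter sums to a constant and keeps the decay over the gap between the
  levels.\<close>

lemma cross_bound:
  assumes reg: "regular" and "i' \<le> i" "0 \<le> B" "0 \<le> E"
  shows "real q * lam ^ i' * (\<Sum>m\<le>i'. lam ^ (m + (i - i')) * (B + E * alpha ^ (m + (i - i')))) \<le>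
    2 * real q * lam ^ i * (B * lam ^ i' / e + E * alpha ^ (i - i') / (1 - alpha))"
proof -
  have lam: "1 < lam" "lam \<le> 2" using reg by (auto simp: regular_def)
  have e0: "0 < e" using lam by (simp add: e_def)
  have "lam ^ i' * (\<Sum>m\<le>i'. lam ^ (m + (i - i')) * (B + E * alpha ^ (m + (i - i')))) =
     lam ^ i' * lam ^ (i - i') * (B * (\<Sum>m\<le>i'. lam ^ m) + E * alpha ^ (i - i') * (\<Sum>m\<le>i'. (lam * alpha) ^ m))"
    by (simp add: sum_distrib_left sum.distrib[symmetric] power_add power_mult_distrib algebra_simps)
  also have "lam ^ i' * lam ^ (i - i') = lam ^ i" using assms(2) by (simp flip: power_add)
  also have "lam ^ i * (B * (\<Sum>m\<le>i'. lam ^ m) + E * alpha ^ (i - i') * (\<Sum>m\<le>i'. (lam * alpha) ^ m)) \<le>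
     lam ^ i * (B * (2 * lam ^ i' / e) + E * alpha ^ (i - i') * (2 / (1 - alpha)))"
  proof (intro mult_left_mono add_mono geo_mixed reg)
    have "(\<Sum>m\<le>i'. lam ^ m) \<le> lam ^ Suc i' / e" by (rule geo_lam[OF lam(1)])
    also have "\<dots> \<le> 2 * lam ^ i' / e" using lam e0 by (intro divide_right_mono) auto
    finally show "(\<Sum>m\<le>i'. lam ^ m) \<le> 2 * lam ^ i' / e" .
  qed (use assms alpha_bounds lam in auto)
  finally have "real q * (lam ^ i' * (\<Sum>m\<le>i'. lam ^ (m + (i - i')) * (B + E * alpha ^ (m + (i - i'))))) \<le>
    real q * (lam ^ i * (B * (2 * lam ^ i' / e) + E * alpha ^ (i - i') * (2 / (1 - alpha))))"
    by (intro mult_left_mono) auto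
  thus ?thesis by (simp add: algebra_simps)
qed

end

lemma sum_lin_comb:
  fixes B E x y c :: real
  shows "(\<Sum>i\<in>I. c * (B * f i / x + E * g i / y)) = c * (B / x * (\<Sum>i\<in>I. f i) + E / y * (\<Sum>i\<in>I. g i))"
  by (induction I rule: infinite_finite_induct) (auto simp: algebra_simps)

context hyp begin

section \<open>Expected losses and pair counts of one exploration\<close>

lemma Ex_init: "Ex i (init J0) \<phi> = bexp p KS (\<lambda>H. \<phi> (run H i (init J0)))"
  by (simp add: Ex_def)

lemma run_init_sub:
  assumes "J0 \<in> JS"
  shows "snd (run H i (init J0)) \<subseteq> JS" "fst (run H i (init J0)) \<subseteq> JS"
    "fst (run H i (init J0)) \<inter> snd (run H i (init J0)) = {}" "finite (fst (run H i (init J0)))" "finite (snd (run H i (init J0)))"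
proof -
  show 1: "snd (run H i (init J0)) \<subseteq> JS" "fst (run H i (init J0)) \<subseteq> JS"
    using run_sub[of "init J0" H i] assms by auto
  show "fst (run H i (init J0)) \<inter> snd (run H i (init J0)) = {}"
    using run_disjoint[of "init J0" H i] assms by auto
  show "finite (fst (run H i (init J0)))" "finite (snd (run H i (init J0)))"
    using 1 finite_JS_sub by auto
qed

lemma t_decay:
  assumes "J \<in> JS" "J' \<in> JS"
  shows "(Tr ^^ m) (t J) J' \<le> lam ^ m * (lam / real N + (lam * (4 * real k / real n)) * alpha ^ m)"
proof -
  have "(Tr ^^ m) (t J) J' \<le> lam ^ m * (avg (t J) + 2 * alpha ^ m * (lam * (2 * real k / real n)))"
    using assms t_le by (intro Trn_decay) auto
  also have "avg (t J) = lam / real N" using assms by (simp add: avg_def t_rowsum)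
  finally show ?thesis by (simp add: mult_ac)
qed

lemma t2_alt: "t2 J = Tr (t J)"
  by (rule ext) (simp add: t2_def Tr_def mult.commute)

lemma t2_decay:
  assumes reg: regular and "J \<in> JS" "J' \<in> JS"
  shows "(Tr ^^ m) (t2 J) J' \<le> lam ^ m * (2 * (lam / real N) + (2 * (lam * (4 * real k / real n))) * alpha ^ m)"
proof -
  have lam: "0 \<le> lam" "lam \<le> 2" using reg by (auto simp: regular_def)
  let ?B = "lam / real N" and ?E = "lam * (4 * real k / real n)"
  have "(Tr ^^ m) (t2 J) J' = (Tr ^^ Suc m) (t J) J'" by (simp add: t2_alt funpow_Suc_right del: funpow.simps)
  also have "\<dots> \<le> lam ^ Suc m * (?B + ?E * alpha ^ Suc m)" by (rule t_decay) fact+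
  also have "\<dots> = lam ^ m * (lam * (?B + ?E * alpha ^ Suc m))" by simp
  also have "\<dots> \<le> lam ^ m * (2 * (?B + ?E * alpha ^ m))"
    using lam alpha_bounds by (intro mult_left_mono mult_mono add_mono) (auto intro!: mult_left_le_one_le)
  finally show ?thesis by (simp add: algebra_simps)
qed

lemma sum_lam:
  assumes "1 < lam" shows "(\<Sum>i<r. lam ^ i) \<le> lam ^ r / e"
  using geometric_sum[of lam r] assms by (simp add: e_def divide_right_mono)

lemma sum_alpha: "(\<Sum>i'\<le>i. alpha ^ (i - i')) \<le> 1 / (1 - alpha)"
proof -
  have "(\<Sum>i'\<le>i. alpha ^ (i - i')) = (\<Sum>m\<le>i. alpha ^ m)"
    by (rule sum.reindex_bij_witness[of _ "\<lambda>m. i - m" "\<lambda>m. i - m"]) auto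
  thus ?thesis using geo_small[of alpha i] alpha_bounds by simp
qed

lemma sum_cross_bound:
  assumes reg: regular and "0 \<le> B" "0 \<le> E"
  shows "(\<Sum>i'\<le>i. 2 * real q * lam ^ i * (B * lam ^ i' / e + E * alpha ^ (i - i') / (1 - alpha))) \<le>
    4 * real q * lam ^ i * (B * lam ^ i / e ^ 2 + E / (1 - alpha) ^ 2)"
proof -
  have lam: "1 < lam" "lam \<le> 2" using reg by (auto simp: regular_def)
  have e0: "0 < e" using lam by (simp add: e_def)
  have "(\<Sum>i'\<le>i. 2 * real q * lam ^ i * (B * lam ^ i' / e + E * alpha ^ (i - i') / (1 - alpha))) =
     2 * real q * lam ^ i * (B / e * (\<Sum>i'\<le>i. lam ^ i') + E / (1 - alpha) * (\<Sum>i'\<le>i. alpha ^ (i - i')))"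
    by (rule sum_lin_comb)
  also have "\<dots> \<le> 2 * real q * lam ^ i * (B / e * (2 * lam ^ i / e) + E / (1 - alpha) * (2 * (1 / (1 - alpha))))"
  proof (intro mult_left_mono add_mono)
    have "(\<Sum>i'\<le>i. lam ^ i') \<le> lam ^ Suc i / e" by (rule geo_lam[OF lam(1)])
    also have "\<dots> \<le> 2 * lam ^ i / e" using lam e0 by (intro divide_right_mono) auto
    finally show "(\<Sum>i'\<le>i. lam ^ i') \<le> 2 * lam ^ i / e" .
    have "1 * (1 / (1 - alpha)) \<le> 2 * (1 / (1 - alpha))" using alpha_bounds by (intro mult_right_mono) auto
    thus "(\<Sum>i'\<le>i. alpha ^ (i - i')) \<le> 2 * (1 / (1 - alpha))" using sum_alpha[of i] by simp
  qed (use assms alpha_bounds e0 lam in auto)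
  also have "\<dots> = 4 * real q * lam ^ i * (B * lam ^ i / e ^ 2 + E / (1 - alpha) ^ 2)"
    by (simp add: power2_eq_square algebra_simps)
  finally show ?thesis .
qed

text \<open>Depends on \<open>k\<close> and \<open>j\<close> only, so it acts as a constant when
  \<open>n\<close> grows.\<close>

definition CL :: real where "CL = 4 * real q * (real q + 2) * (2 + 8 * real k / (1 - alpha) ^ 2)"

lemma CL_nonneg: "0 \<le> CL"
  unfolding CL_def by (intro mult_nonneg_nonneg add_nonneg_nonneg) auto

text \<open>The two summands come from \<open>t_decay\<close>: equidistributed explored j-sets
  interact with intensity \<open>1 / N\<close>, close relatives with intensity of order
  \<open>1 / n\<close>. The dead set is split into its levels by \<open>sum_dead\<close>.\<close>

lemma loss_bound:
  assumes reg: regular and J0: "J0 \<in> JS"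
  shows "Ex i (init J0) (\<lambda>s. loss (fst s) (snd s)) \<le> CL * lam ^ i * (lam ^ i / (real N * e ^ 2) + 1 / real n)"
proof -
  let ?R = "\<lambda>i H. snd (run H i (init J0))"
  let ?B = "lam / real N" and ?E = "lam * (4 * real k / real n)"
  have lam: "1 < lam" "lam \<le> 2" using reg by (auto simp: regular_def)
  have e0: "0 < e" "e \<le> 1" using lam by (auto simp: e_def)
  have al: "0 < 1 - alpha" "1 - alpha \<le> 1" using alpha_bounds by auto
  have B0: "0 \<le> ?B" "0 \<le> ?E" using lam by auto
  have "loss (fst (run H i (init J0))) (?R i H) = 
     (real q + 1) * (\<Sum>i'\<le>i. \<Sum>J\<in>?R i' H. \<Sum>J'\<in>?R i H. t J J') + (\<Sum>J\<in>?R i H. \<Sum>J'\<in>?R i H. t2 J J')" for H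
  proof -
    obtain D G where s: "run H i (init J0) = (D, G)" by (cases "run H i (init J0)")
    have "run H (Suc i) (init J0) = run H (Suc 0) (run H i (init J0))" using run_add[of H i "Suc 0"] by simp
    hence f: "fst (run H (Suc i) (init J0)) = D \<union> G" by (simp add: s)
    have "(\<Sum>J\<in>G. \<Sum>J'\<in>D \<union> G. t J J') = (\<Sum>J'\<in>fst (run H (Suc i) (init J0)). \<Sum>J\<in>G. t J' J)"
      unfolding f by (subst sum.swap) (simp add: t_sym)
    also have "\<dots> = (\<Sum>i'<Suc i. \<Sum>J\<in>?R i' H. \<Sum>J'\<in>?R i H. t J J')"
      by (subst sum_dead[OF J0]) (simp add: s)
    finally show ?thesis by (simp add: loss_def s lessThan_Suc_atMost)
  qed
  hence "Ex i (init J0) (\<lambda>s. loss (fst s) (snd s)) = 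
     (real q + 1) * (\<Sum>i'\<le>i. bexp p KS (\<lambda>H. \<Sum>J\<in>?R i' H. \<Sum>J'\<in>?R i H. t J J')) + bexp p KS (\<lambda>H. \<Sum>J\<in>?R i H. \<Sum>J'\<in>?R i H. t2 J J')"
    by (simp add: Ex_init bexp_add bexp_cmult bexp_sum)
  also have "\<dots> \<le> (real q + 1) * (4 * real q * lam ^ i * (?B * lam ^ i / e ^ 2 + ?E / (1 - alpha) ^ 2)) 
      + 4 * real q * lam ^ i * (?B * lam ^ i / e ^ 2 + ?E / (1 - alpha) ^ 2)"
  proof (intro add_mono mult_left_mono)
    have "(\<Sum>i'\<le>i. bexp p KS (\<lambda>H. \<Sum>J\<in>?R i' H. \<Sum>J'\<in>?R i H. t J J')) \<le> 
      (\<Sum>i'\<le>i. 2 * real q * lam ^ i * (?B * lam ^ i' / e + ?E * alpha ^ (i - i') / (1 - alpha)))"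
    proof (intro sum_mono)
      fix i' assume "i' \<in> {..i}"
      hence i': "i' \<le> i" by simp
      have "bexp p KS (\<lambda>H. \<Sum>J\<in>?R i' H. \<Sum>J'\<in>?R i H. t J J') \<le> 
        real q * lam ^ i' * (\<Sum>m\<le>i'. lam ^ (m + (i - i')) * (?B + ?E * alpha ^ (m + (i - i'))))"
        by (rule pair_cross[OF J0 _ _ i']) (use t_decay in auto)
      also have "\<dots> \<le> 2 * real q * lam ^ i * (?B * lam ^ i' / e + ?E * alpha ^ (i - i') / (1 - alpha))"
        by (rule cross_bound[OF reg i' B0])
      finally show "bexp p KS (\<lambda>H. \<Sum>J\<in>?R i' H. \<Sum>J'\<in>?R i H. t J J') \<le> 2 * real q * lam ^ i * (?B * lam ^ i' / e + ?E * alpha ^ (i - i') / (1 - alpha))" .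
    qed
    also have "\<dots> \<le> 4 * real q * lam ^ i * (?B * lam ^ i / e ^ 2 + ?E / (1 - alpha) ^ 2)"
      by (rule sum_cross_bound[OF reg B0])
    finally show "(\<Sum>i'\<le>i. bexp p KS (\<lambda>H. \<Sum>J\<in>?R i' H. \<Sum>J'\<in>?R i H. t J J')) \<le> 4 * real q * lam ^ i * (?B * lam ^ i / e ^ 2 + ?E / (1 - alpha) ^ 2)" .
    have "bexp p KS (\<lambda>H. \<Sum>J\<in>?R i H. \<Sum>J'\<in>?R i H. t2 J J') \<le> real q * lam ^ i * (\<Sum>m\<le>i. lam ^ (m + (i - i)) * (2 * ?B + (2 * ?E) * alpha ^ (m + (i - i))))"
    proof (rule pair_cross[OF J0])
      fix m J J' assume "J \<in> JS" "J' \<in> JS"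
      thus "(Tr ^^ m) (t2 J) J' \<le> lam ^ m * (2 * ?B + (2 * ?E) * alpha ^ m)" by (rule t2_decay[OF reg])
    qed (auto simp: t2_nonneg)
    also have "\<dots> \<le> 2 * real q * lam ^ i * ((2 * ?B) * lam ^ i / e + (2 * ?E) * alpha ^ (i - i) / (1 - alpha))"
      by (rule cross_bound[OF reg]) (use B0 in auto)
    also have "\<dots> = 4 * real q * lam ^ i * (?B * lam ^ i / e + ?E / (1 - alpha))" by (simp add: algebra_simps)
    also have "\<dots> \<le> 4 * real q * lam ^ i * (?B * lam ^ i / e ^ 2 + ?E / (1 - alpha) ^ 2)"
    proof (intro mult_left_mono add_mono divide_left_mono)
      show "e ^ 2 \<le> e" "(1 - alpha) ^ 2 \<le> 1 - alpha"
        using e0 al by (auto simp: power2_eq_square mult_left_le)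
    qed (use lam B0 e0 al in auto)
    finally show "bexp p KS (\<lambda>H. \<Sum>J\<in>?R i H. \<Sum>J'\<in>?R i H. t2 J J') \<le> 4 * real q * lam ^ i * (?B * lam ^ i / e ^ 2 + ?E / (1 - alpha) ^ 2)" .
  qed auto
  also have "\<dots> = 4 * real q * (real q + 2) * lam ^ i * (?B * lam ^ i / e ^ 2 + ?E / (1 - alpha) ^ 2)"
  proof -
    have "(Q + 1) * (4 * Q * l * X) + 4 * Q * l * X = 4 * Q * (Q + 2) * l * X" for Q l X :: real
      by (simp add: algebra_simps)
    thus ?thesis .
  qed
  also have "\<dots> \<le> 4 * real q * (real q + 2) * lam ^ i * ((2 + 8 * real k / (1 - alpha) ^ 2) * (lam ^ i / (real N * e ^ 2) + 1 / real n))"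
  proof (intro mult_left_mono)
    let ?a = "lam ^ i / (real N * e ^ 2)" and ?c = "8 * real k / (1 - alpha) ^ 2"
    have a0: "0 \<le> ?a" using lam by simp
    have "?B * lam ^ i / e ^ 2 = lam * ?a" by simp
    also have "\<dots> \<le> 2 * ?a" using lam a0 by (intro mult_right_mono) auto
    finally have 1: "?B * lam ^ i / e ^ 2 \<le> 2 * ?a" .
    have "?E / (1 - alpha) ^ 2 \<le> 2 * (4 * real k / real n) / (1 - alpha) ^ 2"
      using lam by (intro divide_right_mono mult_right_mono) auto
    also have "\<dots> = ?c * (1 / real n)" by simp
    finally have 2: "?E / (1 - alpha) ^ 2 \<le> ?c * (1 / real n)" .
    have "0 \<le> ?c * ?a" by (intro mult_nonneg_nonneg a0) auto
    moreover have "0 \<le> 2 * (1 / real n)" by simp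
    ultimately show "?B * lam ^ i / e ^ 2 + ?E / (1 - alpha) ^ 2 \<le> (2 + ?c) * (?a + 1 / real n)"
      using 1 2 unfolding distrib_left distrib_right by linarith
  qed (use lam in auto)
  finally show ?thesis by (simp add: CL_def mult_ac)
qed

text \<open>Growth before a loss, \<open>lam ^ i\<close>, times influence after it,
  \<open>lam ^ (r - Suc i)\<close>, is at most \<open>lam ^ r\<close> at every level. What remains
  is a geometric sum and \<open>r\<close> equal local terms.\<close>

lemma lower_bound:
  assumes reg: regular and J0: "J0 \<in> JS" and zv: "0 \<le> z" "z \<le> 1" "0 \<le> v" "v \<le> 1"
    and sg: "\<And>m. 1 - zs v z m \<le> sg * lam ^ m"
  shows "Ex r (init J0) (\<lambda>s. v ^ card (fst s) * z ^ card (snd s)) \<le> zs v z r + 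
    sg * CL * lam ^ r * (lam ^ r / (real N * e ^ 3) + real r / real n)"
proof -
  have lam: "1 < lam" "lam \<le> 2" using reg by (auto simp: regular_def)
  have e0: "0 < e" using lam by (auto simp: e_def)
  have sg0: "0 \<le> sg" using sg[of 0] zv by simp
  have "Ex r (init J0) (\<lambda>s. v ^ card (fst s) * z ^ card (snd s)) \<le> zs v z r + 
     (\<Sum>i<r. (1 - zs v z (r - Suc i)) * Ex i (init J0) (\<lambda>s. loss (fst s) (snd s)))"
    using lower_potential[of "{}" "{J0}" z v r] zv J0 by (simp add: pre_def init_def)
  also have "(\<Sum>i<r. (1 - zs v z (r - Suc i)) * Ex i (init J0) (\<lambda>s. loss (fst s) (snd s))) \<le>
    (\<Sum>i<r. sg * CL * lam ^ r * (lam ^ i / (real N * e ^ 2) + 1 / real n))"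
  proof (rule sum_mono)
    fix i assume i: "i \<in> {..<r}"
    have "(1 - zs v z (r - Suc i)) * Ex i (init J0) (\<lambda>s. loss (fst s) (snd s)) \<le>
      (sg * lam ^ (r - Suc i)) * (CL * lam ^ i * (lam ^ i / (real N * e ^ 2) + 1 / real n))"
      using zs_bounds[OF zv, of "r - Suc i"] sg0 lam
      by (intro mult_mono sg loss_bound reg J0) (auto simp: Ex_def intro!: bexp_nonneg p0 p1 loss_nonneg)
    also have "\<dots> = sg * CL * (lam ^ (r - Suc i) * lam ^ i) * (lam ^ i / (real N * e ^ 2) + 1 / real n)" by simp
    also have "lam ^ (r - Suc i) * lam ^ i = lam ^ (r - 1)" using i by (simp flip: power_add)
    also have "sg * CL * lam ^ (r - 1) * (lam ^ i / (real N * e ^ 2) + 1 / real n) \<le> sg * CL * lam ^ r * (lam ^ i / (real N * e ^ 2) + 1 / real n)"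
      using lam sg0 CL_nonneg by (intro mult_right_mono mult_left_mono power_increasing) auto
    finally show "(1 - zs v z (r - Suc i)) * Ex i (init J0) (\<lambda>s. loss (fst s) (snd s)) \<le> sg * CL * lam ^ r * (lam ^ i / (real N * e ^ 2) + 1 / real n)" .
  qed
  also have "\<dots> = sg * CL * lam ^ r * ((\<Sum>i<r. lam ^ i) / (real N * e ^ 2) + real r / real n)"
    by (simp add: sum_distrib_left[symmetric] sum.distrib sum_divide_distrib)
  also have "\<dots> \<le> sg * CL * lam ^ r * (lam ^ r / e / (real N * e ^ 2) + real r / real n)"
    using lam sg0 CL_nonneg e0 by (intro mult_left_mono add_right_mono divide_right_mono sum_lam) auto
  also have "lam ^ r / e / (real N * e ^ 2) = lam ^ r / (real N * e ^ 3)" by (simp add: power3_eq_cube power2_eq_square mult_ac)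
  finally show ?thesis by simp
qed

lemma pair_stat_front:
  assumes reg: regular and J0: "J0 \<in> JS" and "0 \<le> \<nu>"
    and a: "\<And>J J'. J \<in> JS \<Longrightarrow> J' \<in> JS \<Longrightarrow> 0 \<le> a J J' \<and> a J J' \<le> 1" "\<And>J. J \<in> JS \<Longrightarrow> avg (a J) \<le> \<nu>"
  shows "bexp p KS (\<lambda>H. \<Sum>J\<in>snd (run H r (init J0)). \<Sum>J'\<in>snd (run H r (init J0)). a J J') \<le>
    2 * real q * lam ^ r * (\<nu> * lam ^ r / e + 2 / (1 - alpha))"
proof -
  have lam: "1 < lam" "lam \<le> 2" using reg by (auto simp: regular_def)
  have "bexp p KS (\<lambda>H. \<Sum>J\<in>snd (run H r (init J0)). \<Sum>J'\<in>snd (run H r (init J0)). a J J') \<le> 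
     real q * lam ^ r * (\<Sum>m\<le>r. lam ^ (m + (r - r)) * (\<nu> + 2 * alpha ^ (m + (r - r))))"
  proof (rule pair_cross[OF J0])
    fix m J J' assume J: "J \<in> JS" "J' \<in> JS"
    have "(Tr ^^ m) (a J) J' \<le> lam ^ m * (avg (a J) + 2 * alpha ^ m * 1)"
      using J a(1) by (intro Trn_decay) auto
    also have "\<dots> \<le> lam ^ m * (\<nu> + 2 * alpha ^ m)" using a(2)[OF J(1)] lam by (intro mult_left_mono) auto
    finally show "(Tr ^^ m) (a J) J' \<le> lam ^ m * (\<nu> + 2 * alpha ^ m)" .
  qed (use a in auto)
  also have "\<dots> \<le> 2 * real q * lam ^ r * (\<nu> * lam ^ r / e + 2 * alpha ^ (r - r) / (1 - alpha))"
    by (rule cross_bound[OF reg]) (use assms in auto)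
  finally show ?thesis by simp
qed

text \<open>Used with \<open>a = isz l\<close>, where \<open>\<nu>\<close> is the proportion of
  j-sets that meet a given one in \<open>l\<close> vertices: apart from close relatives, the dead
  set contains such pairs at the rate of a spread-out set.\<close>

lemma pair_stat_dead:
  assumes reg: regular and J0: "J0 \<in> JS" and nu: "0 \<le> \<nu>"
    and a: "\<And>J J'. J \<in> JS \<Longrightarrow> J' \<in> JS \<Longrightarrow> 0 \<le> a J J' \<and> a J J' \<le> 1" "\<And>J. J \<in> JS \<Longrightarrow> avg (a J) \<le> \<nu>"
    and sym: "\<And>J J'. a J J' = a J' J"
  shows "bexp p KS (\<lambda>H. \<Sum>J\<in>fst (run H r (init J0)). \<Sum>J'\<in>fst (run H r (init J0)). a J J') \<le>
    16 * real q * (\<nu> * lam ^ (2 * r) / e ^ 3 + lam ^ r / (e * (1 - alpha) ^ 2))"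
proof -
  let ?R = "\<lambda>i H. snd (run H i (init J0))"
  have lam: "1 < lam" "lam \<le> 2" using reg by (auto simp: regular_def)
  have e0: "0 < e" using lam by (auto simp: e_def)
  have al: "0 < 1 - alpha" using alpha_bounds by auto
  define X where "X H i i' = (\<Sum>J\<in>?R i H. \<Sum>J'\<in>?R i' H. a J J')" for H i i'
  have X0: "0 \<le> X H i i'" for H i i'
    unfolding X_def using run_init_sub(1)[OF J0] a(1) by (intro sum_nonneg) blast
  have Xsym: "X H i i' = X H i' i" for H i i'
    unfolding X_def by (subst sum.swap) (simp add: sym)
  have "(\<Sum>J\<in>fst (run H r (init J0)). \<Sum>J'\<in>fst (run H r (init J0)). a J J') \<le> 2 * (\<Sum>i<r. \<Sum>i'\<le>i. X H i' i)" for H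
  proof -
    have "(\<Sum>J\<in>fst (run H r (init J0)). \<Sum>J'\<in>fst (run H r (init J0)). a J J') = (\<Sum>i<r. \<Sum>i'<r. X H i i')"
      unfolding sum_dead[OF J0] X_def by (intro sum.cong refl sum.swap)
    also have "\<dots> \<le> (\<Sum>i<r. \<Sum>i'<r. of_bool (i' \<le> i) * X H i' i + of_bool (i \<le> i') * X H i i')"
    proof (intro sum_mono)
      fix i i' :: nat
      show "X H i i' \<le> of_bool (i' \<le> i) * X H i' i + of_bool (i \<le> i') * X H i i'"
        using X0[of H i i'] Xsym[of H i i'] by (cases "i' \<le> i"; cases "i \<le> i'") auto
    qed
    also have "\<dots> = (\<Sum>i<r. \<Sum>i'<r. of_bool (i' \<le> i) * X H i' i) + (\<Sum>i<r. \<Sum>i'<r. of_bool (i \<le> i') * X H i i')"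
      by (simp add: sum.distrib)
    also have "(\<Sum>i<r. \<Sum>i'<r. of_bool (i \<le> i') * X H i i') = (\<Sum>i<r. \<Sum>i'<r. of_bool (i' \<le> i) * X H i' i)"
      by (rule sum.swap)
    also have "(\<Sum>i<r. \<Sum>i'<r. of_bool (i' \<le> i) * X H i' i) = (\<Sum>i<r. \<Sum>i'\<le>i. X H i' i)"
    proof (rule sum.cong[OF refl])
      fix i assume "i \<in> {..<r}"
      thus "(\<Sum>i'<r. of_bool (i' \<le> i) * X H i' i) = (\<Sum>i'\<le>i. X H i' i)"
        by (intro sum.mono_neutral_cong_right) auto
    qed
    finally show ?thesis by simp
  qed
  hence "bexp p KS (\<lambda>H. \<Sum>J\<in>fst (run H r (init J0)). \<Sum>J'\<in>fst (run H r (init J0)). a J J') \<le> 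
     bexp p KS (\<lambda>H. 2 * (\<Sum>i<r. \<Sum>i'\<le>i. X H i' i))"
    by (intro bexp_mono p0 p1)
  also have "\<dots> = 2 * (\<Sum>i<r. \<Sum>i'\<le>i. bexp p KS (\<lambda>H. X H i' i))"
    by (simp add: bexp_cmult bexp_sum)
  also have "\<dots> \<le> 2 * (\<Sum>i<r. \<Sum>i'\<le>i. 2 * real q * lam ^ i * (\<nu> * lam ^ i' / e + 2 * alpha ^ (i - i') / (1 - alpha)))"
  proof (intro mult_left_mono sum_mono)
    fix i i' :: nat assume "i' \<in> {..i}"
    hence i': "i' \<le> i" by simp
    have "bexp p KS (\<lambda>H. X H i' i) \<le> real q * lam ^ i' * (\<Sum>m\<le>i'. lam ^ (m + (i - i')) * (\<nu> + 2 * alpha ^ (m + (i - i'))))"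
      unfolding X_def
    proof (rule pair_cross[OF J0 _ _ i'])
      fix m J J' assume J: "J \<in> JS" "J' \<in> JS"
      have "(Tr ^^ m) (a J) J' \<le> lam ^ m * (avg (a J) + 2 * alpha ^ m * 1)"
        using J a(1) by (intro Trn_decay) auto
      also have "\<dots> \<le> lam ^ m * (\<nu> + 2 * alpha ^ m)" using a(2)[OF J(1)] lam by (intro mult_left_mono) auto
      finally show "(Tr ^^ m) (a J) J' \<le> lam ^ m * (\<nu> + 2 * alpha ^ m)" .
    qed (use a in auto)
    also have "\<dots> \<le> 2 * real q * lam ^ i * (\<nu> * lam ^ i' / e + 2 * alpha ^ (i - i') / (1 - alpha))"
      by (rule cross_bound[OF reg i' nu]) auto
    finally show "bexp p KS (\<lambda>H. X H i' i) \<le> 2 * real q * lam ^ i * (\<nu> * lam ^ i' / e + 2 * alpha ^ (i - i') / (1 - alpha))" .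
  qed auto
  also have "\<dots> \<le> 2 * (\<Sum>i<r. 4 * real q * lam ^ i * (\<nu> * lam ^ r / e ^ 2 + 2 / (1 - alpha) ^ 2))"
  proof (intro mult_left_mono sum_mono)
    fix i assume i: "i \<in> {..<r}"
    have "(\<Sum>i'\<le>i. 2 * real q * lam ^ i * (\<nu> * lam ^ i' / e + 2 * alpha ^ (i - i') / (1 - alpha))) \<le> 
       4 * real q * lam ^ i * (\<nu> * lam ^ i / e ^ 2 + 2 / (1 - alpha) ^ 2)"
      by (rule sum_cross_bound[OF reg nu]) auto
    also have "\<dots> \<le> 4 * real q * lam ^ i * (\<nu> * lam ^ r / e ^ 2 + 2 / (1 - alpha) ^ 2)"
      using i lam nu by (intro mult_left_mono add_right_mono divide_right_mono power_increasing) auto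
    finally show "(\<Sum>i'\<le>i. 2 * real q * lam ^ i * (\<nu> * lam ^ i' / e + 2 * alpha ^ (i - i') / (1 - alpha))) \<le> 
       4 * real q * lam ^ i * (\<nu> * lam ^ r / e ^ 2 + 2 / (1 - alpha) ^ 2)" .
  qed auto
  also have "\<dots> = 8 * real q * (\<nu> * lam ^ r / e ^ 2 + 2 / (1 - alpha) ^ 2) * (\<Sum>i<r. lam ^ i)"
  proof -
    have "2 * (\<Sum>i<r. 4 * Q * lam ^ i * Y) = 8 * Q * Y * (\<Sum>i<r. lam ^ i)" for Q Y :: real
      by (simp add: sum_distrib_left algebra_simps)
    thus ?thesis .
  qed
  also have "\<dots> \<le> 8 * real q * (\<nu> * lam ^ r / e ^ 2 + 2 / (1 - alpha) ^ 2) * (lam ^ r / e)"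
    using lam nu by (intro mult_left_mono sum_lam) auto
  also have "\<dots> = 8 * real q * (\<nu> * lam ^ (2 * r) / e ^ 3 + 2 * (lam ^ r / (e * (1 - alpha) ^ 2)))"
  proof -
    have "lam ^ (2 * r) = lam ^ r * lam ^ r" by (simp add: mult_2 power_add)
    moreover have "8 * Q * (\<nu> * l / e ^ 2 + 2 / A ^ 2) * (l / e) = 8 * Q * (\<nu> * (l * l) / e ^ 3 + 2 * (l / (e * A ^ 2)))" for Q l A :: real
      by (simp add: power2_eq_square power3_eq_cube algebra_simps)
    ultimately show ?thesis by presburger
  qed
  also have "\<dots> \<le> 8 * real q * (2 * (\<nu> * lam ^ (2 * r) / e ^ 3) + 2 * (lam ^ r / (e * (1 - alpha) ^ 2)))"
  proof (intro mult_left_mono add_right_mono)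
    have "0 \<le> \<nu> * lam ^ (2 * r) / e ^ 3" using nu lam e0 by simp
    thus "\<nu> * lam ^ (2 * r) / e ^ 3 \<le> 2 * (\<nu> * lam ^ (2 * r) / e ^ 3)" by linarith
  qed auto
  also have "\<dots> = 16 * real q * (\<nu> * lam ^ (2 * r) / e ^ 3 + lam ^ r / (e * (1 - alpha) ^ 2))"
    by (simp add: algebra_simps)
  finally show ?thesis .
qed

text \<open>Input for the taint estimate: the intensity with which chains of \<open>s + 1\<close>
  steps lead from the dead set to the frontier.\<close>

lemma pair_dead_front:
  assumes reg: regular and J0: "J0 \<in> JS"
  shows "bexp p KS (\<lambda>H. \<Sum>J\<in>fst (run H r (init J0)). \<Sum>J'\<in>snd (run H r (init J0)). (Tr ^^ s) (t J) J') \<le>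
    4 * real q * lam ^ (r + s) * (lam ^ r / (real N * e ^ 2) + 4 * real k / (real n * (1 - alpha) ^ 2))"
proof -
  let ?R = "\<lambda>i H. snd (run H i (init J0))"
  let ?B = "lam ^ s * (lam / real N)" and ?E = "lam ^ s * (lam * (4 * real k / real n))"
  have lam: "1 < lam" "lam \<le> 2" using reg by (auto simp: regular_def)
  have e0: "0 < e" using lam by (auto simp: e_def)
  have al: "0 < 1 - alpha" "0 < alpha" using alpha_bounds by auto
  have "bexp p KS (\<lambda>H. \<Sum>J\<in>fst (run H r (init J0)). \<Sum>J'\<in>?R r H. (Tr ^^ s) (t J) J') = 
    (\<Sum>i'<r. bexp p KS (\<lambda>H. \<Sum>J\<in>?R i' H. \<Sum>J'\<in>?R r H. (Tr ^^ s) (t J) J'))"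
    unfolding sum_dead[OF J0] bexp_sum ..
  also have "\<dots> \<le> (\<Sum>i'<r. 2 * real q * lam ^ r * (?B * lam ^ i' / e + ?E * alpha ^ (r - i') / (1 - alpha)))"
  proof (rule sum_mono)
    fix i' assume "i' \<in> {..<r}"
    hence i': "i' \<le> r" by simp
    have "bexp p KS (\<lambda>H. \<Sum>J\<in>?R i' H. \<Sum>J'\<in>?R r H. (Tr ^^ s) (t J) J') \<le>
      real q * lam ^ i' * (\<Sum>m\<le>i'. lam ^ (m + (r - i')) * (?B + ?E * alpha ^ (m + (r - i'))))"
    proof (rule pair_cross[OF J0 _ _ i'])
      fix J J' assume "J \<in> JS" "J' \<in> JS"
      thus "0 \<le> (Tr ^^ s) (t J) J'" by (intro Trn_nonneg) auto
    next
      fix m J J' assume J: "J \<in> JS" "J' \<in> JS"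
      have "(Tr ^^ m) ((Tr ^^ s) (t J)) J' = (Tr ^^ (m + s)) (t J) J'" by (simp add: funpow_add)
      also have "\<dots> \<le> lam ^ (m + s) * (lam / real N + (lam * (4 * real k / real n)) * alpha ^ (m + s))"
        using J by (rule t_decay)
      also have "\<dots> \<le> lam ^ (m + s) * (lam / real N + (lam * (4 * real k / real n)) * alpha ^ m)"
        using lam al by (intro mult_left_mono add_left_mono power_decreasing) auto
      also have "\<dots> = lam ^ m * (?B + ?E * alpha ^ m)" by (simp add: power_add algebra_simps)
      finally show "(Tr ^^ m) ((Tr ^^ s) (t J)) J' \<le> lam ^ m * (?B + ?E * alpha ^ m)" .
    qed
    also have "\<dots> \<le> 2 * real q * lam ^ r * (?B * lam ^ i' / e + ?E * alpha ^ (r - i') / (1 - alpha))"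
      by (rule cross_bound[OF reg i']) (use lam in auto)
    finally show "bexp p KS (\<lambda>H. \<Sum>J\<in>?R i' H. \<Sum>J'\<in>?R r H. (Tr ^^ s) (t J) J') \<le> 2 * real q * lam ^ r * (?B * lam ^ i' / e + ?E * alpha ^ (r - i') / (1 - alpha))" .
  qed
  also have "\<dots> = 2 * real q * lam ^ r * (?B / e * (\<Sum>i'<r. lam ^ i') + ?E / (1 - alpha) * (\<Sum>i'<r. alpha ^ (r - i')))"
    by (rule sum_lin_comb)
  also have "\<dots> \<le> 2 * real q * lam ^ r * (?B / e * (lam ^ r / e) + ?E / (1 - alpha) * (1 / (1 - alpha)))"
  proof (intro mult_left_mono add_mono sum_lam)
    have "(\<Sum>i'<r. alpha ^ (r - i')) \<le> (\<Sum>i'\<le>r. alpha ^ (r - i'))" using al by (intro sum_mono2) auto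
    also have "\<dots> \<le> 1 / (1 - alpha)" by (rule sum_alpha)
    finally show "(\<Sum>i'<r. alpha ^ (r - i')) \<le> 1 / (1 - alpha)" .
  qed (use lam e0 al in auto)
  also have "\<dots> = lam * (2 * real q * lam ^ (r + s) * (lam ^ r / (real N * e ^ 2) + 4 * real k / (real n * (1 - alpha) ^ 2)))"
    using e0 al by (simp add: power2_eq_square power_add algebra_simps)
  also have "\<dots> \<le> 2 * (2 * real q * lam ^ (r + s) * (lam ^ r / (real N * e ^ 2) + 4 * real k / (real n * (1 - alpha) ^ 2)))"
    using lam by (intro mult_right_mono) auto
  finally show ?thesis by simp
qed

end

section \<open>Survival probabilities\<close>

text \<open>Sharp rational upper bound for the probability that at least one of m trials succeeds; it makes
  the survival recursion linear in the reciprocal.\<close>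

lemma power_compl_upper:
  fixes t :: real
  assumes "0 \<le> t" "t \<le> 1"
  shows "1 - (real m + 1) * t / 2 \<le> (1 - t) ^ m * (1 + (real m - 1) * t / 2)"
proof (induction m)
  case (Suc m)
  let ?A = "1 + (real m - 1) * t / 2"
  have A: "0 < ?A"
  proof (cases m)
    case 0
    thus ?thesis using assms by simp
  next
    case (Suc m')
    thus ?thesis using assms by (auto intro!: add_pos_nonneg)
  qed
  have B: "0 \<le> 1 + real m * t / 2" using assms by simp
  have "(1 - (real m + 2) * t / 2) * ?A \<le> (1 - t) * (1 + real m * t / 2) * (1 - (real m + 1) * t / 2)"
  proof -
    have "(1 - t) * (1 + real m * t / 2) * (1 - (real m + 1) * t / 2) - (1 - (real m + 2) * t / 2) * ?A 
      = real m / 2 * (real m / 2 + 1 / 2) * t ^ 3"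
      by (simp add: field_simps power3_eq_cube)
    moreover have "0 \<le> real m / 2 * (real m / 2 + 1 / 2) * t ^ 3" using assms by (intro mult_nonneg_nonneg) auto
    ultimately show ?thesis by linarith
  qed
  also have "\<dots> \<le> (1 - t) * (1 + real m * t / 2) * ((1 - t) ^ m * ?A)"
    using Suc.IH assms B by (intro mult_left_mono) auto
  also have "\<dots> = ((1 - t) ^ Suc m * (1 + real m * t / 2)) * ?A" by simp
  finally have "1 - (real m + 2) * t / 2 \<le> (1 - t) ^ Suc m * (1 + real m * t / 2)"
    using A by (simp only: mult_le_cancel_right)
  thus ?case by (simp add: algebra_simps)
qed simp

lemma compl_power_le:
  fixes t :: real
  assumes "0 \<le> t" "t \<le> 1" "1 \<le> m"
  shows "(1 - (1 - t) ^ m) * (1 + (real m - 1) * t / 2) \<le> real m * t"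
  using power_compl_upper[OF assms(1,2), of m] by (simp add: algebra_simps diff_divide_distrib add_divide_distrib)

text \<open>Second Bonferroni inequality in polynomial form.\<close>

lemma compl_power_ge:
  fixes t :: real
  assumes "0 \<le> t" "t \<le> 1"
  shows "real m * t - real m * (real m - 1) / 2 * t ^ 2 \<le> 1 - (1 - t) ^ m"
proof (induction m)
  case (Suc m)
  have "(1 - t) ^ Suc m \<le> (1 - t) * (1 - real m * t + real m * (real m - 1) / 2 * t ^ 2)"
    using Suc assms by (simp add: mult_left_mono)
  also have "\<dots> = 1 - real (Suc m) * t + real (Suc m) * (real (Suc m) - 1) / 2 * t ^ 2 - real m * (real m - 1) / 2 * t ^ 3"
    by (simp add: field_simps power2_eq_square power3_eq_cube)
  also have "\<dots> \<le> 1 - real (Suc m) * t + real (Suc m) * (real (Suc m) - 1) / 2 * t ^ 2"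
    using assms by (cases m) auto
  finally show ?case by simp
qed simp

context hyp begin

text \<open>Probability that an individual has a marked child when children are marked independently
  with probability \<open>x\<close>; iterating it gives survival probabilities.\<close>

definition F :: "real \<Rightarrow> real" where "F x = 1 - gen (1 - x)"

text \<open>Chosen so that \<open>F x\<close> equals \<open>lam * x * (1 - ca * x)\<close> up to
  third order.\<close>

definition ca :: real where "ca = (real q - 1 + lam - p * real q) / 2"

lemma F_bounds: "0 \<le> x \<Longrightarrow> x \<le> 1 \<Longrightarrow> 0 \<le> F x \<and> F x \<le> 1"
  using gen_bounds[of "1 - x"] by (simp add: F_def)

lemma F_mono:
  assumes "0 \<le> x" "x \<le> y" "y \<le> 1" shows "F x \<le> F y"
  unfolding F_def gen_def using assms p0 p1 base_bounds[of "1 - y"]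
  by (auto intro!: power_mono mult_left_mono)

lemma F_eq: "F x = 1 - (1 - p * (1 - (1 - x) ^ q)) ^ M"
  by (simp add: F_def gen_def algebra_simps)

text \<open>\<open>F\<close> is a composition of two maps of the form
  \<open>1 - (1 - t) ^ m\<close>. Their Moebius bounds compose to a Moebius bound, and the
  coefficients \<open>(q - 1) / 2\<close> and \<open>(M - 1) * p * q / 2\<close> add up to
  \<open>ca\<close>.\<close>

lemma F_upper:
  assumes "0 \<le> x" "x \<le> 1"
  shows "F x * (1 + ca * x) \<le> lam * x"
proof -
  let ?y = "1 - (1 - x) ^ q"
  let ?u = "1 + (real q - 1) * x / 2"
  let ?w = "1 + (real M - 1) * (p * ?y) / 2"
  have q1: "0 \<le> real q - 1" and M1: "0 \<le> real M - 1" using q_pos M_pos by auto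
  have y: "0 \<le> ?y" "?y \<le> 1" using assms by (auto simp: power_le_one)
  have py: "0 \<le> p * ?y" "p * ?y \<le> 1" using y p0 p1 by (auto intro: mult_le_one)
  have u: "0 < ?u" using assms q1 by (intro add_pos_nonneg) auto
  have 1: "?y * ?u \<le> real q * x" using compl_power_le[OF assms q_pos] .
  have 2: "F x * ?w \<le> real M * (p * ?y)" unfolding F_eq using compl_power_le[OF py M_pos] .
  have Fb: "0 \<le> F x" using F_bounds[OF assms] by simp
  show ?thesis
  proof (cases "?y = 0")
    case True
    hence "F x = 0" by (simp add: F_eq)
    thus ?thesis using assms lam_nonneg by simp
  next
    case False
    have ypos: "0 < ?y" using y False by simp
    have "F x * (1 + ca * x) * ?y = F x * (?y * ?u + (real M - 1) * p * ?y * (real q * x) / 2)"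
      unfolding ca_def lam_def by (simp add: field_simps)
    also have "\<dots> = F x * (?y * ?u) + F x * ?w * (real q * x) - F x * (real q * x)"
      by (simp add: field_simps)
    also have "\<dots> \<le> F x * (real q * x) + (real M * (p * ?y)) * (real q * x) - F x * (real q * x)"
      using 1 2 Fb assms by (intro diff_mono add_mono mult_left_mono mult_right_mono) auto
    also have "\<dots> = lam * x * ?y" by (simp add: lam_def)
    finally show ?thesis using ypos by (simp only: mult_le_cancel_right)
  qed
qed

lemma F_lower:
  assumes "0 \<le> x" "x \<le> 1"
  shows "lam * x * (1 - (real q - 1 + lam) / 2 * x) \<le> F x"
proof -
  define y where "y = 1 - (1 - x) ^ q"
  have y: "0 \<le> y" "y \<le> 1" using assms by (auto simp: y_def power_le_one)
  have py: "0 \<le> p * y" "p * y \<le> 1" using y p0 p1 by (auto intro: mult_le_one mult_nonneg_nonneg)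
  have y1: "real q * x - real q * (real q - 1) / 2 * x ^ 2 \<le> y" unfolding y_def using compl_power_ge[OF assms] .
  have y2: "y \<le> real q * x" using one_minus_power_le[of "1 - x" q] assms by (simp add: y_def)
  have "lam * x * (1 - (real q - 1 + lam) / 2 * x) = 
     real M * (p * (real q * x - real q * (real q - 1) / 2 * x ^ 2)) - real M * real M / 2 * (p * (real q * x)) ^ 2"
    by (simp add: lam_def field_simps power2_eq_square)
  also have "\<dots> \<le> real M * (p * y) - real M * real M / 2 * (p * y) ^ 2"
  proof -
    have "(p * y) ^ 2 \<le> (p * (real q * x)) ^ 2" by (rule power_mono[OF mult_left_mono[OF y2 p0] py(1)])
    hence "real M * real M / 2 * (p * y) ^ 2 \<le> real M * real M / 2 * (p * (real q * x)) ^ 2" by (rule mult_left_mono) simp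
    moreover have "real M * (p * (real q * x - real q * (real q - 1) / 2 * x ^ 2)) \<le> real M * (p * y)"
      using y1 p0 by (intro mult_left_mono) auto
    ultimately show ?thesis by linarith
  qed
  also have "\<dots> \<le> real M * (p * y) - real M * (real M - 1) / 2 * (p * y) ^ 2"
    by (intro diff_left_mono mult_right_mono divide_right_mono mult_left_mono) auto
  also have "\<dots> \<le> F x" using compl_power_ge[OF py] by (simp add: F_eq y_def)
  finally show ?thesis .
qed

text \<open>\<open>xs 1 0 i\<close> is the probability of survival to generation \<open>i\<close>.
  In general it is the probability that some individual is marked, if members of generation
  \<open>i\<close> are marked with probability \<open>1 - z\<close> and all earlier ones with
  probability \<open>1 - v\<close>.\<close>

definition xs :: "real \<Rightarrow> real \<Rightarrow> nat \<Rightarrow> real" where "xs v z i = 1 - zs v z i"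

lemma xs_0 [simp]: "xs v z 0 = 1 - z" by (simp add: xs_def)

lemma xs_Suc: "xs v z (Suc i) = F (xs v z i) + (1 - v) * (1 - F (xs v z i))"
  by (simp add: xs_def F_def algebra_simps)

lemma xs_bounds: "0 \<le> z \<Longrightarrow> z \<le> 1 \<Longrightarrow> 0 \<le> v \<Longrightarrow> v \<le> 1 \<Longrightarrow> 0 \<le> xs v z i \<and> xs v z i \<le> 1"
  using zs_bounds[of z v i] by (simp add: xs_def)

text \<open>In reciprocals \<open>F_upper\<close> reads
  \<open>1 / F x \<ge> (1 / x + ca) / lam\<close>, which a geometric sum solves. Products are used
  because \<open>xs\<close> may vanish, and the bound is uniform in \<open>z\<close>.\<close>

lemma xs_upper:
  assumes "1 < lam" "0 < ca" "0 \<le> z" "z \<le> 1"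
  shows "xs 1 z i * ca * (lam ^ i - 1) \<le> e * lam ^ i"
proof (induction i)
  case 0
  thus ?case using assms by (simp add: e_def)
next
  case (Suc i)
  let ?x = "xs 1 z i" and ?L = "lam ^ i"
  have x: "0 \<le> ?x" "?x \<le> 1" using xs_bounds assms by auto
  have L: "1 \<le> ?L" using assms by simp
  have eL: "lam * ?L = ?L + e * ?L" by (simp add: e_def algebra_simps)
  have pos: "0 < 1 + ca * ?x" using assms x by (intro add_pos_nonneg) auto
  have "F ?x * ca * (lam * ?L - 1) * (1 + ca * ?x) = (F ?x * (1 + ca * ?x)) * (ca * (lam * ?L - 1))" by simp
  also have "\<dots> \<le> (lam * ?x) * (ca * (lam * ?L - 1))"
    using F_upper[OF x] assms L mult_mono[of 1 lam 1 ?L] by (intro mult_right_mono) auto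
  also have "\<dots> = lam * (?x * ca * (?L - 1) + ?x * ca * e * ?L)" by (simp add: eL algebra_simps)
  also have "\<dots> \<le> lam * (e * ?L + ?x * ca * e * ?L)" using Suc.IH assms by (intro mult_left_mono add_right_mono) auto
  also have "\<dots> = e * (lam * ?L) * (1 + ca * ?x)" by (simp add: algebra_simps)
  finally have "F ?x * ca * (lam * ?L - 1) \<le> e * (lam * ?L)" using pos by (simp only: mult_le_cancel_right)
  thus ?case by (simp add: xs_Suc)
qed

text \<open>\<open>e / ca\<close> is the positive fixed point of the increasing majorant
  \<open>lam * x / (1 + ca * x)\<close>.\<close>

lemma xs_le_fix:
  assumes "1 < lam" "0 < ca" "0 \<le> z" "z \<le> 1" "1 - z \<le> e / ca"
  shows "xs 1 z i \<le> e / ca"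
proof (induction i)
  case (Suc i)
  let ?x = "xs 1 z i"
  have x: "0 \<le> ?x" "?x \<le> 1" using xs_bounds assms by auto
  have pos: "0 < 1 + ca * ?x" using assms x by (intro add_pos_nonneg) auto
  have "F ?x * (1 + ca * ?x) \<le> ?x * 1 + e * ?x" using F_upper[OF x] by (simp add: e_def algebra_simps)
  also have "\<dots> \<le> e / ca * 1 + e * ?x" using Suc by (intro add_right_mono mult_right_mono) auto
  also have "\<dots> = e / ca * (1 + ca * ?x)" using assms by (simp add: field_simps)
  finally have "F ?x \<le> e / ca" using pos by (simp only: mult_le_cancel_right)
  thus ?case by (simp add: xs_Suc)
qed (use assms in simp)

text \<open>In the supercritical regime the survival recursion is dominated by its Moebius approximation,
  whose solution is explicit.\<close>

lemma xs_lower: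
  assumes lam: "1 < lam" and ca: "0 < ca" and z: "0 \<le> z" "z < 1" "1 - z \<le> e / ca"
    and A: "0 < A" "(real q - 1 + lam) / 2 + A * ((real q - 1 + lam) / 2) * (e / ca) \<le> A"
  shows "1 \<le> xs 1 z r * (A / e + 1 / (lam ^ r * (1 - z)))" and "0 < xs 1 z r"
proof -
  define b where "b = (real q - 1 + lam) / 2"
  note A2 = A(2)[folded b_def] and F_low = F_lower[folded b_def]
  have e0: "0 < e" using lam by (simp add: e_def)
  have b0: "0 \<le> b" using q_pos lam by (simp add: b_def)
  have "1 \<le> xs 1 z r * (A / e + 1 / (lam ^ r * (1 - z))) \<and> 0 < xs 1 z r"
  proof (induction r)
    case 0
    have "(1 - z) * (A / e + 1 / (1 - z)) = (1 - z) * (A / e) + 1" using z by (simp add: field_simps)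
    moreover have "0 \<le> (1 - z) * (A / e)" using z A e0 by simp
    ultimately show ?case using z by simp
  next
    case (Suc r)
    let ?x = "xs 1 z r" and ?c = "1 / (lam ^ r * (1 - z))"
    have x: "0 \<le> ?x" "?x \<le> 1" using xs_bounds z by auto
    have xe: "?x \<le> e / ca" using xs_le_fix[OF lam ca _ _ z(3)] z by auto
    have pos: "0 < 1 + A * ?x" using A x by (intro add_pos_nonneg) auto
    \<comment> \<open>For \<open>A\<close> slightly above \<open>b\<close>, the quadratic lower
      bound of \<open>F\<close> lies above the Moebius map \<open>lam * x / (1 + A * x)\<close> on
      the whole range up to \<open>e / ca\<close>.\<close>
    have "1 \<le> (1 - b * ?x) * (1 + A * ?x)"
    proof -
      have "b + A * b * ?x \<le> b + A * b * (e / ca)" using xe A b0 by (intro add_left_mono mult_left_mono) auto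
      hence "b + A * b * ?x \<le> A" using A2 by linarith
      hence "0 \<le> A - b - A * b * ?x" by linarith
      hence "0 \<le> ?x * (A - b - A * b * ?x)" using x by (intro mult_nonneg_nonneg)
      also have "\<dots> = (1 - b * ?x) * (1 + A * ?x) - 1" by (simp add: algebra_simps)
      finally show ?thesis by simp
    qed
    hence "lam * ?x * 1 \<le> lam * ?x * ((1 - b * ?x) * (1 + A * ?x))" using lam x by (intro mult_left_mono) auto
    also have "\<dots> = lam * ?x * (1 - b * ?x) * (1 + A * ?x)" by simp
    also have "\<dots> \<le> F ?x * (1 + A * ?x)" using F_low[OF x] pos by (intro mult_right_mono) auto
    finally have 1: "lam * ?x \<le> F ?x * (1 + A * ?x)" by simp
    have Fpos: "0 < F ?x"
    proof -
      have "0 < lam * ?x" using Suc lam by simp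
      hence "0 < F ?x * (1 + A * ?x)" using 1 by linarith
      thus ?thesis using pos by (simp add: zero_less_mult_iff)
    qed
    have "1 + A * ?x \<le> ?x * (A / e + ?c) + A * ?x" using Suc by simp
    also have "\<dots> = lam * ?x * (A / e + ?c / lam)"
    proof -
      have "x * (A / e + c) + A * x = lam * x * (A / e + c / lam)" for x c
      proof -
        have "lam * x * (A / e + c / lam) = x * (lam * A / e) + x * c" using lam by (simp add: algebra_simps)
        also have "lam * A / e = A / e + A" using e0 by (simp add: e_def field_simps)
        finally show ?thesis by (simp add: algebra_simps)
      qed
      thus ?thesis .
    qed
    also have "\<dots> \<le> F ?x * (1 + A * ?x) * (A / e + ?c / lam)"
      using 1 A e0 lam z by (intro mult_right_mono add_nonneg_nonneg) auto
    finally have "1 * (1 + A * ?x) \<le> F ?x * (A / e + ?c / lam) * (1 + A * ?x)" by (simp only: mult_1_left mult_ac)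
    hence "1 \<le> F ?x * (A / e + ?c / lam)" using pos by (simp only: mult_le_cancel_right)
    thus ?case using Fpos by (simp add: xs_Suc mult_ac)
  qed
  thus "1 \<le> xs 1 z r * (A / e + 1 / (lam ^ r * (1 - z)))" "0 < xs 1 z r" by auto
qed

text \<open>After \<open>i0\<close> steps the source \<open>1 - v\<close> is dropped and the
  iteration restarts from a value already reached.\<close>

lemma xs_mono:
  assumes "0 \<le> z" "z \<le> 1" "0 \<le> v" "v \<le> 1" "0 \<le> z'" "z' \<le> 1" "1 - z' \<le> xs v z i0"
  shows "xs 1 z' i \<le> xs v z (i0 + i)"
proof (induction i)
  case (Suc i)
  have x: "0 \<le> xs 1 z' i" "xs v z (i0 + i) \<le> 1" "0 \<le> xs v z (i0 + i)"
    using xs_bounds assms by auto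
  have "F (xs 1 z' i) \<le> F (xs v z (i0 + i))" using F_mono[OF x(1) Suc x(2)] .
  also have "\<dots> \<le> xs v z (Suc (i0 + i))"
    using F_bounds[of "xs v z (i0 + i)"] x assms by (simp add: xs_Suc)
  finally show ?case by (simp add: xs_Suc)
qed (use assms in simp)

text \<open>Below \<open>kap\<close> one has \<open>F x \<ge> x\<close>, so nothing is lost and the
  source accumulates linearly; half of it is kept because it acts on the unmarked part, which is at
  least one half there.\<close>

lemma xs_source:
  assumes lam: "1 < lam" and v: "0 \<le> v" "v \<le> 1" and kap: "0 \<le> kap" "kap \<le> 1 / 2" "lam * (real q - 1 + lam) / 2 * kap \<le> e"
  shows "min (real i * (1 - v) / 2) kap \<le> xs v 1 i"
proof (induction i)
  case (Suc i)
  let ?m = "min (real i * (1 - v) / 2) kap" and ?x = "xs v 1 i"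
  have m: "0 \<le> ?m" "?m \<le> 1 / 2" "?m \<le> kap" using kap v by auto
  have x: "?x \<le> 1" using xs_bounds v by auto
  have "?m \<le> lam * ?m * (1 - (real q - 1 + lam) / 2 * ?m)"
  proof -
    have "lam * (real q - 1 + lam) / 2 * ?m \<le> lam * (real q - 1 + lam) / 2 * kap"
      using m lam q_pos by (intro mult_left_mono) auto
    hence "0 \<le> ?m * (e - lam * (real q - 1 + lam) / 2 * ?m)" using m kap by (intro mult_nonneg_nonneg) linarith+
    thus ?thesis by (simp add: e_def field_simps)
  qed
  also have "\<dots> \<le> F ?m" using m by (intro F_lower) auto
  also have "\<dots> \<le> F ?x" using Suc m x by (intro F_mono) auto
  finally have 1: "?m \<le> F ?x" .
  have "?m + (1 - v) / 2 \<le> ?m + (1 - v) * (1 - ?m)" using v m mult_left_mono[of "1/2" "1 - ?m" "1 - v"] by simp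
  also have "\<dots> = v * ?m + (1 - v)" by (simp add: algebra_simps)
  also have "\<dots> \<le> v * F ?x + (1 - v)" using 1 v by (intro add_right_mono mult_left_mono) auto
  also have "\<dots> = xs v 1 (Suc i)" by (simp add: xs_Suc algebra_simps)
  finally have "?m + (1 - v) / 2 \<le> xs v 1 (Suc i)" .
  moreover have "min (real (Suc i) * (1 - v) / 2) kap \<le> ?m + (1 - v) / 2"
    using v by (simp add: min_def field_simps)
  ultimately show ?case by linarith
qed (use kap in simp)

text \<open>First-moment bound for the marking probability; it supplies the weights
  \<open>sg\<close> that \<open>lower_bound\<close> asks for.\<close>

lemma xs_sg:
  assumes lam: "1 < lam" and z: "0 \<le> z" "z \<le> 1" and v: "0 \<le> v" "v \<le> 1"
  shows "1 - zs v z m \<le> ((1 - z) + (1 - v) / e) * lam ^ m"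
proof -
  have e0: "0 < e" using lam by (simp add: e_def)
  have "1 - zs v z m \<le> (1 - z) * lam ^ m + (1 - v) * (lam ^ m - 1) / e"
  proof (induction m)
    case (Suc m)
    have zb: "0 \<le> zs v z m" "zs v z m \<le> 1" using zs_bounds z v by auto
    have "1 - zs v z (Suc m) = (1 - v) + v * (1 - gen (zs v z m))" by (simp add: algebra_simps)
    also have "\<dots> \<le> (1 - v) + 1 * (1 - gen (zs v z m))" using v gen_bounds[OF zb] by (intro add_left_mono mult_right_mono) auto
    also have "\<dots> \<le> (1 - v) + lam * (1 - zs v z m)" using gen_ge[OF zb] by simp
    also have "\<dots> \<le> (1 - v) + lam * ((1 - z) * lam ^ m + (1 - v) * (lam ^ m - 1) / e)"
      using Suc lam by (intro add_left_mono mult_left_mono) auto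
    also have "\<dots> = (1 - z) * lam ^ Suc m + (1 - v) * (lam ^ Suc m - 1) / e"
      using e0 by (simp add: field_simps e_def)
    finally show ?case .
  qed simp
  also have "\<dots> \<le> (1 - z) * lam ^ m + (1 - v) * lam ^ m / e"
    using v e0 by (intro add_left_mono divide_right_mono mult_left_mono) auto
  also have "\<dots> = ((1 - z) + (1 - v) / e) * lam ^ m" by (simp add: algebra_simps)
  finally show ?thesis .
qed

end

section \<open>Components\<close>

lemma jconnected_sym:
  assumes "jconnected H j J J'" shows "jconnected H j J' J"
proof (cases "J = J'")
  case False
  then obtain es where es: "es \<noteq> []" "set es \<subseteq> H" "J \<subseteq> hd es" "J' \<subseteq> last es"
    "\<And>i. Suc i < length es \<Longrightarrow> j \<le> card (es ! i \<inter> es ! Suc i)"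
    using assms by (auto simp: jconnected_def)
  have "j \<le> card (rev es ! i \<inter> rev es ! Suc i)" if "Suc i < length (rev es)" for i
  proof -
    have "rev es ! i = es ! Suc (length es - Suc (Suc i))" "rev es ! Suc i = es ! (length es - Suc (Suc i))"
      using that by (auto simp: rev_nth Suc_diff_Suc)
    thus ?thesis using es(5)[of "length es - Suc (Suc i)"] that by (simp add: Int_commute)
  qed
  thus ?thesis using es unfolding jconnected_def
    by (intro disjI2 exI[of _ "rev es"]) (auto simp: hd_rev last_rev)
qed (simp add: jconnected_def)

text \<open>The walks may be concatenated because \<open>J'\<close> lies in the last hyperedge of
  the first and in the first hyperedge of the second.\<close>

lemma jconnected_trans:
  assumes "H \<subseteq> ksets n k" "J' \<in> ksets n j" "jconnected H j J J'" "jconnected H j J' J''"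
  shows "jconnected H j J J''"
proof -
  have fin: "finite E" if "E \<in> H" for E using that assms(1) ksets_finite_elem by blast
  consider "J = J'" | "J' = J''" | "J \<noteq> J'" "J' \<noteq> J''" by blast
  thus ?thesis
  proof cases
    case 3
    obtain es where es: "es \<noteq> []" "set es \<subseteq> H" "J \<subseteq> hd es" "J' \<subseteq> last es"
      "\<And>i. Suc i < length es \<Longrightarrow> j \<le> card (es ! i \<inter> es ! Suc i)"
      using assms(3) 3 by (auto simp: jconnected_def)
    obtain fs where fs: "fs \<noteq> []" "set fs \<subseteq> H" "J' \<subseteq> hd fs" "J'' \<subseteq> last fs"
      "\<And>i. Suc i < length fs \<Longrightarrow> j \<le> card (fs ! i \<inter> fs ! Suc i)"
      using assms(4) 3 by (auto simp: jconnected_def)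
    have mid: "j \<le> card (last es \<inter> hd fs)"
    proof -
      have "last es \<in> H" using es(1,2) last_in_set by blast
      hence "finite (last es)" by (rule fin)
      hence "card J' \<le> card (last es \<inter> hd fs)" using es fs by (intro card_mono) auto
      thus ?thesis using assms(2) by (simp add: ksets_def)
    qed
    have "j \<le> card ((es @ fs) ! i \<inter> (es @ fs) ! Suc i)" if i: "Suc i < length (es @ fs)" for i
    proof -
      consider "Suc i < length es" | "Suc i = length es" | "length es \<le> i" by linarith
      thus ?thesis
      proof cases
        case 1
        thus ?thesis using es(5)[of i] by (simp add: nth_append)
      next
        case 2
        hence "(es @ fs) ! i = last es" "(es @ fs) ! Suc i = hd fs"
          using es(1) fs(1) last_conv_nth[OF es(1)] by (auto simp: nth_append hd_conv_nth simp flip: 2)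
        thus ?thesis using mid by simp
      next
        case 3
        thus ?thesis using fs(5)[of "i - length es"] i by (simp add: nth_append Suc_diff_le)
      qed
    qed
    thus ?thesis unfolding jconnected_def using es fs
      by (intro disjI2 exI[of _ "es @ fs"]) auto
  qed (use assms in auto)
qed

lemma jconnected_edge:
  assumes "K \<in> H" "J \<subseteq> K" "J' \<subseteq> K" shows "jconnected H j J J'"
  unfolding jconnected_def using assms by (intro disjI2 exI[of _ "[K]"]) auto

text \<open>Induction along the walk: consecutive hyperedges share a whole j-set, so once the j-sets
  of one lie in \<open>C\<close>, the next hyperedge contains a member of \<open>C\<close>.\<close>

lemma closed_jconnected:
  assumes "H \<subseteq> ksets n k" "\<And>K J. K \<in> H \<Longrightarrow> J \<in> C \<Longrightarrow> J \<subseteq> K \<Longrightarrow> jsub j K \<subseteq> C"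
    "J \<in> C" "J' \<in> ksets n j" "jconnected H j J J'"
  shows "J' \<in> C"
proof (cases "J = J'")
  case False
  obtain es where es: "es \<noteq> []" "set es \<subseteq> H" "J \<subseteq> hd es" "J' \<subseteq> last es"
    "\<And>i. Suc i < length es \<Longrightarrow> j \<le> card (es ! i \<inter> es ! Suc i)"
    using assms(5) False by (auto simp: jconnected_def)
  have "jsub j (es ! i) \<subseteq> C" if "i < length es" for i
    using that
  proof (induction i)
    case 0
    hence "es ! 0 \<in> H" using es(2) nth_mem by blast
    thus ?case using assms(2)[of "es ! 0" J] es(1,3) assms(3) by (simp add: hd_conv_nth)
  next
    case (Suc i)
    obtain L where L: "L \<subseteq> es ! i \<inter> es ! Suc i" "card L = j"
      using es(5)[OF Suc.prems] obtain_subset_with_card_n by metis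
    hence "L \<in> jsub j (es ! i)" by (simp add: jsub_def)
    hence "L \<in> C" using Suc by auto
    moreover have "es ! Suc i \<in> H" using es(2) Suc.prems nth_mem by blast
    ultimately show ?case using assms(2)[of "es ! Suc i" L] L by auto
  qed
  hence "jsub j (last es) \<subseteq> C" using es(1) by (simp add: last_conv_nth)
  thus ?thesis using es(4) assms(4) by (auto simp: jsub_def ksets_def)
qed (use assms in simp)

context hyp begin

definition comp :: "nat set set \<Rightarrow> nat set \<Rightarrow> nat set set" where
  "comp H J = {J' \<in> JS. jconnected H j J J'}"

lemma run_connected:
  assumes "H \<subseteq> KS" "J \<in> JS" "J' \<in> fst (run H i (init J)) \<union> snd (run H i (init J))"
  shows "jconnected H j J J'"
  using assms(3)
proof (induction i arbitrary: J')
  case 0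
  thus ?case by (simp add: jconnected_def)
next
  case (Suc i)
  obtain D G where s: "run H i (init J) = (D, G)" by (cases "run H i (init J)")
  have sub: "D \<subseteq> JS" "G \<subseteq> JS" using run_sub[of "init J" H i] assms(2) s by auto
  have "run H (Suc i) (init J) = run H (Suc 0) (run H i (init J))" using run_add[of H i "Suc 0"] by simp
  hence "run H (Suc i) (init J) = (D \<union> G, nw j (H \<inter> KK D G) G)" by (simp add: s)
  hence "J' \<in> D \<union> G \<or> J' \<in> nw j (H \<inter> KK D G) G" using Suc.prems by auto
  thus ?case
  proof
    assume "J' \<in> nw j (H \<inter> KK D G) G"
    then obtain K L where K: "K \<in> H" "J' \<subseteq> K" "L \<in> G" "L \<subseteq> K"
      by (auto simp: nw_def KK_def jsub_def)
    have "jconnected H j J L" using Suc.IH[of L] K by (simp add: s)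
    thus ?thesis using jconnected_trans[OF assms(1), of L j J J'] jconnected_edge[OF K(1), of L J'] K sub by blast
  qed (use Suc.IH s in auto)
qed

text \<open>A hyperedge that was unqueried at the start is queried when its first j-set is
  processed; then all its j-sets are dead or in the new frontier.\<close>

lemma run_closed:
  assumes "K \<in> H" "K \<in> free (fst s)" "J \<in> fst (run H i s) - fst s" "J \<subseteq> K"
  shows "jsub j K \<subseteq> fst (run H i s) \<union> snd (run H i s)"
  using assms(3,4)
proof (induction i arbitrary: J)
  case (Suc i)
  obtain D G where s: "run H i s = (D, G)" by (cases "run H i s")
  have "run H (Suc i) s = run H (Suc 0) (run H i s)" using run_add[of H i "Suc 0"] by simp
  hence r: "run H (Suc i) s = (D \<union> G, nw j (H \<inter> KK D G) G)" by (simp add: s)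
  show ?case
  proof (cases "\<exists>L\<in>D - fst s. L \<subseteq> K")
    case True
    thus ?thesis using Suc.IH r s by auto
  next
    case False
    have "J \<in> G" using Suc.prems False by (auto simp: r)
    moreover have "K \<in> free D" using False assms(2) by (auto simp: free_def)
    ultimately have "K \<in> KK D G" using Suc.prems by (auto simp: KK_def)
    thus ?thesis using assms(1) by (auto simp: r nw_def)
  qed
qed simp

lemma run_start:
  assumes "J \<in> snd s" "0 < i" shows "J \<in> fst (run H i s)"
proof -
  obtain i' where i: "i = Suc i'" using assms by (cases i) auto
  obtain D G where s: "s = (D, G)" by (cases s)
  show ?thesis using run_fst_mono[of "(D \<union> G, nw j (H \<inter> KK D G) G)" H i'] assms by (auto simp: i s)
qed

text \<open>\<open>A\<close> and \<open>B\<close> are the dead set and the frontier of an earlier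
  exploration. Hyperedges at \<open>A\<close> stay inside \<open>A \<union> B\<close>, so a second
  exploration that dies out without meeting \<open>B\<close> has found the entire component.\<close>

lemma comp_small:
  assumes H: "H \<subseteq> KS" and r: "0 < r" and J: "J2 \<in> JS" "J2 \<notin> A" "A \<subseteq> JS"
    and c1: "\<And>K J. K \<in> H \<Longrightarrow> J \<in> A \<Longrightarrow> J \<subseteq> K \<Longrightarrow> jsub j K \<subseteq> A \<union> B"
    and "snd (run H r (A, {J2})) = {}" "fst (run H r (A, {J2})) \<inter> B = {}"
  shows "comp H J2 \<subseteq> fst (run H r (A, {J2})) - A"
proof
  let ?C = "fst (run H r (A, {J2})) - A"
  fix J' assume J': "J' \<in> comp H J2"
  show "J' \<in> ?C"
  proof (rule closed_jconnected[OF H])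
    fix K J assume K: "K \<in> H" "J \<in> ?C" "J \<subseteq> K"
    show "jsub j K \<subseteq> ?C"
    proof (cases "K \<in> free A")
      case True
      have "jsub j K \<subseteq> fst (run H r (A, {J2}))" using run_closed[of K H "(A, {J2})" J r] K True assms by auto
      thus ?thesis using True by (auto simp: free_def jsub_def)
    next
      case False
      then obtain d where "d \<in> A" "d \<subseteq> K" using K H by (auto simp: free_def)
      hence "jsub j K \<subseteq> A \<union> B" using c1 K by auto
      moreover have "J \<in> jsub j K"
      proof -
        have "J \<in> JS" using K run_sub(1)[of "(A, {J2})" H r] J by auto
        thus ?thesis using K by (simp add: mem_jsub_iff)
      qed
      ultimately show ?thesis using K assms by auto
    qed
  next
    show "J2 \<in> ?C" using run_start[of J2 "(A, {J2})" r H] r J by auto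
  qed (use J' in \<open>auto simp: comp_def\<close>)
qed

lemma As_le:
  assumes "\<And>J. J \<in> JS \<Longrightarrow> h J \<le> 1" "J \<in> JS"
  shows "As h i J \<le> (\<Sum>m\<le>i. lam ^ m)"
  using assms(2)
proof (induction i arbitrary: J)
  case (Suc i)
  have "As h (Suc i) J \<le> 1 + Tr (\<lambda>_. \<Sum>m\<le>i. lam ^ m) J"
    using Suc assms(1) by (auto intro!: add_mono Tr_mono)
  also have "\<dots> = 1 + lam * (\<Sum>m\<le>i. lam ^ m)" using Suc.prems by (simp add: Tr_const)
  also have "\<dots> = (\<Sum>m\<le>Suc i. lam ^ m)" by (simp add: sum.atMost_Suc_shift sum_distrib_left del: sum.atMost_Suc)
  finally show ?case .
qed (use assms in simp)

lemma sum_As: "(\<Sum>J\<in>JS. As h i J) = (\<Sum>m\<le>i. lam ^ m) * (\<Sum>J\<in>JS. h J)"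
proof (induction i)
  case (Suc i)
  have "(\<Sum>J\<in>JS. As h (Suc i) J) = (1 + lam * (\<Sum>m\<le>i. lam ^ m)) * (\<Sum>J\<in>JS. h J)"
    using Suc by (simp add: sum.distrib sum_Tr algebra_simps)
  also have "1 + lam * (\<Sum>m\<le>i. lam ^ m) = (\<Sum>m\<le>Suc i. lam ^ m)" by (simp add: sum.atMost_Suc_shift sum_distrib_left del: sum.atMost_Suc)
  finally show ?case .
qed simp

lemma geo_lam2: "1 < lam \<Longrightarrow> lam \<le> 2 \<Longrightarrow> (\<Sum>m\<le>i. lam ^ m) \<le> 2 * lam ^ i / e"
proof -
  assume lam: "1 < lam" "lam \<le> 2"
  have "(\<Sum>m\<le>i. lam ^ m) \<le> lam * lam ^ i / e" using geo_lam[OF lam(1), of i] by simp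
  also have "\<dots> \<le> 2 * lam ^ i / e" using lam by (intro divide_right_mono mult_right_mono) (auto simp: e_def)
  finally show ?thesis .
qed

text \<open>The generating function at \<open>z = 0\<close>, where \<open>0 ^ card G\<close> is the
  indicator of an empty frontier.\<close>

lemma surv_upper:
  assumes "pre D {J}"
  shows "Ex r (D, {J}) (\<lambda>s. of_bool (snd s \<noteq> {})) \<le> xs 1 0 r"
proof -
  have J: "J \<in> JS" "D \<subseteq> JS" using assms by (auto simp: pre_def)
  have "Ex r (D, {J}) (\<lambda>s. of_bool (snd s \<noteq> {})) \<le> Ex r (D, {J}) (\<lambda>s. 1 + (-1) * 0 ^ card (snd s))"
  proof (rule Ex_mono)
    fix D' G' assume "D' \<subseteq> JS" "G' \<subseteq> JS"
    hence "G' = {} \<longleftrightarrow> card G' = 0" using finite_JS_sub by auto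
    thus "of_bool (snd (D', G') \<noteq> {}) \<le> (1 :: real) + (-1) * 0 ^ card (snd (D', G'))"
      by (cases "card G'") auto
  qed (use J in auto)
  also have "\<dots> = 1 - Ex r (D, {J}) (\<lambda>s. 0 ^ card (snd s))"
    unfolding Ex_add Ex_cmult by simp
  also have "\<dots> \<le> xs 1 0 r"
    using upper_potential[OF assms, of 0 r] by (simp add: xs_def)
  finally show ?thesis .
qed

lemma new_count:
  assumes "pre D {J}" "1 < lam" "lam \<le> 2"
  shows "Ex r (D, {J}) (\<lambda>s. real (card ((fst s \<union> snd s) - D))) \<le> 2 * lam ^ r / e"
proof -
  have J: "J \<in> JS" "D \<subseteq> JS" "J \<notin> D" using assms by (auto simp: pre_def)
  let ?h = "\<lambda>J. of_bool (J \<notin> D) :: real"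
  have "Ex r (D, {J}) (\<lambda>s. real (card ((fst s \<union> snd s) - D))) \<le> Ex r (D, {J}) (\<lambda>s. \<Sum>J\<in>fst s \<union> snd s. ?h J)"
  proof (rule Ex_mono)
    fix D' G' assume "D' \<subseteq> JS" "G' \<subseteq> JS"
    hence "finite (D' \<union> G')" using finite_JS_sub by auto
    thus "real (card ((fst (D', G') \<union> snd (D', G')) - D)) \<le> (\<Sum>J\<in>fst (D', G') \<union> snd (D', G'). ?h J)"
      by (simp add: sum_of_bool_eq Diff_eq Collect_neg_eq)
  qed (use J in auto)
  also have "\<dots> \<le> (\<Sum>J\<in>D. ?h J) + (\<Sum>J\<in>{J}. As ?h r J)"
    by (rule linear_potential_all[OF assms(1)]) auto
  also have "\<dots> = As ?h r J" by simp
  also have "\<dots> \<le> (\<Sum>m\<le>r. lam ^ m)" using J by (intro As_le) auto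
  also have "\<dots> \<le> 2 * lam ^ r / e" using geo_lam2 assms by auto
  finally show ?thesis .
qed

lemma dead_count:
  assumes "J \<in> JS" "1 < lam" "lam \<le> 2"
  shows "Ex r (init J) (\<lambda>s. real (card (fst s))) \<le> 2 * lam ^ r / e"
proof -
  have "Ex r (init J) (\<lambda>s. real (card (fst s))) \<le> Ex r (init J) (\<lambda>s. real (card ((fst s \<union> snd s) - {})))"
    by (rule Ex_mono) (use assms finite_JS_sub in \<open>auto intro!: card_mono\<close>)
  also have "\<dots> \<le> 2 * lam ^ r / e" unfolding init_def by (rule new_count) (use assms in \<open>auto simp: pre_def\<close>)
  finally show ?thesis .
qed

lemma front_count:
  assumes "J \<in> JS"
  shows "Ex r (init J) (\<lambda>s. real (card (snd s))) \<le> lam ^ r"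
  using linear_potential[of "{}" "{J}" "\<lambda>_. 1" r] assms by (simp add: init_def pre_def Trn_const)

text \<open>The trace that a large component leaves at a finite level: the exploration is still
  running or has already found \<open>L\<close> j-sets outside \<open>D\<close>.\<close>

definition alive :: "real \<Rightarrow> nat set set \<Rightarrow> nat set set \<times> nat set set \<Rightarrow> bool" where
  "alive L D s \<longleftrightarrow> snd s \<noteq> {} \<or> L \<le> real (card (fst s - D))"

lemma alive_upper:
  assumes "pre D {J}" "1 < lam" "lam \<le> 2" "0 < L"
  shows "Ex r (D, {J}) (\<lambda>s. of_bool (alive L D s)) \<le> xs 1 0 r + 2 * lam ^ r / (e * L)"
proof -
  have J: "J \<in> JS" "D \<subseteq> JS" "J \<notin> D" using assms by (auto simp: pre_def)
  have "Ex r (D, {J}) (\<lambda>s. of_bool (alive L D s)) \<le> Ex r (D, {J}) (\<lambda>s. of_bool (snd s \<noteq> {}) + (1 / L) * real (card ((fst s \<union> snd s) - D)))"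
  proof (rule Ex_mono)
    fix D' G' assume "D' \<subseteq> JS" "G' \<subseteq> JS"
    hence "finite (D' \<union> G')" using finite_JS_sub by auto
    hence "card (D' - D) \<le> card ((D' \<union> G') - D)" by (intro card_mono) auto
    moreover have "1 \<le> 1 / L * x \<longleftrightarrow> L \<le> x" for x using assms by (simp add: field_simps)
    ultimately show "of_bool (alive L D (D', G')) \<le> of_bool (snd (D', G') \<noteq> {}) + (1 / L) * real (card ((fst (D', G') \<union> snd (D', G')) - D))"
      using assms(4) by (auto simp: alive_def of_bool_def)
  qed (use J in auto)
  also have "\<dots> = Ex r (D, {J}) (\<lambda>s. of_bool (snd s \<noteq> {})) + (1 / L) * Ex r (D, {J}) (\<lambda>s. real (card ((fst s \<union> snd s) - D)))"
    unfolding Ex_add Ex_cmult ..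
  also have "\<dots> \<le> xs 1 0 r + (1 / L) * (2 * lam ^ r / e)"
    using assms by (intro add_mono mult_left_mono surv_upper new_count) auto
  finally show ?thesis by (simp add: field_simps)
qed

definition large :: "real \<Rightarrow> nat set set \<Rightarrow> nat set \<Rightarrow> bool" where
  "large L H J \<longleftrightarrow> L \<le> real (card (comp H J))"

lemma finite_run_fst: "D \<subseteq> JS \<Longrightarrow> J \<in> JS \<Longrightarrow> finite (fst (run H r (D, {J})))"
  using run_sub[of "(D, {J})" H r] finite_JS_sub by auto

lemma large_alive:
  assumes "H \<subseteq> KS" "0 < r" "J \<in> JS" "large L H J"
  shows "alive L {} (run H r (init J))"
proof (rule ccontr)
  assume na: "\<not> alive L {} (run H r (init J))"
  hence "comp H J \<subseteq> fst (run H r (init J)) - {}"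
    unfolding init_def by (intro comp_small[where B = "{}"]) (use assms in \<open>auto simp: alive_def init_def\<close>)
  hence "card (comp H J) \<le> card (fst (run H r (init J)))"
    using finite_run_fst[of "{}" J H r] assms by (intro card_mono) (auto simp: init_def)
  thus False using na assms(4) by (auto simp: alive_def large_def)
qed

lemma Ex_mono_pre:
  assumes "pre (fst s) (snd s)" "\<And>D G. pre D G \<Longrightarrow> \<phi> (D, G) \<le> \<psi> (D, G)"
  shows "Ex i s \<phi> \<le> Ex i s \<psi>"
  unfolding Ex_def
proof (intro bexp_mono p0 p1)
  fix H
  have "pre (fst (run H i s)) (snd (run H i s))"
    using assms(1) run_sub[of s H i] run_disjoint[of s H i] by (simp add: pre_def)
  thus "\<phi> (run H i s) \<le> \<psi> (run H i s)" using assms(2) by (metis prod.collapse)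
qed

lemma pre_init: "J \<in> JS \<Longrightarrow> pre (fst (init J)) (snd (init J))"
  by (simp add: pre_def)

text \<open>The second exploration treats the dead set of the first as queried, so it uses fresh
  hyperedges. If it starts outside the first one, dies out small and avoids its frontier, it has
  found the component of \<open>J2\<close>, which is then too small.\<close>

lemma large_two:
  assumes H: "H \<subseteq> KS" and r: "0 < r" and J: "J1 \<in> JS" "J2 \<in> JS" and L: "large L H J1" "large L H J2"
    and s: "run H r (init J1) = (D, G)"
  shows "alive L {} (D, G) \<and> (J2 \<in> D \<union> G \<or> alive L D (run H r (D, {J2})) \<or> fst (run H r (D, {J2})) \<inter> G \<noteq> {})"
proof (intro conjI)
  show "alive L {} (D, G)" using large_alive[OF H r J(1) L(1)] by (simp add: s)
  have sub: "D \<subseteq> JS" "G \<subseteq> JS" using run_sub[of "init J1" H r] J s by auto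
  show "J2 \<in> D \<union> G \<or> alive L D (run H r (D, {J2})) \<or> fst (run H r (D, {J2})) \<inter> G \<noteq> {}"
  proof (rule ccontr)
    assume *: "\<not> (J2 \<in> D \<union> G \<or> alive L D (run H r (D, {J2})) \<or> fst (run H r (D, {J2})) \<inter> G \<noteq> {})"
    have "comp H J2 \<subseteq> fst (run H r (D, {J2})) - D"
    proof (rule comp_small[OF H r J(2) _ sub(1)])
      fix K J assume "K \<in> H" "J \<in> D" "J \<subseteq> K"
      thus "jsub j K \<subseteq> D \<union> G" using run_closed[of K H "init J1" J r] H s by auto
    qed (use * in \<open>auto simp: alive_def\<close>)
    hence "card (comp H J2) \<le> card (fst (run H r (D, {J2})) - D)"
      using finite_run_fst[OF sub(1) J(2), of H r] by (intro card_mono) auto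
    thus False using L(2) * by (auto simp: large_def alive_def)
  qed
qed

text \<open>By the Markov property the bound \<open>a\<close> applies twice. The exceptional pairs,
  where \<open>J2\<close> is already found or runs into the first frontier, are summed over all
  \<open>J2\<close>: on average a second exploration contains a given j-set with probability of
  order \<open>lam ^ r / (e * N)\<close>.\<close>

lemma large_pair_upper:
  assumes lam: "1 < lam" "lam \<le> 2" and L: "0 < L" and r: "0 < r"
    and a: "xs 1 0 r + 2 * lam ^ r / (e * L) \<le> a"
  shows "(\<Sum>J1\<in>JS. \<Sum>J2\<in>JS. bexp p KS (\<lambda>H. of_bool (large L H J1 \<and> large L H J2))) \<le>
    real N * (real N * a ^ 2 + 4 * lam ^ (2 * r) / e)"
proof -
  have e0: "0 < e" using lam by (simp add: e_def)
  have a0: "0 \<le> a" 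
  proof -
    have "0 \<le> xs 1 0 r" using xs_bounds[of 0 1 r] by simp
    moreover have "0 \<le> 2 * lam ^ r / (e * L)" using lam L e0 by simp
    ultimately show ?thesis using a by linarith
  qed
  have one: "(\<Sum>J2\<in>JS. bexp p KS (\<lambda>H. of_bool (large L H J1 \<and> large L H J2))) \<le> real N * a ^ 2 + 4 * lam ^ (2 * r) / e"
    if J1: "J1 \<in> JS" for J1
  proof -
    let ?h = "\<lambda>G J. of_bool (J \<in> G) :: real"
    \<comment> \<open>\<open>\<Phi>\<close> is written in terms of the first final state and the
      fresh hyperedges, as \<open>run_markov\<close> demands; \<open>\<Psi>\<close> is its average
      over the latter.\<close>
    define \<Phi> where "\<Phi> J2 s H = of_bool (alive L {} s) * (of_bool (J2 \<in> fst s \<union> snd s) + of_bool (J2 \<notin> fst s) *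
       (of_bool (alive L (fst s) (run H r (fst s, {J2}))) + (\<Sum>J\<in>fst (run H r (fst s, {J2})) \<union> snd (run H r (fst s, {J2})). ?h (snd s) J)))"
      for J2 s H
    define \<Psi> where "\<Psi> J2 s = of_bool (alive L {} s) * (of_bool (J2 \<in> fst s \<union> snd s) + of_bool (J2 \<notin> fst s) *
       (Ex r (fst s, {J2}) (\<lambda>s2. of_bool (alive L (fst s) s2)) + Ex r (fst s, {J2}) (\<lambda>s2. \<Sum>J\<in>fst s2 \<union> snd s2. ?h (snd s) J)))"
      for J2 s
    have "bexp p KS (\<lambda>H. of_bool (large L H J1 \<and> large L H J2)) \<le> Ex r (init J1) (\<Psi> J2)" if J2: "J2 \<in> JS" for J2
    proof -
      have "bexp p KS (\<lambda>H. of_bool (large L H J1 \<and> large L H J2)) \<le> 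
        bexp p KS (\<lambda>H. \<Phi> J2 (run H r (init J1)) (H \<inter> free (fst (run H r (init J1)))))"
      proof (intro bexp_mono p0 p1)
        fix H assume H: "H \<subseteq> KS"
        obtain D G where s: "run H r (init J1) = (D, G)" by (cases "run H r (init J1)")
        have sub: "D \<subseteq> JS" "G \<subseteq> JS" using run_sub[of "init J1" H r] J1 s by auto
        have res: "run (H \<inter> free D) r (D, {J2}) = run H r (D, {J2})"
          using run_restrict[of H r "(D, {J2})"] by simp
        let ?s2 = "run H r (D, {J2})"
        have fin: "finite (fst ?s2 \<union> snd ?s2)"
          using run_sub[of "(D, {J2})" H r] sub J2 finite_JS_sub by auto
        have hit: "1 \<le> (\<Sum>J\<in>fst ?s2 \<union> snd ?s2. ?h G J)" if ne: "fst ?s2 \<inter> G \<noteq> {}"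
        proof -
          obtain J where J: "J \<in> fst ?s2" "J \<in> G" using ne by auto
          have "?h G J \<le> (\<Sum>J\<in>fst ?s2 \<union> snd ?s2. ?h G J)" using J fin by (intro member_le_sum) auto
          thus ?thesis using J by simp
        qed
        have nn: "0 \<le> (\<Sum>J\<in>fst ?s2 \<union> snd ?s2. ?h G J)" by (intro sum_nonneg) auto
        show "of_bool (large L H J1 \<and> large L H J2) \<le> \<Phi> J2 (run H r (init J1)) (H \<inter> free (fst (run H r (init J1))))"
        proof (cases "large L H J1 \<and> large L H J2")
          case True
          hence *: "alive L {} (D, G)" "J2 \<in> D \<union> G \<or> alive L D ?s2 \<or> fst ?s2 \<inter> G \<noteq> {}"
            using large_two[OF H r J1 J2 _ _ s] by blast+
          show ?thesis
          proof (cases "J2 \<in> D \<union> G")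
            case True
            thus ?thesis using * nn by (auto simp: \<Phi>_def s res)
          next
            case False
            hence "alive L D ?s2 \<or> fst ?s2 \<inter> G \<noteq> {}" using * by blast
            thus ?thesis using * nn hit False by (auto simp: \<Phi>_def s res)
          qed
        next
          case False
          have "0 \<le> \<Phi> J2 (run H r (init J1)) (H \<inter> free (fst (run H r (init J1))))"
            unfolding \<Phi>_def by (intro mult_nonneg_nonneg add_nonneg_nonneg sum_nonneg) auto
          thus ?thesis using False by auto
        qed
      qed
      also have "\<dots> = Ex r (init J1) (\<lambda>s. bexp p (free (fst s)) (\<Phi> J2 s))"
        using run_markov[of "init J1" "\<Phi> J2" r] by simp
      also have "\<dots> = Ex r (init J1) (\<Psi> J2)"
        unfolding \<Phi>_def \<Psi>_def by (simp add: bexp_cmult bexp_add Ex_def[of _ "(_, {_})"])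
      finally show ?thesis .
    qed
    hence "(\<Sum>J2\<in>JS. bexp p KS (\<lambda>H. of_bool (large L H J1 \<and> large L H J2))) \<le> (\<Sum>J2\<in>JS. Ex r (init J1) (\<Psi> J2))"
      by (intro sum_mono)
    also have "\<dots> = Ex r (init J1) (\<lambda>s. \<Sum>J2\<in>JS. \<Psi> J2 s)" by (simp add: Ex_sum)
    also have "\<dots> \<le> Ex r (init J1) (\<lambda>s. (real N * a) * of_bool (alive L {} s) + (real (card ((fst s \<union> snd s) - {})) + (2 * lam ^ r / e) * real (card (snd s))))"
    proof (rule Ex_mono_pre[OF pre_init[OF J1]])
      fix D G assume pre: "pre D G"
      hence sub: "D \<subseteq> JS" "G \<subseteq> JS" "D \<inter> G = {}" by (auto simp: pre_def)
      have pos: "0 \<le> As (?h G) r J" if "J \<in> JS" for J using that by (intro As_nonneg) auto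
      have "(\<Sum>J2\<in>JS. \<Psi> J2 (D, G)) \<le> (\<Sum>J2\<in>JS. a * of_bool (alive L {} (D, G)) + (of_bool (J2 \<in> D \<union> G) + As (?h G) r J2))"
      proof (rule sum_mono)
        fix J2 assume J2: "J2 \<in> JS"
        show "\<Psi> J2 (D, G) \<le> a * of_bool (alive L {} (D, G)) + (of_bool (J2 \<in> D \<union> G) + As (?h G) r J2)"
        proof (cases "J2 \<in> D")
          case True
          thus ?thesis using a0 pos[OF J2] by (auto simp: \<Psi>_def)
        next
          case False
          hence pre2: "pre D {J2}" using sub J2 by (auto simp: pre_def)
          have "Ex r (D, {J2}) (\<lambda>s2. of_bool (alive L D s2)) \<le> a"
            using alive_upper[OF pre2 lam L, of r] a by linarith
          moreover have "Ex r (D, {J2}) (\<lambda>s2. \<Sum>J\<in>fst s2 \<union> snd s2. ?h G J) \<le> As (?h G) r J2"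
          proof -
            have "(\<Sum>J\<in>D. ?h G J) = 0" using sub by (intro sum.neutral) auto
            thus ?thesis using linear_potential_all[OF pre2, of "?h G" r] by simp
          qed
          ultimately show ?thesis using False a0 pos[OF J2] by (auto simp: \<Psi>_def)
        qed
      qed
      also have "\<dots> = real N * (a * of_bool (alive L {} (D, G))) + (real (card (D \<union> G)) + (\<Sum>m\<le>r. lam ^ m) * real (card G))"
      proof -
        have "(\<Sum>J2\<in>JS. of_bool (J2 \<in> X)) = real (card X)" if "X \<subseteq> JS" for X
        proof -
          have "JS \<inter> {J. J \<in> X} = X" using that by auto
          thus ?thesis by (subst sum_of_bool_eq) auto
        qed
        note cnt = this[of "D \<union> G"] this[of G]
        have "D \<union> G \<subseteq> JS" using sub by auto
        thus ?thesis using sub cnt by (simp only: sum.distrib sum_As card_JS sum_constant)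
      qed
      also have "\<dots> \<le> real N * (a * of_bool (alive L {} (D, G))) + (real (card (D \<union> G)) + (2 * lam ^ r / e) * real (card G))"
        using geo_lam2[OF lam, of r] by (intro add_left_mono mult_right_mono) auto
      finally show "(\<Sum>J2\<in>JS. \<Psi> J2 (D, G)) \<le> (real N * a) * of_bool (alive L {} (D, G)) + 
        (real (card ((fst (D, G) \<union> snd (D, G)) - {})) + (2 * lam ^ r / e) * real (card (snd (D, G))))" by simp
    qed
    also have "\<dots> = (real N * a) * Ex r (init J1) (\<lambda>s. of_bool (alive L {} s)) + 
       (Ex r (init J1) (\<lambda>s. real (card ((fst s \<union> snd s) - {}))) + (2 * lam ^ r / e) * Ex r (init J1) (\<lambda>s. real (card (snd s))))"
      unfolding Ex_add Ex_cmult ..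
    also have "\<dots> \<le> (real N * a) * a + (2 * lam ^ r / e + (2 * lam ^ r / e) * lam ^ r)"
    proof (intro add_mono mult_left_mono front_count J1)
      show "Ex r (init J1) (\<lambda>s. of_bool (alive L {} s)) \<le> a"
        unfolding init_def using alive_upper[of "{}" J1 L r] J1 lam L a by (auto simp: pre_def)
      show "Ex r (init J1) (\<lambda>s. real (card ((fst s \<union> snd s) - {}))) \<le> 2 * lam ^ r / e"
        unfolding init_def by (rule new_count) (use J1 lam in \<open>auto simp: pre_def\<close>)
    qed (use a0 lam e0 in auto)
    also have "\<dots> \<le> real N * a ^ 2 + 4 * lam ^ (2 * r) / e"
    proof -
      have gen: "2 * l / x + (2 * l / x) * l \<le> 4 * (l * l) / x" if "1 \<le> l" "0 < x" for l x :: real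
      proof -
        have "2 * l / x + (2 * l / x) * l = (2 * (1 * l) + 2 * (l * l)) / x" by (simp add: add_divide_distrib)
        also have "\<dots> \<le> (2 * (l * l) + 2 * (l * l)) / x"
          using that by (intro divide_right_mono add_mono mult_left_mono mult_right_mono) auto
        finally show ?thesis by simp
      qed
      have "1 \<le> lam ^ r" using lam by simp
      hence "2 * lam ^ r / e + (2 * lam ^ r / e) * lam ^ r \<le> 4 * (lam ^ r * lam ^ r) / e" using e0 by (rule gen)
      moreover have "lam ^ r * lam ^ r = lam ^ (2 * r)" by (simp only: mult_2 power_add)
      moreover have "real N * a * a = real N * a ^ 2" by (simp only: power2_eq_square mult.assoc)
      ultimately show ?thesis by (simp only: add_left_mono)
    qed
    finally show ?thesis .
  qed
  have "(\<Sum>J1\<in>JS. \<Sum>J2\<in>JS. bexp p KS (\<lambda>H. of_bool (large L H J1 \<and> large L H J2))) \<le>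
    (\<Sum>J1\<in>JS. real N * a ^ 2 + 4 * lam ^ (2 * r) / e)"
    by (intro sum_mono one)
  thus ?thesis by (simp add: card_JS)
qed

section \<open>Large frontiers and tainted explorations\<close>

lemma run_empty_front: "run H m (D, {}) = (D, {})"
  by (induction m) (auto simp: KK_def nw_def)

text \<open>Mark frontier members with probability \<open>s\<close>. A mark appears with probability
  at least \<open>xs 1 (1 - s) r\<close> minus losses; nonempty frontiers smaller than
  \<open>f\<close> explain at most \<open>s * f\<close> times the survival probability, and the rest
  must come from frontiers of size at least \<open>f\<close>.\<close>

lemma front_lower:
  assumes reg: regular and J0: "J0 \<in> JS" and s: "0 \<le> s" "s \<le> 1" and f: "0 \<le> f"
  shows "xs 1 (1 - s) r - s * CL * lam ^ r * (lam ^ r / (real N * e ^ 3) + real r / real n) - s * f * xs 1 0 r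
    \<le> Ex r (init J0) (\<lambda>x. of_bool (f \<le> real (card (snd x))))"
proof -
  have lam: "1 < lam" "lam \<le> 2" using reg by (auto simp: regular_def)
  have "Ex r (init J0) (\<lambda>x. 1 ^ card (fst x) * (1 - s) ^ card (snd x)) \<le> zs 1 (1 - s) r + 
    s * CL * lam ^ r * (lam ^ r / (real N * e ^ 3) + real r / real n)"
  proof (rule lower_bound[OF reg J0])
    fix m show "1 - zs 1 (1 - s) m \<le> s * lam ^ m"
      using xs_sg[OF lam(1), of "1 - s" 1 m] s by simp
  qed (use s in auto)
  hence 1: "Ex r (init J0) (\<lambda>x. (1 - s) ^ card (snd x)) \<le> 1 - xs 1 (1 - s) r + s * CL * lam ^ r * (lam ^ r / (real N * e ^ 3) + real r / real n)"
    by (simp add: xs_def)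
  have "1 + (-1) * Ex r (init J0) (\<lambda>x. (1 - s) ^ card (snd x)) = Ex r (init J0) (\<lambda>x. 1 + (-1) * (1 - s) ^ card (snd x))"
    unfolding Ex_add Ex_cmult by simp
  also have "\<dots> \<le> Ex r (init J0) (\<lambda>x. of_bool (f \<le> real (card (snd x))) + (s * f) * of_bool (snd x \<noteq> {}))"
  proof (rule Ex_mono_pre[OF pre_init[OF J0]])
    fix D G assume "pre D G"
    hence "finite G" using finite_JS_sub by (auto simp: pre_def)
    have b: "1 - (1 - s) ^ card G \<le> real (card G) * s" using one_minus_power_le[of "1 - s" "card G"] s by simp
    show "1 + (-1) * (1 - s) ^ card (snd (D, G)) \<le> of_bool (f \<le> real (card (snd (D, G)))) + (s * f) * of_bool (snd (D, G) \<noteq> {})"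
    proof (cases "f \<le> real (card G)")
      case True
      have "0 \<le> (1 - s) ^ card G" using s by simp
      moreover have "0 \<le> s * f * of_bool (G \<noteq> {})" using s f by simp
      ultimately show ?thesis using True by simp
    next
      case False
      show ?thesis
      proof (cases "G = {}")
        case True
        thus ?thesis by simp
      next
        case False
        have "real (card G) * s \<le> f * s" using \<open>\<not> f \<le> real (card G)\<close> s by (intro mult_right_mono) auto
        hence "real (card G) * s \<le> s * f" by (simp only: mult.commute)
        thus ?thesis using False b \<open>\<not> f \<le> real (card G)\<close> by simp
      qed
    qed
  qed
  also have "\<dots> = Ex r (init J0) (\<lambda>x. of_bool (f \<le> real (card (snd x)))) + (s * f) * Ex r (init J0) (\<lambda>x. of_bool (snd x \<noteq> {}))"
    unfolding Ex_add Ex_cmult ..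
  also have "\<dots> \<le> Ex r (init J0) (\<lambda>x. of_bool (f \<le> real (card (snd x)))) + (s * f) * xs 1 0 r"
    unfolding init_def using s f J0 by (intro add_left_mono mult_left_mono surv_upper) (auto simp: pre_def)
  finally show ?thesis using 1 by linarith
qed

text \<open>The same truncation with marks on dead j-sets. Explorations extinct by level
  \<open>r0\<close> are charged through the mean dead set at \<open>r0\<close>, the others through
  the probability of surviving to \<open>r0\<close>.\<close>

lemma dead_lower:
  assumes reg: regular and J0: "J0 \<in> JS" and s: "0 \<le> s" "s \<le> 1" and T: "0 \<le> T" and r0: "r0 \<le> r"
  shows "xs (1 - s) 1 r - s / e * CL * lam ^ r * (lam ^ r / (real N * e ^ 3) + real r / real n) 
     - s * (2 * lam ^ r0 / e) - s * T * xs 1 0 r0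
    \<le> Ex r (init J0) (\<lambda>x. of_bool (T \<le> real (card (fst x))))"
proof -
  have lam: "1 < lam" "lam \<le> 2" using reg by (auto simp: regular_def)
  have "Ex r (init J0) (\<lambda>x. (1 - s) ^ card (fst x) * 1 ^ card (snd x)) \<le> zs (1 - s) 1 r + 
    s / e * CL * lam ^ r * (lam ^ r / (real N * e ^ 3) + real r / real n)"
  proof (rule lower_bound[OF reg J0])
    fix m show "1 - zs (1 - s) 1 m \<le> s / e * lam ^ m"
      using xs_sg[OF lam(1), of 1 "1 - s" m] s by simp
  qed (use s in auto)
  hence 1: "Ex r (init J0) (\<lambda>x. (1 - s) ^ card (fst x)) \<le> 1 - xs (1 - s) 1 r + s / e * CL * lam ^ r * (lam ^ r / (real N * e ^ 3) + real r / real n)"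
    by (simp add: xs_def)
  have "1 + (-1) * Ex r (init J0) (\<lambda>x. (1 - s) ^ card (fst x)) = Ex r (init J0) (\<lambda>x. 1 + (-1) * (1 - s) ^ card (fst x))"
    unfolding Ex_add Ex_cmult by simp
  also have "\<dots> = bexp p KS (\<lambda>H. 1 - (1 - s) ^ card (fst (run H r (init J0))))"
    by (simp add: Ex_init)
  also have "\<dots> \<le> bexp p KS (\<lambda>H. of_bool (T \<le> real (card (fst (run H r (init J0))))) + 
     (s * real (card (fst (run H r0 (init J0)))) + (s * T) * of_bool (snd (run H r0 (init J0)) \<noteq> {})))"
  proof (intro bexp_mono p0 p1)
    fix H
    obtain D G where DG: "run H r (init J0) = (D, G)" by (cases "run H r (init J0)")
    obtain D0 G0 where DG0: "run H r0 (init J0) = (D0, G0)" by (cases "run H r0 (init J0)")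
    have b: "1 - (1 - s) ^ card D \<le> real (card D) * s" using one_minus_power_le[of "1 - s" "card D"] s by simp
    have n0: "0 \<le> s * real (card D0)" "0 \<le> (s * T) * of_bool (G0 \<noteq> {})" using s T by auto
    show "1 - (1 - s) ^ card (fst (run H r (init J0))) \<le> of_bool (T \<le> real (card (fst (run H r (init J0))))) + 
     (s * real (card (fst (run H r0 (init J0)))) + (s * T) * of_bool (snd (run H r0 (init J0)) \<noteq> {}))"
    proof (cases "T \<le> real (card D)")
      case True
      have "0 \<le> (1 - s) ^ card D" using s by simp
      thus ?thesis using True n0 unfolding DG DG0 by simp
    next
      case False
      show ?thesis
      proof (cases "G0 = {}")
        case True
        have "run H r (init J0) = run H (r - r0) (run H r0 (init J0))" using run_add[of H r0 "r - r0"] r0 by simp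
        \<comment> \<open>An empty frontier stays empty, so the dead set is frozen after level
          \<open>r0\<close>.\<close>
        hence "D = D0" using DG DG0 True by (simp add: run_empty_front)
        thus ?thesis using b n0 False True unfolding DG DG0 by (simp add: mult.commute)
      next
        case G0: False
        have "real (card D) * s \<le> T * s" using False s by (intro mult_right_mono) auto
        hence "real (card D) * s \<le> s * T" by (simp only: mult.commute)
        thus ?thesis using G0 False b n0 unfolding DG DG0 by simp
      qed
    qed
  qed
  also have "\<dots> = Ex r (init J0) (\<lambda>x. of_bool (T \<le> real (card (fst x)))) + 
     (s * Ex r0 (init J0) (\<lambda>x. real (card (fst x))) + (s * T) * Ex r0 (init J0) (\<lambda>x. of_bool (snd x \<noteq> {})))"
    unfolding Ex_init bexp_add bexp_cmult ..
  also have "\<dots> \<le> Ex r (init J0) (\<lambda>x. of_bool (T \<le> real (card (fst x)))) + (s * (2 * lam ^ r0 / e) + (s * T) * xs 1 0 r0)"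
  proof (intro add_left_mono add_mono mult_left_mono dead_count J0 lam)
    show "Ex r0 (init J0) (\<lambda>x. of_bool (snd x \<noteq> {})) \<le> xs 1 0 r0"
      unfolding init_def using J0 by (intro surv_upper) (auto simp: pre_def)
  qed (use s T in auto)
  finally show ?thesis using 1 by linarith
qed

text \<open>Tainted exploration: T collects the j-sets all of whose discovery paths might use a hyperedge
  that touches A, i.e. one that an earlier exploration with dead set A has already queried.\<close>

definition tn :: "nat set set \<Rightarrow> nat set set \<Rightarrow> nat set set \<Rightarrow> nat set set \<Rightarrow> nat set set" where
  "tn A H G T = {J' \<in> nw j H G. \<exists>K\<in>H. J' \<subseteq> K \<and> (K \<notin> free A \<or> (\<exists>J\<in>G \<inter> T. J \<subseteq> K))}"

fun runT :: "nat set set \<Rightarrow> nat set set \<Rightarrow> nat \<Rightarrow> nat set set \<times> nat set set \<times> nat set set \<Rightarrow> nat set set \<times> nat set set \<times> nat set set" where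
  "runT A H 0 s = s"
| "runT A H (Suc i) (D, G, T) = runT A H i (D \<union> G, nw j (H \<inter> KK D G) G, T \<union> tn A (H \<inter> KK D G) G T)"

lemma runT_run: "run H i (fst s, fst (snd s)) = (fst (runT A H i s), fst (snd (runT A H i s)))"
proof (induction i arbitrary: s)
  case (Suc i)
  obtain D G T where s: "s = (D, G, T)" by (cases s) auto
  show ?case using Suc[of "(D \<union> G, nw j (H \<inter> KK D G) G, T \<union> tn A (H \<inter> KK D G) G T)"] by (simp add: s)
qed simp

lemma runT_add: "runT A H (i + m) s = runT A H m (runT A H i s)"
proof (induction i arbitrary: s)
  case (Suc i)
  obtain D G T where s: "s = (D, G, T)" by (cases s) auto
  show ?case using Suc by (simp add: s)
qed simp

lemma runT_restrict: "runT A H i s = runT A (H \<inter> free (fst s)) i s"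
proof (induction i arbitrary: s H)
  case (Suc i)
  obtain D G T where s: "s = (D, G, T)" by (cases s) auto
  have e: "H \<inter> free D \<inter> KK D G = H \<inter> KK D G" by (auto simp: KK_def)
  let ?s = "(D \<union> G, nw j (H \<inter> KK D G) G, T \<union> tn A (H \<inter> KK D G) G T)"
  have "runT A H (Suc i) s = runT A H i ?s" by (simp add: s)
  also have "\<dots> = runT A (H \<inter> free (D \<union> G)) i ?s"
    by (subst Suc.IH) simp
  also have "H \<inter> free (D \<union> G) = H \<inter> free D \<inter> free (D \<union> G)"
    by (auto simp: free_Un)
  also have "runT A (H \<inter> free D \<inter> free (D \<union> G)) i ?s = runT A (H \<inter> free D) i ?s"
    by (subst (2) Suc.IH) simp
  finally show ?case by (simp add: s e)
qed simp

lemma runT_union: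
  assumes "H1 \<subseteq> KK D G" "H2 \<subseteq> free (D \<union> G)"
  shows "runT A (H1 \<union> H2) (Suc i) (D, G, T) = runT A H2 i (D \<union> G, nw j H1 G, T \<union> tn A H1 G T)"
proof -
  have "(H1 \<union> H2) \<inter> KK D G = H1" "(H1 \<union> H2) \<inter> free (D \<union> G) = H2"
    using assms free_split(2)[of D G] by auto
  thus ?thesis
    using runT_restrict[of A "H1 \<union> H2" i "(D \<union> G, nw j H1 G, T \<union> tn A H1 G T)"] by simp
qed

text \<open>Every discovery of an untainted j-set goes through an untainted parent and a hyperedge
  of \<open>free A\<close>; following these back to the root gives the walk.\<close>

lemma runT_connected:
  assumes H: "H \<subseteq> KS" and J0: "J0 \<in> JS" and s: "runT A H i ({}, {J0}, {}) = (D, G, T)"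
    and J': "J' \<in> D \<union> G" "J' \<notin> T"
  shows "jconnected (H \<inter> free A) j J0 J'"
  using s J'
proof (induction i arbitrary: J' D G T)
  case 0
  hence "J' = J0" by auto
  thus ?case by (simp add: jconnected_def)
next
  case (Suc i)
  obtain D' G' T' where s: "runT A H i ({}, {J0}, {}) = (D', G', T')" by (cases "runT A H i ({}, {J0}, {})") auto
  have sub: "D' \<subseteq> JS" "G' \<subseteq> JS" using runT_run[of H i "({}, {J0}, {})" A] run_sub[of "({}, {J0})" H i] J0 s by auto
  have "runT A H (i + Suc 0) ({}, {J0}, {}) = runT A H (Suc 0) (runT A H i ({}, {J0}, {}))" by (rule runT_add)
  hence "runT A H (Suc i) ({}, {J0}, {}) = (D' \<union> G', nw j (H \<inter> KK D' G') G', T' \<union> tn A (H \<inter> KK D' G') G' T')"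
    unfolding s add_Suc_right add_0_right by (simp only: runT.simps)
  hence DG: "D = D' \<union> G'" "G = nw j (H \<inter> KK D' G') G'" "T = T' \<union> tn A (H \<inter> KK D' G') G' T'"
    unfolding Suc.prems(1) by auto
  show ?case
  proof (cases "J' \<in> D' \<union> G'")
    case True
    thus ?thesis using Suc.IH[OF s, of J'] Suc.prems DG by auto
  next
    case False
    hence nwJ: "J' \<in> nw j (H \<inter> KK D' G') G'" using Suc.prems DG by auto
    then obtain K L where K: "K \<in> H \<inter> KK D' G'" "J' \<subseteq> K" "L \<in> G'" "L \<subseteq> K"
      by (auto simp: nw_def KK_def jsub_def)
    have "J' \<notin> tn A (H \<inter> KK D' G') G' T'" using Suc.prems DG by auto
    hence KL: "K \<in> free A" "L \<notin> T'" using K nwJ unfolding tn_def by blast+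
    have "jconnected (H \<inter> free A) j J0 L" using Suc.IH[OF s, of L] K KL by auto
    moreover have "jconnected (H \<inter> free A) j L J'" using K KL by (intro jconnected_edge[of K]) auto
    moreover have "L \<in> JS" using K sub by auto
    moreover have "H \<inter> free A \<subseteq> KS" using H by auto
    ultimately show ?thesis using jconnected_trans by blast
  qed
qed

text \<open>One application of the kernel restricted to hyperedges that touch \<open>A\<close>: the
  taint newly created at \<open>J\<close>.\<close>

definition Fk :: "nat set set \<Rightarrow> (nat set \<Rightarrow> real) \<Rightarrow> nat set \<Rightarrow> real" where
  "Fk A h J = p * (\<Sum>K | K \<in> KS \<and> J \<subseteq> K. of_bool (K \<notin> free A) * (\<Sum>J'\<in>jsub j K - {J}. h J'))"

lemma step_tn:
  assumes "G \<subseteq> JS" "\<And>J. J \<in> JS \<Longrightarrow> 0 \<le> h J"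
  shows "bexp p (KK D G) (\<lambda>H. \<Sum>J\<in>tn A H G T. h J) \<le> (\<Sum>J\<in>G \<inter> T. Tr h J) + (\<Sum>J\<in>G. Fk A h J)"
proof -
  define W where "W K = (\<Sum>J\<in>jsub j K - G. h J)" for K
  let ?c1 = "\<lambda>K. of_bool (K \<notin> free A) :: real" and ?c2 = "\<lambda>K. of_bool (\<exists>J\<in>G \<inter> T. J \<subseteq> K) :: real"
  have pos: "0 \<le> h J'" if "J' \<in> jsub j K" "K \<in> KS" for J' K using that jsub_subset[OF that(2)] assms(2) by auto
  have W0: "0 \<le> W K" if "K \<in> KS" for K unfolding W_def using that pos by (intro sum_nonneg) auto
  have "bexp p (KK D G) (\<lambda>H. \<Sum>J\<in>tn A H G T. h J) \<le> bexp p (KK D G) (\<lambda>H. \<Sum>K\<in>H. (?c1 K + ?c2 K) * W K)"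
  proof (intro bexp_mono p0 p1)
    fix H assume "H \<subseteq> KK D G"
    hence HK: "H \<subseteq> KS" using KK_subset[of D G] by auto
    have fH: "finite H" using HK by (rule finite_subset) simp
    let ?H = "{K \<in> H. K \<notin> free A \<or> (\<exists>J\<in>G \<inter> T. J \<subseteq> K)}"
    have "tn A H G T \<subseteq> nw j ?H G"
    proof
      fix J assume J: "J \<in> tn A H G T"
      then obtain K where K: "K \<in> ?H" "J \<subseteq> K" by (auto simp: tn_def)
      moreover have "J \<notin> G" "card J = j" using J by (auto simp: tn_def nw_def jsub_def)
      ultimately show "J \<in> nw j ?H G" unfolding nw_def jsub_def by blast
    qed
    moreover have "nw j ?H G \<subseteq> JS" using HK by (intro nw_subset) auto
    ultimately have "(\<Sum>J\<in>tn A H G T. h J) \<le> (\<Sum>J\<in>nw j ?H G. h J)"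
      using assms(2) finite_JS_sub by (intro sum_mono2) auto
    also have "\<dots> \<le> (\<Sum>K\<in>?H. W K)" unfolding W_def using HK assms(2) by (intro sum_nw_le) auto
    also have "\<dots> \<le> (\<Sum>K\<in>?H. (?c1 K + ?c2 K) * W K)"
      using HK W0 by (intro sum_mono) (auto simp: of_bool_def)
    also have "\<dots> \<le> (\<Sum>K\<in>H. (?c1 K + ?c2 K) * W K)"
      using HK W0 fH by (intro sum_mono2) auto
    finally show "(\<Sum>J\<in>tn A H G T. h J) \<le> (\<Sum>K\<in>H. (?c1 K + ?c2 K) * W K)" .
  qed
  also have "\<dots> = p * (\<Sum>K\<in>KK D G. (?c1 K + ?c2 K) * W K)" by (simp add: bexp_sum_mem)
  also have "\<dots> = p * (\<Sum>K\<in>KK D G. ?c1 K * W K) + p * (\<Sum>K\<in>KK D G. ?c2 K * W K)"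
    by (simp add: distrib_right sum.distrib distrib_left)
  also have "(\<Sum>K\<in>KK D G. ?c2 K * W K) = (\<Sum>K\<in>KK D (G \<inter> T). W K)"
    by (intro sum.mono_neutral_cong_right) (auto simp: KK_def)
  also have "p * (\<Sum>K\<in>KK D (G \<inter> T). W K) \<le> p * (\<Sum>J\<in>G \<inter> T. \<Sum>K | K \<in> KS \<and> J \<subseteq> K. \<Sum>J'\<in>jsub j K - {J}. h J')"
  proof (intro mult_left_mono sum_KK_le p0)
    fix J K assume *: "K \<in> KS" "J \<in> G \<inter> T" "J \<subseteq> K"
    show "W K \<le> (\<Sum>J'\<in>jsub j K - {J}. h J')"
      unfolding W_def using * pos finite_jsub[OF *(1)] by (intro sum_mono2) auto
    show "0 \<le> (\<Sum>J'\<in>jsub j K - {J}. h J')" using * pos by (intro sum_nonneg) auto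
  qed (use assms in auto)
  also have "\<dots> = (\<Sum>J\<in>G \<inter> T. Tr h J)"
    using assms by (subst sum_distrib_left) (intro sum.cong refl Tr_alt, auto)
  also have "p * (\<Sum>K\<in>KK D G. ?c1 K * W K) \<le> p * (\<Sum>J\<in>G. \<Sum>K | K \<in> KS \<and> J \<subseteq> K. ?c1 K * (\<Sum>J'\<in>jsub j K - {J}. h J'))"
  proof (rule mult_left_mono[OF _ p0], rule sum_KK_le[OF assms(1)])
    fix J K assume *: "K \<in> KS" "J \<in> G" "J \<subseteq> K"
    show "?c1 K * W K \<le> ?c1 K * (\<Sum>J'\<in>jsub j K - {J}. h J')"
      unfolding W_def using * pos finite_jsub[OF *(1)] by (intro mult_left_mono sum_mono2) auto
    show "0 \<le> ?c1 K * (\<Sum>J'\<in>jsub j K - {J}. h J')" using * pos by (intro mult_nonneg_nonneg sum_nonneg) auto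
  qed
  also have "\<dots> = (\<Sum>J\<in>G. Fk A h J)" by (simp add: Fk_def sum_distrib_left)
  finally show ?thesis by simp
qed

text \<open>Decomposition by the step at which taint enters: \<open>Fk\<close> is applied to
  everything that can follow from there.\<close>

fun Fc :: "nat set set \<Rightarrow> (nat set \<Rightarrow> real) \<Rightarrow> nat \<Rightarrow> nat set \<Rightarrow> real" where
  "Fc A h 0 J = 0"
| "Fc A h (Suc i) J = Tr (Fc A h i) J + Fk A (As h i) J"

lemma Fk_nonneg: "(\<And>J. J \<in> JS \<Longrightarrow> 0 \<le> h J) \<Longrightarrow> 0 \<le> Fk A h J"
  unfolding Fk_def
proof (intro mult_nonneg_nonneg sum_nonneg p0)
  fix K J' assume *: "\<And>J. J \<in> JS \<Longrightarrow> 0 \<le> h J" "K \<in> {K. K \<in> KS \<and> J \<subseteq> K}" "J' \<in> jsub j K - {J}"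
  thus "0 \<le> h J'" using jsub_subset[of K n k j] by auto
qed auto

lemma Fc_nonneg: "(\<And>J. J \<in> JS \<Longrightarrow> 0 \<le> h J) \<Longrightarrow> J \<in> JS \<Longrightarrow> 0 \<le> Fc A h i J"
  by (induction i arbitrary: J) (auto intro!: add_nonneg_nonneg Tr_nonneg Fk_nonneg As_nonneg)

text \<open>Tainted dead j-sets are final, tainted frontier sets pass the taint to all their
  offspring (\<open>As\<close>), and new taint may still enter below any frontier set
  (\<open>Fc\<close>).\<close>

lemma taint_potential:
  assumes "pre D G" "T \<subseteq> D \<union> G" "\<And>J. J \<in> JS \<Longrightarrow> 0 \<le> h J"
  shows "bexp p (free D) (\<lambda>H. \<Sum>J\<in>snd (snd (runT A H i (D, G, T))). h J) \<le>
    (\<Sum>J\<in>T - G. h J) + (\<Sum>J\<in>G \<inter> T. As h i J) + (\<Sum>J\<in>G. Fc A h i J)"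
  using assms(1,2)
proof (induction i arbitrary: D G T)
  case 0
  have "finite T" using 0 finite_JS_sub by (auto simp: pre_def intro: finite_subset[of T "D \<union> G"])
  hence "(\<Sum>J\<in>T. h J) = (\<Sum>J\<in>T - G. h J) + (\<Sum>J\<in>T \<inter> G. h J)"
    by (metis sum.Int_Diff add.commute)
  thus ?case by (simp add: Int_commute)
next
  case (Suc i)
  let ?\<psi> = "\<lambda>G T. (\<Sum>J\<in>T - G. h J) + (\<Sum>J\<in>G \<inter> T. As h i J) + (\<Sum>J\<in>G. Fc A h i J)"
  let ?f = "\<lambda>H. \<Sum>J\<in>snd (snd (runT A H (Suc i) (D, G, T))). h J"
  have sub: "D \<subseteq> JS" "G \<subseteq> JS" "D \<inter> G = {}" using Suc.prems by (auto simp: pre_def)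
  have finT: "finite T" using sub Suc.prems finite_JS_sub by (auto intro: finite_subset[of T "D \<union> G"])
  have "bexp p (free D) ?f = bexp p (KK D G \<union> free (D \<union> G)) ?f" using free_split(1)[of D G] by simp
  also have "\<dots> = bexp p (KK D G) (\<lambda>H1. bexp p (free (D \<union> G)) (\<lambda>H2. ?f (H1 \<union> H2)))"
    by (rule bexp_union) (use free_split(2) in auto)
  also have "\<dots> = bexp p (KK D G) (\<lambda>H1. bexp p (free (D \<union> G)) (\<lambda>H2. \<Sum>J\<in>snd (snd (runT A H2 i (D \<union> G, nw j H1 G, T \<union> tn A H1 G T))). h J))"
    by (intro bexp_cong) (simp add: runT_union del: runT.simps)
  also have "\<dots> \<le> bexp p (KK D G) (\<lambda>H1. ?\<psi> (nw j H1 G) (T \<union> tn A H1 G T))"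
  proof (intro bexp_mono p0 p1 Suc.IH)
    fix H assume H: "H \<subseteq> KK D G"
    show "pre (D \<union> G) (nw j H G)" using pre_step[OF Suc.prems(1) H] .
    show "T \<union> tn A H G T \<subseteq> D \<union> G \<union> nw j H G" using Suc.prems by (auto simp: tn_def)
  qed
  also have "\<dots> = bexp p (KK D G) (\<lambda>H1. (\<Sum>J\<in>T. h J) + (\<Sum>J\<in>tn A H1 G T. As h i J) + (\<Sum>J\<in>nw j H1 G. Fc A h i J))"
  proof (rule bexp_cong)
    fix H assume H: "H \<subseteq> KK D G"
    have "nw j H G \<inter> (D \<union> G) = {}" using nw_disjoint[OF H] sub by auto
    moreover have "tn A H G T \<subseteq> nw j H G" by (auto simp: tn_def)
    ultimately have "T \<union> tn A H G T - nw j H G = T" "nw j H G \<inter> (T \<union> tn A H G T) = tn A H G T"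
      using Suc.prems(2) by auto
    thus "?\<psi> (nw j H G) (T \<union> tn A H G T) = (\<Sum>J\<in>T. h J) + (\<Sum>J\<in>tn A H G T. As h i J) + (\<Sum>J\<in>nw j H G. Fc A h i J)"
      by simp
  qed
  also have "\<dots> = (\<Sum>J\<in>T. h J) + bexp p (KK D G) (\<lambda>H. \<Sum>J\<in>tn A H G T. As h i J) + bexp p (KK D G) (\<lambda>H. \<Sum>J\<in>nw j H G. Fc A h i J)"
    by (simp add: bexp_add)
  also have "\<dots> \<le> (\<Sum>J\<in>T. h J) + ((\<Sum>J\<in>G \<inter> T. Tr (As h i) J) + (\<Sum>J\<in>G. Fk A (As h i) J)) + (\<Sum>J\<in>G. Tr (Fc A h i) J)"
    using sub assms(3) by (intro add_mono step_tn step_linear As_nonneg Fc_nonneg) auto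
  also have "(\<Sum>J\<in>T. h J) = (\<Sum>J\<in>T - G. h J) + (\<Sum>J\<in>G \<inter> T. h J)"
    using finT by (metis sum.Int_Diff add.commute Int_commute)
  finally show ?case by (simp add: sum.distrib)
qed


lemma Tr_adjoint: "(\<Sum>J\<in>JS. h J * Tr g J) = (\<Sum>J\<in>JS. Tr h J * g J)"
proof -
  have "(\<Sum>J\<in>JS. h J * Tr g J) = (\<Sum>J\<in>JS. \<Sum>J'\<in>JS. h J * (t J J' * g J'))"
    by (simp add: Tr_def sum_distrib_left)
  also have "\<dots> = (\<Sum>J'\<in>JS. \<Sum>J\<in>JS. t J' J * h J * g J')"
    by (subst sum.swap) (simp add: t_sym mult_ac)
  also have "\<dots> = (\<Sum>J\<in>JS. Tr h J * g J)" by (simp add: Tr_def sum_distrib_right)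
  finally show ?thesis .
qed

lemma Trn_adjoint: "(\<Sum>J\<in>JS. h J * (Tr ^^ m) g J) = (\<Sum>J\<in>JS. (Tr ^^ m) h J * g J)"
proof (induction m arbitrary: h)
  case (Suc m)
  have "(\<Sum>J\<in>JS. h J * (Tr ^^ Suc m) g J) = (\<Sum>J\<in>JS. Tr h J * (Tr ^^ m) g J)"
    by (simp add: Tr_adjoint)
  also have "\<dots> = (\<Sum>J\<in>JS. (Tr ^^ Suc m) h J * g J)"
    using Suc by (simp add: funpow_Suc_right del: funpow.simps)
  finally show ?case .
qed simp

lemma As_expand: "As h i J = (\<Sum>m\<le>i. (Tr ^^ m) h J)"
proof (induction i arbitrary: J)
  case (Suc i)
  have "As h i = (\<lambda>J. \<Sum>m\<le>i. (Tr ^^ m) h J)" using Suc by blast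
  thus ?case by (simp add: Tr_sum sum.atMost_Suc_shift del: sum.atMost_Suc)
qed simp

text \<open>Over all roots the restricted kernel can be summed by hyperedges: one that touches
  \<open>A\<close> is charged to its members \<open>d\<close> of \<open>A\<close>, and each j-set in
  it has \<open>q\<close> partners. The term with \<open>p * real M\<close> is the contribution of
  \<open>d\<close> itself.\<close>

lemma sum_Fk:
  assumes "A \<subseteq> JS" "\<And>J. J \<in> JS \<Longrightarrow> 0 \<le> h J"
  shows "(\<Sum>J\<in>JS. Fk A h J) \<le> real q * (\<Sum>d\<in>A. Tr h d + p * real M * h d)"
proof -
  let ?c = "\<lambda>K. of_bool (K \<notin> free A) :: real" and ?W = "\<lambda>K. \<Sum>J\<in>jsub j K. h J"
  have fA: "finite A" using assms finite_JS_sub by auto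
  have js: "{J. J \<in> JS \<and> J \<subseteq> K} = jsub j K" if "K \<in> KS" for K
    using that by (auto simp: jsub_def ksets_def)
  have W0: "0 \<le> ?W K" if "K \<in> KS" for K
    using that jsub_subset[of K n k j] assms(2) by (intro sum_nonneg) auto
  have "(\<Sum>J\<in>JS. \<Sum>K | K \<in> KS \<and> J \<subseteq> K. ?c K * (\<Sum>J'\<in>jsub j K - {J}. h J')) =
     (\<Sum>K\<in>KS. \<Sum>J | J \<in> JS \<and> J \<subseteq> K. ?c K * (\<Sum>J'\<in>jsub j K - {J}. h J'))"
    by (rule sum.swap_restrict) auto
  also have "\<dots> = (\<Sum>K\<in>KS. ?c K * (real q * ?W K))"
  proof (rule sum.cong[OF refl])
    fix K assume K: "K \<in> KS"
    have f: "finite (jsub j K)" using K by auto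
    have "(\<Sum>J\<in>jsub j K. \<Sum>J'\<in>jsub j K - {J}. h J') = (\<Sum>J\<in>jsub j K. ?W K - h J)"
      using f by (intro sum.cong refl) (simp add: sum_diff1)
    also have "\<dots> = real q * ?W K"
      using card_jsub[OF K, of j] by (simp add: sum_subtractf Suc_q[symmetric] algebra_simps)
    finally show "(\<Sum>J | J \<in> JS \<and> J \<subseteq> K. ?c K * (\<Sum>J'\<in>jsub j K - {J}. h J')) = ?c K * (real q * ?W K)"
      unfolding js[OF K] by (simp only: sum_distrib_left[symmetric])
  qed
  also have "\<dots> \<le> (\<Sum>K\<in>KS. (\<Sum>d | d \<in> A \<and> d \<subseteq> K. 1) * (real q * ?W K))"
  proof (intro sum_mono mult_right_mono mult_nonneg_nonneg W0)
    fix K assume K: "K \<in> KS"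
    show "?c K \<le> (\<Sum>d | d \<in> A \<and> d \<subseteq> K. 1)"
    proof (cases "K \<in> free A")
      case False
      then obtain d where "d \<in> A" "d \<subseteq> K" using K by (auto simp: free_def)
      hence "card {d. d \<in> A \<and> d \<subseteq> K} \<ge> 1" using fA by (auto simp: Suc_le_eq card_gt_0_iff)
      thus ?thesis by simp
    qed auto
  qed auto
  also have "\<dots> = (\<Sum>K\<in>KS. \<Sum>d | d \<in> A \<and> d \<subseteq> K. real q * ?W K)" by (simp add: sum_distrib_right)
  also have "\<dots> = (\<Sum>d\<in>A. \<Sum>K | K \<in> KS \<and> d \<subseteq> K. real q * ?W K)"
    by (rule sum.swap_restrict) (use fA in auto)
  also have "\<dots> = (\<Sum>d\<in>A. real q * (\<Sum>K | K \<in> KS \<and> d \<subseteq> K. h d + (\<Sum>J\<in>jsub j K - {d}. h J)))"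
  proof (rule sum.cong[OF refl])
    fix d assume d: "d \<in> A"
    have "(\<Sum>K | K \<in> KS \<and> d \<subseteq> K. ?W K) = (\<Sum>K | K \<in> KS \<and> d \<subseteq> K. h d + (\<Sum>J\<in>jsub j K - {d}. h J))"
    proof (rule sum.cong[OF refl])
      fix K assume K: "K \<in> {K. K \<in> KS \<and> d \<subseteq> K}"
      have "d \<in> jsub j K" using d assms(1) K by (auto simp: mem_jsub_iff)
      thus "?W K = h d + (\<Sum>J\<in>jsub j K - {d}. h J)" using K by (intro sum.remove) auto
    qed
    thus "(\<Sum>K | K \<in> KS \<and> d \<subseteq> K. real q * ?W K) = real q * (\<Sum>K | K \<in> KS \<and> d \<subseteq> K. h d + (\<Sum>J\<in>jsub j K - {d}. h J))"
      by (simp only: sum_distrib_left[symmetric])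
  qed
  finally have "(\<Sum>J\<in>JS. Fk A h J) \<le> p * (\<Sum>d\<in>A. real q * (\<Sum>K | K \<in> KS \<and> d \<subseteq> K. h d + (\<Sum>J\<in>jsub j K - {d}. h J)))"
    using p0 by (simp add: Fk_def mult_left_mono flip: sum_distrib_left)
  also have "\<dots> = (\<Sum>d\<in>A. real q * (p * (\<Sum>K | K \<in> KS \<and> d \<subseteq> K. \<Sum>J\<in>jsub j K - {d}. h J) + p * (real (card {K. K \<in> KS \<and> d \<subseteq> K}) * h d)))"
    by (simp add: sum.distrib sum_distrib_left algebra_simps)
  also have "\<dots> = (\<Sum>d\<in>A. real q * (Tr h d + p * real M * h d))"
  proof (rule sum.cong[OF refl])
    fix d assume "d \<in> A"
    hence d: "d \<in> JS" using assms by auto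
    show "real q * (p * (\<Sum>K | K \<in> KS \<and> d \<subseteq> K. \<Sum>J\<in>jsub j K - {d}. h J) + p * (real (card {K. K \<in> KS \<and> d \<subseteq> K}) * h d)) = real q * (Tr h d + p * real M * h d)"
      unfolding Tr_alt[OF d] card_above[OF d] by simp
  qed
  finally show ?thesis by (simp add: sum_distrib_left)
qed

text \<open>Self-adjointness moves the powers from the indicator of \<open>B\<close> to a row of the
  kernel, where decay estimates are available.\<close>

lemma kernel_pairing:
  assumes "B \<subseteq> JS" "d \<in> JS"
  shows "Tr ((Tr ^^ m) (\<lambda>J. of_bool (J \<in> B))) d = (\<Sum>b\<in>B. (Tr ^^ m) (t d) b)"
proof -
  have "(\<Sum>b\<in>B. (Tr ^^ m) (t d) b) = (\<Sum>J\<in>JS. of_bool (J \<in> B) * (Tr ^^ m) (t d) J)"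
    using assms by (intro sum.mono_neutral_cong_left) auto
  also have "\<dots> = (\<Sum>J\<in>JS. (Tr ^^ m) (\<lambda>J. of_bool (J \<in> B)) J * t d J)" by (rule Trn_adjoint)
  finally show ?thesis by (simp add: Tr_def mult.commute)
qed

lemma pM_le: "lam \<le> 2 \<Longrightarrow> p * real M \<le> 2"
proof -
  assume "lam \<le> 2"
  moreover have "p * real M * 1 \<le> p * real M * real q" using q_pos p0 by (intro mult_left_mono) auto
  ultimately show ?thesis by (simp add: lam_def)
qed

text \<open>A tainted hit of \<open>B\<close> contains a chain from some \<open>d\<close> in
  \<open>A\<close> to some \<open>b\<close> in \<open>B\<close>. Summation over the roots turns the
  part before \<open>A\<close> into a power of \<open>lam\<close>; the factor \<open>r\<close>
  covers the possible steps at which the taint enters.\<close>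

lemma sum_Fc:
  assumes "A \<subseteq> JS" "B \<subseteq> JS" "A \<inter> B = {}" "1 < lam" "lam \<le> 2"
  shows "(\<Sum>J\<in>JS. Fc A (\<lambda>J. of_bool (J \<in> B)) r J) \<le> 
    3 * real q * real r * (\<Sum>m<r. lam ^ (r - m) * (\<Sum>d\<in>A. \<Sum>b\<in>B. (Tr ^^ m) (t d) b))"
proof -
  let ?h = "\<lambda>J. of_bool (J \<in> B) :: real"
  let ?Y = "\<lambda>m. \<Sum>d\<in>A. \<Sum>b\<in>B. (Tr ^^ m) (t d) b"
  have Y0: "0 \<le> ?Y m" for m using assms by (intro sum_nonneg Trn_nonneg) auto
  have Fk: "(\<Sum>J\<in>JS. Fk A (As ?h i) J) \<le> 3 * real q * (\<Sum>m<r. ?Y m)" if i: "i < r" for i r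
  proof -
    have *: "Tr (As ?h i) d + p * real M * As ?h i d \<le> 3 * (\<Sum>m<r. \<Sum>b\<in>B. (Tr ^^ m) (t d) b)" if d: "d \<in> A" for d
    proof -
      have dJ: "d \<in> JS" using d assms by auto
      have nn: "0 \<le> (\<Sum>b\<in>B. (Tr ^^ m) (t d) b)" for m using assms by (intro sum_nonneg Trn_nonneg) auto
      have "As ?h i = (\<lambda>J. \<Sum>m\<le>i. (Tr ^^ m) ?h J)" using As_expand by blast
      hence "Tr (As ?h i) d = (\<Sum>m\<le>i. \<Sum>b\<in>B. (Tr ^^ m) (t d) b)"
        by (simp add: Tr_sum kernel_pairing[OF assms(2) dJ])
      also have "\<dots> \<le> (\<Sum>m<r. \<Sum>b\<in>B. (Tr ^^ m) (t d) b)" using i nn by (intro sum_mono2) auto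
      finally have 1: "Tr (As ?h i) d \<le> (\<Sum>m<r. \<Sum>b\<in>B. (Tr ^^ m) (t d) b)" .
      \<comment> \<open>The zeroth term vanishes since \<open>d\<close> lies in \<open>A\<close> and
        hence not in \<open>B\<close>; after the shift every term is a power applied to a row of
        \<open>t\<close>.\<close>
      have "As ?h i d = (\<Sum>m<i. \<Sum>b\<in>B. (Tr ^^ m) (t d) b)"
        using d assms(3) by (auto simp: As_expand lessThan_Suc_atMost[symmetric] sum.lessThan_Suc_shift kernel_pairing[OF assms(2) dJ] simp del: sum.lessThan_Suc)
      also have "\<dots> \<le> (\<Sum>m<r. \<Sum>b\<in>B. (Tr ^^ m) (t d) b)" using i nn by (intro sum_mono2) auto
      finally have 2: "As ?h i d \<le> (\<Sum>m<r. \<Sum>b\<in>B. (Tr ^^ m) (t d) b)" .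
      have "0 \<le> As ?h i d" using dJ by (intro As_nonneg) auto
      hence "p * real M * As ?h i d \<le> 2 * As ?h i d" using pM_le assms by (intro mult_right_mono) auto
      thus ?thesis using 1 2 by linarith
    qed
    have "(\<Sum>J\<in>JS. Fk A (As ?h i) J) \<le> real q * (\<Sum>d\<in>A. Tr (As ?h i) d + p * real M * As ?h i d)"
      using assms by (intro sum_Fk As_nonneg) auto
    also have "\<dots> \<le> real q * (\<Sum>d\<in>A. 3 * (\<Sum>m<r. \<Sum>b\<in>B. (Tr ^^ m) (t d) b))"
      using * by (intro mult_left_mono sum_mono) auto
    also have "\<dots> = 3 * real q * (\<Sum>m<r. ?Y m)"
      by (simp add: sum_distrib_left[symmetric] sum.swap[of _ A])
    finally show ?thesis .
  qed
  show ?thesis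
  proof (induction r)
    case (Suc i)
    let ?W = "\<Sum>m<Suc i. lam ^ (Suc i - m) * ?Y m"
    have W0: "0 \<le> ?W"
    proof (rule sum_nonneg)
      fix m show "0 \<le> lam ^ (Suc i - m) * ?Y m" using Y0[of m] assms(4) by simp
    qed
    have W1: "(\<Sum>m<Suc i. ?Y m) \<le> ?W"
    proof (rule sum_mono)
      fix m
      show "?Y m \<le> lam ^ (Suc i - m) * ?Y m"
        using mult_right_mono[OF one_le_power[of lam "Suc i - m"] Y0[of m]] assms(4) by simp
    qed
    have W2: "lam * (\<Sum>m<i. lam ^ (i - m) * ?Y m) \<le> ?W"
    proof -
      have "lam * (\<Sum>m<i. lam ^ (i - m) * ?Y m) = (\<Sum>m<i. lam ^ (Suc i - m) * ?Y m)"
        by (simp add: sum_distrib_left Suc_diff_le mult.assoc)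
      thus ?thesis using Y0[of i] assms(4) by simp
    qed
    have "(\<Sum>J\<in>JS. Fc A ?h (Suc i) J) = lam * (\<Sum>J\<in>JS. Fc A ?h i J) + (\<Sum>J\<in>JS. Fk A (As ?h i) J)"
      by (simp add: sum.distrib sum_Tr)
    also have "\<dots> \<le> lam * (3 * real q * real i * (\<Sum>m<i. lam ^ (i - m) * ?Y m)) + 3 * real q * (\<Sum>m<Suc i. ?Y m)"
      using Suc Fk[of i "Suc i"] assms(4) by (intro add_mono mult_left_mono) auto
    also have "\<dots> = 3 * real q * real i * (lam * (\<Sum>m<i. lam ^ (i - m) * ?Y m)) + 3 * real q * (\<Sum>m<Suc i. ?Y m)"
      by (simp only: mult_ac)
    also have "\<dots> \<le> 3 * real q * real i * ?W + 3 * real q * ?W"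
      using W1 W2 by (intro add_mono mult_left_mono) auto
    also have "\<dots> = 3 * real q * real (Suc i) * ?W" by (simp add: algebra_simps)
    finally show ?case .
  qed simp
qed

definition ZZ :: "nat \<Rightarrow> real" where
  "ZZ r = lam ^ r / (real N * e ^ 2) + 4 * real k / (real n * (1 - alpha) ^ 2)"

definition taint :: "nat set set \<Rightarrow> nat set set \<Rightarrow> nat \<Rightarrow> nat set \<Rightarrow> nat set set" where
  "taint A H r J = snd (snd (runT A H r ({}, {J}, {})))"

lemma taint_total:
  assumes reg: regular and J1: "J1 \<in> JS"
  shows "Ex r (init J1) (\<lambda>s. \<Sum>J2\<in>JS. bexp p KS (\<lambda>H. \<Sum>J\<in>taint (fst s) H r J2. of_bool (J \<in> snd s))) \<le>
    12 * real q ^ 2 * real r ^ 2 * lam ^ (2 * r) * ZZ r"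
proof -
  have lam: "1 < lam" "lam \<le> 2" using reg by (auto simp: regular_def)
  have e0: "0 < e" using lam by (simp add: e_def)
  have Z0: "0 \<le> ZZ r" unfolding ZZ_def using lam by (intro add_nonneg_nonneg) auto
  let ?Y = "\<lambda>m s. \<Sum>d\<in>fst s. \<Sum>b\<in>snd s. (Tr ^^ m) (t d) b"
  have "Ex r (init J1) (\<lambda>s. \<Sum>J2\<in>JS. bexp p KS (\<lambda>H. \<Sum>J\<in>taint (fst s) H r J2. of_bool (J \<in> snd s))) \<le>
     Ex r (init J1) (\<lambda>s. (3 * real q * real r) * (\<Sum>m<r. lam ^ (r - m) * ?Y m s))"
  proof (rule Ex_mono_pre[OF pre_init[OF J1]])
    fix D G assume pre: "pre D G"
    hence sub: "D \<subseteq> JS" "G \<subseteq> JS" "D \<inter> G = {}" by (auto simp: pre_def)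
    let ?h = "\<lambda>J. of_bool (J \<in> G) :: real"
    have "(\<Sum>J2\<in>JS. bexp p KS (\<lambda>H. \<Sum>J\<in>taint D H r J2. ?h J)) \<le> (\<Sum>J2\<in>JS. Fc D ?h r J2)"
    proof (rule sum_mono)
      fix J2 assume "J2 \<in> JS"
      thus "bexp p KS (\<lambda>H. \<Sum>J\<in>taint D H r J2. ?h J) \<le> Fc D ?h r J2"
        using taint_potential[of "{}" "{J2}" "{}" ?h D r] by (simp add: pre_def taint_def)
    qed
    also have "\<dots> \<le> 3 * real q * real r * (\<Sum>m<r. lam ^ (r - m) * (\<Sum>d\<in>D. \<Sum>b\<in>G. (Tr ^^ m) (t d) b))"
      by (rule sum_Fc[OF sub lam])
    finally show "(\<Sum>J2\<in>JS. bexp p KS (\<lambda>H. \<Sum>J\<in>taint (fst (D, G)) H r J2. of_bool (J \<in> snd (D, G)))) \<le>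
       (3 * real q * real r) * (\<Sum>m<r. lam ^ (r - m) * ?Y m (D, G))" by simp
  qed
  also have "\<dots> = (3 * real q * real r) * (\<Sum>m<r. lam ^ (r - m) * Ex r (init J1) (?Y m))"
    unfolding Ex_cmult Ex_sum ..
  also have "\<dots> \<le> (3 * real q * real r) * (\<Sum>m<r. 4 * real q * lam ^ (2 * r) * ZZ r)"
  proof (intro mult_left_mono sum_mono)
    fix m assume m: "m \<in> {..<r}"
    have "lam ^ (r - m) * Ex r (init J1) (?Y m) \<le> lam ^ (r - m) * (4 * real q * lam ^ (r + m) * ZZ r)"
      unfolding Ex_init ZZ_def using lam by (intro mult_left_mono pair_dead_front[OF reg J1]) auto
    also have "\<dots> = 4 * real q * (lam ^ (r - m) * lam ^ (r + m)) * ZZ r" by (simp only: mult_ac)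
    also have "lam ^ (r - m) * lam ^ (r + m) = lam ^ (2 * r)" using m by (simp add: mult_2 flip: power_add)
    finally show "lam ^ (r - m) * Ex r (init J1) (?Y m) \<le> 4 * real q * lam ^ (2 * r) * ZZ r" .
  qed (use lam in auto)
  also have "\<dots> = 12 * real q ^ 2 * real r ^ 2 * lam ^ (2 * r) * ZZ r"
    by (simp add: power2_eq_square)
  finally show ?thesis .
qed

end

section \<open>Vertex symmetry\<close>

lemma jsub_image:
  assumes "inj \<pi>" shows "jsub j (\<pi> ` K) = (`) \<pi> ` jsub j K"
proof
  show "(`) \<pi> ` jsub j K \<subseteq> jsub j (\<pi> ` K)"
    using assms by (auto simp: jsub_def card_image inj_on_subset[OF assms])
  show "jsub j (\<pi> ` K) \<subseteq> (`) \<pi> ` jsub j K"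
  proof
    fix J assume "J \<in> jsub j (\<pi> ` K)"
    then obtain L where "L \<subseteq> K" "J = \<pi> ` L" "card J = j" by (auto simp: jsub_def subset_image_iff)
    thus "J \<in> (`) \<pi> ` jsub j K" using card_image[OF inj_on_subset[OF assms], of L] by (auto simp: jsub_def)
  qed
qed

lemma ksets_image:
  assumes "\<pi> permutes {..<n}" "K \<in> ksets n k" shows "\<pi> ` K \<in> ksets n k"
proof -
  have "inj \<pi>" using assms(1) by (rule permutes_inj)
  hence "card (\<pi> ` K) = card K" by (metis card_image inj_on_subset subset_UNIV)
  moreover have "\<pi> ` K \<subseteq> {..<n}" using permutes_image[OF assms(1)] assms(2) by (auto simp: ksets_def)
  ultimately show ?thesis using assms(2) by (simp add: ksets_def)
qed

lemma bij_ksets: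
  assumes "\<pi> permutes {..<n}" shows "bij_betw ((`) \<pi>) (ksets n k) (ksets n k)"
proof -
  have "inj ((`) \<pi>)" using permutes_inj[OF assms] by (simp add: inj_image_eq_iff inj_def)
  hence "inj_on ((`) \<pi>) (ksets n k)" by (rule inj_on_subset) auto
  moreover have "(`) \<pi> ` ksets n k \<subseteq> ksets n k" using ksets_image[OF assms] by auto
  ultimately show ?thesis
    by (simp add: bij_betw_def endo_inj_surj)
qed

text \<open>The membership pattern of a vertex in two j-sets takes four values, and the sizes of the
  four classes depend on the intersection size only; so the patterns agree up to a permutation of
  the vertices.\<close>

lemma permute_pair:
  assumes "b \<in> ksets n j" "b' \<in> ksets n j" "c \<in> ksets n j" "c' \<in> ksets n j" "card (b \<inter> b') = card (c \<inter> c')"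
  obtains \<pi> where "\<pi> permutes {..<n}" "\<pi> ` b = c" "\<pi> ` b' = c'"
proof -
  let ?f = "\<lambda>x. (x \<in> b, x \<in> b')" and ?g = "\<lambda>x. (x \<in> c, x \<in> c')"
  have fiber: "count (image_mset f (mset_set {..<n})) v = card {x \<in> {..<n}. f x = v}" for f :: "nat \<Rightarrow> bool \<times> bool" and v
    by (simp add: count_image_mset vimage_def Int_def conj_commute)
  have fin: "finite b" "finite b'" "finite c" "finite c'" using assms ksets_finite_elem by auto
  have fc: "card {x \<in> {..<n}. (x \<in> b, x \<in> b') = (u, w)} = 
      (if u then if w then card (b \<inter> b') else j - card (b \<inter> b') else if w then j - card (b \<inter> b') else n - (j + j - card (b \<inter> b')))"
    if "b \<in> ksets n j" "b' \<in> ksets n j" for b b' :: "nat set" and u w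
  proof -
    have f: "finite b" "finite b'" using that ksets_finite_elem by auto
    have s: "b \<subseteq> {..<n}" "b' \<subseteq> {..<n}" "card b = j" "card b' = j" using that by (auto simp: ksets_def)
    have c: "card {x \<in> {..<n}. (x \<in> b, x \<in> b') = (True, True)} = card (b \<inter> b')" 
      "card {x \<in> {..<n}. (x \<in> b, x \<in> b') = (True, False)} = card (b - b')"
      "card {x \<in> {..<n}. (x \<in> b, x \<in> b') = (False, True)} = card (b' - b)"
      "card {x \<in> {..<n}. (x \<in> b, x \<in> b') = (False, False)} = card ({..<n} - (b \<union> b'))"
      using s(1,2) by (auto intro!: arg_cong[where f = card])
    have d: "card (b - b') = j - card (b \<inter> b')" using card_Diff_subset_Int[of b b'] f s by simp
    have d': "card (b' - b) = j - card (b \<inter> b')" using card_Diff_subset_Int[of b' b] f s by (simp add: Int_commute)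
    have d'': "card ({..<n} - (b \<union> b')) = n - (j + j - card (b \<inter> b'))"
    proof -
      have "card (b \<union> b') = j + j - card (b \<inter> b')" using card_Un_Int[OF f] s by simp
      moreover have "card ({..<n} - (b \<union> b')) = card {..<n} - card (b \<union> b')"
        using f s by (intro card_Diff_subset) auto
      ultimately show ?thesis by simp
    qed
    show ?thesis by (cases u; cases w; simp only: c d d' d'' if_True if_False)
  qed
  have "image_mset ?f (mset_set {..<n}) = image_mset ?g (mset_set {..<n})"
  proof (rule multiset_eqI)
    fix v :: "bool \<times> bool"
    obtain u w where v: "v = (u, w)" by (cases v)
    show "count (image_mset ?f (mset_set {..<n})) v = count (image_mset ?g (mset_set {..<n})) v"
      unfolding fiber v fc[OF assms(1,2)] fc[OF assms(3,4)] assms(5) ..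
  qed
  then obtain \<pi> where p: "\<pi> permutes {..<n}" "\<forall>x\<in>{..<n}. ?f x = ?g (\<pi> x)"
    by (rule image_mset_eq_implies_permutes[rotated]) auto
  have img: "\<pi> ` B = C" if "B \<in> ksets n j" "C \<in> ksets n j" "\<And>x. x < n \<Longrightarrow> x \<in> B \<longleftrightarrow> \<pi> x \<in> C" for B C
  proof -
    have "\<pi> ` B \<subseteq> C" using that by (auto simp: ksets_def)
    moreover have "card (\<pi> ` B) = card C"
      using card_image[OF inj_on_subset[OF permutes_inj[OF p(1)]], of B] that by (auto simp: ksets_def)
    ultimately show ?thesis using card_subset_eq[of C "\<pi> ` B"] that ksets_finite_elem by auto
  qed
  have "\<pi> ` b = c" by (rule img) (use p(2) assms in auto)
  moreover have "\<pi> ` b' = c'" by (rule img) (use p(2) assms in auto)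
  ultimately show ?thesis using that[OF p(1)] by blast
qed

context hyp begin

lemma run_image:
  assumes "\<pi> permutes {..<n}"
  shows "run ((`) ((`) \<pi>) H) i (map_prod ((`) ((`) \<pi>)) ((`) ((`) \<pi>)) s) = map_prod ((`) ((`) \<pi>)) ((`) ((`) \<pi>)) (run H i s)"
proof (induction i arbitrary: s)
  case (Suc i)
  let ?P = "(`) \<pi> :: nat set \<Rightarrow> nat set"
  obtain D G where s: "s = (D, G)" by (cases s)
  have inj: "inj \<pi>" using assms by (rule permutes_inj)
  have injP: "inj ?P" using inj by (simp add: inj_image_eq_iff inj_def)
  have sub: "?P A \<subseteq> ?P B \<longleftrightarrow> A \<subseteq> B" for A B using inj by (simp add: inj_image_subset_iff)
  have KSP: "?P K \<in> KS \<longleftrightarrow> K \<in> KS" for K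
  proof
    assume "?P K \<in> KS"
    hence "?P K \<in> ?P ` KS" using bij_ksets[OF assms, of k] by (simp only: bij_betw_def)
    then obtain K' where "?P K = ?P K'" "K' \<in> KS" by (rule imageE)
    thus "K \<in> KS" using injD[OF injP] by metis
  qed (rule ksets_image[OF assms])
  have fr: "?P K \<in> KK (?P ` D) (?P ` G) \<longleftrightarrow> K \<in> KK D G" for K
    by (auto simp: KK_def free_def KSP sub)
  have 1: "?P ` H \<inter> KK (?P ` D) (?P ` G) = ?P ` (H \<inter> KK D G)"
    using fr by auto
  have 2: "nw j (?P ` H) (?P ` G) = ?P ` nw j H G" for H
    unfolding nw_def by (simp add: image_set_diff[OF injP] image_UN jsub_image[OF inj])
  show ?case using Suc[of "(D \<union> G, nw j (H \<inter> KK D G) G)"] by (simp add: s 1 2 image_Un)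
qed simp

text \<open>\<open>N\<close> times the expectation for a uniform root; for a fixed root the law of
  the dead set is not invariant under vertex permutations.\<close>

definition GG :: "nat \<Rightarrow> (nat set set \<Rightarrow> real) \<Rightarrow> real" where
  "GG r \<phi> = (\<Sum>J\<in>JS. Ex r (init J) (\<lambda>s. \<phi> (fst s)))"

lemma GG_image:
  assumes "\<pi> permutes {..<n}"
  shows "GG r (\<lambda>X. \<phi> ((`) \<pi> ` X)) = GG r \<phi>"
proof -
  let ?P = "(`) \<pi> :: nat set \<Rightarrow> nat set"
  have "GG r (\<lambda>X. \<phi> (?P ` X)) = (\<Sum>J\<in>JS. bexp p KS (\<lambda>H. \<phi> (fst (run (?P ` H) r (init (?P J))))))"
    unfolding GG_def Ex_init
  proof (intro sum.cong refl bexp_cong)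
    fix J H
    have "run (?P ` H) r (init (?P J)) = map_prod ((`) ?P) ((`) ?P) (run H r (init J))"
      using run_image[OF assms, of H r "init J"] by (simp add: init_def)
    thus "\<phi> (?P ` fst (run H r (init J))) = \<phi> (fst (run (?P ` H) r (init (?P J))))" by simp
  qed
  also have "\<dots> = (\<Sum>J\<in>JS. bexp p KS (\<lambda>H. \<phi> (fst (run H r (init (?P J))))))"
  proof (rule sum.cong[OF refl])
    fix J
    show "bexp p KS (\<lambda>H. \<phi> (fst (run (?P ` H) r (init (?P J))))) = bexp p KS (\<lambda>H. \<phi> (fst (run H r (init (?P J)))))"
      by (rule bexp_permute[OF finite_ksets bij_ksets[OF assms], where f = "\<lambda>H. \<phi> (fst (run H r (init (?P J))))"])
  qed
  also have "\<dots> = GG r \<phi>"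
    unfolding GG_def Ex_init
    by (rule sum.reindex_bij_betw[OF bij_ksets[OF assms], of "\<lambda>J. bexp p KS (\<lambda>H. \<phi> (fst (run H r (init J))))"])
  finally show ?thesis .
qed

lemma GG_mono:
  assumes "\<And>X. X \<subseteq> JS \<Longrightarrow> \<phi> X \<le> \<psi> X" shows "GG r \<phi> \<le> GG r \<psi>"
  unfolding GG_def by (intro sum_mono Ex_mono) (use assms in auto)

lemma GG_cong:
  assumes "\<And>X. X \<subseteq> JS \<Longrightarrow> \<phi> X = \<psi> X" shows "GG r \<phi> = GG r \<psi>"
  using assms by (intro antisym GG_mono) auto

lemma GG_add: "GG r (\<lambda>X. \<phi> X + \<psi> X) = GG r \<phi> + GG r \<psi>"
  by (simp add: GG_def Ex_add sum.distrib)

lemma GG_cmult: "GG r (\<lambda>X. c * \<phi> X) = c * GG r \<phi>"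
  by (simp add: GG_def Ex_cmult sum_distrib_left)

lemma GG_sum: "GG r (\<lambda>X. \<Sum>i\<in>I. \<phi> i X) = (\<Sum>i\<in>I. GG r (\<phi> i))"
  unfolding GG_def Ex_sum by (rule sum.swap)

text \<open>The relations of the Johnson scheme, which are the orbits of pairs of j-sets under
  vertex permutations; \<open>nu l\<close> is the relative valency of such a relation.\<close>

definition isz :: "nat \<Rightarrow> nat set \<Rightarrow> nat set \<Rightarrow> real" where
  "isz l J J' = of_bool (card (J \<inter> J') = l)"

definition pst :: "nat \<Rightarrow> nat set set \<Rightarrow> real" where
  "pst l X = (\<Sum>J\<in>X. \<Sum>J'\<in>X. isz l J J')"

definition nu :: "nat \<Rightarrow> real" where "nu l = avg (isz l {..<j})"

lemma base_mem: "{..<j} \<in> JS" using nk jk by (auto simp: ksets_def)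

lemma isz_sym: "isz l J J' = isz l J' J" by (simp add: isz_def Int_commute)

lemma avg_isz:
  assumes "J \<in> JS" shows "avg (isz l J) = nu l"
proof -
  have "card ({..<j} \<inter> {..<j}) = card (J \<inter> J)" using assms by (auto simp: ksets_def)
  then obtain \<pi> where p: "\<pi> permutes {..<n}" "\<pi> ` {..<j} = J" "\<pi> ` {..<j} = J"
    using permute_pair[OF base_mem base_mem assms assms] by metis
  have inj: "inj \<pi>" using p by (simp add: permutes_inj)
  have "(\<Sum>J'\<in>JS. isz l J J') = (\<Sum>J'\<in>JS. isz l J (\<pi> ` J'))"
    by (rule sum.reindex_bij_betw[OF bij_ksets[OF p(1)], symmetric])
  also have "\<dots> = (\<Sum>J'\<in>JS. isz l {..<j} J')"
  proof (rule sum.cong[OF refl])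
    fix J'
    have "J \<inter> \<pi> ` J' = \<pi> ` ({..<j} \<inter> J')" using p image_Int[OF inj] by auto
    hence "card (J \<inter> \<pi> ` J') = card ({..<j} \<inter> J')" using card_image[OF inj_on_subset[OF inj]] by auto
    thus "isz l J (\<pi> ` J') = isz l {..<j} J'" by (simp add: isz_def)
  qed
  finally show ?thesis by (simp add: avg_def nu_def)
qed

lemma meeting_count: "(\<Sum>J'\<in>JS. of_bool ({..<j} \<inter> J' \<noteq> {})) \<le> real j ^ 2 / real n * real N"
proof -
  have "(\<Sum>J'\<in>JS. of_bool ({..<j} \<inter> J' \<noteq> {})) \<le> (\<Sum>J'\<in>JS. \<Sum>v<j. of_bool (v \<in> J') :: real)"
  proof (rule sum_mono)
    fix J' :: "nat set"
    show "of_bool ({..<j} \<inter> J' \<noteq> {}) \<le> (\<Sum>v<j. of_bool (v \<in> J') :: real)"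
    proof (cases "{..<j} \<inter> J' = {}")
      case False
      then obtain v where "v < j" "v \<in> J'" by auto
      hence "of_bool (v \<in> J') \<le> (\<Sum>v<j. of_bool (v \<in> J') :: real)" by (intro member_le_sum) auto
      thus ?thesis using \<open>v \<in> J'\<close> by simp
    qed (simp add: sum_nonneg)
  qed
  also have "\<dots> = (\<Sum>v<j. real ((n - 1) choose (j - 1)))"
  proof (subst sum.swap, rule sum.cong[OF refl])
    fix v assume v: "v \<in> {..<j}"
    have "(\<Sum>J'\<in>JS. of_bool (v \<in> J') :: real) = real (card {J' \<in> JS. {v} \<subseteq> J'})"
      by (subst sum_of_bool_eq) (auto simp: Int_def)
    thus "(\<Sum>J'\<in>JS. of_bool (v \<in> J') :: real) = real ((n - 1) choose (j - 1))"
      using card_supersets[of "{v}" n j] v nk jk j1 by simp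
  qed
  also have "\<dots> = real j * real ((n - 1) choose (j - 1))" by simp
  also have "\<dots> = real j ^ 2 / real n * real N"
  proof -
    have e: "Suc (n - 1) = n" "Suc (j - 1) = j" using nk jk j1 by auto
    have "j * N = n * ((n - 1) choose (j - 1))"
      using Suc_times_binomial[of "j - 1" "n - 1"] unfolding e N_def .
    hence "real j * real N = real n * real ((n - 1) choose (j - 1))" by (simp only: flip: of_nat_mult)
    thus ?thesis using nk jk by (simp add: field_simps power2_eq_square)
  qed
  finally show ?thesis .
qed

lemma nu_le: "1 \<le> l \<Longrightarrow> nu l \<le> real j ^ 2 / real n"
proof -
  assume l: "1 \<le> l"
  have "(\<Sum>J'\<in>JS. isz l {..<j} J') \<le> (\<Sum>J'\<in>JS. of_bool ({..<j} \<inter> J' \<noteq> {}))"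
    using l by (intro sum_mono) (auto simp: isz_def of_bool_def)
  also have "\<dots> \<le> real j ^ 2 / real n * real N" by (rule meeting_count)
  finally show ?thesis using N_pos by (simp add: nu_def avg_def divide_le_eq)
qed

lemma nu0_ge: "1 - real j ^ 2 / real n \<le> nu 0"
proof -
  have "(\<Sum>J'\<in>JS. isz 0 {..<j} J') = (\<Sum>J'\<in>JS. 1 - of_bool ({..<j} \<inter> J' \<noteq> {}))"
    by (intro sum.cong refl) (auto simp: isz_def)
  also have "\<dots> = real N - (\<Sum>J'\<in>JS. of_bool ({..<j} \<inter> J' \<noteq> {}))" by (simp add: sum_subtractf card_JS)
  finally have "nu 0 * real N \<ge> real N - real j ^ 2 / real n * real N"
    using meeting_count N_pos by (simp add: nu_def avg_def)
  hence "(1 - real j ^ 2 / real n) * real N \<le> nu 0 * real N" by (simp add: algebra_simps)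
  thus ?thesis using N_pos by simp
qed

text \<open>One witness suffices: an interval shifted so as to share exactly \<open>l\<close>
  vertices with the base set. The bound makes division by \<open>nu l\<close> affordable.\<close>

lemma nu_ge:
  assumes "l \<le> j" shows "1 / real N \<le> nu l"
proof -
  let ?J = "{j - l..<2 * j - l}"
  have J: "?J \<in> JS" using nk jk assms by (auto simp: ksets_def)
  have "{..<j} \<inter> ?J = {j - l..<j}" using assms by auto
  hence "isz l {..<j} ?J = 1" using assms by (simp add: isz_def)
  moreover have "isz l {..<j} ?J \<le> (\<Sum>J'\<in>JS. isz l {..<j} J')"
    using J by (intro member_le_sum) (auto simp: isz_def)
  ultimately show ?thesis by (simp add: nu_def avg_def divide_right_mono)
qed

lemma isz_total:
  assumes "J \<in> JS" shows "(\<Sum>l\<le>j. isz l J J') = 1"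
proof -
  have "card (J \<inter> J') \<le> card J" using ksets_finite_elem[OF assms] by (intro card_mono) auto
  hence "card (J \<inter> J') \<in> {..j}" using assms by (simp add: ksets_def)
  thus ?thesis by (simp add: isz_def of_bool_def)
qed

lemma pst_zero_le: "finite X \<Longrightarrow> pst l X \<le> real (card X) ^ 2"
proof -
  assume "finite X"
  have "pst l X \<le> (\<Sum>J\<in>X. \<Sum>J'\<in>X. 1)" unfolding pst_def by (intro sum_mono) (auto simp: isz_def)
  thus ?thesis by (simp add: power2_eq_square)
qed

lemma pst_nonneg: "0 \<le> pst l X"
  unfolding pst_def isz_def by (intro sum_nonneg) auto

text \<open>Since the law of the dead set is invariant under vertex permutations, the second moment of its
  intersection with a fixed set B only involves the pair statistics of both sets.\<close>

lemma hit_chebyshev: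
  assumes B: "B \<subseteq> JS" "B \<noteq> {}" and T: "0 < T"
  shows "GG r (\<lambda>X. of_bool (T \<le> real (card X) \<and> real (card (X \<inter> B)) < real (card X) * real (card B) / (2 * real N))) \<le>
    4 * (1 / nu 0 - 1) * GG r (\<lambda>X. of_bool (T \<le> real (card X))) + 
    4 / (real (card B) ^ 2 * T ^ 2) * (\<Sum>l=1..j. pst l B * GG r (pst l) / nu l)"
proof -
  let ?N = "real N" and ?b = "real (card B)"
  have Np: "0 < ?N" using N_pos by simp
  have finB: "finite B" using B finite_JS_sub by auto
  have bp: "0 < ?b" using B finB by (simp add: card_gt_0_iff)
  \<comment> \<open>The weight \<open>1 / card X ^ 2\<close> turns hits into relative hits
    \<open>card (X \<inter> B) / card X\<close>, to be compared with
    \<open>card B / N\<close>.\<close>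
  define w where "w X = of_bool (T \<le> real (card X)) / real (card X) ^ 2" for X :: "nat set set"
  define g where "g = GG r (\<lambda>X. of_bool (T \<le> real (card X)))"
  define R where "R b b' = GG r (\<lambda>X. w X * of_bool (b \<in> X \<and> b' \<in> X))" for b b'
  have w0: "0 \<le> w X" for X by (simp add: w_def)
  have wT: "w X \<le> 1 / T ^ 2" for X
  proof (cases "T \<le> real (card X)")
    case True
    thus ?thesis using T by (auto simp: w_def intro!: divide_left_mono power_mono)
  qed (use T in \<open>simp add: w_def\<close>)
  have wc: "w X * real (card X) ^ 2 = of_bool (T \<le> real (card X))" for X
    using T by (auto simp: w_def)
  have nup: "0 < nu l" if "l \<le> j" for l using nu_ge[OF that] Np by (meson divide_pos_pos less_le_trans zero_less_one)
  have Rinv: "R b b' = R c c'" if bc: "b \<in> JS" "b' \<in> JS" "c \<in> JS" "c' \<in> JS" "card (b \<inter> b') = card (c \<inter> c')" for b b' c c'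
  proof -
    obtain \<pi> where p: "\<pi> permutes {..<n}" "\<pi> ` b = c" "\<pi> ` b' = c'" using permute_pair[OF bc] .
    have inj: "inj ((`) \<pi>)" using permutes_inj[OF p(1)] by (simp add: inj_image_eq_iff inj_def)
    have "R c c' = GG r (\<lambda>X. w ((`) \<pi> ` X) * of_bool (c \<in> (`) \<pi> ` X \<and> c' \<in> (`) \<pi> ` X))"
      unfolding R_def by (rule GG_image[OF p(1), symmetric])
    also have "\<dots> = R b b'"
      unfolding R_def
    proof (intro GG_cong arg_cong2[where f = times])
      fix X :: "nat set set"
      have "card ((`) \<pi> ` X) = card X" using inj by (intro card_image inj_on_subset[OF inj]) auto
      thus "w ((`) \<pi> ` X) = w X" by (simp add: w_def)
      show "of_bool (c \<in> (`) \<pi> ` X \<and> c' \<in> (`) \<pi> ` X) = (of_bool (b \<in> X \<and> b' \<in> X) :: real)"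
        using inj by (simp add: p(2,3)[symmetric] inj_image_mem_iff)
    qed
    finally show ?thesis by simp
  qed
  have msum: "(\<Sum>b\<in>A. \<Sum>b'\<in>A. isz l b b' * R b b') = GG r (\<lambda>X. w X * pst l (X \<inter> A))" if "finite A" for A l
  proof -
    have "(\<Sum>b\<in>A. \<Sum>b'\<in>A. isz l b b' * R b b') = GG r (\<lambda>X. \<Sum>b\<in>A. \<Sum>b'\<in>A. isz l b b' * (w X * of_bool (b \<in> X \<and> b' \<in> X)))"
      unfolding R_def GG_sum GG_cmult ..
    also have "\<dots> = GG r (\<lambda>X. w X * pst l (X \<inter> A))"
    proof (rule GG_cong)
      fix X :: "nat set set"
      have "pst l (X \<inter> A) = (\<Sum>b\<in>A. \<Sum>b'\<in>A. isz l b b' * of_bool (b \<in> X \<and> b' \<in> X))"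
      proof -
        have "(\<Sum>b\<in>A. \<Sum>b'\<in>A. isz l b b' * of_bool (b \<in> X \<and> b' \<in> X)) = (\<Sum>b\<in>A. of_bool (b \<in> X) * (\<Sum>b'\<in>A. of_bool (b' \<in> X) * isz l b b'))"
          unfolding sum_distrib_left by (intro sum.cong refl) auto
        also have "\<dots> = (\<Sum>b\<in>X \<inter> A. \<Sum>b'\<in>A. of_bool (b' \<in> X) * isz l b b')"
          using that by (intro sum.mono_neutral_cong_right) auto
        also have "\<dots> = (\<Sum>b\<in>X \<inter> A. \<Sum>b'\<in>X \<inter> A. isz l b b')"
          by (rule sum.cong[OF refl], rule sum.mono_neutral_cong_right) (use that in auto)
        finally show ?thesis by (simp add: pst_def)
      qed
      thus "(\<Sum>b\<in>A. \<Sum>b'\<in>A. isz l b b' * (w X * of_bool (b \<in> X \<and> b' \<in> X))) = w X * pst l (X \<inter> A)"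
        by (simp add: sum_distrib_left mult_ac)
    qed
    finally show ?thesis .
  qed
  \<comment> \<open>\<open>R\<close> is constant on each relation, so its value is the total over
    the relation, a pair statistic of \<open>X\<close>, divided by the number
    \<open>N ^ 2 * nu l\<close> of pairs.\<close>
  have Rval: "R b b' = GG r (\<lambda>X. w X * pst l X) / (?N ^ 2 * nu l)" if bb: "b \<in> JS" "b' \<in> JS" "card (b \<inter> b') = l" for b b' l
  proof -
    have lj: "l \<le> j" 
    proof -
      have "card (b \<inter> b') \<le> card b" using ksets_finite_elem[OF bb(1)] by (intro card_mono) auto
      thus ?thesis using bb by (simp add: ksets_def)
    qed
    have "(\<Sum>c\<in>JS. \<Sum>c'\<in>JS. isz l c c' * R c c') = (\<Sum>c\<in>JS. \<Sum>c'\<in>JS. isz l c c' * R b b')"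
    proof (intro sum.cong refl)
      fix c c' assume c: "c \<in> JS" "c' \<in> JS"
      show "isz l c c' * R c c' = isz l c c' * R b b'"
        using Rinv[OF c bb(1,2)] bb(3) by (cases "card (c \<inter> c') = l") (auto simp: isz_def)
    qed
    also have "\<dots> = (\<Sum>c\<in>JS. avg (isz l c) * ?N) * R b b'"
    proof -
      have "avg h * ?N = (\<Sum>J\<in>JS. h J)" for h using Np by (simp add: avg_def)
      thus ?thesis by (simp only: sum_distrib_right)
    qed
    also have "\<dots> = ?N ^ 2 * nu l * R b b'" by (simp add: avg_isz card_JS power2_eq_square)
    finally have "?N ^ 2 * nu l * R b b' = GG r (\<lambda>X. w X * pst l (X \<inter> JS))" using msum[of JS l] by simp
    also have "\<dots> = GG r (\<lambda>X. w X * pst l X)" by (intro GG_cong) (simp add: Int_absorb2)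
    finally show ?thesis using Np nup[OF lj] by (simp add: field_simps)
  qed
  have sq: "GG r (\<lambda>X. w X * real (card (X \<inter> B)) ^ 2) = (\<Sum>l\<le>j. pst l B * GG r (\<lambda>X. w X * pst l X) / (?N ^ 2 * nu l))"
  proof -
    have "GG r (\<lambda>X. w X * real (card (X \<inter> B)) ^ 2) = GG r (\<lambda>X. \<Sum>l\<le>j. w X * pst l (X \<inter> B))"
    proof (rule GG_cong)
      fix X assume X: "X \<subseteq> JS"
      have "(\<Sum>l\<le>j. pst l (X \<inter> B)) = (\<Sum>b\<in>X \<inter> B. \<Sum>b'\<in>X \<inter> B. \<Sum>l\<le>j. isz l b b')"
        unfolding pst_def by (subst sum.swap, intro sum.cong refl, rule sum.swap)
      also have "\<dots> = (\<Sum>b\<in>X \<inter> B. \<Sum>b'\<in>X \<inter> B. 1)"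
        using X by (intro sum.cong refl isz_total) auto
      also have "\<dots> = real (card (X \<inter> B)) ^ 2" by (simp add: power2_eq_square)
      finally show "w X * real (card (X \<inter> B)) ^ 2 = (\<Sum>l\<le>j. w X * pst l (X \<inter> B))"
        by (simp add: sum_distrib_left[symmetric])
    qed
    also have "\<dots> = (\<Sum>l\<le>j. \<Sum>b\<in>B. \<Sum>b'\<in>B. isz l b b' * R b b')"
      unfolding GG_sum msum[OF finB] ..
    also have "\<dots> = (\<Sum>l\<le>j. \<Sum>b\<in>B. \<Sum>b'\<in>B. isz l b b' * (GG r (\<lambda>X. w X * pst l X) / (?N ^ 2 * nu l)))"
    proof (intro sum.cong refl)
      fix l b b' assume "b \<in> B" "b' \<in> B"
      hence bJ: "b \<in> JS" "b' \<in> JS" using B by auto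
      show "isz l b b' * R b b' = isz l b b' * (GG r (\<lambda>X. w X * pst l X) / (?N ^ 2 * nu l))"
        using Rval[OF bJ] by (cases "card (b \<inter> b') = l") (auto simp: isz_def)
    qed
    also have "\<dots> = (\<Sum>l\<le>j. pst l B * GG r (\<lambda>X. w X * pst l X) / (?N ^ 2 * nu l))"
      by (simp add: pst_def sum_distrib_right sum_divide_distrib)
    finally show ?thesis .
  qed
  have lin: "GG r (\<lambda>X. w X * real (card X) * real (card (X \<inter> B))) = ?b * g / ?N"
  proof -
    define Q where "Q b = GG r (\<lambda>X. w X * real (card X) * of_bool (b \<in> X))" for b
    have Qinv: "Q b = Q c" if bc: "b \<in> JS" "c \<in> JS" for b c
    proof -
      have "card (b \<inter> b) = card (c \<inter> c)" using bc by (simp add: ksets_def)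
      then obtain \<pi> where p: "\<pi> permutes {..<n}" "\<pi> ` b = c" "\<pi> ` b = c"
        using permute_pair[OF bc(1,1,2,2)] by metis
      have inj: "inj ((`) \<pi>)" using permutes_inj[OF p(1)] by (simp add: inj_image_eq_iff inj_def)
      have "Q c = GG r (\<lambda>X. w ((`) \<pi> ` X) * real (card ((`) \<pi> ` X)) * of_bool (c \<in> (`) \<pi> ` X))"
        unfolding Q_def by (rule GG_image[OF p(1), symmetric])
      also have "\<dots> = Q b"
        unfolding Q_def
      proof (intro GG_cong arg_cong2[where f = times])
        fix X :: "nat set set"
        show cX: "real (card ((`) \<pi> ` X)) = real (card X)" using inj by (simp add: card_image inj_on_subset[OF inj])
        thus "w ((`) \<pi> ` X) = w X" by (simp add: w_def)
        show "of_bool (c \<in> (`) \<pi> ` X) = (of_bool (b \<in> X) :: real)"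
          using inj by (simp add: p(2)[symmetric] inj_image_mem_iff)
      qed
      finally show ?thesis by simp
    qed
    have Qsum: "(\<Sum>b\<in>A. Q b) = GG r (\<lambda>X. w X * real (card X) * real (card (X \<inter> A)))" if "finite A" for A
    proof -
      have "(\<Sum>b\<in>A. of_bool (b \<in> X)) = real (card (X \<inter> A))" for X
      proof -
        have "A \<inter> {b. b \<in> X} = X \<inter> A" by auto
        thus ?thesis using that by (subst sum_of_bool_eq) auto
      qed
      thus ?thesis unfolding Q_def GG_sum[symmetric] sum_distrib_left[symmetric] by simp
    qed
    obtain b0 where b0: "b0 \<in> B" using B by auto
    hence b0J: "b0 \<in> JS" using B by auto
    have "?N * Q b0 = (\<Sum>b\<in>JS. Q b)" using Qinv[OF _ b0J] by (simp add: card_JS)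
    also have "\<dots> = g" unfolding Qsum[OF finite_ksets] g_def
      by (rule GG_cong) (simp add: Int_absorb2 wc[symmetric] power2_eq_square mult.assoc)
    finally have "Q b0 = g / ?N" using Np by (simp add: field_simps)
    moreover have "(\<Sum>b\<in>B. Q b) = (\<Sum>b\<in>B. Q b0)" using B b0J by (intro sum.cong refl Qinv) auto
    ultimately show ?thesis using Qsum[OF finB] by simp
  qed
  have GGp: "0 \<le> GG r (\<lambda>X. w X * pst l X)" for l
    using GG_mono[of "\<lambda>_. 0" "\<lambda>X. w X * pst l X" r] w0 pst_nonneg by (simp add: GG_def)
  have var: "GG r (\<lambda>X. w X * (real (card (X \<inter> B)) - real (card X) * ?b / ?N) ^ 2) \<le>
     ?b ^ 2 / ?N ^ 2 * (1 / nu 0 - 1) * g + (\<Sum>l=1..j. pst l B * GG r (pst l) / (T ^ 2 * ?N ^ 2 * nu l))"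
  proof -
    have "GG r (\<lambda>X. w X * (real (card (X \<inter> B)) - real (card X) * ?b / ?N) ^ 2) = 
      GG r (\<lambda>X. w X * real (card (X \<inter> B)) ^ 2 + ((- 2 * ?b / ?N) * (w X * real (card X) * real (card (X \<inter> B))) + (?b ^ 2 / ?N ^ 2) * of_bool (T \<le> real (card X))))"
      by (rule GG_cong) (simp add: wc[symmetric] power2_eq_square algebra_simps)
    also have "\<dots> = GG r (\<lambda>X. w X * real (card (X \<inter> B)) ^ 2) - ?b ^ 2 / ?N ^ 2 * g"
      unfolding GG_add GG_cmult lin g_def[symmetric] by (simp add: power2_eq_square)
    also have "GG r (\<lambda>X. w X * real (card (X \<inter> B)) ^ 2) \<le> ?b ^ 2 / ?N ^ 2 * (1 / nu 0) * g + (\<Sum>l=1..j. pst l B * GG r (pst l) / (T ^ 2 * ?N ^ 2 * nu l))"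
    proof -
      \<comment> \<open>Disjoint pairs reproduce the squared mean up to the factor
        \<open>1 / nu 0\<close>; intersecting pairs are rare and tolerate the crude weight
        \<open>1 / T ^ 2\<close>.\<close>
      have "GG r (\<lambda>X. w X * real (card (X \<inter> B)) ^ 2) = pst 0 B * GG r (\<lambda>X. w X * pst 0 X) / (?N ^ 2 * nu 0) 
         + (\<Sum>l=1..j. pst l B * GG r (\<lambda>X. w X * pst l X) / (?N ^ 2 * nu l))"
        unfolding sq atMost_atLeast0 by (subst sum.atLeast_Suc_atMost) auto
      also have "\<dots> \<le> ?b ^ 2 * g / (?N ^ 2 * nu 0) + (\<Sum>l=1..j. pst l B * (1 / T ^ 2 * GG r (pst l)) / (?N ^ 2 * nu l))"
      proof (intro add_mono sum_mono divide_right_mono mult_mono mult_left_mono pst_zero_le finB)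
        show "GG r (\<lambda>X. w X * pst 0 X) \<le> g" unfolding g_def
        proof (rule GG_mono)
          fix X assume "X \<subseteq> JS"
          hence "finite X" by (rule finite_JS_sub)
          thus "w X * pst 0 X \<le> of_bool (T \<le> real (card X))"
            unfolding wc[symmetric] by (intro mult_left_mono pst_zero_le w0)
        qed
        fix l
        show "GG r (\<lambda>X. w X * pst l X) \<le> 1 / T ^ 2 * GG r (pst l)"
          unfolding GG_cmult[symmetric] by (intro GG_mono mult_right_mono wT pst_nonneg)
      qed (use nup Np pst_nonneg GGp in \<open>auto simp: less_imp_le\<close>)
      also have "\<dots> = ?b ^ 2 / ?N ^ 2 * (1 / nu 0) * g + (\<Sum>l=1..j. pst l B * GG r (pst l) / (T ^ 2 * ?N ^ 2 * nu l))"
        by (simp add: mult_ac)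
      finally show ?thesis .
    qed
    finally have "GG r (\<lambda>X. w X * (real (card (X \<inter> B)) - real (card X) * ?b / ?N) ^ 2) \<le> 
      ?b ^ 2 / ?N ^ 2 * (1 / nu 0) * g + (\<Sum>l=1..j. pst l B * GG r (pst l) / (T ^ 2 * ?N ^ 2 * nu l)) - ?b ^ 2 / ?N ^ 2 * g"
      by simp
    moreover have "?b ^ 2 / ?N ^ 2 * (1 / nu 0 - 1) * g = ?b ^ 2 / ?N ^ 2 * (1 / nu 0) * g - ?b ^ 2 / ?N ^ 2 * g"
      by (simp only: right_diff_distrib left_diff_distrib mult_1_right)
    ultimately show ?thesis by linarith
  qed
  have "GG r (\<lambda>X. of_bool (T \<le> real (card X) \<and> real (card (X \<inter> B)) < real (card X) * ?b / (2 * ?N))) \<le>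
    GG r (\<lambda>X. (4 * ?N ^ 2 / ?b ^ 2) * (w X * (real (card (X \<inter> B)) - real (card X) * ?b / ?N) ^ 2))"
  proof (rule GG_mono)
    fix X :: "nat set set"
    let ?x = "real (card X)" and ?y = "real (card (X \<inter> B))"
    show "of_bool (T \<le> ?x \<and> ?y < ?x * ?b / (2 * ?N)) \<le> (4 * ?N ^ 2 / ?b ^ 2) * (w X * (?y - ?x * ?b / ?N) ^ 2)"
    proof (cases "T \<le> ?x \<and> ?y < ?x * ?b / (2 * ?N)")
      case True
      hence x: "0 < ?x" using T by linarith
      have "(?x * ?b / (2 * ?N)) ^ 2 \<le> (?x * ?b / ?N - ?y) ^ 2"
        using True Np bp x by (intro power_mono) (auto simp: field_simps)
      hence "(?x * ?b / (2 * ?N)) ^ 2 \<le> (?y - ?x * ?b / ?N) ^ 2" by (simp add: power2_commute)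
      hence "(4 * ?N ^ 2 / ?b ^ 2) * (w X * (?x * ?b / (2 * ?N)) ^ 2) \<le> (4 * ?N ^ 2 / ?b ^ 2) * (w X * (?y - ?x * ?b / ?N) ^ 2)"
        using w0 by (intro mult_left_mono) auto
      moreover have "(4 * ?N ^ 2 / ?b ^ 2) * (w X * (?x * ?b / (2 * ?N)) ^ 2) = 1"
        using True x bp Np by (simp add: w_def power_mult_distrib power_divide)
      ultimately have "1 \<le> (4 * ?N ^ 2 / ?b ^ 2) * (w X * (?y - ?x * ?b / ?N) ^ 2)" by linarith
      moreover have "of_bool (T \<le> ?x \<and> ?y < ?x * ?b / (2 * ?N)) = (1 :: real)" using True by simp
      ultimately show ?thesis by (simp only:)
    next
      case False
      have "0 \<le> (4 * ?N ^ 2 / ?b ^ 2) * (w X * (?y - ?x * ?b / ?N) ^ 2)" using w0 by (intro mult_nonneg_nonneg) auto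
      thus ?thesis using False by auto
    qed
  qed
  also have "\<dots> \<le> (4 * ?N ^ 2 / ?b ^ 2) * (?b ^ 2 / ?N ^ 2 * (1 / nu 0 - 1) * g + (\<Sum>l=1..j. pst l B * GG r (pst l) / (T ^ 2 * ?N ^ 2 * nu l)))"
    unfolding GG_cmult by (intro mult_left_mono var) auto
  also have "\<dots> = 4 * (1 / nu 0 - 1) * g + 4 / (?b ^ 2 * T ^ 2) * (\<Sum>l=1..j. pst l B * GG r (pst l) / nu l)"
    using bp Np T by (simp add: distrib_left sum_distrib_left field_simps)
  finally show ?thesis unfolding g_def .
qed

end

section \<open>Meeting of two explorations\<close>

lemma jconnected_mono: "jconnected H j J J' \<Longrightarrow> H \<subseteq> H' \<Longrightarrow> jconnected H' j J J'"
  unfolding jconnected_def by blast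

context hyp begin

lemma taint_subset:
  assumes "J0 \<in> JS" shows "taint A H r J0 \<subseteq> JS"
proof -
  have "snd (snd (runT A H r s)) \<subseteq> JS" if "snd (snd s) \<subseteq> JS" for s
    using that
  proof (induction r arbitrary: s)
    case (Suc r)
    obtain D G T where s: "s = (D, G, T)" by (cases s) auto
    have "tn A (H \<inter> KK D G) G T \<subseteq> nw j (H \<inter> KK D G) G" by (auto simp: tn_def)
    also have "\<dots> \<subseteq> JS" using KK_subset[of D G] by (intro nw_subset) auto
    finally show ?case using Suc by (simp add: s)
  qed simp
  thus ?thesis by (simp add: taint_def)
qed

definition good :: "real \<Rightarrow> real \<Rightarrow> nat set set \<times> nat set set \<Rightarrow> bool" where
  "good f T s \<longleftrightarrow> f \<le> real (card (snd s)) \<and> T \<le> real (card (fst s))"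

text \<open>A large dead set with at least half of the predicted hits has at least
  \<open>T * f / (2 * N)\<close> hits. If none of them is connected to \<open>J2\<close> through
  fresh hyperedges, all are tainted and the taint term is at least 1.\<close>

lemma hit_pointwise:
  fixes r :: nat
  assumes H: "H \<subseteq> KS" and J2: "J2 \<in> JS" and pre: "pre D B" and f: "0 < f" "f \<le> real (card B)" and T: "0 < T"
  defines "X \<equiv> fst (run H r (init J2))"
  shows "of_bool (T \<le> real (card X)) - of_bool (T \<le> real (card X) \<and> real (card (X \<inter> B)) < real (card X) * real (card B) / (2 * real N))
      - (2 * real N / (T * f)) * (\<Sum>J\<in>taint D H r J2. of_bool (J \<in> B)) \<le> of_bool (\<exists>b\<in>B. jconnected (H \<inter> free D) j J2 b)"
proof -
  let ?Tn = "taint D H r J2"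
  let ?S = "\<Sum>J\<in>?Tn. of_bool (J \<in> B) :: real"
  have Np: "0 < real N" using N_pos by simp
  have finT: "finite ?Tn" using taint_subset[OF J2] finite_JS_sub by auto
  have finX: "finite X" unfolding X_def using run_init_sub[OF J2] by auto
  have S: "?S = real (card (?Tn \<inter> B))"
  proof -
    have "?Tn \<inter> {J. J \<in> B} = ?Tn \<inter> B" by auto
    thus ?thesis using finT by (subst sum_of_bool_eq) auto
  qed
  have S0: "0 \<le> (2 * real N / (T * f)) * ?S" using f T by (simp add: S)
  show ?thesis
  proof (cases "T \<le> real (card X) \<and> \<not> real (card (X \<inter> B)) < real (card X) * real (card B) / (2 * real N)")
    case False
    hence "of_bool (T \<le> real (card X)) - of_bool (T \<le> real (card X) \<and> real (card (X \<inter> B)) < real (card X) * real (card B) / (2 * real N)) \<le> (0 :: real)" by auto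
    moreover have "(0 :: real) \<le> of_bool (\<exists>b\<in>B. jconnected (H \<inter> free D) j J2 b)" by simp
    ultimately show ?thesis using S0 by linarith
  next
    case True
    have "T * f / (2 * real N) \<le> real (card X) * real (card B) / (2 * real N)"
      using True f T by (intro divide_right_mono mult_mono) auto
    also have "\<dots> \<le> real (card (X \<inter> B))" using True by simp
    finally have hit: "T * f / (2 * real N) \<le> real (card (X \<inter> B))" .
    show ?thesis
    proof (cases "\<exists>b\<in>B. jconnected (H \<inter> free D) j J2 b")
      case True
      thus ?thesis using S0 by (simp add: of_bool_def)
    next
      case False
      have "X \<inter> B \<subseteq> ?Tn \<inter> B"
      proof
        fix b assume b: "b \<in> X \<inter> B"
        obtain D' G' T' where s: "runT D H r ({}, {J2}, {}) = (D', G', T')" by (cases "runT D H r ({}, {J2}, {})") auto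
        have "X = D'" using runT_run[of H r "({}, {J2}, {})" D] s by (simp add: X_def init_def)
        moreover have "?Tn = T'" by (simp add: taint_def s)
        ultimately show "b \<in> ?Tn \<inter> B" using runT_connected[OF H J2 s, of b] b False by auto
      qed
      hence "card (X \<inter> B) \<le> card (?Tn \<inter> B)" using finT by (intro card_mono) auto
      hence "T * f / (2 * real N) \<le> ?S" using hit S by linarith
      hence "(2 * real N / (T * f)) * (T * f / (2 * real N)) \<le> (2 * real N / (T * f)) * ?S"
        using f T by (intro mult_left_mono) auto
      hence "1 \<le> (2 * real N / (T * f)) * ?S" using f T Np by simp
      moreover have "of_bool (T \<le> real (card X)) - of_bool (T \<le> real (card X) \<and> real (card (X \<inter> B)) < real (card X) * real (card B) / (2 * real N)) \<le> (1 :: real)"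
        by simp
      ultimately show ?thesis using False by simp
    qed
  qed
qed

lemma GG_le: "(\<And>X. X \<subseteq> JS \<Longrightarrow> \<phi> X \<le> 1) \<Longrightarrow> GG r \<phi> \<le> real N"
  using GG_mono[of \<phi> "\<lambda>_. 1" r] by (simp add: GG_def card_JS)

lemma GG_nonneg: "(\<And>X. X \<subseteq> JS \<Longrightarrow> 0 \<le> \<phi> X) \<Longrightarrow> 0 \<le> GG r \<phi>"
  using GG_mono[of "\<lambda>_. 0" \<phi> r] by (simp add: GG_def)

lemma nu_le_1: "nu l \<le> 1"
proof -
  have "(\<Sum>J'\<in>JS. isz l {..<j} J') \<le> (\<Sum>J'\<in>JS. 1)" by (intro sum_mono) (simp add: isz_def)
  thus ?thesis using N_pos by (simp add: nu_def avg_def card_JS)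
qed

text \<open>The frontier of a good exploration from \<open>J1\<close> is the target, and
  \<open>J2\<close> joins the component when its fresh exploration reaches the target untainted. The
  terms are the main term, the two Chebyshev errors and the taint.\<close>

lemma connect_lower:
  assumes J1: "J1 \<in> JS" and f: "0 < f" and T: "0 < T" "L \<le> T" and nu0: "0 < nu 0"
  shows "Ex r (init J1) (\<lambda>s. of_bool (good f T s)) * GG r (\<lambda>X. of_bool (T \<le> real (card X)))
     - Ex r (init J1) (\<lambda>s. of_bool (good f T s)) * (4 * (1 / nu 0 - 1) * real N)
     - 4 / (f ^ 2 * T ^ 2) * (\<Sum>l=1..j. Ex r (init J1) (\<lambda>s. pst l (snd s)) * GG r (pst l) / nu l)
     - (2 * real N / (T * f)) * Ex r (init J1) (\<lambda>s. \<Sum>J2\<in>JS. bexp p KS (\<lambda>H. \<Sum>J\<in>taint (fst s) H r J2. of_bool (J \<in> snd s)))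
   \<le> (\<Sum>J2\<in>JS. bexp p KS (\<lambda>H. of_bool (J2 \<in> comp H J1 \<and> large L H J1)))"
proof -
  let ?c = "\<lambda>s J2 H. of_bool (\<exists>b\<in>snd s. jconnected H j J2 b) :: real"
  let ?tt = "\<lambda>s. \<Sum>J2\<in>JS. bexp p KS (\<lambda>H. \<Sum>J\<in>taint (fst s) H r J2. of_bool (J \<in> snd s)) :: real"
  define g where "g = GG r (\<lambda>X. of_bool (T \<le> real (card X)))"
  define cb where "cb = 4 * (1 / nu 0 - 1) * real N"
  let ?P = "\<lambda>s. \<Sum>l=1..j. pst l (snd s) * GG r (pst l) / nu l"
  have nup: "0 < nu l" if "l \<le> j" for l using nu_ge[OF that] N_pos by (meson divide_pos_pos less_le_trans zero_less_one of_nat_0_less_iff)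
  have GP: "0 \<le> GG r (pst l)" for l by (intro GG_nonneg pst_nonneg)
  have "Ex r (init J1) (\<lambda>s. (g - cb) * of_bool (good f T s) + (- 4 / (f ^ 2 * T ^ 2) * ?P s + (- 2 * real N / (T * f)) * ?tt s)) \<le> 
     Ex r (init J1) (\<lambda>s. \<Sum>J2\<in>JS. of_bool (good f T s) * bexp p (free (fst s)) (?c s J2))"
  proof (rule Ex_mono_pre[OF pre_init[OF J1]])
    fix D B assume pre: "pre D B"
    have P0: "0 \<le> ?P (D, B)" using nup GP pst_nonneg by (intro sum_nonneg divide_nonneg_nonneg mult_nonneg_nonneg) (auto intro: less_imp_le)
    have t0: "0 \<le> ?tt (D, B)" using p0 p1 by (intro sum_nonneg bexp_nonneg) auto
    show "(g - cb) * of_bool (good f T (D, B)) + (- 4 / (f ^ 2 * T ^ 2) * ?P (D, B) + (- 2 * real N / (T * f)) * ?tt (D, B)) \<le>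
      (\<Sum>J2\<in>JS. of_bool (good f T (D, B)) * bexp p (free (fst (D, B))) (?c (D, B) J2))"
    proof (cases "good f T (D, B)")
      case False
      have "0 \<le> 4 / (f ^ 2 * T ^ 2) * ?P (D, B)" "0 \<le> (2 * real N / (T * f)) * ?tt (D, B)"
        using P0 t0 f T by (auto intro!: mult_nonneg_nonneg)
      thus ?thesis using False by simp
    next
      case True
      hence fB: "f \<le> real (card B)" by (simp add: good_def)
      have Bne: "B \<noteq> {}" using fB f by auto
      have BJ: "B \<subseteq> JS" using pre by (simp add: pre_def)
      let ?bad = "\<lambda>X. of_bool (T \<le> real (card X) \<and> real (card (X \<inter> B)) < real (card X) * real (card B) / (2 * real N)) :: real"
      have bad: "GG r ?bad \<le> cb + 4 / (f ^ 2 * T ^ 2) * ?P (D, B)"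
      proof -
        have "GG r ?bad \<le> 4 * (1 / nu 0 - 1) * GG r (\<lambda>X. of_bool (T \<le> real (card X))) + 4 / (real (card B) ^ 2 * T ^ 2) * ?P (D, B)"
          using hit_chebyshev[OF BJ Bne T(1), of r] by simp
        also have "\<dots> \<le> 4 * (1 / nu 0 - 1) * real N + 4 / (f ^ 2 * T ^ 2) * ?P (D, B)"
        proof (intro add_mono mult_left_mono mult_right_mono GG_le divide_left_mono power_mono P0)
          have "1 \<le> 1 / nu 0" using nu0 nu_le_1[of 0] by simp
          thus "0 \<le> 4 * (1 / nu 0 - 1)" by simp
        qed (use f T fB in \<open>auto intro!: mult_pos_pos\<close>)
        finally show ?thesis by (simp add: cb_def)
      qed
      \<comment> \<open>The second exploration runs in a full copy of the hypergraph, whose law has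
        the vertex symmetry; the comparison with \<open>H \<inter> free D\<close> is left to the
        taint.\<close>
      have "(\<Sum>J2\<in>JS. bexp p (free D) (?c (D, B) J2)) = (\<Sum>J2\<in>JS. bexp p KS (\<lambda>H. ?c (D, B) J2 (H \<inter> free D)))"
      proof (rule sum.cong[OF refl])
        fix J2
        have "KS \<inter> free D = free D" using free_subset by auto
        thus "bexp p (free D) (?c (D, B) J2) = bexp p KS (\<lambda>H. ?c (D, B) J2 (H \<inter> free D))"
          using bexp_restrict[of KS p "?c (D, B) J2" "free D"] by simp
      qed
      also have "\<dots> \<ge> (\<Sum>J2\<in>JS. bexp p KS (\<lambda>H. of_bool (T \<le> real (card (fst (run H r (init J2))))) - ?bad (fst (run H r (init J2)))
         - (2 * real N / (T * f)) * (\<Sum>J\<in>taint D H r J2. of_bool (J \<in> B))))"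
      proof (intro sum_mono bexp_mono p0 p1)
        fix J2 H assume "J2 \<in> JS" "H \<subseteq> KS"
        thus "of_bool (T \<le> real (card (fst (run H r (init J2))))) - ?bad (fst (run H r (init J2)))
           - (2 * real N / (T * f)) * (\<Sum>J\<in>taint D H r J2. of_bool (J \<in> B)) \<le> ?c (D, B) J2 (H \<inter> free D)"
          using hit_pointwise[of H J2 D B f T r] pre f fB T by simp
      qed
      also (xtrans) have "(\<Sum>J2\<in>JS. bexp p KS (\<lambda>H. of_bool (T \<le> real (card (fst (run H r (init J2))))) - ?bad (fst (run H r (init J2)))
         - (2 * real N / (T * f)) * (\<Sum>J\<in>taint D H r J2. of_bool (J \<in> B)))) = g - GG r ?bad - (2 * real N / (T * f)) * ?tt (D, B)"
        unfolding g_def GG_def Ex_init by (simp only: bexp_diff bexp_cmult sum_subtractf sum_distrib_left[symmetric] fst_conv snd_conv)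
      finally have "g - GG r ?bad - (2 * real N / (T * f)) * ?tt (D, B) \<le> (\<Sum>J2\<in>JS. bexp p (free D) (?c (D, B) J2))" .
      thus ?thesis using bad True by simp
    qed
  qed
  also have "\<dots> = (\<Sum>J2\<in>JS. Ex r (init J1) (\<lambda>s. bexp p (free (fst s)) (\<lambda>H. of_bool (good f T s) * ?c s J2 H)))"
    unfolding Ex_sum bexp_cmult ..
  also have "\<dots> = (\<Sum>J2\<in>JS. bexp p KS (\<lambda>H. of_bool (good f T (run H r (init J1))) * ?c (run H r (init J1)) J2 (H \<inter> free (fst (run H r (init J1))))))"
  proof (rule sum.cong[OF refl])
    fix J2
    show "Ex r (init J1) (\<lambda>s. bexp p (free (fst s)) (\<lambda>H. of_bool (good f T s) * ?c s J2 H)) = 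
      bexp p KS (\<lambda>H. of_bool (good f T (run H r (init J1))) * ?c (run H r (init J1)) J2 (H \<inter> free (fst (run H r (init J1)))))"
      using run_markov[of "init J1" "\<lambda>s H. of_bool (good f T s) * ?c s J2 H" r, symmetric] by simp
  qed
  also have "\<dots> \<le> (\<Sum>J2\<in>JS. bexp p KS (\<lambda>H. of_bool (J2 \<in> comp H J1 \<and> large L H J1)))"
  proof (intro sum_mono bexp_mono p0 p1)
    fix J2 H assume J2: "J2 \<in> JS" and H: "H \<subseteq> KS"
    obtain D B where s: "run H r (init J1) = (D, B)" by (cases "run H r (init J1)")
    have sub: "D \<subseteq> JS" "B \<subseteq> JS" using run_init_sub[OF J1, of H r] s by auto
    have "J2 \<in> comp H J1 \<and> large L H J1" if g: "good f T (D, B)" and b: "b \<in> B" "jconnected (H \<inter> free D) j J2 b" for b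
    proof -
      have bJ: "b \<in> JS" using b sub by auto
      have "jconnected H j J1 b" using run_connected[OF H J1, of b r] b s by simp
      moreover have "jconnected H j b J2" using jconnected_mono[OF b(2), of H] by (auto intro: jconnected_sym)
      ultimately have "jconnected H j J1 J2" using jconnected_trans[OF H bJ] by blast
      moreover have "D \<subseteq> comp H J1" using run_connected[OF H J1, of _ r] s sub by (auto simp: comp_def)
      hence "card D \<le> card (comp H J1)" by (intro card_mono) (auto simp: comp_def)
      hence "large L H J1" using g T by (simp add: good_def large_def)
      ultimately show ?thesis using J2 by (simp add: comp_def)
    qed
    thus "of_bool (good f T (run H r (init J1))) * ?c (run H r (init J1)) J2 (H \<inter> free (fst (run H r (init J1)))) \<le> of_bool (J2 \<in> comp H J1 \<and> large L H J1)"
      unfolding s fst_conv snd_conv by (auto simp: of_bool_def)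
  qed
  finally have "Ex r (init J1) (\<lambda>s. (g - cb) * of_bool (good f T s) + (- 4 / (f ^ 2 * T ^ 2) * ?P s + (- 2 * real N / (T * f)) * ?tt s)) \<le>
     (\<Sum>J2\<in>JS. bexp p KS (\<lambda>H. of_bool (J2 \<in> comp H J1 \<and> large L H J1)))" .
  moreover have "Ex r (init J1) ?P = (\<Sum>l=1..j. Ex r (init J1) (\<lambda>s. pst l (snd s)) * GG r (pst l) / nu l)"
  proof -
    have "Ex r (init J1) ?P = Ex r (init J1) (\<lambda>s. \<Sum>l=1..j. (GG r (pst l) / nu l) * pst l (snd s))"
      by (simp add: mult.commute)
    also have "\<dots> = (\<Sum>l=1..j. (GG r (pst l) / nu l) * Ex r (init J1) (\<lambda>s. pst l (snd s)))"
      unfolding Ex_sum Ex_cmult ..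
    finally show ?thesis by (simp add: mult.commute)
  qed
  ultimately show ?thesis unfolding Ex_add Ex_cmult g_def cb_def by (simp add: algebra_simps)
qed

section \<open>The giant component\<close>

lemma comp_eq:
  assumes H: "H \<subseteq> KS" and "J \<in> JS" "J' \<in> comp H J" shows "comp H J' = comp H J"
proof -
  have J': "J' \<in> JS" "jconnected H j J J'" "jconnected H j J' J" using assms by (auto simp: comp_def intro: jconnected_sym)
  show ?thesis
    using jconnected_trans[OF H] J' assms(2) unfolding comp_def by blast
qed

lemma comp_subset: "comp H J \<subseteq> JS" by (auto simp: comp_def)

lemma finite_comp [simp]: "finite (comp H J)" using comp_subset by (rule finite_JS_sub)

lemma jcomponents_eq: "jcomponents n j H = comp H ` JS"
  by (simp add: jcomponents_def comp_def)

definition giant :: "real \<Rightarrow> real \<Rightarrow> nat set set \<Rightarrow> bool" where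
  "giant y d H \<longleftrightarrow> (\<exists>X0\<in>jcomponents n j H. (\<forall>X\<in>jcomponents n j H. card X \<le> card X0) \<and>
     \<bar>real (card X0) - y\<bar> \<le> d * y \<and> (\<forall>X\<in>jcomponents n j H. X \<noteq> X0 \<longrightarrow> real (card X) \<le> d * y))"

text \<open>The double sum is the sum of squared sizes of the large components, hence at most
  \<open>s * m\<close> with \<open>s\<close> the number of large j-sets and \<open>m\<close> the
  maximal component size. If it is close to \<open>s ^ 2\<close>, then \<open>m\<close> is close to
  \<open>s\<close>.\<close>

lemma giant_det:
  assumes H: "H \<subseteq> KS" and y: "0 < y" and tau: "0 < tau'" "tau' \<le> 1 / 4" and L: "L \<le> tau' * y"
    and S: "\<bar>(\<Sum>J\<in>JS. of_bool (large L H J)) - y\<bar> \<le> tau' * y"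
    and Q: "(\<Sum>J\<in>JS. of_bool (large L H J)) ^ 2 - (\<Sum>J1\<in>JS. \<Sum>J2\<in>JS. of_bool (J2 \<in> comp H J1 \<and> large L H J1)) \<le> tau' * y ^ 2"
  shows "giant y (4 * tau') H"
proof -
  define W where "W = {J \<in> JS. large L H J}"
  define s where "s = real (card W)"
  have finW: "finite W" by (simp add: W_def)
  have Ws: "(\<Sum>J\<in>JS. of_bool (large L H J)) = s"
    unfolding s_def W_def by (subst sum_of_bool_eq) (auto simp: Int_def)
  have s1: "(1 - tau') * y \<le> s" "s \<le> (1 + tau') * y" using S unfolding Ws by (auto simp: abs_le_iff algebra_simps)
  have "0 < (1 - tau') * y" using tau y by (intro mult_pos_pos) auto
  hence sp: "0 < s" using s1 by linarith
  have JSne: "JS \<noteq> {}" using base_mem by auto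
  let ?c = "\<lambda>J. card (comp H J)"
  have "Max (?c ` JS) \<in> ?c ` JS" using JSne by (intro Max_in) auto
  then obtain J0 where J0a: "J0 \<in> JS" "Max (?c ` JS) = ?c J0" by auto
  have J0: "J0 \<in> JS" "\<And>J. J \<in> JS \<Longrightarrow> card (comp H J) \<le> card (comp H J0)"
    using J0a(1) by (auto simp flip: J0a(2))
  define m where "m = real (card (comp H J0))"
  have "W \<noteq> {}" using sp by (auto simp: s_def)
  then obtain J1 where J1: "J1 \<in> JS" "large L H J1" by (auto simp: W_def)
  have L0: "L \<le> m" using J1 J0(2)[OF J1(1)] by (auto simp: large_def m_def)
  have sub: "comp H J \<subseteq> W" if "J \<in> JS" "large L H J" for J
    using comp_eq[OF H that(1)] that comp_subset[of H J] by (auto simp: W_def large_def)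
  have sub0: "comp H J0 \<subseteq> W" by (rule sub[OF J0(1)]) (use L0 in \<open>simp add: large_def m_def\<close>)
  have ms: "m \<le> s" unfolding m_def s_def using card_mono[OF finW sub0] by simp
  have "(\<Sum>J1\<in>JS. \<Sum>J2\<in>JS. of_bool (J2 \<in> comp H J1 \<and> large L H J1)) \<le> (\<Sum>J1\<in>JS. of_bool (large L H J1) * m)"
  proof (rule sum_mono)
    fix J1 assume J1: "J1 \<in> JS"
    have "(\<Sum>J2\<in>JS. of_bool (J2 \<in> comp H J1 \<and> large L H J1)) = of_bool (large L H J1) * (\<Sum>J2\<in>JS. of_bool (J2 \<in> comp H J1) :: real)"
      by simp
    also have "(\<Sum>J2\<in>JS. of_bool (J2 \<in> comp H J1) :: real) = real (card (comp H J1))"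
    proof -
      have "JS \<inter> {J2. J2 \<in> comp H J1} = comp H J1" using comp_subset by auto
      thus ?thesis by (subst sum_of_bool_eq) auto
    qed
    also have "of_bool (large L H J1) * real (card (comp H J1)) \<le> of_bool (large L H J1) * m"
      using J0(2)[OF J1] by (intro mult_left_mono) (auto simp: m_def)
    finally show "(\<Sum>J2\<in>JS. of_bool (J2 \<in> comp H J1 \<and> large L H J1)) \<le> of_bool (large L H J1) * m" .
  qed
  also have "\<dots> = s * m" using Ws by (simp flip: sum_distrib_right)
  finally have "s ^ 2 - s * m \<le> tau' * y ^ 2" using Q unfolding Ws by linarith
  hence sm: "s * (s - m) \<le> tau' * y ^ 2" by (simp add: power2_eq_square algebra_simps)
  have sm2: "s - m \<le> 2 * tau' * y"
  proof -
    have "y / 2 \<le> (1 - tau') * y" using tau y by (simp add: field_simps)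
    hence ys: "y / 2 \<le> s" using s1 by linarith
    have "y / 2 * (s - m) \<le> s * (s - m)" using ys ms by (intro mult_right_mono) auto
    moreover have "y * (s - m) = 2 * (y / 2 * (s - m))" by simp
    ultimately have "y * (s - m) \<le> 2 * (tau' * y ^ 2)" using sm by linarith
    also have "2 * (tau' * y ^ 2) = y * (2 * tau' * y)" by (simp add: power2_eq_square)
    finally show ?thesis using y by (simp only: mult_le_cancel_left_pos)
  qed
  have "\<bar>m - y\<bar> \<le> 4 * tau' * y" using sm2 ms s1 y tau by (auto simp: abs_le_iff algebra_simps)
  moreover have "real (card (comp H J)) \<le> 4 * tau' * y" if J: "J \<in> JS" "comp H J \<noteq> comp H J0" for J
  proof (cases "large L H J")
    case False
    thus ?thesis using L tau y by (simp add: large_def)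
  next
    case True
    have dis: "comp H J \<inter> comp H J0 = {}"
    proof (rule ccontr)
      assume "comp H J \<inter> comp H J0 \<noteq> {}"
      then obtain J' where "J' \<in> comp H J" "J' \<in> comp H J0" by auto
      thus False using comp_eq[OF H] J J0(1) by metis
    qed
    have "card (comp H J \<union> comp H J0) \<le> card W" using finW sub[OF J(1) True] sub0 by (intro card_mono) auto
    hence "real (card (comp H J)) + m \<le> s" using dis by (simp add: card_Un_disjoint m_def s_def)
    moreover have "2 * tau' * y \<le> 4 * tau' * y" using tau y by simp
    ultimately show ?thesis using sm2 by linarith
  qed
  ultimately show ?thesis
    unfolding giant_def jcomponents_eq using J0 by (intro bexI[of _ "comp H J0"]) (auto simp: m_def)
qed

text \<open>Failure is measured by two nonnegative quantities: the squared deviation of the number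
  of large j-sets, and the number of pairs of large j-sets in different components. Markov's
  inequality for their scaled sum gives 5 as 3 + 2.\<close>

lemma giant_prob:
  assumes y: "0 < y" and tau: "0 < tau'" "tau' \<le> 1 / 4" and L: "L \<le> tau' * y" and eta: "0 \<le> eta"
    and c2: "(\<Sum>J1\<in>JS. \<Sum>J2\<in>JS. bexp p KS (\<lambda>H. of_bool (large L H J1 \<and> large L H J2))) \<le> (1 + eta) * y ^ 2"
    and c3: "(1 - eta) * y \<le> (\<Sum>J\<in>JS. bexp p KS (\<lambda>H. of_bool (large L H J)))"
    and c4: "(1 - eta) * y ^ 2 \<le> (\<Sum>J1\<in>JS. \<Sum>J2\<in>JS. bexp p KS (\<lambda>H. of_bool (J2 \<in> comp H J1 \<and> large L H J1)))"
  shows "1 - 5 * eta / tau' ^ 2 \<le> bexp p KS (\<lambda>H. of_bool (giant y (4 * tau') H))"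
proof -
  define S where "S H = (\<Sum>J\<in>JS. of_bool (large L H J) :: real)" for H
  define Q where "Q H = (\<Sum>J1\<in>JS. \<Sum>J2\<in>JS. of_bool (J2 \<in> comp H J1 \<and> large L H J1) :: real)" for H
  have S2: "S H ^ 2 = (\<Sum>J1\<in>JS. \<Sum>J2\<in>JS. of_bool (large L H J1 \<and> large L H J2))" for H
    unfolding S_def power2_eq_square sum_product by (intro sum.cong refl) auto
  have QS: "Q H \<le> S H ^ 2" if "H \<subseteq> KS" for H
    unfolding Q_def S2
  proof (intro sum_mono)
    fix J1 J2 assume "J1 \<in> JS" "J2 \<in> JS"
    thus "of_bool (J2 \<in> comp H J1 \<and> large L H J1) \<le> (of_bool (large L H J1 \<and> large L H J2) :: real)"
      using comp_eq[OF that, of J1 J2] by (auto simp: large_def)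
  qed
  have ES2: "bexp p KS (\<lambda>H. S H ^ 2) \<le> (1 + eta) * y ^ 2" using c2 unfolding S2 bexp_sum .
  have ES: "(1 - eta) * y \<le> bexp p KS S" using c3 unfolding S_def bexp_sum .
  have EQ: "(1 - eta) * y ^ 2 \<le> bexp p KS Q" using c4 unfolding Q_def bexp_sum .
  have "bexp p KS (\<lambda>H. 1 + (-1) * of_bool (giant y (4 * tau') H)) \<le> 
     bexp p KS (\<lambda>H. 1 / (tau' * y) ^ 2 * (S H - y) ^ 2 + 1 / (tau' * y ^ 2) * (S H ^ 2 - Q H))"
  proof (intro bexp_mono p0 p1)
    fix H assume H: "H \<subseteq> KS"
    have n1: "0 \<le> 1 / (tau' * y) ^ 2 * (S H - y) ^ 2" by simp
    have n2: "0 \<le> 1 / (tau' * y ^ 2) * (S H ^ 2 - Q H)" using QS[OF H] tau y by simp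
    show "1 + (-1) * of_bool (giant y (4 * tau') H) \<le> 1 / (tau' * y) ^ 2 * (S H - y) ^ 2 + 1 / (tau' * y ^ 2) * (S H ^ 2 - Q H)"
    proof (cases "giant y (4 * tau') H")
      case True
      thus ?thesis using n1 n2 by simp
    next
      case False
      hence "tau' * y < \<bar>S H - y\<bar> \<or> tau' * y ^ 2 < S H ^ 2 - Q H"
        using giant_det[OF H y tau L] unfolding S_def Q_def by (meson not_le)
      thus ?thesis
      proof
        assume "tau' * y < \<bar>S H - y\<bar>"
        hence "(tau' * y) ^ 2 \<le> \<bar>S H - y\<bar> ^ 2" using tau y by (intro power_mono) auto
        hence "1 \<le> 1 / (tau' * y) ^ 2 * (S H - y) ^ 2" using tau y by (simp add: field_simps)
        moreover have "of_bool (giant y (4 * tau') H) = (0 :: real)" using False by simp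
        ultimately show ?thesis using n2 by linarith
      next
        assume "tau' * y ^ 2 < S H ^ 2 - Q H"
        hence "1 \<le> 1 / (tau' * y ^ 2) * (S H ^ 2 - Q H)" using tau y by (simp add: field_simps)
        moreover have "of_bool (giant y (4 * tau') H) = (0 :: real)" using False by simp
        ultimately show ?thesis using n1 by linarith
      qed
    qed
  qed
  also have "\<dots> = 1 / (tau' * y) ^ 2 * bexp p KS (\<lambda>H. (S H - y) ^ 2) + 1 / (tau' * y ^ 2) * (bexp p KS (\<lambda>H. S H ^ 2) - bexp p KS Q)"
    by (simp only: bexp_add bexp_cmult bexp_diff)
  also have "bexp p KS (\<lambda>H. (S H - y) ^ 2) = bexp p KS (\<lambda>H. S H ^ 2 + ((- 2 * y) * S H + y ^ 2))"
    by (rule bexp_cong) (simp add: power2_eq_square algebra_simps)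
  also have "\<dots> = bexp p KS (\<lambda>H. S H ^ 2) + ((- 2 * y) * bexp p KS S + y ^ 2)"
    by (simp only: bexp_add bexp_cmult bexp_const finite_ksets)
  also have "1 / (tau' * y) ^ 2 * (bexp p KS (\<lambda>H. S H ^ 2) + ((- 2 * y) * bexp p KS S + y ^ 2)) + 1 / (tau' * y ^ 2) * (bexp p KS (\<lambda>H. S H ^ 2) - bexp p KS Q)
     \<le> 1 / (tau' * y) ^ 2 * (3 * eta * y ^ 2) + 1 / (tau' * y ^ 2) * (2 * eta * y ^ 2)"
  proof (intro add_mono mult_left_mono)
    have "2 * y * ((1 - eta) * y) \<le> 2 * y * bexp p KS S" using ES y by (intro mult_left_mono) auto
    thus "bexp p KS (\<lambda>H. S H ^ 2) + ((- 2 * y) * bexp p KS S + y ^ 2) \<le> 3 * eta * y ^ 2"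
      using ES2 by (simp add: power2_eq_square algebra_simps)
    show "bexp p KS (\<lambda>H. S H ^ 2) - bexp p KS Q \<le> 2 * eta * y ^ 2"
      using ES2 EQ by (simp add: algebra_simps)
  qed (use tau y in auto)
  also have "\<dots> = 3 * eta / tau' ^ 2 + 2 * eta / tau'"
    using tau y by (simp add: field_simps power2_eq_square)
  also have "\<dots> \<le> 3 * eta / tau' ^ 2 + 2 * eta / tau' ^ 2"
    using tau eta by (intro add_left_mono divide_left_mono) (auto simp: power2_eq_square)
  finally have "bexp p KS (\<lambda>H. 1 + (-1) * of_bool (giant y (4 * tau') H)) \<le> 3 * eta / tau' ^ 2 + 2 * eta / tau' ^ 2" .
  moreover have "bexp p KS (\<lambda>H. 1 + (-1) * of_bool (giant y (4 * tau') H)) = 1 - bexp p KS (\<lambda>H. of_bool (giant y (4 * tau') H))"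
    unfolding bexp_add bexp_cmult by simp
  ultimately show ?thesis by simp
qed

end

text \<open>Up to the factor e, upper and lower bounds for the probability that a j-set is large; both tend
  to 2/q as x tends to 0.\<close>

definition Ua :: "real \<Rightarrow> real \<Rightarrow> real" where "Ua q x = (1 + x) / (q / 2 * (1 - x)) + x"
definition Pl :: "real \<Rightarrow> real \<Rightarrow> real" where "Pl q x = 1 / (q / 2 + 18 * x) - 2 * x - 8 * x ^ 2"

text \<open>Here x is the target accuracy. With Lam = e^3 N, the parameters are tuned such that lam^r0 and lam^r are
  of order Lam^(1/4) and Lam^(3/4), i0 is about 1/e and L = Lam^(1/2)/e^2.\<close>

locale giant_params = hyp +
  fixes x :: real and r0 r i0 :: nat and L :: real
  assumes reg: regular
    and x: "0 < x" "x \<le> 1 / 2"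
    and h2: "real q / 2 * (1 - x) \<le> ca"
    and h3: "(real q - 1 + lam) / 2 + (real q / 2 + x) * ((real q - 1 + lam) / 2) * (e / ca) \<le> real q / 2 + x"
    and h4: "2 \<le> lam ^ r0" "lam ^ r0 / (lam ^ r0 - 1) \<le> 1 + x"
    and h5: "0 < L" "2 * lam ^ r0 / (e * L) \<le> x * e"
    and h6: "4 * lam ^ (2 * r0) / e \<le> x * e ^ 2 * real N"
    and h7: "CL * (lam ^ r / (real N * e ^ 3) + real r / real n) \<le> x ^ 2"
    and h8: "2 * lam ^ r0 / lam ^ r \<le> x ^ 2"
    and h9: "1 / lam ^ r \<le> x / (4 * real q)"
    and h10: "L \<le> x ^ 3 * lam ^ r / e ^ 2"
    and h11: "0 < nu 0" "4 * (1 / nu 0 - 1) \<le> x * e"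
    and h12: "128 * real j * real q ^ 2 * (real j ^ 2 / real n + 4 / (1 - alpha) ^ 2 * e / lam ^ r + 4 / (1 - alpha) ^ 4 * (real N * e ^ 3 / lam ^ (2 * r))) \<le> x ^ 13"
    and h13: "24 * real q ^ 2 * (e * real r) ^ 2 * (lam ^ r / (real N * e ^ 3) + 4 * real k / (e * real n * (1 - alpha) ^ 2)) \<le> x ^ 7"
    and h14: "i0 \<le> r" "lam ^ i0 \<le> 8" "1 \<le> e * real i0" "r0 \<le> r" "0 < r0"
begin

lemma lam: "1 < lam" "lam \<le> 2" using reg by (auto simp: regular_def)
lemma e0: "0 < e" "e \<le> 1" using lam by (auto simp: e_def)
lemma q1: "1 \<le> real q" using q_pos by simp
lemma ca0: "real q / 4 \<le> ca" "0 < ca"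
proof -
  have "real q / 2 * (1 / 2) \<le> real q / 2 * (1 - x)" using x by (intro mult_left_mono) auto
  thus "real q / 4 \<le> ca" using h2 by simp
  thus "0 < ca" using q1 by simp
qed
lemma ca_le: "ca \<le> real q"
proof -
  have "0 \<le> p * real q" using p0 by simp
  hence "ca \<le> (real q - 1 + lam) / 2" unfolding ca_def by simp
  also have "\<dots> \<le> real q" using lam q1 by simp
  finally show ?thesis .
qed

lemma surv_le:
  assumes "2 \<le> lam ^ i" "lam ^ i / (lam ^ i - 1) \<le> c" "0 \<le> c"
  shows "xs 1 0 i \<le> e * c / ca"
proof -
  have "xs 1 0 i * ca * (lam ^ i - 1) \<le> e * lam ^ i" using xs_upper[OF lam(1) ca0(2), of 0 i] by simp
  hence "xs 1 0 i * ca \<le> e * (lam ^ i / (lam ^ i - 1))" using assms(1) by (simp add: pos_le_divide_eq)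
  also have "\<dots> \<le> e * c" using assms e0 by (intro mult_left_mono) auto
  finally show ?thesis using ca0 by (simp add: pos_le_divide_eq)
qed

lemma surv_le8:
  assumes "2 \<le> lam ^ i" shows "xs 1 0 i \<le> 8 * e"
proof -
  have "lam ^ i / (lam ^ i - 1) \<le> 2" using assms by (simp add: pos_divide_le_eq)
  hence "xs 1 0 i \<le> e * 2 / ca" using assms by (intro surv_le) auto
  also have "\<dots> \<le> e * 2 / (1 / 4)" using ca0 q1 e0 by (intro divide_left_mono) auto
  finally show ?thesis by simp
qed

definition a where "a = e * Ua (real q) x"
definition pl where "pl = e * Pl (real q) x"

lemma a_ge: "xs 1 0 r0 + 2 * lam ^ r0 / (e * L) \<le> a"
proof -
  have "xs 1 0 r0 \<le> e * (1 + x) / ca" using h4 x by (intro surv_le) auto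
  also have "\<dots> \<le> e * (1 + x) / (real q / 2 * (1 - x))"
    using h2 ca0 e0 x q1 by (intro divide_left_mono) auto
  finally show ?thesis using h5 by (simp add: a_def Ua_def algebra_simps)
qed

lemma a_nonneg: "0 \<le> a"
  unfolding a_def Ua_def using e0 x q1 by (intro mult_nonneg_nonneg add_nonneg_nonneg divide_nonneg_nonneg) auto

lemma C2: "(\<Sum>J1\<in>JS. \<Sum>J2\<in>JS. bexp p KS (\<lambda>H. of_bool (large L H J1 \<and> large L H J2))) \<le> (real N * e) ^ 2 * (Ua (real q) x ^ 2 + x)"
proof -
  have "(\<Sum>J1\<in>JS. \<Sum>J2\<in>JS. bexp p KS (\<lambda>H. of_bool (large L H J1 \<and> large L H J2))) \<le> real N * (real N * a ^ 2 + 4 * lam ^ (2 * r0) / e)"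
    using lam h5 h14 a_ge by (intro large_pair_upper) auto
  also have "\<dots> \<le> real N * (real N * a ^ 2 + x * e ^ 2 * real N)"
    using h6 by (intro mult_left_mono add_left_mono) auto
  also have "\<dots> = (real N * e) ^ 2 * (Ua (real q) x ^ 2 + x)"
    by (simp add: a_def power2_eq_square algebra_simps)
  finally show ?thesis .
qed

lemma Xr: "2 \<le> lam ^ r" "0 < lam ^ r"
proof -
  have "lam ^ r0 \<le> lam ^ r" using lam h14 by (intro power_increasing) auto
  thus "2 \<le> lam ^ r" using h4 by simp
  thus "0 < lam ^ r" by simp
qed

lemma xs_lower_e:
  assumes z: "0 \<le> z" "z < 1" "1 - z \<le> e / ca" and c: "1 / (lam ^ i * (1 - z)) \<le> c / e"
  shows "e / (real q / 2 + x + c) \<le> xs 1 z i"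
proof -
  have A: "0 < real q / 2 + x" using q1 x by simp
  have "0 < 1 / (lam ^ i * (1 - z))" using lam z by simp
  hence c0: "0 < c" using c e0 by (meson less_le_trans zero_less_divide_iff not_less_iff_gr_or_eq)
  note low = xs_lower[OF lam(1) ca0(2) z A h3, of i]
  have "1 \<le> xs 1 z i * ((real q / 2 + x) / e + 1 / (lam ^ i * (1 - z)))" by (rule low(1))
  also have "\<dots> \<le> xs 1 z i * ((real q / 2 + x) / e + c / e)" using c low(2) by (intro mult_left_mono) auto
  also have "\<dots> = xs 1 z i * ((real q / 2 + x + c) / e)" by (simp add: add_divide_distrib)
  finally show ?thesis using A c0 e0 by (simp add: field_simps)
qed

text \<open>Frontier and dead set of a surviving exploration have natural sizes
  \<open>lam ^ r / e\<close> and \<open>lam ^ r / e ^ 2\<close>; the factor \<open>x ^ 3\<close> in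
  \<open>f\<close> and \<open>T\<close> makes falling short unlikely.\<close>

definition f where "f = x ^ 3 * lam ^ r / e"
definition T where "T = x ^ 3 * lam ^ r / e ^ 2"

lemma fT: "0 < f" "0 < T" "L \<le> T" using x Xr e0 h10 by (auto simp: f_def T_def)

lemma Kx: "1 / (x * lam ^ r) \<le> 1 / (4 * real q)"
  using h9 x Xr q1 by (simp add: field_simps)

lemma err: "CL * (lam ^ r / (real N * e ^ 3) + real r / real n) / x \<le> x"
  using h7 x by (simp add: divide_le_eq power2_eq_square)

lemma front_ge:
  assumes J: "J \<in> JS"
  shows "pl \<le> Ex r (init J) (\<lambda>s. of_bool (f \<le> real (card (snd s))))"
proof -
  \<comment> \<open>Small enough that \<open>s * f = x ^ 2\<close>, so short frontiers contribute
    little, and large enough that the transient \<open>1 / (s * lam ^ r) = x / e\<close> is small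
    against \<open>1 / e\<close>.\<close>
  define s where "s = e / (x * lam ^ r)"
  have s1: "s \<le> e / (4 * real q)" using mult_left_mono[OF Kx, of e] e0 by (simp add: s_def)
  have s0: "0 < s" using e0 x Xr by (simp add: s_def)
  have "e / (4 * real q) \<le> 1 * 1 / (4 * 1)" using e0 q1 by (intro frac_le) auto
  hence s2: "s \<le> 1 / 4" using s1 by simp
  have s3: "s \<le> e / ca"
  proof -
    have "e / (4 * real q) \<le> e / ca" using ca_le ca0 e0 q1 by (intro divide_left_mono) auto
    thus ?thesis using s1 by simp
  qed
  have sX: "s * lam ^ r = e / x" using Xr lam by (simp add: s_def)
  \<comment> \<open>The transient costs \<open>x\<close> here and \<open>16 * x\<close> in
    \<open>dead_ge\<close>; the common allowance 17 leads to the 18 in \<open>Pl\<close>.\<close>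
  have main: "e / (real q / 2 + x + 17 * x) \<le> xs 1 (1 - s) r"
  proof (rule xs_lower_e)
    show "1 / (lam ^ r * (1 - (1 - s))) \<le> 17 * x / e"
      using sX x e0 by (simp add: mult.commute divide_right_mono)
  qed (use s0 s2 s3 in auto)
  have 1: "s * CL * lam ^ r * (lam ^ r / (real N * e ^ 3) + real r / real n) \<le> e * x"
  proof -
    have "s * CL * lam ^ r * (lam ^ r / (real N * e ^ 3) + real r / real n) = (s * lam ^ r) * (CL * (lam ^ r / (real N * e ^ 3) + real r / real n))" by simp
    also have "\<dots> = e * (CL * (lam ^ r / (real N * e ^ 3) + real r / real n) / x)" unfolding sX by simp
    also have "\<dots> \<le> e * x" using err e0 by (intro mult_left_mono) auto
    finally show ?thesis .
  qed
  have 2: "s * f * xs 1 0 r \<le> x ^ 2 * (8 * e)"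
  proof -
    have "s * f = (s * lam ^ r) * (x ^ 3 / e)" by (simp add: f_def)
    also have "\<dots> = x ^ 2" unfolding sX using x e0 by (simp add: power2_eq_square power3_eq_cube)
    finally show ?thesis using surv_le8[OF Xr(1)] by (simp add: mult_left_mono)
  qed
  have "e / (real q / 2 + x + 17 * x) = e * (1 / (real q / 2 + 18 * x))" by simp
  hence "pl \<le> xs 1 (1 - s) r - e * x - x ^ 2 * (8 * e)"
  proof -
    have "0 \<le> e * x" using x e0 by simp
    thus ?thesis using main \<open>e / (real q / 2 + x + 17 * x) = e * (1 / (real q / 2 + 18 * x))\<close>
      unfolding pl_def Pl_def by (simp add: algebra_simps)
  qed
  also have "\<dots> \<le> xs 1 (1 - s) r - s * CL * lam ^ r * (lam ^ r / (real N * e ^ 3) + real r / real n) - s * f * xs 1 0 r"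
    using 1 2 by linarith
  also have "\<dots> \<le> Ex r (init J) (\<lambda>s. of_bool (f \<le> real (card (snd s))))"
    using s0 s2 fT by (intro front_lower reg J) auto
  finally show ?thesis .
qed

lemma dead_ge:
  assumes J: "J \<in> JS"
  shows "pl \<le> Ex r (init J) (\<lambda>s. of_bool (T \<le> real (card (fst s))))"
proof -
  \<comment> \<open>Marks are rarer by a factor \<open>e\<close> than in \<open>front_ge\<close>, as
    the dead set exceeds the frontier by \<open>1 / e\<close>; again
    \<open>s * T = x ^ 2\<close>.\<close>
  define s where "s = e ^ 2 / (x * lam ^ r)"
  \<comment> \<open>The level that the source has reached after \<open>i0\<close> steps:
    \<open>i0 * s / 2 \<ge> s / (2 * e) = 1 - z\<close>.\<close>
  define z where "z = 1 - e / (2 * (x * lam ^ r))"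
  have s1: "s \<le> e ^ 2 / (4 * real q)" using mult_left_mono[OF Kx, of "e ^ 2"] by (simp add: s_def)
  have s0: "0 < s" using e0 x Xr by (simp add: s_def)
  have "e ^ 2 / (4 * real q) \<le> 1 / (4 * 1)" using e0 q1 by (intro frac_le) (auto simp: power_le_one)
  hence s2: "s \<le> 1 / 4" using s1 by simp
  have sX: "s * lam ^ r = e ^ 2 / x" using Xr lam by (simp add: s_def)
  have z0: "e / (2 * (x * lam ^ r)) \<le> e / (2 * real q)"
  proof -
    have "e / 2 * (1 / (x * lam ^ r)) \<le> e / 2 * (1 / (4 * real q))" using Kx e0 by (intro mult_left_mono) auto
    also have "\<dots> \<le> e / (2 * real q)" using e0 q1 by (simp add: field_simps)
    finally show ?thesis by simp
  qed
  have q2: "e / (2 * real q) \<le> 1 / 2" using e0 q1 by (simp add: field_simps)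
  have src: "1 - z \<le> xs (1 - s) 1 i0"
  proof -
    have "min (real i0 * (1 - (1 - s)) / 2) (e / (2 * real q)) \<le> xs (1 - s) 1 i0"
    proof (rule xs_source[OF lam(1)])
      have "lam * (real q - 1 + lam) / 2 * (e / (2 * real q)) \<le> 2 * (2 * real q) / 2 * (e / (2 * real q))"
        using lam q1 e0 by (intro mult_right_mono divide_right_mono mult_mono) auto
      also have "\<dots> = e" using q1 by simp
      finally show "lam * (real q - 1 + lam) / 2 * (e / (2 * real q)) \<le> e" .
    qed (use s0 s2 e0 q1 q2 in auto)
    moreover have "e / (2 * (x * lam ^ r)) \<le> real i0 * (1 - (1 - s)) / 2"
    proof -
      have "s / (2 * e) * 1 \<le> s / (2 * e) * (e * real i0)" using h14 s0 e0 by (intro mult_left_mono) auto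
      also have "\<dots> = real i0 * (1 - (1 - s)) / 2" using e0 by simp
      also have "s / (2 * e) * 1 = e / (2 * (x * lam ^ r))" using e0 by (simp add: s_def power2_eq_square)
      finally show ?thesis .
    qed
    moreover have "1 - z = e / (2 * (x * lam ^ r))" by (simp add: z_def)
    ultimately show ?thesis using z0 by linarith
  qed
  have zb: "0 \<le> z" "z < 1" "1 - z \<le> e / ca"
  proof -
    have "e / (2 * real q) \<le> e / ca" using ca_le ca0 e0 q1 by (intro divide_left_mono) auto
    thus "1 - z \<le> e / ca" using z0 by (simp add: z_def)
    show "0 \<le> z" using z0 q2 by (simp add: z_def)
    show "z < 1" using e0 x Xr by (simp add: z_def)
  qed
  have "e / (real q / 2 + x + 17 * x) \<le> xs 1 z (r - i0)"
  proof (rule xs_lower_e[OF zb])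
    have "lam ^ r = lam ^ (r - i0) * lam ^ i0" using h14 by (simp flip: power_add)
    also have "\<dots> \<le> lam ^ (r - i0) * 8" using h14 lam by (intro mult_left_mono) auto
    finally have X: "lam ^ r / 8 \<le> lam ^ (r - i0)" by simp
    have "e / (16 * x) = lam ^ r / 8 * (1 - z)" using Xr x lam by (simp add: z_def)
    also have "\<dots> \<le> lam ^ (r - i0) * (1 - z)" using X zb by (intro mult_right_mono) auto
    finally have "1 / (lam ^ (r - i0) * (1 - z)) \<le> 1 / (e / (16 * x))"
      using x e0 lam zb by (intro divide_left_mono) auto
    also have "\<dots> \<le> 17 * x / e" using x e0 by (simp add: divide_right_mono)
    finally show "1 / (lam ^ (r - i0) * (1 - z)) \<le> 17 * x / e" .
  qed
  also have "\<dots> \<le> xs (1 - s) 1 (i0 + (r - i0))"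
    using s0 s2 zb src by (intro xs_mono) auto
  also have "i0 + (r - i0) = r" using h14 by simp
  finally have main: "e / (real q / 2 + x + 17 * x) \<le> xs (1 - s) 1 r" .
  have 1: "s / e * CL * lam ^ r * (lam ^ r / (real N * e ^ 3) + real r / real n) \<le> e * x"
  proof -
    have "s / e * CL * lam ^ r * (lam ^ r / (real N * e ^ 3) + real r / real n) = (s * lam ^ r) / e * (CL * (lam ^ r / (real N * e ^ 3) + real r / real n))" by simp
    also have "\<dots> = e * (CL * (lam ^ r / (real N * e ^ 3) + real r / real n) / x)" unfolding sX using e0 by (simp add: power2_eq_square)
    also have "\<dots> \<le> e * x" using err e0 by (intro mult_left_mono) auto
    finally show ?thesis .
  qed
  have 2: "s * T * xs 1 0 r0 \<le> x ^ 2 * (8 * e)"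
  proof -
    have "s * T = (s * lam ^ r) * (x ^ 3 / e ^ 2)" by (simp add: T_def)
    also have "\<dots> = x ^ 2" unfolding sX using x e0 by (simp add: power2_eq_square power3_eq_cube)
    finally show ?thesis using surv_le8[OF h4(1)] by (simp add: mult_left_mono)
  qed
  have 3: "s * (2 * lam ^ r0 / e) \<le> e * x"
  proof -
    have "s * (2 * lam ^ r0 / e) = e / x * (2 * lam ^ r0 / lam ^ r)" using e0 x Xr by (simp add: s_def power2_eq_square field_simps)
    also have "\<dots> \<le> e / x * x ^ 2" using h8 e0 x by (intro mult_left_mono) auto
    also have "\<dots> = e * x" using x by (simp add: power2_eq_square)
    finally show ?thesis .
  qed
  have "e / (real q / 2 + x + 17 * x) = e * (1 / (real q / 2 + 18 * x))" by simp
  hence "pl \<le> xs (1 - s) 1 r - e * x - e * x - x ^ 2 * (8 * e)"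
    using main unfolding pl_def Pl_def by (simp add: algebra_simps)
  also have "\<dots> \<le> xs (1 - s) 1 r - s / e * CL * lam ^ r * (lam ^ r / (real N * e ^ 3) + real r / real n) - s * (2 * lam ^ r0 / e) - s * T * xs 1 0 r0"
    using 1 2 3 by linarith
  also have "\<dots> \<le> Ex r (init J) (\<lambda>s. of_bool (T \<le> real (card (fst s))))"
    using s0 s2 fT h14 by (intro dead_lower reg J) auto
  finally show ?thesis .
qed

lemma C3:
  assumes J: "J \<in> JS"
  shows "pl \<le> bexp p KS (\<lambda>H. of_bool (large L H J))"
proof -
  have "pl \<le> bexp p KS (\<lambda>H. of_bool (T \<le> real (card (fst (run H r (init J))))))"
    using dead_ge[OF J] by (simp add: Ex_init)
  also have "\<dots> \<le> bexp p KS (\<lambda>H. of_bool (large L H J))"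
  proof (intro bexp_mono p0 p1)
    fix H assume H: "H \<subseteq> KS"
    have "fst (run H r (init J)) \<subseteq> comp H J"
      using run_connected[OF H J, of _ r] run_init_sub(2)[OF J, of H r] by (auto simp: comp_def)
    hence "card (fst (run H r (init J))) \<le> card (comp H J)" by (intro card_mono) auto
    thus "of_bool (T \<le> real (card (fst (run H r (init J))))) \<le> (of_bool (large L H J) :: real)"
      using fT(3) by (auto simp: large_def of_bool_def)
  qed
  finally show ?thesis .
qed

lemma good_alive:
  assumes J: "J \<in> JS" and "f \<le> real (card (snd (run H r (init J)))) \<or> T \<le> real (card (fst (run H r (init J))))"
  shows "alive L {} (run H r0 (init J))"
proof -
  obtain D G where s: "run H r0 (init J) = (D, G)" by (cases "run H r0 (init J)")
  have rr: "run H r (init J) = run H (r - r0) (D, G)" using run_add[of H r0 "r - r0" "init J"] h14 by (simp add: s)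
  show ?thesis
  proof (cases "G = {}")
    case True
    hence "run H r (init J) = (D, {})" using rr by (simp add: run_empty_front)
    thus ?thesis using assms(2) fT by (auto simp: alive_def s)
  qed (simp add: alive_def s)
qed

text \<open>Each of the two events has probability at least \<open>pl\<close>, and either one forces
  the exploration to be alive at level \<open>r0\<close>, which has probability at most
  \<open>a\<close>; inclusion and exclusion gives their intersection.\<close>

lemma good_prob:
  assumes J: "J \<in> JS"
  shows "2 * pl - a \<le> Ex r (init J) (\<lambda>s. of_bool (good f T s))" and "Ex r (init J) (\<lambda>s. of_bool (good f T s)) \<le> a"
proof -
  let ?R = "\<lambda>H. run H r (init J)"
  have al: "Ex r0 (init J) (\<lambda>s. of_bool (alive L {} s)) \<le> a"
    using alive_upper[of "{}" J L r0] J lam h5 a_ge by (simp add: init_def pre_def)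
  have "bexp p KS (\<lambda>H. of_bool (f \<le> real (card (snd (?R H)))) + of_bool (T \<le> real (card (fst (?R H))))) \<le>
     bexp p KS (\<lambda>H. of_bool (good f T (?R H)) + of_bool (alive L {} (run H r0 (init J))))"
    using good_alive[OF J] by (intro bexp_mono p0 p1) (auto simp: good_def)
  thus "2 * pl - a \<le> Ex r (init J) (\<lambda>s. of_bool (good f T s))"
    using front_ge[OF J] dead_ge[OF J] al by (simp add: bexp_add Ex_init)
  have "bexp p KS (\<lambda>H. of_bool (good f T (?R H))) \<le> bexp p KS (\<lambda>H. of_bool (alive L {} (run H r0 (init J))))"
    using good_alive[OF J] by (intro bexp_mono p0 p1) (auto simp: good_def)
  thus "Ex r (init J) (\<lambda>s. of_bool (good f T s)) \<le> a" using al by (simp add: Ex_init)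
qed

text \<open>After expanding the product, the term with a factor \<open>nu l\<close> uses
  \<open>nu l \<le> j ^ 2 / n\<close> and the term with \<open>1 / nu l\<close> uses
  \<open>nu l \<ge> 1 / N\<close>.\<close>

lemma pair_term:
  assumes J: "J \<in> JS" and l: "l \<in> {1..j}"
  shows "Ex r (init J) (\<lambda>s. pst l (snd s)) * GG r (pst l) / nu l \<le> 
    32 * real q ^ 2 * real N * ((lam ^ r) ^ 2 / e) * (real j ^ 2 / real n * (lam ^ r) ^ 2 / e ^ 3 + 4 / (1 - alpha) ^ 2 * lam ^ r / e ^ 2 + 4 / (1 - alpha) ^ 4 * real N)"
proof -
  let ?X = "lam ^ r" and ?c = "2 / (1 - alpha) ^ 2"
  have nup: "0 < nu l" using nu_ge[of l] l N_pos by (meson atLeastAtMost_iff divide_pos_pos less_le_trans zero_less_one of_nat_0_less_iff)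
  have al: "0 < 1 - alpha" "1 - alpha \<le> 1" using alpha_bounds by auto
  have c: "2 / (1 - alpha) \<le> ?c" using al by (intro divide_left_mono) (auto simp: power2_eq_square mult_left_le)
  have c0: "0 \<le> ?c" by simp
  have iszb: "0 \<le> isz l J J' \<and> isz l J J' \<le> 1" for J J' by (simp add: isz_def)
  have F: "Ex r (init J) (\<lambda>s. pst l (snd s)) \<le> 2 * real q * ?X * (nu l * ?X / e + ?c)"
  proof -
    have "Ex r (init J) (\<lambda>s. pst l (snd s)) \<le> 2 * real q * ?X * (nu l * ?X / e + 2 / (1 - alpha))"
      unfolding Ex_init pst_def by (rule pair_stat_front[OF reg J]) (use nup iszb avg_isz in auto)
    also have "\<dots> \<le> 2 * real q * ?X * (nu l * ?X / e + ?c)"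
      using c lam by (intro mult_left_mono add_left_mono) auto
    finally show ?thesis .
  qed
  have G: "GG r (pst l) \<le> real N * (16 * real q * ((?X / e) * (nu l * ?X / e ^ 2 + ?c)))"
  proof -
    have "GG r (pst l) \<le> (\<Sum>J\<in>JS. 16 * real q * (nu l * lam ^ (2 * r) / e ^ 3 + ?X / (e * (1 - alpha) ^ 2)))"
      unfolding GG_def Ex_init pst_def
      by (intro sum_mono pair_stat_dead[OF reg]) (use nup iszb avg_isz isz_sym in auto)
    also have "\<dots> = real N * (16 * real q * (nu l * lam ^ (2 * r) / e ^ 3 + ?X / (e * (1 - alpha) ^ 2)))" by (simp add: card_JS)
    also have "\<dots> \<le> real N * (16 * real q * ((?X / e) * (nu l * ?X / e ^ 2 + ?c)))"
    proof (intro mult_left_mono)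
      have "lam ^ (2 * r) = ?X * ?X" by (simp add: mult_2 power_add)
      hence "nu l * lam ^ (2 * r) / e ^ 3 + ?X / (e * (1 - alpha) ^ 2) = (?X / e) * (nu l * ?X / e ^ 2 + 1 / (1 - alpha) ^ 2)"
        by (simp add: power2_eq_square power3_eq_cube distrib_left mult_ac)
      also have "\<dots> \<le> (?X / e) * (nu l * ?X / e ^ 2 + ?c)"
        using lam e0 al by (intro mult_left_mono add_left_mono divide_right_mono) auto
      finally show "nu l * lam ^ (2 * r) / e ^ 3 + ?X / (e * (1 - alpha) ^ 2) \<le> (?X / e) * (nu l * ?X / e ^ 2 + ?c)" .
    qed auto
    finally show ?thesis .
  qed
  have "Ex r (init J) (\<lambda>s. pst l (snd s)) * GG r (pst l) / nu l \<le> 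
     (2 * real q * ?X * (nu l * ?X / e + ?c)) * (real N * (16 * real q * ((?X / e) * (nu l * ?X / e ^ 2 + ?c)))) / nu l"
    using F G nup lam e0 c0 by (intro divide_right_mono mult_mono GG_nonneg pst_nonneg) (auto intro!: add_nonneg_nonneg mult_nonneg_nonneg)
  also have "\<dots> = 32 * real q ^ 2 * real N * (?X ^ 2 / e) * (((nu l * ?X / e + ?c) * (nu l * ?X / e ^ 2 + ?c)) / nu l)"
    by (simp add: power2_eq_square)
  also have "\<dots> \<le> 32 * real q ^ 2 * real N * (?X ^ 2 / e) * (real j ^ 2 / real n * ?X ^ 2 / e ^ 3 + 4 / (1 - alpha) ^ 2 * ?X / e ^ 2 + 4 / (1 - alpha) ^ 4 * real N)"
  proof (intro mult_left_mono)
    have "((nu l * ?X / e + ?c) * (nu l * ?X / e ^ 2 + ?c)) / nu l = nu l * (?X ^ 2 / e ^ 3) + ?c * (?X / e) + ?c * (?X / e ^ 2) + ?c ^ 2 * (1 / nu l)"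
    proof -
      have "((v * X / e + c) * (v * X / e ^ 2 + c)) / v = v * (X ^ 2 / e ^ 3) + c * (X / e) + c * (X / e ^ 2) + c ^ 2 * (1 / v)"
        if "0 < v" for v c X
        using that e0 by (simp add: field_simps power2_eq_square power3_eq_cube)
      from this[OF nup] show ?thesis .
    qed
    also have "\<dots> \<le> real j ^ 2 / real n * (?X ^ 2 / e ^ 3) + ?c * (?X / e ^ 2) + ?c * (?X / e ^ 2) + ?c ^ 2 * real N"
    proof (intro add_mono mult_left_mono mult_right_mono)
      show "nu l \<le> real j ^ 2 / real n" using l by (intro nu_le) auto
      show "?X / e \<le> ?X / e ^ 2" using lam e0 by (intro divide_left_mono) (auto simp: power2_eq_square mult_left_le)
      have "1 / real N \<le> nu l" using nu_ge[of l] l by auto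
      thus "1 / nu l \<le> real N" using nup N_pos by (simp add: field_simps)
    qed (use lam e0 in auto)
    also have "?c ^ 2 = 4 / (1 - alpha) ^ 4" by (simp add: power_divide flip: power_mult)
    finally show "((nu l * ?X / e + ?c) * (nu l * ?X / e ^ 2 + ?c)) / nu l \<le> 
       real j ^ 2 / real n * ?X ^ 2 / e ^ 3 + 4 / (1 - alpha) ^ 2 * ?X / e ^ 2 + 4 / (1 - alpha) ^ 4 * real N" by simp
  qed (use lam e0 in auto)
  finally show ?thesis .
qed

text \<open>The main term is \<open>(2 * pl - a) * pl\<close>. The errors are divided by
  \<open>f ^ 2 * T ^ 2\<close> and \<open>T * f\<close>, which carry \<open>x ^ 12\<close> and
  \<open>x ^ 6\<close>; this explains the powers of \<open>x\<close> in \<open>h12\<close> and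
  \<open>h13\<close>.\<close>

lemma C4:
  assumes J: "J \<in> JS" and pos: "0 \<le> Pl (real q) x" "Ua (real q) x \<le> 2 * Pl (real q) x"
  shows "real N * e ^ 2 * ((2 * Pl (real q) x - Ua (real q) x) * Pl (real q) x - x * Ua (real q) x - 2 * x)
     \<le> (\<Sum>J2\<in>JS. bexp p KS (\<lambda>H. of_bool (J2 \<in> comp H J \<and> large L H J)))"
proof -
  let ?X = "lam ^ r" and ?U = "Ua (real q) x" and ?P = "Pl (real q) x"
  let ?g = "Ex r (init J) (\<lambda>s. of_bool (good f T s))"
  have Np: "0 < real N" using N_pos by simp
  have t1: "real N * (e ^ 2 * ((2 * ?P - ?U) * ?P)) \<le> ?g * GG r (\<lambda>X. of_bool (T \<le> real (card X)))"
  proof -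
    have "real N * pl = (\<Sum>J\<in>JS. pl)" by (simp add: card_JS)
    also have "\<dots> \<le> GG r (\<lambda>X. of_bool (T \<le> real (card X)))" unfolding GG_def by (intro sum_mono dead_ge)
    finally have "(2 * pl - a) * (real N * pl) \<le> ?g * GG r (\<lambda>X. of_bool (T \<le> real (card X)))"
      using good_prob(1)[OF J] pos e0 by (intro mult_mono) (auto simp: pl_def a_def Ex_def intro!: mult_nonneg_nonneg bexp_nonneg p0 p1)
    moreover have "(2 * pl - a) * (real N * pl) = real N * (e ^ 2 * ((2 * ?P - ?U) * ?P))"
      by (simp add: pl_def a_def power2_eq_square algebra_simps)
    ultimately show ?thesis by simp
  qed
  have t2: "?g * (4 * (1 / nu 0 - 1) * real N) \<le> real N * (e ^ 2 * (x * ?U))"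
  proof -
    have "1 \<le> 1 / nu 0" using h11(1) nu_le_1[of 0] by simp
    hence nn: "0 \<le> 4 * (1 / nu 0 - 1) * real N" by simp
    have le: "4 * (1 / nu 0 - 1) * real N \<le> x * e * real N" using h11(2) by (rule mult_right_mono) simp
    have "?g * (4 * (1 / nu 0 - 1) * real N) \<le> a * (x * e * real N)"
      by (rule mult_mono[OF good_prob(2)[OF J] le a_nonneg nn])
    also have "\<dots> = real N * (e ^ 2 * (x * ?U))" by (simp add: a_def power2_eq_square)
    finally show ?thesis .
  qed
  have t3: "4 / (f ^ 2 * T ^ 2) * (\<Sum>l=1..j. Ex r (init J) (\<lambda>s. pst l (snd s)) * GG r (pst l) / nu l) \<le> real N * (e ^ 2 * x)"
  proof -
    let ?B = "32 * real q ^ 2 * real N * (?X ^ 2 / e) * (real j ^ 2 / real n * ?X ^ 2 / e ^ 3 + 4 / (1 - alpha) ^ 2 * ?X / e ^ 2 + 4 / (1 - alpha) ^ 4 * real N)"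
    have "4 / (f ^ 2 * T ^ 2) * (\<Sum>l=1..j. Ex r (init J) (\<lambda>s. pst l (snd s)) * GG r (pst l) / nu l) \<le> 4 / (f ^ 2 * T ^ 2) * (\<Sum>l=1..j. ?B)"
      by (rule mult_left_mono[OF sum_mono[OF pair_term[OF J]]]) auto
    also have "(\<Sum>l=1..j. ?B) = real j * ?B" by simp
    also have "4 / (f ^ 2 * T ^ 2) * (real j * ?B) = real N * e ^ 2 / x ^ 12 * (128 * real j * real q ^ 2 * (real j ^ 2 / real n + 4 / (1 - alpha) ^ 2 * e / ?X + 4 / (1 - alpha) ^ 4 * (real N * e ^ 3 / lam ^ (2 * r))))"
    proof -
      have fT2: "f ^ 2 * T ^ 2 = x ^ 12 * ?X ^ 4 / e ^ 6"
      proof -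
        have "(x ^ 3 * Y / e) ^ 2 * (x ^ 3 * Y / e ^ 2) ^ 2 = x ^ 12 * Y ^ 4 / e ^ 6" for Y :: real
          by (simp add: eval_nat_numeral mult_ac)
        thus ?thesis unfolding f_def T_def .
      qed
      have "lam ^ (2 * r) = ?X ^ 2" by (simp add: power_mult mult.commute[of 2])
      have gen: "4 / (x ^ 12 * Y ^ 4 / e ^ 6) * (jj * (32 * Q * NN * (Y ^ 2 / e) * (A * Y ^ 2 / e ^ 3 + B * Y / e ^ 2 + C * NN))) =
         NN * e ^ 2 / x ^ 12 * (128 * jj * Q * (A + B * e / Y + C * (NN * e ^ 3 / Y ^ 2)))" if "0 < Y" for Y jj Q NN A B C :: real
      proof -
        have "4 / (x ^ 12 * Y ^ 4 / e ^ 6) * (jj * (32 * Q * NN * (Y ^ 2 / e) * (A * Y ^ 2 / e ^ 3 + B * Y / e ^ 2 + C * NN))) =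
          128 * jj * Q * NN / x ^ 12 * (e ^ 5 / Y ^ 2 * (A * Y ^ 2 / e ^ 3 + B * Y / e ^ 2 + C * NN))"
        proof -
          have "4 / (x ^ 12 * Y ^ 4 / e ^ 6) * (jj * (32 * Q * NN * (Y ^ 2 / e) * W)) = 128 * jj * Q * NN / x ^ 12 * (e ^ 5 / Y ^ 2 * W)" for W :: real
            using that e0 x by (simp add: eval_nat_numeral mult_ac)
          thus ?thesis .
        qed
        also have "e ^ 5 / Y ^ 2 * (A * Y ^ 2 / e ^ 3 + B * Y / e ^ 2 + C * NN) = e ^ 2 * (A + B * e / Y + C * (NN * e ^ 3 / Y ^ 2))"
          using that e0 by (simp add: field_simps eval_nat_numeral)
        finally show ?thesis by simp
      qed
      show ?thesis unfolding fT2 \<open>lam ^ (2 * r) = ?X ^ 2\<close> by (rule gen) (rule Xr(2))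
    qed
    also have "\<dots> \<le> real N * e ^ 2 / x ^ 12 * x ^ 13" using h12 by (intro mult_left_mono) auto
    also have "\<dots> = real N * (e ^ 2 * x)" using x by (simp add: eval_nat_numeral)
    finally show ?thesis .
  qed
  have t4: "(2 * real N / (T * f)) * Ex r (init J) (\<lambda>s. \<Sum>J2\<in>JS. bexp p KS (\<lambda>H. \<Sum>J\<in>taint (fst s) H r J2. of_bool (J \<in> snd s))) \<le> real N * (e ^ 2 * x)"
  proof -
    have "(2 * real N / (T * f)) * Ex r (init J) (\<lambda>s. \<Sum>J2\<in>JS. bexp p KS (\<lambda>H. \<Sum>J\<in>taint (fst s) H r J2. of_bool (J \<in> snd s))) \<le>
       (2 * real N / (T * f)) * (12 * real q ^ 2 * real r ^ 2 * lam ^ (2 * r) * ZZ r)"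
      using fT by (intro mult_left_mono taint_total reg J) auto
    also have "\<dots> = real N * e ^ 2 / x ^ 6 * (24 * real q ^ 2 * (e * real r) ^ 2 * (lam ^ r / (real N * e ^ 3) + 4 * real k / (e * real n * (1 - alpha) ^ 2)))"
    proof -
      have fT2: "T * f = x ^ 6 * lam ^ (2 * r) / e ^ 3"
        unfolding f_def T_def by (simp add: eval_nat_numeral power_add mult_ac)
      have Z: "ZZ r = e * (lam ^ r / (real N * e ^ 3) + 4 * real k / (e * real n * (1 - alpha) ^ 2))"
        unfolding ZZ_def using e0 by (simp add: distrib_left eval_nat_numeral)
      have gen: "(2 * NN / (x ^ 6 * Y / e ^ 3)) * (12 * Q * R * Y * (e * Z)) = NN * e ^ 2 / x ^ 6 * (24 * Q * (e ^ 2 * R) * Z)" if "0 < Y" for NN Y Q R Z :: real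
        using that e0 x by (simp add: field_simps eval_nat_numeral)
      have "0 < lam ^ (2 * r)" using lam by simp
      from gen[OF this] show ?thesis unfolding fT2 Z power_mult_distrib .
    qed
    also have "\<dots> \<le> real N * e ^ 2 / x ^ 6 * x ^ 7" using h13 by (intro mult_left_mono) auto
    also have "\<dots> = real N * (e ^ 2 * x)" using x by (simp add: eval_nat_numeral)
    finally show ?thesis .
  qed
  have "real N * e ^ 2 * ((2 * ?P - ?U) * ?P - x * ?U - 2 * x) = 
     real N * (e ^ 2 * ((2 * ?P - ?U) * ?P)) - real N * (e ^ 2 * (x * ?U)) - real N * (e ^ 2 * x) - real N * (e ^ 2 * x)"
    by (simp add: algebra_simps)
  also have "\<dots> \<le> ?g * GG r (\<lambda>X. of_bool (T \<le> real (card X))) - ?g * (4 * (1 / nu 0 - 1) * real N)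
     - 4 / (f ^ 2 * T ^ 2) * (\<Sum>l=1..j. Ex r (init J) (\<lambda>s. pst l (snd s)) * GG r (pst l) / nu l)
     - (2 * real N / (T * f)) * Ex r (init J) (\<lambda>s. \<Sum>J2\<in>JS. bexp p KS (\<lambda>H. \<Sum>J\<in>taint (fst s) H r J2. of_bool (J \<in> snd s)))"
    by (intro diff_mono t1 t2 t3 t4)
  also have "\<dots> \<le> (\<Sum>J2\<in>JS. bexp p KS (\<lambda>H. of_bool (J2 \<in> comp H J \<and> large L H J)))"
    by (rule connect_lower[OF J fT(1,2,3) h11(1)])
  finally show ?thesis .
qed

end

section \<open>Choice of the levels and existence of the parameters\<close>

lemma power_level:
  fixes l A :: real
  assumes l: "1 < l" "l \<le> 3 / 2" and A: "1 < A"
  obtains r :: nat where "A \<le> l ^ r" "l ^ r \<le> 2 * A" "(l - 1) * real r \<le> 2 * ln A + 2" "0 < r"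
proof -
  have "\<exists>r. A \<le> l ^ r" using real_arch_pow[OF l(1), of A] by (auto intro: less_imp_le)
  define r where "r = (LEAST r. A \<le> l ^ r)"
  have r: "A \<le> l ^ r" unfolding r_def using \<open>\<exists>r. A \<le> l ^ r\<close> by (rule LeastI_ex)
  have r0: "r \<noteq> 0" using r A by (cases r) auto
  then obtain m where m: "r = Suc m" by (cases r) auto
  have less: "l ^ m < A" using not_less_Least[of m "\<lambda>r. A \<le> l ^ r"] m by (auto simp: r_def)
  have "l * l ^ m \<le> 2 * A" using less l A by (intro mult_mono) auto
  hence 2: "l ^ r \<le> 2 * A" by (simp add: m)
  \<comment> \<open>This gives \<open>ln l \<ge> (l - 1) / 2\<close>, so about
    \<open>2 * ln A / (l - 1)\<close> levels suffice to reach \<open>A\<close>.\<close>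
  have "(l - 1) - (l - 1) ^ 2 \<le> ln (1 + (l - 1))" using l by (intro ln_one_plus_pos_lower_bound) auto
  moreover have "(l - 1) * (l - 1) \<le> (l - 1) * (1 / 2)" using l by (intro mult_left_mono) auto
  ultimately have ln: "(l - 1) / 2 \<le> ln l" by (simp add: power2_eq_square)
  have "(l - 1) / 2 * real m \<le> ln l * real m" using ln by (intro mult_right_mono) auto
  also have "\<dots> = ln (l ^ m)" using l by (simp add: ln_realpow)
  also have "\<dots> \<le> ln A" using less l A by simp
  finally have "(l - 1) * real m \<le> 2 * ln A" by simp
  hence "(l - 1) * real r \<le> 2 * ln A + 2" using l by (simp add: m algebra_simps)
  thus thesis using that r 2 r0 by auto
qed

context hyp
begin

text \<open>\<open>b\<close> is the fourth root of \<open>e ^ 3 * N\<close>. With levels reaching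
  \<open>b\<close> and \<open>b ^ 3\<close>, the error terms become inverse powers of
  \<open>b\<close>, \<open>n\<close> and \<open>e * n\<close> up to logarithms.\<close>

lemma giant_params_exist:
  assumes x: "0 < x" "x \<le> 1 / 2" and e: "0 < e" "e \<le> 1 / 2" "e \<le> (1 - alpha) / 2" "e \<le> x / (1 + 4 * real q)"
    and px: "p \<le> x" and b4: "real N * e ^ 3 = b ^ 4" and b: "16 * real q / x ^ 3 \<le> b"
    and en: "8 * real j ^ 2 \<le> x * (e * real n)"
    and f7: "CL * (2 / b + (6 * ln b + 2) / (e * real n)) \<le> x ^ 2"
    and f12: "128 * real j * real q ^ 2 * (real j ^ 2 / real n + 4 / (1 - alpha) ^ 2 * (1 / b) + 4 / (1 - alpha) ^ 4 * (1 / b)) \<le> x ^ 13"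
    and f13: "24 * real q ^ 2 * (6 * ln b + 2) ^ 2 * (2 / b + 4 * real k / (1 - alpha) ^ 2 * (1 / (e * real n))) \<le> x ^ 7"
  shows "\<exists>r0 r i0. giant_params n k j p x r0 r i0 (b ^ 2 / e ^ 2)"
proof -
  have q1: "1 \<le> real q" using q_pos by simp
  have al: "0 < alpha" "alpha < 1" using alpha_bounds by auto
  have lam: "1 < lam" "lam \<le> 3 / 2" using e by (auto simp: e_def)
  have bq: "16 * real q \<le> b * x ^ 3" using b x by (simp add: divide_le_eq)
  have b0: "0 < b"
  proof (rule ccontr)
    assume "\<not> 0 < b"
    hence "b * x ^ 3 \<le> 0" using x by (simp add: mult_nonpos_nonneg)
    thus False using bq q1 by simp
  qed
  have x3: "x ^ 3 \<le> x ^ 2" "x ^ 2 \<le> x"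
    using x power_decreasing[of 2 3 x] power_decreasing[of 1 2 x] by auto
  have bx2: "16 * real q \<le> b * x ^ 2" using mult_left_mono[OF x3(1), of b] bq b0 by linarith
  have bx: "16 * real q \<le> b * x" using mult_left_mono[OF x3(2), of b] bx2 b0 by linarith
  have b16: "16 \<le> b"
  proof -
    have "b * x \<le> b * 1" using x b0 by (intro mult_left_mono) auto
    thus ?thesis using bx q1 by simp
  qed
  have bp: "b \<le> b ^ 2" "b ^ 2 \<le> b ^ 3" "b \<le> b ^ 3"
    using b16 power_increasing[of 1 2 b] power_increasing[of 2 3 b] power_increasing[of 1 3 b] by auto
  obtain r0 where r0: "b \<le> lam ^ r0" "lam ^ r0 \<le> 2 * b" "0 < r0"
    using power_level[of lam b] lam b16 by auto
  obtain r where r: "b ^ 3 \<le> lam ^ r" "lam ^ r \<le> 2 * b ^ 3" "(lam - 1) * real r \<le> 2 * ln (b ^ 3) + 2"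
    using power_level[of lam "b ^ 3"] lam b16 bp by auto
  have er: "e * real r \<le> 6 * ln b + 2" using r(3) b0 by (simp add: e_def ln_realpow)
  \<comment> \<open>Long enough for the source in \<open>dead_ge\<close> to act over
    \<open>1 / e\<close> levels, short enough for \<open>lam ^ i0\<close> to stay bounded.\<close>
  define i0 where "i0 = nat \<lceil>1 / e\<rceil>"
  have i0: "1 / e \<le> real i0" "real i0 \<le> 1 / e + 1" using e by (auto simp: i0_def)
  have i8: "lam ^ i0 \<le> 8"
  proof -
    have "lam ^ i0 \<le> exp (e * real i0)"
      using exp_ge_add_one_self[of e] power_mono[of lam "exp e" i0] lam by (simp add: e_def exp_of_nat2_mult)
    also have "\<dots> \<le> exp (1 + e)" using i0 e by (simp add: field_simps)
    also have "\<dots> = exp 1 * exp e" by (simp add: exp_add)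
    also have "\<dots> \<le> 3 * 2"
    proof (intro mult_mono exp_le)
      have "e * e \<le> 1 / 2 * 1" using e by (intro mult_mono) auto
      moreover have "exp e \<le> 1 + e + e ^ 2" using e by (intro exp_bound) auto
      ultimately show "exp e \<le> 2" using e by (simp add: power2_eq_square)
    qed auto
    finally show ?thesis by simp
  qed
  have nn: "0 < real n" using nk jk by simp
  have Xp: "0 < lam ^ r0" "0 < lam ^ r" using lam by auto
  have ineq: "lam ^ a \<le> lam ^ c \<Longrightarrow> a \<le> c" for a c using lam power_increasing_iff[of lam a c] by simp
  have c1: "giant_params_axioms n k j p x r0 r i0 (b ^ 2 / e ^ 2)"
  proof
    show regular
    proof -
      have "e * alpha \<le> (1 - alpha) / 2 * 1" using e al by (intro mult_mono) auto
      thus ?thesis using lam by (auto simp: regular_def e_def algebra_simps)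
    qed
    have ca: "real q / 2 * (1 - x) \<le> ca"
    proof -
      have "p * real q \<le> x * real q" using px by (intro mult_right_mono) auto
      moreover have "real q / 2 * (1 - x) = (real q - x * real q) / 2" by (simp add: field_simps)
      ultimately show ?thesis using lam by (simp add: ca_def)
    qed
    show "real q / 2 * (1 - x) \<le> ca" by (rule ca)
    have "real q / 2 * (1 / 2) \<le> real q / 2 * (1 - x)" using x by (intro mult_left_mono) auto
    hence ca4: "real q / 4 \<le> ca" using ca by simp
    show "(real q - 1 + lam) / 2 + (real q / 2 + x) * ((real q - 1 + lam) / 2) * (e / ca) \<le> real q / 2 + x"
    proof -
      have "e / ca \<le> e / (real q / 4)" using ca4 q1 e by (intro divide_left_mono) auto
      hence "(real q / 2 + x) * ((real q - 1 + lam) / 2) * (e / ca) \<le> real q * real q * (e / (real q / 4))"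
        using x q1 lam e ca4 by (intro mult_mono) auto
      also have "\<dots> = 4 * real q * e" using q1 by simp
      finally have 1: "(real q / 2 + x) * ((real q - 1 + lam) / 2) * (e / ca) \<le> 4 * real q * e" .
      have "e * (1 + 4 * real q) \<le> x" using e(4) by (simp add: pos_le_divide_eq)
      moreover have "(real q - 1 + lam) / 2 = real q / 2 + e / 2" by (simp add: e_def field_simps)
      moreover have "e * (1 + 4 * real q) = e + 4 * real q * e" by (simp add: algebra_simps)
      ultimately show ?thesis using 1 e(1) by linarith
    qed
    show "2 \<le> lam ^ r0" using r0 b16 by simp
    show "lam ^ r0 / (lam ^ r0 - 1) \<le> 1 + x"
    proof -
      have "1 + x \<le> b * x" using bx q1 x by linarith
      also have "\<dots> \<le> lam ^ r0 * x" using r0 x by (intro mult_right_mono) auto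
      finally show ?thesis using r0 b16 by (simp add: pos_divide_le_eq algebra_simps)
    qed
    show "0 < b ^ 2 / e ^ 2" using b0 e by simp
    show "2 * lam ^ r0 / (e * (b ^ 2 / e ^ 2)) \<le> x * e"
    proof -
      have "2 * lam ^ r0 / (e * (b ^ 2 / e ^ 2)) = 2 * lam ^ r0 / b ^ 2 * e" using e b0 by (simp add: power2_eq_square)
      also have "\<dots> \<le> x * e"
      proof (intro mult_right_mono)
        have "2 * lam ^ r0 \<le> b * 4" using r0 by simp
        also have "\<dots> \<le> b * (b * x)" using bx q1 b0 by (intro mult_left_mono) auto
        finally show "2 * lam ^ r0 / b ^ 2 \<le> x" using b0 by (simp add: divide_le_eq power2_eq_square mult_ac)
      qed (use e in auto)
      finally show ?thesis .
    qed
    show "4 * lam ^ (2 * r0) / e \<le> x * e ^ 2 * real N"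
    proof -
      have "lam ^ (2 * r0) = lam ^ r0 * lam ^ r0" by (simp add: mult_2 power_add)
      also have "\<dots> \<le> (2 * b) * (2 * b)" using r0 lam b0 by (intro mult_mono) auto
      finally have "4 * lam ^ (2 * r0) \<le> 16 * b ^ 2" by (simp add: power2_eq_square)
      also have "\<dots> \<le> (b * (b * x)) * b ^ 2"
      proof (intro mult_right_mono)
        have "16 * 1 \<le> b * (b * x)" using bx q1 b16 by (intro mult_mono) auto
        thus "16 \<le> b * (b * x)" by simp
      qed auto
      also have "\<dots> = x * b ^ 4" by (simp add: eval_nat_numeral)
      finally have "4 * lam ^ (2 * r0) \<le> x * e ^ 2 * real N * e" unfolding b4[symmetric] by (simp add: eval_nat_numeral mult_ac)
      thus ?thesis using e by (simp add: pos_divide_le_eq)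
    qed
    have X4: "lam ^ r / (real N * e ^ 3) \<le> 2 / b"
    proof -
      have "lam ^ r / b ^ 4 \<le> 2 * b ^ 3 / b ^ 4" using r by (intro divide_right_mono) auto
      also have "\<dots> = 2 / b" using b0 by (simp add: eval_nat_numeral)
      finally show ?thesis by (simp add: b4)
    qed
    have rn: "real r / real n \<le> (6 * ln b + 2) / (e * real n)"
    proof -
      have "real r / real n = (e * real r) / (e * real n)" using e by simp
      also have "\<dots> \<le> (6 * ln b + 2) / (e * real n)" using er e nn by (intro divide_right_mono) auto
      finally show ?thesis .
    qed
    show "CL * (lam ^ r / (real N * e ^ 3) + real r / real n) \<le> x ^ 2"
      using mult_left_mono[OF add_mono[OF X4 rn] CL_nonneg] f7 by linarith
    show "2 * lam ^ r0 / lam ^ r \<le> x ^ 2"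
    proof -
      have "4 * b \<le> 16 * real q * b" using q1 b0 by (simp add: mult_mono)
      also have "\<dots> \<le> b * x ^ 2 * b" using bx2 b0 by (intro mult_right_mono) auto
      also have "\<dots> = x ^ 2 * b ^ 2" by (simp add: power2_eq_square)
      also have "\<dots> \<le> x ^ 2 * lam ^ r" using bp r by (intro mult_left_mono) auto
      finally have "2 * lam ^ r0 \<le> x ^ 2 * lam ^ r" using r0 by linarith
      thus ?thesis using Xp by (simp add: divide_le_eq)
    qed
    have bX: "b \<le> lam ^ r" using bp r by linarith
    show "1 / lam ^ r \<le> x / (4 * real q)"
    proof -
      have "16 * real q \<le> x * lam ^ r" using bx mult_left_mono[OF bX, of x] x unfolding mult.commute[of b x] by linarith
      hence "4 * real q \<le> x * lam ^ r" using q1 by linarith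
      thus ?thesis using Xp q1 by (simp add: field_simps)
    qed
    show "b ^ 2 / e ^ 2 \<le> x ^ 3 * lam ^ r / e ^ 2"
    proof (intro divide_right_mono)
      have "b ^ 2 * 1 \<le> b ^ 2 * (b * x ^ 3)" using bq q1 by (intro mult_left_mono) auto
      also have "\<dots> = x ^ 3 * b ^ 3" by (simp add: eval_nat_numeral)
      also have "\<dots> \<le> x ^ 3 * lam ^ r" using r x by (intro mult_left_mono) auto
      finally show "b ^ 2 \<le> x ^ 3 * lam ^ r" by simp
    qed auto
    have jn: "real j ^ 2 / real n \<le> x * e / 8" using en nn by (simp add: field_simps)
    have xe: "x * e \<le> 1 / 2 * (1 / 2)" using x e by (intro mult_mono) auto
    show nu0: "0 < nu 0" using nu0_ge jn xe by linarith
    show "4 * (1 / nu 0 - 1) \<le> x * e"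
    proof -
      have "1 - x * e / 8 \<le> nu 0" using nu0_ge jn by linarith
      hence "1 / nu 0 \<le> 1 / (1 - x * e / 8)" using xe by (intro divide_left_mono) auto
      also have "\<dots> \<le> 1 + x * e / 4"
      proof -
        have "0 \<le> x * e * (1 - x * e / 4)" using x e xe by (intro mult_nonneg_nonneg) auto
        thus ?thesis using xe by (simp add: pos_divide_le_eq algebra_simps)
      qed
      finally show ?thesis by simp
    qed
    show "128 * real j * real q ^ 2 * (real j ^ 2 / real n + 4 / (1 - alpha) ^ 2 * e / lam ^ r + 4 / (1 - alpha) ^ 4 * (real N * e ^ 3 / lam ^ (2 * r))) \<le> x ^ 13"
    proof -
      have 1: "e / lam ^ r \<le> 1 / b" using bX b0 e by (intro frac_le) auto
      have 2: "real N * e ^ 3 / lam ^ (2 * r) \<le> 1 / b"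
      proof -
        have "b ^ 4 * b \<le> b ^ 3 * b ^ 3" using bp b0 power_increasing[of 5 6 b] b16 by (simp add: eval_nat_numeral mult_ac)
        also have "\<dots> \<le> lam ^ r * lam ^ r" using r b0 by (intro mult_mono) auto
        also have "\<dots> = lam ^ (2 * r)" by (simp add: mult_2 power_add)
        finally show ?thesis unfolding b4 using b0 lam by (simp add: field_simps)
      qed
      have "128 * real j * real q ^ 2 * (real j ^ 2 / real n + 4 / (1 - alpha) ^ 2 * (e / lam ^ r) + 4 / (1 - alpha) ^ 4 * (real N * e ^ 3 / lam ^ (2 * r))) \<le>
        128 * real j * real q ^ 2 * (real j ^ 2 / real n + 4 / (1 - alpha) ^ 2 * (1 / b) + 4 / (1 - alpha) ^ 4 * (1 / b))"
        using 1 2 by (intro mult_left_mono add_mono) auto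
      thus ?thesis using f12 by simp
    qed
    show "24 * real q ^ 2 * (e * real r) ^ 2 * (lam ^ r / (real N * e ^ 3) + 4 * real k / (e * real n * (1 - alpha) ^ 2)) \<le> x ^ 7"
    proof -
      have "24 * real q ^ 2 * (e * real r) ^ 2 * (lam ^ r / (real N * e ^ 3) + 4 * real k / (e * real n * (1 - alpha) ^ 2)) \<le>
        24 * real q ^ 2 * (6 * ln b + 2) ^ 2 * (2 / b + 4 * real k / (1 - alpha) ^ 2 * (1 / (e * real n)))"
        using X4 er e lam by (intro mult_mono mult_left_mono add_mono power_mono) (auto intro!: add_nonneg_nonneg divide_nonneg_nonneg mult_nonneg_nonneg simp: mult.commute)
      thus ?thesis using f13 by linarith
    qed
    show "i0 \<le> r" using ineq[of i0 r] i8 r bp b16 by linarith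
    show "lam ^ i0 \<le> 8" by (rule i8)
    show "1 \<le> e * real i0" using i0(1) e by (simp add: field_simps)
    show "r0 \<le> r"
    proof (rule ineq)
      have "2 * b \<le> b * b" using b16 by simp
      thus "lam ^ r0 \<le> lam ^ r" using r0 r bp by (simp add: power2_eq_square)
    qed
    show "0 < r0" by (rule r0)
  qed (use x in auto)
  show ?thesis using c1 hyp_axioms unfolding giant_params_def by blast
qed

section \<open>The subcritical regime\<close>

lemma run_length:
  assumes "J \<in> JS" "snd (run H r (init J)) \<noteq> {}"
  shows "r \<le> card (fst (run H r (init J)))"
  using assms(2)
proof (induction r)
  case (Suc r)
  obtain D G where s: "run H r (init J) = (D, G)" by (cases "run H r (init J)")
  have "run H (Suc r) (init J) = run H (Suc 0) (run H r (init J))" using run_add[of H r "Suc 0"] by simp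
  hence R: "run H (Suc r) (init J) = (D \<union> G, nw j (H \<inter> KK D G) G)" by (simp add: s)
  have G: "G \<noteq> {}" using Suc.prems R by (auto simp: KK_def nw_def)
  have "r \<le> card D" using Suc.IH G by (simp add: s)
  moreover have "card (D \<union> G) = card D + card G" "card G \<noteq> 0"
    using run_init_sub(3,4,5)[OF assms(1), of H r] G by (auto simp: s card_Un_disjoint)
  ultimately show ?case by (simp add: R)
qed simp

text \<open>Losses do no harm here: for \<open>z \<ge> 1\<close> and \<open>th \<ge> 0\<close>
  domination by the branching process points in the required direction.\<close>

lemma large_exp_bound:
  assumes J: "J \<in> JS" and th: "0 \<le> th" and z: "1 \<le> z" "exp th * gen z \<le> z"
  shows "bexp p KS (\<lambda>H. of_bool (large L H J)) \<le> z * exp (- th * L)"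
proof -
  define \<psi> where "\<psi> s = exp (th * real (card (fst s))) * z ^ card (snd s)" for s :: "nat set set \<times> nat set set"
  have gen0: "0 \<le> gen z" unfolding gen_def using p0 p1 z by simp
  have pot: "Ex r (D, G) \<psi> \<le> \<psi> (D, G)" if "pre D G" for r D G
    using that
  proof (rule Ex_induct_le[where \<psi> = "\<lambda>_. \<psi>", rotated -1])
    fix D G assume pre: "pre D G"
    have fin: "finite D" "finite G" "D \<inter> G = {}" using pre finite_JS_sub by (auto simp: pre_def)
    have "bexp p (KK D G) (\<lambda>H. \<psi> (D \<union> G, nw j H G)) = exp (th * real (card (D \<union> G))) * bexp p (KK D G) (\<lambda>H. z ^ card (nw j H G))"
      by (simp add: \<psi>_def bexp_cmult)
    also have "\<dots> \<le> exp (th * real (card (D \<union> G))) * gen z ^ card G"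
      using pre z by (intro mult_left_mono step_power_large) (auto simp: pre_def)
    also have "\<dots> = exp (th * real (card D)) * (exp th * gen z) ^ card G"
      using fin by (simp add: card_Un_disjoint distrib_left exp_add power_mult_distrib exp_of_nat2_mult)
    also have "\<dots> \<le> exp (th * real (card D)) * z ^ card G"
      using z gen0 by (intro mult_left_mono power_mono) auto
    finally show "bexp p (KK D G) (\<lambda>H. \<psi> (D \<union> G, nw j H G)) \<le> \<psi> (D, G)" by (simp add: \<psi>_def)
  qed auto
  \<comment> \<open>Every level with a nonempty frontier adds a dead j-set, so after
    \<open>N + 1\<close> levels the frontier is empty and the dead set is the component.\<close>
  let ?r = "Suc N"
  have "bexp p KS (\<lambda>H. of_bool (large L H J)) \<le> bexp p KS (\<lambda>H. exp (- th * L) * \<psi> (run H ?r (init J)))"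
  proof (intro bexp_mono p0 p1)
    fix H assume H: "H \<subseteq> KS"
    let ?s = "run H ?r (init J)"
    show "of_bool (large L H J) \<le> exp (- th * L) * \<psi> ?s"
    proof (cases "large L H J")
      case True
      have "card (fst ?s) \<le> card JS" using run_init_sub(2)[OF J] by (intro card_mono) auto
      hence "snd ?s = {}" using run_length[OF J, of H ?r] card_JS by fastforce
      hence "L \<le> real (card (fst ?s))" using large_alive[OF H _ J True, of ?r] by (auto simp: alive_def)
      hence "th * L \<le> th * real (card (fst ?s))" using th by (intro mult_left_mono) auto
      hence "1 \<le> exp (- th * L + th * real (card (fst ?s)))" by simp
      also have "\<dots> = exp (- th * L) * \<psi> ?s" unfolding \<psi>_def using \<open>snd ?s = {}\<close> by (simp del: run.simps flip: exp_add)
      finally show ?thesis by simp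
    qed (use z in \<open>simp add: \<psi>_def\<close>)
  qed
  also have "\<dots> = exp (- th * L) * Ex ?r (init J) \<psi>" by (simp only: bexp_cmult Ex_init)
  also have "\<dots> \<le> exp (- th * L) * \<psi> (init J)"
    using pot[of "{}" "{J}" ?r] J by (intro mult_left_mono) (auto simp: init_def pre_def)
  finally show ?thesis by (simp add: \<psi>_def mult.commute)
qed

lemma subcritical_large:
  assumes J: "J \<in> JS" and ep: "0 < ep" "ep \<le> 1" and lam: "lam \<le> 1 - ep"
  shows "bexp p KS (\<lambda>H. of_bool (large L H J)) \<le> 3 * exp (- (ep ^ 2 / (4 * real q)) * L)"
proof -
  have q1: "1 \<le> real q" using q_pos by simp
  define z where "z = exp (ep / (2 * real q))"
  have z1: "1 \<le> z" using ep by (simp add: z_def)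
  have z3: "z \<le> 3"
  proof -
    have "ep / (2 * real q) \<le> 1" using ep q1 by (simp add: divide_le_eq)
    hence "z \<le> exp 1" by (simp add: z_def)
    thus ?thesis using exp_le by linarith
  qed
  have zq: "z ^ q \<le> 1 + ep / 2 + ep ^ 2 / 4"
  proof -
    have "z ^ q = exp (ep / 2)" using q1 by (simp add: z_def flip: exp_of_nat_mult)
    also have "\<dots> \<le> 1 + ep / 2 + (ep / 2) ^ 2" using ep by (intro exp_bound) auto
    finally show ?thesis by (simp add: power_divide)
  qed
  have zq1: "1 \<le> z ^ q" using z1 by simp
  have "gen z \<le> exp (p * (z ^ q - 1)) ^ M"
  proof -
    have "1 - p + p * z ^ q = 1 + p * (z ^ q - 1)" by (simp add: algebra_simps)
    also have "\<dots> \<le> exp (p * (z ^ q - 1))" by (rule exp_ge_add_one_self)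
    finally show ?thesis unfolding gen_def using p0 p1 z1 by (intro power_mono) auto
  qed
  also have "\<dots> = exp (p * real M * (z ^ q - 1))" by (simp flip: exp_of_nat_mult add: mult_ac)
  also have "\<dots> \<le> exp ((1 - ep) / real q * (ep / 2 + ep ^ 2 / 4))"
  proof -
    have "p * real M \<le> (1 - ep) / real q" using lam q1 by (simp add: lam_def pos_le_divide_eq)
    thus ?thesis using mult_mono[of "p * real M" "(1 - ep) / real q" "z ^ q - 1" "ep / 2 + ep ^ 2 / 4"] zq zq1 ep by simp
  qed
  finally have "exp (ep ^ 2 / (4 * real q)) * gen z \<le> exp (ep ^ 2 / (4 * real q)) * exp ((1 - ep) / real q * (ep / 2 + ep ^ 2 / 4))" by simp
  also have "\<dots> \<le> z"
  proof -
    \<comment> \<open>The quadratic terms cancel: 1/4 from the tilt of the dead set and 1/4 from the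
      bound on \<open>z ^ q\<close>, against 1/2 from the drift.\<close>
    have "ep ^ 2 / (4 * real q) + (1 - ep) / real q * (ep / 2 + ep ^ 2 / 4) = ep / (2 * real q) - ep ^ 3 / (4 * real q)"
      using q1 by (simp add: field_simps eval_nat_numeral)
    moreover have "0 \<le> ep ^ 3 / (4 * real q)" using ep by simp
    ultimately show ?thesis by (simp add: z_def flip: exp_add)
  qed
  finally have "bexp p KS (\<lambda>H. of_bool (large L H J)) \<le> z * exp (- (ep ^ 2 / (4 * real q)) * L)"
    using J z1 q1 by (intro large_exp_bound) auto
  also have "\<dots> \<le> 3 * exp (- (ep ^ 2 / (4 * real q)) * L)" using z3 by (intro mult_right_mono) auto
  finally show ?thesis .
qed

lemma subcritical_prob:
  assumes ep: "0 < ep" "ep \<le> 1" and lam: "lam \<le> 1 - ep"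
  shows "1 - 3 * real N * exp (- (ep ^ 2 / (4 * real q)) * L) \<le> bexp p KS (\<lambda>H. of_bool (\<forall>X\<in>jcomponents n j H. real (card X) \<le> L))"
proof -
  have "bexp p KS (\<lambda>H. 1 + (-1) * (\<Sum>J\<in>JS. of_bool (large L H J))) \<le> bexp p KS (\<lambda>H. of_bool (\<forall>X\<in>jcomponents n j H. real (card X) \<le> L))"
  proof (intro bexp_mono p0 p1)
    fix H assume "H \<subseteq> KS"
    show "1 + (-1) * (\<Sum>J\<in>JS. of_bool (large L H J)) \<le> (of_bool (\<forall>X\<in>jcomponents n j H. real (card X) \<le> L) :: real)"
    proof (cases "\<forall>X\<in>jcomponents n j H. real (card X) \<le> L")
      case True
      have "0 \<le> (\<Sum>J\<in>JS. of_bool (large L H J) :: real)" by (intro sum_nonneg) auto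
      thus ?thesis using True by simp
    next
      case False
      then obtain J where J: "J \<in> JS" "large L H J" unfolding jcomponents_eq by (auto simp: large_def)
      have "(of_bool (large L H J) :: real) \<le> (\<Sum>J\<in>JS. of_bool (large L H J))"
        by (rule member_le_sum[OF J(1)]) auto
      thus ?thesis using J False by simp
    qed
  qed
  moreover have "bexp p KS (\<lambda>H. 1 + (-1) * (\<Sum>J\<in>JS. of_bool (large L H J))) = 1 - (\<Sum>J\<in>JS. bexp p KS (\<lambda>H. of_bool (large L H J)))"
    unfolding bexp_add bexp_cmult bexp_sum by simp
  moreover have "(\<Sum>J\<in>JS. bexp p KS (\<lambda>H. of_bool (large L H J))) \<le> (\<Sum>J\<in>JS. 3 * exp (- (ep ^ 2 / (4 * real q)) * L))"
    by (intro sum_mono subcritical_large ep lam)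
  ultimately show ?thesis by (simp add: card_JS mult_ac)
qed

end

section \<open>Asymptotics\<close>

text \<open>Pascal's rule applied \<open>j\<close> times.\<close>

lemma choose_diff_bound:
  assumes "1 \<le> m" "j \<le> n"
  shows "(n choose m) \<le> ((n - j) choose m) + j * ((n - 1) choose (m - 1))"
  using assms(2)
proof (induction j)
  case (Suc j)
  have "(n - j) choose m = ((n - Suc j) choose (m - 1)) + ((n - Suc j) choose m)"
    using assms(1) Suc.prems choose_reduce_nat[of "n - j" m] by simp
  moreover have "(n - Suc j) choose (m - 1) \<le> (n - 1) choose (m - 1)" by (intro binomial_right_mono) auto
  ultimately show ?case using Suc by simp
qed simp

text \<open>\<open>p0\<close> is normalised by \<open>n choose (k - j)\<close>, while a j-set has
  \<open>(n - j) choose (k - j)\<close> k-sets above it; the mean offspring is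
  \<open>1 + c * ep n\<close> times this ratio (\<open>lam_pp\<close>).\<close>

lemma choose_ratio:
  assumes "1 \<le> m" "j \<le> n" "m \<le> n"
  shows "1 - real (j * m) / real n \<le> real ((n - j) choose m) / real (n choose m)"
    and "real ((n - j) choose m) / real (n choose m) \<le> 1"
proof -
  have c: "0 < real (n choose m)" "0 < real n" using assms by auto
  have "m * (n choose m) = n * ((n - 1) choose (m - 1))" using assms by (intro times_binomial_minus1_eq) auto
  hence "real m * real (n choose m) = real n * real ((n - 1) choose (m - 1))" by (metis of_nat_mult)
  hence a: "real ((n - 1) choose (m - 1)) = real m / real n * real (n choose m)" using c by (simp add: field_simps)
  have "real (n choose m) \<le> real ((n - j) choose m) + real j * real ((n - 1) choose (m - 1))"
    using choose_diff_bound[OF assms(1,2)] by (metis of_nat_add of_nat_mono of_nat_mult)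
  hence "(1 - real (j * m) / real n) * real (n choose m) \<le> real ((n - j) choose m)"
    unfolding a by (simp add: algebra_simps)
  thus "1 - real (j * m) / real n \<le> real ((n - j) choose m) / real (n choose m)" using c by (simp add: pos_le_divide_eq)
  have "(n - j) choose m \<le> n choose m" by (intro binomial_right_mono) auto
  thus "real ((n - j) choose m) / real (n choose m) \<le> 1" using c by simp
qed

lemma prob_tendsto_1:
  fixes P :: "nat \<Rightarrow> real"
  assumes "\<And>n. P n \<le> 1" "\<And>\<zeta>. 0 < \<zeta> \<Longrightarrow> eventually (\<lambda>n. 1 - \<zeta> \<le> P n) sequentially"
  shows "P \<longlonglongrightarrow> 1"
proof (rule order_tendstoI)
  fix a :: real assume "a < 1"
  hence "eventually (\<lambda>n. 1 - (1 - a) / 2 \<le> P n) sequentially" by (intro assms(2)) simp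
  thus "eventually (\<lambda>n. a < P n) sequentially" by eventually_elim (use \<open>a < 1\<close> in \<open>simp add: field_simps\<close>)
next
  fix a :: real assume "1 < a"
  thus "eventually (\<lambda>n. P n < a) sequentially" using assms(1) by (intro always_eventually) (metis le_less_trans)
qed

text \<open>As \<open>x\<close> tends to 0, both \<open>Ua\<close> and \<open>Pl\<close> tend to
  \<open>2 / q\<close>, and each inequality is strict in the limit.\<close>

lemma pick_x:
  fixes q eta :: real
  assumes q: "1 \<le> q" and eta: "0 < eta"
  obtains x where "0 < x" "x \<le> 1 / 2" "Ua q x ^ 2 + x \<le> (1 + eta) * (2 / q) ^ 2" "(1 - eta) * (2 / q) \<le> Pl q x" "0 \<le> Pl q x"
    "Ua q x \<le> 2 * Pl q x" "(1 - eta) * (2 / q) ^ 2 \<le> (2 * Pl q x - Ua q x) * Pl q x - x * Ua q x - 2 * x"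
proof -
  define c where "c = 2 / q"
  have c: "0 < c" using q by (simp add: c_def)
  have U: "((\<lambda>x. Ua q x) \<longlongrightarrow> c) (at_right 0)"
    unfolding Ua_def using q by (auto intro!: tendsto_eq_intros simp: c_def)
  have P: "((\<lambda>x. Pl q x) \<longlongrightarrow> c) (at_right 0)"
    unfolding Pl_def using q by (auto intro!: tendsto_eq_intros simp: c_def)
  have X: "((\<lambda>x :: real. x) \<longlongrightarrow> 0) (at_right 0)" by (rule tendsto_ident_at)
  have 1: "((\<lambda>x. Ua q x ^ 2 + x) \<longlongrightarrow> c ^ 2) (at_right 0)"
    using tendsto_add[OF tendsto_power[OF U, of 2] X] by simp
  have 2: "((\<lambda>x. 2 * Pl q x - Ua q x) \<longlongrightarrow> c) (at_right 0)"
    using tendsto_diff[OF tendsto_mult[OF tendsto_const[of 2] P] U] by simp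
  have 3: "((\<lambda>x. (2 * Pl q x - Ua q x) * Pl q x - x * Ua q x - 2 * x) \<longlongrightarrow> c ^ 2) (at_right 0)"
    using tendsto_diff[OF tendsto_diff[OF tendsto_mult[OF 2 P] tendsto_mult[OF X U]] tendsto_mult[OF tendsto_const[of 2] X]]
    by (simp add: power2_eq_square)
  have lt: "c ^ 2 < (1 + eta) * c ^ 2" "(1 - eta) * c < c" "(1 - eta) * c ^ 2 < c ^ 2" using c eta by (auto simp: algebra_simps)
  have "eventually (\<lambda>x. 0 < x) (at_right (0 :: real))" by (simp add: eventually_at_right_less)
  moreover have "eventually (\<lambda>x. x < 1 / 2) (at_right (0 :: real))" by (rule order_tendstoD(2)[OF X]) simp
  ultimately have "eventually (\<lambda>x. 0 < x \<and> x \<le> 1 / 2 \<and> Ua q x ^ 2 + x \<le> (1 + eta) * c ^ 2 \<and> (1 - eta) * c \<le> Pl q x \<and> 0 \<le> Pl q x \<and> 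
    Ua q x \<le> 2 * Pl q x \<and> (1 - eta) * c ^ 2 \<le> (2 * Pl q x - Ua q x) * Pl q x - x * Ua q x - 2 * x) (at_right 0)"
    using order_tendstoD(2)[OF 1 lt(1)] order_tendstoD(1)[OF P lt(2)] order_tendstoD(1)[OF P c] order_tendstoD(1)[OF 2 c] order_tendstoD(1)[OF 3 lt(3)]
    by eventually_elim auto
  then obtain x where "0 < x \<and> x \<le> 1 / 2 \<and> Ua q x ^ 2 + x \<le> (1 + eta) * c ^ 2 \<and> (1 - eta) * c \<le> Pl q x \<and> 0 \<le> Pl q x \<and> 
    Ua q x \<le> 2 * Pl q x \<and> (1 - eta) * c ^ 2 \<le> (2 * Pl q x - Ua q x) * Pl q x - x * Ua q x - 2 * x"
    using eventually_happens'[OF trivial_limit_at_right_real] by blast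
  thus thesis using that unfolding c_def by blast
qed

text \<open>The last assumption yields \<open>ep n * n \<ge> sqrt n\<close> (\<open>ep_n\<close>),
  so \<open>ep n\<close> outweighs both the relative error of order \<open>1 / n\<close> in the mean
  offspring and the local losses.\<close>

locale window =
  fixes k j :: nat and ep :: "nat \<Rightarrow> real"
  assumes j1: "1 \<le> j" and jk: "j < k"
    and ep_pos: "eventually (\<lambda>n. 0 < ep n) sequentially"
    and ep_0: "ep \<longlonglongrightarrow> 0"
    and ep_cube: "filterlim (\<lambda>n. ep n ^ 3 * real n ^ j) at_top sequentially"
    and ep_sq: "eventually (\<lambda>n. 1 \<le> ep n ^ 2 * real n) sequentially"
begin

abbreviation "Q \<equiv> real (hyp.q k j)"
abbreviation "pp c n \<equiv> (1 + c * ep n) * p0 k j n"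

lemma Q: "real (k choose j) - 1 = Q" "1 \<le> Q"
proof -
  \<comment> \<open>\<open>q\<close> depends on \<open>k\<close> and \<open>j\<close> only, so its
    properties can be read off from any instance of the locale; \<open>alpha\<close> and
    \<open>CL\<close> are treated alike below.\<close>
  interpret hyp "4 * k" k j 0 using j1 jk by unfold_locales auto
  have "1 \<le> k choose j" using jk by (simp add: Suc_leI)
  thus "real (k choose j) - 1 = Q" by (simp add: q_def of_nat_diff)
  show "1 \<le> Q" using q_pos by simp
qed

lemma ep_small: "0 < s \<Longrightarrow> eventually (\<lambda>n. ep n \<le> s) sequentially"
  using order_tendstoD(2)[OF ep_0, of s] by (auto elim: eventually_mono)

lemma p0_le:
  assumes "4 * k \<le> n" shows "0 < p0 k j n" "p0 k j n \<le> real k / real n"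
proof -
  let ?m = "k - j"
  have n: "0 < real n" "?m \<le> n" "0 < ?m" using assms jk by auto
  have "real n / real k \<le> real n / real ?m" using n by (intro divide_left_mono) auto
  also have "\<dots> \<le> (real n / real ?m) ^ ?m" using n by (intro self_le_power) auto
  also have "\<dots> \<le> real (n choose ?m)" using n by (intro binomial_ge_n_over_k_pow_k) auto
  finally have c: "real n / real k \<le> real (n choose ?m)" .
  have kp: "0 < real n / real k" using n jk by simp
  have "p0 k j n = 1 / Q * (1 / real (n choose ?m))" by (simp add: p0_def Q)
  also have "\<dots> \<le> 1 * (1 / (real n / real k))" using c kp Q order_less_le_trans[OF kp c] by (intro mult_mono divide_left_mono mult_pos_pos) auto
  finally show "p0 k j n \<le> real k / real n" by simp
  show "0 < p0 k j n" using n Q by (simp add: p0_def)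
qed

lemma hyp_pp:
  assumes "\<bar>c\<bar> \<le> 1" shows "eventually (\<lambda>n. hyp n k j (pp c n)) sequentially"
proof -
  have "eventually (\<lambda>n. 4 * k \<le> n) sequentially" by (rule eventually_ge_at_top)
  thus ?thesis using ep_pos ep_small[of 1, OF zero_less_one]
  proof eventually_elim
    case (elim n)
    have "\<bar>c * ep n\<bar> \<le> 1 * 1" unfolding abs_mult using assms elim by (intro mult_mono) auto
    hence c: "0 \<le> 1 + c * ep n" "1 + c * ep n \<le> 2" by auto
    have "pp c n \<le> 2 * (real k / real n)" using c p0_le[OF elim(1)] by (intro mult_mono) auto
    also have "\<dots> \<le> 1" using elim(1) jk by (simp add: divide_le_eq)
    finally have "pp c n \<le> 1" .
    thus ?case using j1 jk elim c p0_le[OF elim(1)] by unfold_locales auto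
  qed
qed

lemma lam_pp:
  assumes "hyp n k j (pp c n)"
  shows "hyp.lam n k j (pp c n) = (1 + c * ep n) * (real ((n - j) choose (k - j)) / real (n choose (k - j)))"
proof -
  interpret hyp n k j "pp c n" by fact
  show ?thesis unfolding lam_def unfolding M_def p0_def Q(1) using Q(2) by (simp add: mult_ac)
qed

lemma subcritical:
  "\<exists>C>0. (\<lambda>n. measure_pmf.prob (random_hypergraph n k ((1 - ep n) * p0 k j n))
     {H. \<forall>X\<in>jcomponents n j H. real (card X) \<le> C * ep n powi (-2) * ln (real n)}) \<longlonglongrightarrow> 1"
proof (intro exI conjI)
  \<comment> \<open>With this constant the exponent in \<open>subcritical_prob\<close> is
    \<open>(j + 1) * ln n\<close>, which beats the at most \<open>n ^ j\<close> terms of the union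
    bound by a factor \<open>n\<close>.\<close>
  let ?C = "4 * Q * (real j + 1)"
  show "0 < ?C" using Q by simp
  show "(\<lambda>n. measure_pmf.prob (random_hypergraph n k ((1 - ep n) * p0 k j n))
     {H. \<forall>X\<in>jcomponents n j H. real (card X) \<le> ?C * ep n powi (-2) * ln (real n)}) \<longlonglongrightarrow> 1"
  proof (rule prob_tendsto_1)
    fix z :: real assume z: "0 < z"
    have "eventually (\<lambda>n. 3 / real n \<le> z) sequentially" using z by real_asymp
    moreover have "eventually (\<lambda>n. 1 \<le> n) sequentially" by (rule eventually_ge_at_top)
    ultimately show "eventually (\<lambda>n. 1 - z \<le> measure_pmf.prob (random_hypergraph n k ((1 - ep n) * p0 k j n))
       {H. \<forall>X\<in>jcomponents n j H. real (card X) \<le> ?C * ep n powi (-2) * ln (real n)}) sequentially"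
      using hyp_pp[of "-1", simplified] ep_pos ep_small[of 1, OF zero_less_one]
    proof eventually_elim
      case (elim n)
      interpret hyp n k j "(1 - ep n) * p0 k j n" by fact
      let ?L = "?C * ep n powi (-2) * ln (real n)"
      have "lam = (1 - ep n) * (real ((n - j) choose (k - j)) / real (n choose (k - j)))"
        using lam_pp[of n "-1"] elim by simp
      also have "\<dots> \<le> (1 - ep n) * 1" using elim nk jk by (intro mult_left_mono choose_ratio) auto
      finally have lam: "lam \<le> 1 - ep n" by simp
      have "ep n ^ 2 / (4 * Q) * ?L = (real j + 1) * ln (real n)"
        using elim Q by (simp add: power_int_minus field_simps)
      hence "- (ep n ^ 2 / (4 * Q)) * ?L = - (real (Suc j) * ln (real n))" by simp
      hence "exp (- (ep n ^ 2 / (4 * Q)) * ?L) = inverse (exp (real (Suc j) * ln (real n)))" by (simp only: exp_minus)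
      also have "exp (real (Suc j) * ln (real n)) = real n ^ Suc j" using elim by (simp only: exp_of_nat_mult exp_ln of_nat_0_less_iff)
      also have "inverse (real n ^ Suc j) = 1 / (real n ^ j * real n)" by (simp add: inverse_eq_divide mult.commute)
      finally have ex: "exp (- (ep n ^ 2 / (4 * Q)) * ?L) = 1 / (real n ^ j * real n)" .
      have "real N \<le> real n ^ j" using binomial_le_pow[of j n] nk jk by (simp add: N_def flip: of_nat_power)
      hence "real N * (1 / (real n ^ j * real n)) \<le> real n ^ j * (1 / (real n ^ j * real n))" by (intro mult_right_mono) auto
      also have "\<dots> = 1 / real n" using elim by simp
      finally have "1 - 3 / real n \<le> 1 - 3 * real N * exp (- (ep n ^ 2 / (4 * Q)) * ?L)" unfolding ex by simp
      also have "\<dots> \<le> bexp ((1 - ep n) * p0 k j n) KS (\<lambda>H. of_bool (\<forall>X\<in>jcomponents n j H. real (card X) \<le> ?L))"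
        using elim lam by (intro subcritical_prob) auto
      finally show ?case using elim(1) by (subst prob_random_hypergraph[OF p0 p1]) simp
    qed
  qed simp
qed

text \<open>The true excess of the mean offspring, slightly below \<open>ep n\<close>; the estimates
  use it, and the translation to \<open>ep n\<close> comes at the end.\<close>

definition lambda where "lambda n = hyp.lam n k j (pp 1 n) - 1"
definition bb where "bb n = root 4 (real (n choose j) * lambda n ^ 3)"

lemma e_lambda: "hyp n k j (pp 1 n) \<Longrightarrow> hyp.e n k j (pp 1 n) = lambda n"
  by (simp add: hyp.e_def lambda_def)

lemma ep_n: "eventually (\<lambda>n. sqrt (real n) \<le> ep n * real n) sequentially"
  using ep_sq ep_pos eventually_gt_at_top[of 0]
proof eventually_elim
  case (elim n)
  have "1 \<le> sqrt (ep n ^ 2 * real n)" using elim by simp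
  also have "\<dots> = ep n * sqrt (real n)" using elim by (simp add: real_sqrt_mult)
  finally have "1 * sqrt (real n) \<le> ep n * sqrt (real n) * sqrt (real n)" by (intro mult_right_mono) auto
  thus ?case by (simp add: mult.assoc)
qed

text \<open>The binomial ratio costs order \<open>1 / n\<close>, which is negligible against
  \<open>ep n\<close> because \<open>ep n * n\<close> tends to infinity.\<close>

lemma lambda_bounds:
  assumes s: "0 < s"
  shows "eventually (\<lambda>n. (1 - s) * ep n \<le> lambda n \<and> lambda n \<le> ep n) sequentially"
proof -
  let ?c = "real (j * (k - j))"
  have "eventually (\<lambda>n. 2 * ?c \<le> s * sqrt (real n)) sequentially" using s by real_asymp
  thus ?thesis using ep_n hyp_pp[of 1, simplified] ep_pos ep_small[of 1, OF zero_less_one]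
  proof eventually_elim
    case (elim n)
    let ?r = "real ((n - j) choose (k - j)) / real (n choose (k - j))"
    interpret hyp n k j "(1 + ep n) * p0 k j n" by fact
    have n: "0 < real n" using nk jk by simp
    have r: "1 - ?c / real n \<le> ?r" "?r \<le> 1" using nk jk by (intro choose_ratio; simp)+
    have l: "lambda n = (1 + ep n) * ?r - 1" using lam_pp[of n 1] elim by (simp add: lambda_def)
    have "(1 + ep n) * ?r \<le> (1 + ep n) * 1" using r elim by (intro mult_left_mono) auto
    moreover have "(1 - s) * ep n \<le> lambda n"
    proof -
      have "2 * ?c \<le> s * (ep n * real n)" using elim s mult_left_mono[of "sqrt (real n)" "ep n * real n" s] by linarith
      hence "2 * (?c / real n) \<le> s * ep n" using n by (simp add: field_simps)
      moreover have "(1 + ep n) * (?c / real n) \<le> 2 * (?c / real n)" using elim by (intro mult_right_mono) auto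
      moreover have "(1 + ep n) * (1 - ?c / real n) \<le> (1 + ep n) * ?r" using r elim by (intro mult_left_mono) auto
      ultimately show ?thesis unfolding l by (simp add: algebra_simps)
    qed
    ultimately show ?case using l by simp
  qed
qed

lemma lambda_pos: "eventually (\<lambda>n. 0 < lambda n) sequentially"
  using lambda_bounds[of "1 / 2", simplified] ep_pos by eventually_elim linarith

lemma lambda_small:
  assumes "0 < s" shows "eventually (\<lambda>n. lambda n \<le> s) sequentially"
  using lambda_bounds[of "1 / 2", simplified] ep_small[OF assms] by eventually_elim linarith

lemma lambda_n: "eventually (\<lambda>n. sqrt (real n) / 2 \<le> lambda n * real n) sequentially"
  using lambda_bounds[of "1 / 2", simplified] ep_n
proof eventually_elim
  case (elim n)
  have "ep n / 2 * real n \<le> lambda n * real n" using elim by (intro mult_right_mono) auto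
  thus ?case using elim by simp
qed

lemma bb4: "eventually (\<lambda>n. real (n choose j) * lambda n ^ 3 = bb n ^ 4) sequentially"
  using lambda_pos by eventually_elim (simp add: bb_def)

lemma bb_top: "filterlim bb at_top sequentially"
proof -
  have r: "filterlim (root 4) at_top at_top"
    unfolding filterlim_at_top
  proof
    fix Z :: real
    have "eventually (\<lambda>x. \<bar>Z\<bar> ^ 4 \<le> x) at_top" by (rule eventually_ge_at_top)
    thus "eventually (\<lambda>x. Z \<le> root 4 x) at_top"
    proof eventually_elim
      case (elim x)
      have "root 4 (\<bar>Z\<bar> ^ 4) = \<bar>Z\<bar>" by (rule real_root_power_cancel) auto
      hence "Z \<le> root 4 (\<bar>Z\<bar> ^ 4)" by linarith
      also have "\<dots> \<le> root 4 x" using elim by simp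
      finally show ?case .
    qed
  qed
  \<comment> \<open>The factor comes from \<open>n choose j \<ge> (n / j) ^ j\<close> and
    \<open>lambda n \<ge> ep n / 2\<close>.\<close>
  have "filterlim (\<lambda>n. 1 / (8 * real j ^ j) * (ep n ^ 3 * real n ^ j)) at_top sequentially"
    using j1 by (intro filterlim_tendsto_pos_mult_at_top[OF tendsto_const _ ep_cube]) simp
  hence "filterlim (\<lambda>n. real (n choose j) * lambda n ^ 3) at_top sequentially"
  proof (rule filterlim_at_top_mono)
    show "eventually (\<lambda>n. 1 / (8 * real j ^ j) * (ep n ^ 3 * real n ^ j) \<le> real (n choose j) * lambda n ^ 3) sequentially"
      using lambda_bounds[of "1 / 2", simplified] ep_pos eventually_ge_at_top[of j]
    proof eventually_elim
      case (elim n)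
      have "(real n / real j) ^ j * (ep n / 2) ^ 3 \<le> real (n choose j) * lambda n ^ 3"
        using elim by (intro mult_mono power_mono binomial_ge_n_over_k_pow_k) auto
      thus ?case by (simp add: power_divide mult_ac)
    qed
  qed
  from filterlim_compose[OF r this] show ?thesis unfolding bb_def .
qed

text \<open>Polynomial growth of \<open>bb\<close> allows its logarithm to be compared with
  \<open>sqrt n\<close>, hence with \<open>lambda n * n\<close>.\<close>

lemma ln_bb: "eventually (\<lambda>n. 0 \<le> ln (bb n) \<and> ln (bb n) \<le> real j * ln (real n)) sequentially"
proof -
  have "eventually (\<lambda>n. 1 \<le> bb n) sequentially" using bb_top by (auto simp: filterlim_at_top)
  thus ?thesis using bb4 lambda_small[of 1, OF zero_less_one] lambda_pos eventually_ge_at_top[of "max 1 j"]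
  proof eventually_elim
    case (elim n)
    have "bb n ^ 1 \<le> bb n ^ 4" using elim by (intro power_increasing) auto
    also have "\<dots> = real (n choose j) * lambda n ^ 3" using elim by simp
    also have "\<dots> \<le> real n ^ j * 1"
      using elim binomial_le_pow[of j n] by (intro mult_mono power_le_one) (auto simp flip: of_nat_power)
    finally have "ln (bb n) \<le> ln (real n ^ j)" using elim by simp
    thus ?case using elim by (simp add: ln_realpow)
  qed
qed

lemma giant_params_eventually:
  assumes x: "0 < x" "x \<le> 1 / 2"
  shows "eventually (\<lambda>n. \<exists>r0 r i0. giant_params n k j (pp 1 n) x r0 r i0 (bb n ^ 2 / lambda n ^ 2)) sequentially"
proof -
  let ?al = "hyp.alpha k j" and ?CL = "hyp.CL k j"
  define l where "l n = (6 * (real j * ln (real n)) + 2) * (2 / sqrt (real n))" for n :: nat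
  \<comment> \<open>\<open>l\<close> and \<open>l2\<close> majorise the terms in which a logarithm
    of \<open>bb n\<close> meets \<open>1 / (lambda n * n)\<close>; logarithms against
    \<open>1 / bb n\<close> vanish by \<open>bb_top\<close>.\<close>
  define l2 where "l2 n = (6 * (real j * ln (real n)) + 2) ^ 2 * (2 / sqrt (real n))" for n :: nat
  have j0: "0 < real j" using j1 by simp
  have l0: "l \<longlonglongrightarrow> 0" unfolding l_def by real_asymp
  have l20: "l2 \<longlonglongrightarrow> 0" unfolding l2_def using j0 by real_asymp
  have b0: "(\<lambda>n. 1 / bb n) \<longlonglongrightarrow> 0" by (rule filterlim_compose[OF _ bb_top]) real_asymp
  have b2: "(\<lambda>n. (6 * ln (bb n) + 2) ^ 2 * (2 / bb n)) \<longlonglongrightarrow> 0" by (rule filterlim_compose[OF _ bb_top]) real_asymp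
  have n0: "(\<lambda>n. real j ^ 2 / real n) \<longlonglongrightarrow> 0" by real_asymp
  have al: "0 < 1 - ?al" 
  proof -
    interpret hyp "4 * k" k j 0 using j1 jk by unfold_locales auto
    show ?thesis using alpha_bounds by simp
  qed
  have CL: "0 \<le> ?CL"
  proof -
    interpret hyp "4 * k" k j 0 using j1 jk by unfold_locales auto
    show ?thesis by (rule CL_nonneg)
  qed
  have t7: "(\<lambda>n. ?CL * (2 * (1 / bb n) + l n)) \<longlonglongrightarrow> ?CL * (2 * 0 + 0)"
    by (intro tendsto_intros b0 l0)
  have t12: "(\<lambda>n. 128 * real j * Q ^ 2 * (real j ^ 2 / real n + 4 / (1 - ?al) ^ 2 * (1 / bb n) + 4 / (1 - ?al) ^ 4 * (1 / bb n))) \<longlonglongrightarrow>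
     128 * real j * Q ^ 2 * (0 + 4 / (1 - ?al) ^ 2 * 0 + 4 / (1 - ?al) ^ 4 * 0)"
    by (intro tendsto_add tendsto_mult tendsto_const b0 n0)
  have t13: "(\<lambda>n. 24 * Q ^ 2 * ((6 * ln (bb n) + 2) ^ 2 * (2 / bb n) + 4 * real k / (1 - ?al) ^ 2 * l2 n)) \<longlonglongrightarrow> 24 * Q ^ 2 * (0 + 4 * real k / (1 - ?al) ^ 2 * 0)"
    by (intro tendsto_add tendsto_mult tendsto_const b2 l20)
  have e7: "eventually (\<lambda>n. ?CL * (2 * (1 / bb n) + l n) \<le> x ^ 2) sequentially"
    using order_tendstoD(2)[OF t7, of "x ^ 2"] x by (auto elim: eventually_mono)
  have e12: "eventually (\<lambda>n. 128 * real j * Q ^ 2 * (real j ^ 2 / real n + 4 / (1 - ?al) ^ 2 * (1 / bb n) + 4 / (1 - ?al) ^ 4 * (1 / bb n)) \<le> x ^ 13) sequentially"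
    using order_tendstoD(2)[OF t12, of "x ^ 13"] x by (auto elim: eventually_mono)
  have e13: "eventually (\<lambda>n. 24 * Q ^ 2 * ((6 * ln (bb n) + 2) ^ 2 * (2 / bb n) + 4 * real k / (1 - ?al) ^ 2 * l2 n) \<le> x ^ 7) sequentially"
    using order_tendstoD(2)[OF t13, of "x ^ 7"] x by (auto elim: eventually_mono)
  have eb: "eventually (\<lambda>n. 16 * Q / x ^ 3 \<le> bb n) sequentially" using bb_top by (auto simp: filterlim_at_top)
  have ej: "eventually (\<lambda>n. 8 * real j ^ 2 \<le> x * (sqrt (real n) / 2)) sequentially" using x by real_asymp
  have ek: "eventually (\<lambda>n. 2 * real k / real n \<le> x) sequentially" using x by real_asymp
  define s where "s = min (1 / 2) (min ((1 - ?al) / 2) (x / (1 + 4 * Q)))"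
  have s: "0 < s" using al x Q by (auto simp: s_def)
  show ?thesis
    using e7 e12 e13 eb ej ek lambda_small[OF s] lambda_pos bb4 ln_bb lambda_n hyp_pp[of 1, simplified] ep_small[of 1, OF zero_less_one] ep_pos eventually_gt_at_top[of 0]
  proof eventually_elim
    case (elim n)
    interpret hyp n k j "(1 + ep n) * p0 k j n" by fact
    have e: "e = lambda n" using e_lambda[of n] elim by simp
    have rn: "0 < sqrt (real n) / 2" using elim by simp
    have en: "1 / (lambda n * real n) \<le> 2 / sqrt (real n)"
      using elim rn by (simp add: field_simps)
    have f7: "(6 * ln (bb n) + 2) / (lambda n * real n) \<le> l n"
    proof -
      have "(6 * ln (bb n) + 2) * (1 / (lambda n * real n)) \<le> l n"
        unfolding l_def using elim en by (intro mult_mono) auto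
      thus ?thesis by simp
    qed
    have f13: "(6 * ln (bb n) + 2) ^ 2 * (1 / (lambda n * real n)) \<le> l2 n"
      unfolding l2_def using elim en by (intro mult_mono power_mono) auto
    have "\<exists>r0 r i0. giant_params n k j ((1 + ep n) * p0 k j n) x r0 r i0 (bb n ^ 2 / e ^ 2)"
    proof (rule giant_params_exist[OF x])
      show "0 < e" "e \<le> 1 / 2" "e \<le> (1 - alpha) / 2" "e \<le> x / (1 + 4 * Q)" using elim by (auto simp: e s_def)
      have "(1 + ep n) * p0 k j n \<le> 2 * (real k / real n)" using elim p0_le[OF nk] by (intro mult_mono) auto
      thus "(1 + ep n) * p0 k j n \<le> x" using elim by simp
      show "real N * e ^ 3 = bb n ^ 4" using elim by (simp add: e N_def)
      show "16 * Q / x ^ 3 \<le> bb n" by fact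
      have "x * (sqrt (real n) / 2) \<le> x * (e * real n)" using elim x by (intro mult_left_mono) (auto simp: e)
      thus "8 * real j ^ 2 \<le> x * (e * real n)" using elim by linarith
      have "?CL * (2 / bb n + (6 * ln (bb n) + 2) / (e * real n)) \<le> ?CL * (2 * (1 / bb n) + l n)"
        using f7 CL by (intro mult_left_mono) (auto simp: e)
      thus "?CL * (2 / bb n + (6 * ln (bb n) + 2) / (e * real n)) \<le> x ^ 2" using elim by linarith
      show "128 * real j * Q ^ 2 * (real j ^ 2 / real n + 4 / (1 - ?al) ^ 2 * (1 / bb n) + 4 / (1 - ?al) ^ 4 * (1 / bb n)) \<le> x ^ 13" by fact
      have "24 * Q ^ 2 * (6 * ln (bb n) + 2) ^ 2 * (2 / bb n + 4 * real k / (1 - ?al) ^ 2 * (1 / (e * real n))) =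
        24 * Q ^ 2 * ((6 * ln (bb n) + 2) ^ 2 * (2 / bb n) + 4 * real k / (1 - ?al) ^ 2 * ((6 * ln (bb n) + 2) ^ 2 * (1 / (lambda n * real n))))"
        unfolding e by (simp only: distrib_left mult_ac)
      also have "\<dots> \<le> 24 * Q ^ 2 * ((6 * ln (bb n) + 2) ^ 2 * (2 / bb n) + 4 * real k / (1 - ?al) ^ 2 * l2 n)"
        using f13 by (intro mult_left_mono add_left_mono) auto
      finally show "24 * Q ^ 2 * (6 * ln (bb n) + 2) ^ 2 * (2 / bb n + 4 * real k / (1 - ?al) ^ 2 * (1 / (e * real n))) \<le> x ^ 7"
        using elim by linarith
    qed
    thus ?case by (simp add: e)
  qed
qed

text \<open>The order of choices matters: \<open>eta\<close> determines \<open>x\<close>, and the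
  parameters exist once \<open>n\<close> is large in terms of \<open>x\<close>.\<close>

lemma giant_eventually:
  assumes eta: "0 < eta" and tau: "0 < tau'" "tau' \<le> 1 / 4"
  shows "eventually (\<lambda>n. 1 - 5 * eta / tau' ^ 2 \<le> bexp (pp 1 n) (ksets n k) (\<lambda>H. of_bool (hyp.giant n j (2 / Q * (lambda n * real (n choose j))) (4 * tau') H))) sequentially"
proof -
  obtain x where x: "0 < x" "x \<le> 1 / 2" and U: "Ua Q x ^ 2 + x \<le> (1 + eta) * (2 / Q) ^ 2" and P: "(1 - eta) * (2 / Q) \<le> Pl Q x" 
    and P0: "0 \<le> Pl Q x" "Ua Q x \<le> 2 * Pl Q x" and PU: "(1 - eta) * (2 / Q) ^ 2 \<le> (2 * Pl Q x - Ua Q x) * Pl Q x - x * Ua Q x - 2 * x"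
    using pick_x[OF Q(2) eta] by blast
  have lim: "(\<lambda>n. (1 / bb n) ^ 2) \<longlonglongrightarrow> 0" by (rule filterlim_compose[OF _ bb_top]) real_asymp
  have "eventually (\<lambda>n. (1 / bb n) ^ 2 < tau' * 2 / Q) sequentially" by (rule order_tendstoD(2)[OF lim]) (use tau Q in simp)
  moreover have "eventually (\<lambda>n. 0 < bb n) sequentially" using bb_top by (auto simp: filterlim_at_top_dense)
  ultimately show ?thesis using giant_params_eventually[OF x, simplified] bb4 lambda_pos hyp_pp[of 1, simplified]
  proof eventually_elim
    case (elim n)
    define L where "L = bb n ^ 2 / lambda n ^ 2"
    obtain r0 r i0 where "giant_params n k j ((1 + ep n) * p0 k j n) x r0 r i0 L" using elim by (auto simp: L_def)
    then interpret giant_params n k j "(1 + ep n) * p0 k j n" x r0 r i0 L .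
    have e: "e = lambda n" using e_lambda[of n] elim by simp
    define y where "y = 2 / Q * (e * real N)"
    have Np: "0 < real N" using N_pos by simp
    have y: "0 < y" using e0 Np Q by (simp add: y_def)
    have y2: "y ^ 2 = (real N * e) ^ 2 * (2 / Q) ^ 2" by (simp add: y_def power_mult_distrib power_divide)
    have "1 - 5 * eta / tau' ^ 2 \<le> bexp ((1 + ep n) * p0 k j n) KS (\<lambda>H. of_bool (giant y (4 * tau') H))"
    proof (rule giant_prob[OF y tau _ less_imp_le[OF eta]])
      show "L \<le> tau' * y"
      proof -
        have N4: "real N * e ^ 3 = bb n ^ 4" using elim by (simp add: e N_def)
        have "L = bb n ^ 4 * (1 / bb n) ^ 2 / e ^ 2" using elim by (simp add: L_def e power_divide eval_nat_numeral)
        also have "\<dots> = real N * e * (1 / bb n) ^ 2" unfolding N4[symmetric] using e0 by (simp add: eval_nat_numeral)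
        also have "\<dots> \<le> real N * e * (tau' * 2 / Q)" using elim e0 Np by (intro mult_left_mono) auto
        finally show ?thesis by (simp add: y_def mult_ac)
      qed
      have "(\<Sum>J1\<in>JS. \<Sum>J2\<in>JS. bexp ((1 + ep n) * p0 k j n) KS (\<lambda>H. of_bool (large L H J1 \<and> large L H J2))) \<le> (real N * e) ^ 2 * (Ua Q x ^ 2 + x)" by (rule C2)
      also have "\<dots> \<le> (real N * e) ^ 2 * ((1 + eta) * (2 / Q) ^ 2)" using U by (intro mult_left_mono) auto
      finally show "(\<Sum>J1\<in>JS. \<Sum>J2\<in>JS. bexp ((1 + ep n) * p0 k j n) KS (\<lambda>H. of_bool (large L H J1 \<and> large L H J2))) \<le> (1 + eta) * y ^ 2"
        unfolding y2 by (simp add: mult_ac)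
      have "(1 - eta) * y = real N * (e * ((1 - eta) * (2 / Q)))" by (simp add: y_def)
      also have "\<dots> \<le> real N * pl" unfolding pl_def using P e0 by (intro mult_left_mono) auto
      also have "\<dots> = (\<Sum>J\<in>JS. pl)" by (simp add: card_JS)
      also have "\<dots> \<le> (\<Sum>J\<in>JS. bexp ((1 + ep n) * p0 k j n) KS (\<lambda>H. of_bool (large L H J)))" by (intro sum_mono C3)
      finally show "(1 - eta) * y \<le> (\<Sum>J\<in>JS. bexp ((1 + ep n) * p0 k j n) KS (\<lambda>H. of_bool (large L H J)))" .
      have "(1 - eta) * y ^ 2 = real N * (real N * e ^ 2 * ((1 - eta) * (2 / Q) ^ 2))" unfolding y2 by (simp add: power2_eq_square)
      also have "\<dots> \<le> real N * (real N * e ^ 2 * ((2 * Pl Q x - Ua Q x) * Pl Q x - x * Ua Q x - 2 * x))" using PU by (intro mult_left_mono) auto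
      also have "\<dots> = (\<Sum>J\<in>JS. real N * e ^ 2 * ((2 * Pl Q x - Ua Q x) * Pl Q x - x * Ua Q x - 2 * x))" by (simp add: card_JS)
      also have "\<dots> \<le> (\<Sum>J1\<in>JS. \<Sum>J2\<in>JS. bexp ((1 + ep n) * p0 k j n) KS (\<lambda>H. of_bool (J2 \<in> comp H J1 \<and> large L H J1)))"
        by (intro sum_mono C4 P0)
      finally show "(1 - eta) * y ^ 2 \<le> (\<Sum>J1\<in>JS. \<Sum>J2\<in>JS. bexp ((1 + ep n) * p0 k j n) KS (\<lambda>H. of_bool (J2 \<in> comp H J1 \<and> large L H J1)))" .
    qed
    thus ?case by (simp add: y_def e N_def)
  qed
qed

lemma supercritical:
  assumes eta: "0 < eta"
  shows "(\<lambda>n. measure_pmf.prob (random_hypergraph n k ((1 + ep n) * p0 k j n))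
        {H. \<exists>X0 \<in> jcomponents n j H.
              (\<forall>X \<in> jcomponents n j H. card X \<le> card X0) \<and>
              \<bar>real (card X0) - 2 * ep n / (real (k choose j) - 1) * real (n choose j)\<bar>
                \<le> eta * (2 * ep n / (real (k choose j) - 1) * real (n choose j)) \<and>
              (\<forall>X \<in> jcomponents n j H. X \<noteq> X0 \<longrightarrow> real (card X) \<le> eta * ep n * real n ^ j)})
      \<longlonglongrightarrow> 1" (is "(\<lambda>n. measure_pmf.prob _ (?E n)) \<longlonglongrightarrow> 1")
proof (rule prob_tendsto_1)
  fix z :: real assume z: "0 < z"
  \<comment> \<open>Half of \<open>eta\<close> pays for the relative error \<open>4 * t\<close> of
    the component size, the other half for replacing \<open>lambda n\<close> by
    \<open>ep n\<close>.\<close>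
  define t where "t = min (1 / 4) (eta / 8)"
  have t: "0 < t" "t \<le> 1 / 4" "4 * t \<le> eta / 2" using eta by (auto simp: t_def)
  \<comment> \<open>This accuracy makes the failure bound in \<open>giant_eventually\<close> equal
    to \<open>z\<close>.\<close>
  have "0 < z * t ^ 2 / 5" using z t by simp
  note G = giant_eventually[OF this t(1,2)]
  have "0 < min 1 (eta / 2)" using eta by simp
  note B = lambda_bounds[OF this]
  show "eventually (\<lambda>n. 1 - z \<le> measure_pmf.prob (random_hypergraph n k ((1 + ep n) * p0 k j n)) (?E n)) sequentially"
    using G B hyp_pp[of 1, simplified] ep_pos
  proof eventually_elim
    case (elim n)
    interpret hyp n k j "(1 + ep n) * p0 k j n" by fact
    define Y where "Y = 2 * ep n / Q * real N"
    define y where "y = 2 / Q * (lambda n * real N)"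
    have Np: "0 < real N" using N_pos by simp
    have Yp: "0 < Y" using Np elim Q by (simp add: Y_def)
    have c0: "0 \<le> 2 / Q * real N" by simp
    have Ye: "Y = 2 / Q * real N * ep n" "y = 2 / Q * real N * lambda n" by (auto simp: Y_def y_def)
    have yY: "y \<le> Y" unfolding Ye using elim c0 by (intro mult_left_mono) auto
    have "(1 - eta / 2) * Y \<le> y"
    proof -
      have "(1 - eta / 2) * ep n \<le> (1 - min 1 (eta / 2)) * ep n" using elim by (intro mult_right_mono) auto
      hence "(1 - eta / 2) * ep n \<le> lambda n" using elim by linarith
      from mult_left_mono[OF this c0] show ?thesis unfolding Ye by (simp add: mult_ac)
    qed
    hence yY2: "Y - y \<le> eta / 2 * Y" by (simp add: algebra_simps)
    have y0: "0 \<le> y"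
    proof -
      have "0 \<le> (1 - min 1 (eta / 2)) * ep n" using elim by (intro mult_nonneg_nonneg) auto
      hence "0 \<le> lambda n" using elim by linarith
      thus ?thesis by (simp add: y_def)
    qed
    have d: "4 * t * y \<le> eta / 2 * Y" using t y0 yY by (intro mult_mono) auto
    have big: "eta / 2 * Y \<le> eta * ep n * real n ^ j"
    proof -
      have "real N \<le> real n ^ j" using binomial_le_pow[of j n] nk jk by (simp add: N_def flip: of_nat_power)
      moreover have "1 / Q \<le> 1" using Q by simp
      ultimately have "(eta * ep n) * (1 / Q * real N) \<le> (eta * ep n) * (1 * real n ^ j)"
        using eta elim by (intro mult_left_mono mult_mono) auto
      thus ?thesis by (simp add: Y_def)
    qed
    have "1 - z \<le> bexp ((1 + ep n) * p0 k j n) KS (\<lambda>H. of_bool (giant y (4 * t) H))"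
      using elim(1) t by (simp add: y_def N_def)
    also have "\<dots> \<le> bexp ((1 + ep n) * p0 k j n) KS (\<lambda>H. of_bool (H \<in> ?E n))"
    proof (intro bexp_mono p0 p1)
      fix H
      have "H \<in> ?E n" if gi: "giant y (4 * t) H"
      proof -
        obtain X0 where X0: "X0 \<in> jcomponents n j H" "\<forall>X\<in>jcomponents n j H. card X \<le> card X0"
          "\<bar>real (card X0) - y\<bar> \<le> 4 * t * y" "\<forall>X\<in>jcomponents n j H. X \<noteq> X0 \<longrightarrow> real (card X) \<le> 4 * t * y"
          using gi unfolding giant_def by blast
        have "\<bar>real (card X0) - Y\<bar> \<le> eta * Y" using X0(3) d yY yY2 by linarith
        moreover have "\<forall>X\<in>jcomponents n j H. X \<noteq> X0 \<longrightarrow> real (card X) \<le> eta * ep n * real n ^ j"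
          using X0(4) d big by fastforce
        ultimately show ?thesis using X0(1,2) unfolding Q(1) N_def[symmetric] Y_def by blast
      qed
      thus "of_bool (giant y (4 * t) H) \<le> (of_bool (H \<in> ?E n) :: real)" by auto
    qed
    finally show ?case by (subst prob_random_hypergraph[OF p0 p1])
  qed
qed simp

end

theorem theorem1p2:
  fixes k j :: nat and \<epsilon> :: "nat \<Rightarrow> real" and \<delta> :: real
  assumes "1 \<le> j" and "j \<le> k - 1"
    and "eventually (\<lambda>n. \<epsilon> n > 0) sequentially"
    and "\<epsilon> \<longlonglongrightarrow> 0"
    and "filterlim (\<lambda>n. \<epsilon> n ^ 3 * real n ^ j) at_top sequentially"
    and "\<delta> > 0"
    and "filterlim (\<lambda>n. \<epsilon> n ^ 2 * real n powr (1 - 2 * \<delta>)) at_top sequentially"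
  shows
    "(\<exists>C > 0. (\<lambda>n. measure_pmf.prob
        (random_hypergraph n k ((1 - \<epsilon> n) * p0 k j n))
        {H. \<forall>X \<in> jcomponents n j H. real (card X) \<le> C * \<epsilon> n powi (-2) * ln (real n)})
      \<longlonglongrightarrow> 1) \<and>
    (\<forall>\<eta> > 0. (\<lambda>n. measure_pmf.prob
        (random_hypergraph n k ((1 + \<epsilon> n) * p0 k j n))
        {H. \<exists>X0 \<in> jcomponents n j H.
              (\<forall>X \<in> jcomponents n j H. card X \<le> card X0) \<and>
              \<bar>real (card X0) - 2 * \<epsilon> n / (real (k choose j) - 1) * real (n choose j)\<bar>
                \<le> \<eta> * (2 * \<epsilon> n / (real (k choose j) - 1) * real (n choose j)) \<and>
              (\<forall>X \<in> jcomponents n j H. X \<noteq> X0 \<longrightarrow> real (card X) \<le> \<eta> * \<epsilon> n * real n ^ j)})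
      \<longlonglongrightarrow> 1)"
proof -
  interpret window k j \<epsilon>
  proof
    show "j < k" using assms(1,2) by simp
    have "eventually (\<lambda>n. 1 \<le> \<epsilon> n ^ 2 * real n powr (1 - 2 * \<delta>)) sequentially"
      using assms(7) by (auto simp: filterlim_at_top)
    thus "eventually (\<lambda>n. 1 \<le> \<epsilon> n ^ 2 * real n) sequentially" using eventually_ge_at_top[of 1]
    proof eventually_elim
      case (elim n)
      \<comment> \<open>Since \<open>\<delta>\<close> is positive, the exponent
        \<open>1 - 2 * \<delta>\<close> may be raised to 1.\<close>
      have "real n powr (1 - 2 * \<delta>) \<le> real n powr 1" using elim assms(6) by (intro powr_mono) auto
      hence "\<epsilon> n ^ 2 * real n powr (1 - 2 * \<delta>) \<le> \<epsilon> n ^ 2 * real n" using elim by (intro mult_left_mono) auto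
      thus ?case using elim by linarith
    qed
  qed (use assms in auto)
  show ?thesis using subcritical supercritical by blast
qed

end
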